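(* Let $G$ be a Lie group with Lie algebra $\mathfrak{g}$, and let $V$ be a module in $\mathbf{Mod}(\mathrm{C}_\bullet(G))$ with structure map $\rho\colon\mathrm{C}_\bullet(G)\to\mathrm{End}(V)$. Then there is a representation $\mathcal{D}(\rho)\colon\mathbb{T}\mathfrak{g}\to\mathrm{End}(V)$ given by $$\mathcal{D}(\rho)(L_x)=\frac{d}{dt}\Big|_{t=0}\rho(\exp(tx)),\qquad \mathcal{D}(\rho)(i_x)=\frac{d}{dt}\Big|_{t=0}\rho(\sigma[tx]),\qquad x\in\mathfrak{g},$$ where $\sigma[x]\colon\Delta_1=[0,1]\to G$ is the simplex $\sigma[x](s)=\exp(sx)$. Moreover, if $\phi\colon V\to W$ is a morphism in $\mathbf{Mod}(\mathrm{C}_\bullet(G))$, it is also a morphism in $\mathbf{Rep}(\mathbb{T}\mathfrak{g})$, so there is a functor $\mathcal{D}\colon\mathbf{Mod}(\mathrm{C}_\bullet(G))\to\mathbf{Rep}(\mathbb{T}\mathfrak{g})$. The functor $\mathcal{D}$ is monoidal.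
   Context: All vector spaces are over $\mathbb{R}$; differentials have degree $+1$; commutators are graded. $\mathfrak{g}$ is the Lie algebra of left invariant vector fields. For a finite dimensional cochain complex $(V,\delta)$, $\mathrm{End}(V)$ is a DG algebra with $\delta(T)=[\delta,T]=\delta\circ T-(-1)^{|T|}T\circ\delta$. **The DG Lie algebra $\mathbb{T}\mathfrak{g}$.** $\mathbb{T}\mathfrak{g}^0=\{L_x:x\in\mathfrak{g}\}\cong\mathfrak{g}$, $\mathbb{T}\mathfrak{g}^{-1}=\{i_x:x\in\mathfrak{g}\}\cong\mathfrak{g}$, differential $d(i_x)=L_x$, brackets $[L_x,L_y]=L_{[x,y]}$, $[L_x,i_y]=i_{[x,y]}$, $[i_x,i_y]=0$. $\mathbf{Rep}(\mathbb{T}\mathfrak{g})$ is the category of representations of $\mathbb{T}\mathfrak{g}$ on finite dimensional cochain complexes (DG Lie algebra morphisms $\mathbb{T}\mathfrak{g}\to\mathrm{End}(V)$), morphisms being equivariant cochain maps of degree $0$. Tensor product: $L_x(v\otimes v')=L_xv\otimes v'+v\otimes L_xv'$, $i_x(v\otimes v')=i_xv\otimes v'+(-1)^{|v|}v\otimes i_xv'$. **Singular chains.** $\Delta_k=\{1\ge t_1\ge\dots\ge t_k\ge 0\}\subset\mathbb{R}^k$ with vertices $v_i=(1,\dots,1,0,\dots,0)$ ($i$ ones) and $I=[0,1]$. $\mathrm{C}_\bullet(G)$ is the complex of smooth singular chains on $G$ with real coefficients, $k$-simplices in degree $-k$, boundary $\partial\sigma=\sum_{i=0}^k(-1)^i\,\sigma|_{\text{face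 omitting }v_i}$. It is a DG algebra with product $\sigma\cdot\nu=\sum_{\chi}(-1)^{|\chi|}\mu\circ(\sigma\times\nu)\circ\chi_*$ for $\sigma\in \mathrm C_r(G),\nu\in \mathrm C_s(G)$, where $\mu$ is multiplication in $G$, $\chi$ runs over $(r,s)$-shuffles, $(-1)^{|\chi|}$ is the sign of $\chi$ and $\chi_*(t)=((t_{\chi(1)},\dots,t_{\chi(r)}),(t_{\chi(r+1)},\dots,t_{\chi(r+s)}))$; the unit is the $0$-simplex at $e$. The coproduct is $\Delta(\sigma)=\sum_{i+j=k}(\sigma\circ f^k_i)\otimes(\sigma\circ b^k_j)$, where $f_i^k\colon\Delta_i\to\Delta_k$ and $b_j^k\colon\Delta_j\to\Delta_k$ are the affine maps sending the $l$-th vertex to $v_l$ and $v_{l+k-j}$ respectively. **The category $\mathbf{Mod}(\mathrm{C}_\bullet(G))$.** Objects are left DG modules $\rho\colon\mathrm{C}_\bullet(G)\to\mathrm{End}(V)$ (DG algebra morphisms) such that: (a) $V$ is a finite dimensional cochain complex; (b) $\rho$ vanishes on thin simplices, a simplex $\sigma\colon\Delta_k\to G$ being thin if the rank of its differential is less than $k$ at every point; (c) for every manifold $M$ and smooth $\sigma_M\colon M\times\Delta_k\to G$, the map $p\mapsto\rho(\sigma_M(p,-))$, $M\to\mathrm{End}(V)$, is smooth; (d) for a basis of $V$, the matrix-entry cochains $\sigma\mapsto\rho(\sigma)_{ij}$ are alternating and subdivision invariant (below). Morphisms are $\mathrm{C}_\bullet(G)$-equivariant cochain maps of degree $0$. The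 tensor product of modules is $\rho_{V\otimes W}(a)=\mathrm{nat}\circ(\rho_V\otimes\rho_W)\circ\Delta(a)$ with $\mathrm{nat}(\phi\otimes\varphi)(v\otimes w)=(-1)^{|v||\varphi|}\phi(v)\otimes\varphi(w)$. Alternating/subdivision invariant: for a singular cochain $c\in\mathrm{C}^k(M)$ (a linear functional on smooth singular $k$-chains) and smooth $\theta\colon I^k\to M$ put $\tau(c)(\theta)=\sum_{\chi\in\mathfrak{S}_k}\mathrm{sgn}(\chi)\,c(\theta\circ\chi_* )$, $\chi_*\colon\Delta_k\to I^k$, $\chi_*(t)=(t_{\chi(1)},\dots,t_{\chi(k)})$. $c$ is alternating if $\tau(c)(\theta\circ\chi_* )=\mathrm{sgn}(\chi)\tau(c)(\theta)$ for all smooth $\theta\colon I^k\to M$ and $\chi\in\mathfrak{S}_k$ (where now $\chi_*\colon I^k\to I^k$ is given by the same formula). $c$ is subdivision invariant if for every triangulation $f\colon|X|\to I^k$ of the cube by a finite simplicial complex with totally ordered vertex set, affine on each simplex, and every smooth $\theta\colon I^k\to M$, $\tau(c)(\theta)=\sum_{\sigma}\mathrm{sgn}(\sigma)\,c(\theta\circ\sigma)$, the sum over the $k$-simplices $\sigma\colon\Delta_k\to I^k$ of the triangulation (parametrized affinely, respecting the vertex order), $\mathrm{sgn}(\sigma)=\pm1$ according to whether $\sigma$ preserves or reverses orientation.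
   Formalization: The tensor product of two modules in Mod(C(G)) can fail to vanish on thin simplices, so it need not lie in Mod(C(G)); monoidality is stated by applying the formulas for D to V⊗W for all V, W in Mod(C(G)), without claiming that V⊗W is in Mod(C(G)). *)

theory Defs
  imports "HOL-Analysis.Analysis" "HOL-Library.Poly_Mapping" "HOL-Algebra.Group"
begin

section \<open>Smooth manifolds\<close>

text \<open>
  The dimensions \<open>k\<close> of simplices and \<open>n\<close> of manifolds are quantified inside the definitions below.
  Therefore \<open>\<real>\<^sup>n\<close> is the library space \<^const>\<open>Euclidean_space\<close> \<open>n\<close>: sequences
  \<open>x :: nat \<Rightarrow> real\<close> with \<open>x i = 0\<close> for \<open>i \<ge> n\<close>. Coordinates are counted from 0.
\<close>

primrec C_k_on :: "nat \<Rightarrow> nat \<Rightarrow> (nat \<Rightarrow> real) set \<Rightarrow> ((nat \<Rightarrow> real) \<Rightarrow> real) \<Rightarrow> bool" where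
  "C_k_on n 0 U f = continuous_on U f"
| "C_k_on n (Suc k) U f =
    (continuous_on U f \<and>
     (\<forall>i<n. \<exists>g. (\<forall>x\<in>U. ((\<lambda>s. f (x(i := s))) has_real_derivative g x) (at (x i))) \<and> C_k_on n k U g))"

text \<open>The following is meant for \<open>U\<close> open in \<open>\<real>\<^sup>n\<close>.\<close>

definition smooth_fun :: "nat \<Rightarrow> (nat \<Rightarrow> real) set \<Rightarrow> ((nat \<Rightarrow> real) \<Rightarrow> real) \<Rightarrow> bool" where
  "smooth_fun n U f \<longleftrightarrow> (\<forall>k. C_k_on n k U f)"

record 'm mfd =
  mtop :: "'m topology"
  mdim :: nat
  charts :: "('m set \<times> ('m \<Rightarrow> nat \<Rightarrow> real)) set"

text \<open>The atlas need not be maximal.\<close>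

definition smooth_manifold :: "'m mfd \<Rightarrow> bool" where
  "smooth_manifold M \<longleftrightarrow>
     Hausdorff_space (mtop M) \<and> second_countable (mtop M) \<and>
     (\<forall>(U, \<phi>)\<in>charts M. openin (mtop M) U \<and> openin (Euclidean_space (mdim M)) (\<phi> ` U) \<and>
        homeomorphic_map (subtopology (mtop M) U) (subtopology (Euclidean_space (mdim M)) (\<phi> ` U)) \<phi>) \<and>
     (\<Union>(U, \<phi>)\<in>charts M. U) = topspace (mtop M) \<and>
     (\<forall>(U, \<phi>)\<in>charts M. \<forall>(V, \<psi>)\<in>charts M. \<forall>a<mdim M.
        smooth_fun (mdim M) (\<phi> ` (U \<inter> V)) (\<lambda>x. \<psi> (inv_into U \<phi> x) a))"

definition eucl :: "nat \<Rightarrow> (nat \<Rightarrow> real) mfd" where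
  "eucl n = \<lparr>mtop = Euclidean_space n, mdim = n, charts = {(topspace (Euclidean_space n), \<lambda>x. x)}\<rparr>"

definition concat_coords :: "nat \<Rightarrow> (nat \<Rightarrow> real) \<Rightarrow> (nat \<Rightarrow> real) \<Rightarrow> nat \<Rightarrow> real" where
  "concat_coords m x y = (\<lambda>i. if i < m then x i else y (i - m))"

definition prod_mfd :: "'m mfd \<Rightarrow> 'n mfd \<Rightarrow> ('m \<times> 'n) mfd" where
  "prod_mfd M N = \<lparr>mtop = prod_topology (mtop M) (mtop N), mdim = mdim M + mdim N,
     charts = {(U \<times> V, \<lambda>(p, q). concat_coords (mdim M) (\<phi> p) (\<psi> q)) | U \<phi> V \<psi>.
                 (U, \<phi>) \<in> charts M \<and> (V, \<psi>) \<in> charts N}\<rparr>"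

definition smooth_map :: "'m mfd \<Rightarrow> 'n mfd \<Rightarrow> 'm set \<Rightarrow> ('m \<Rightarrow> 'n) \<Rightarrow> bool" where
  "smooth_map M N W f \<longleftrightarrow>
     openin (mtop M) W \<and> continuous_map (subtopology (mtop M) W) (mtop N) f \<and>
     (\<forall>(U, \<phi>)\<in>charts M. \<forall>(V, \<psi>)\<in>charts N. \<forall>a<mdim N.
        smooth_fun (mdim M) (\<phi> ` {p \<in> U \<inter> W. f p \<in> V}) (\<lambda>x. \<psi> (f (inv_into U \<phi> x)) a))"

text \<open>Smoothness on an arbitrary subset \<open>S\<close>, such as a simplex or a cube, means local extendability
  to a smooth map on an open set.\<close>

definition smooth_on_set :: "'m mfd \<Rightarrow> 'n mfd \<Rightarrow> 'm set \<Rightarrow> ('m \<Rightarrow> 'n) \<Rightarrow> bool" where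
  "smooth_on_set M N S f \<longleftrightarrow>
     (\<forall>p\<in>S. \<exists>W F. p \<in> W \<and> smooth_map M N W F \<and> (\<forall>q\<in>W \<inter> S. F q = f q))"

definition smooth_real :: "'m mfd \<Rightarrow> ('m \<Rightarrow> real) \<Rightarrow> bool" where
  "smooth_real M f \<longleftrightarrow>
     (\<forall>(U, \<phi>)\<in>charts M. smooth_fun (mdim M) (\<phi> ` U) (\<lambda>x. f (inv_into U \<phi> x)))"

text \<open>The algebra of smooth real functions, extended by 0 outside the manifold.\<close>

definition Cinf :: "'m mfd \<Rightarrow> ('m \<Rightarrow> real) set" where
  "Cinf M = {f. smooth_real M f \<and> (\<forall>p. p \<notin> topspace (mtop M) \<longrightarrow> f p = 0)}"

section \<open>Lie groups, left invariant vector fields and the exponential map\<close>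

record 'g lgroup = "'g monoid" +
  mfd_of :: "'g mfd"

definition lie_group :: "'g lgroup \<Rightarrow> bool" where
  "lie_group G \<longleftrightarrow>
     group G \<and> smooth_manifold (mfd_of G) \<and> topspace (mtop (mfd_of G)) = carrier G \<and>
     smooth_map (prod_mfd (mfd_of G) (mfd_of G)) (mfd_of G) (carrier G \<times> carrier G)
       (\<lambda>(p, q). p \<otimes>\<^bsub>G\<^esub> q) \<and>
     smooth_map (mfd_of G) (mfd_of G) (carrier G) (\<lambda>p. inv\<^bsub>G\<^esub> p)"

text \<open>Vector fields are the derivations of the algebra of smooth functions. They are set to 0 on
  functions outside \<open>Cinf M\<close>, so that equal vector fields are equal as functions.\<close>

type_synonym 'm vfield = "('m \<Rightarrow> real) \<Rightarrow> 'm \<Rightarrow> real"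

definition vector_fields :: "'m mfd \<Rightarrow> 'm vfield set" where
  "vector_fields M = {X.
     (\<forall>f\<in>Cinf M. X f \<in> Cinf M) \<and> (\<forall>f. f \<notin> Cinf M \<longrightarrow> X f = (\<lambda>_. 0)) \<and>
     (\<forall>f\<in>Cinf M. \<forall>g\<in>Cinf M. X (\<lambda>p. f p + g p) = (\<lambda>p. X f p + X g p)) \<and>
     (\<forall>c. \<forall>f\<in>Cinf M. X (\<lambda>p. c * f p) = (\<lambda>p. c * X f p)) \<and>
     (\<forall>f\<in>Cinf M. \<forall>g\<in>Cinf M. X (\<lambda>p. f p * g p) = (\<lambda>p. f p * X g p + g p * X f p))}"

definition vf_zero :: "'m vfield" where
  "vf_zero = (\<lambda>f p. 0)"

definition vf_add :: "'m vfield \<Rightarrow> 'm vfield \<Rightarrow> 'm vfield" where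
  "vf_add X Y = (\<lambda>f p. X f p + Y f p)"

definition vf_scale :: "real \<Rightarrow> 'm vfield \<Rightarrow> 'm vfield" where
  "vf_scale c X = (\<lambda>f p. c * X f p)"

definition vf_bracket :: "'m vfield \<Rightarrow> 'm vfield \<Rightarrow> 'm vfield" where
  "vf_bracket X Y = (\<lambda>f p. X (Y f) p - Y (X f) p)"

definition left_translate :: "'g lgroup \<Rightarrow> 'g \<Rightarrow> ('g \<Rightarrow> real) \<Rightarrow> 'g \<Rightarrow> real" where
  "left_translate G g f = (\<lambda>p. if p \<in> carrier G then f (g \<otimes>\<^bsub>G\<^esub> p) else 0)"

definition lie_alg :: "'g lgroup \<Rightarrow> 'g vfield set" where
  "lie_alg G = {X \<in> vector_fields (mfd_of G).
     \<forall>g\<in>carrier G. \<forall>f\<in>Cinf (mfd_of G). X (left_translate G g f) = left_translate G g (X f)}"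

definition integral_curve :: "'m mfd \<Rightarrow> 'm vfield \<Rightarrow> (real \<Rightarrow> 'm) \<Rightarrow> bool" where
  "integral_curve M X \<gamma> \<longleftrightarrow>
     (\<forall>t. \<gamma> t \<in> topspace (mtop M)) \<and>
     (\<forall>f\<in>Cinf M. \<forall>t. ((\<lambda>s. f (\<gamma> s)) has_real_derivative X f (\<gamma> t)) (at t))"

definition lie_exp :: "'g lgroup \<Rightarrow> 'g vfield \<Rightarrow> 'g" where
  "lie_exp G X = (THE \<gamma>. integral_curve (mfd_of G) X \<gamma> \<and> \<gamma> 0 = \<one>\<^bsub>G\<^esub>) 1"

section \<open>Smooth singular chains\<close>

text \<open>The coordinate \<open>t\<^sub>i\<close> of the literature is \<open>t (i - 1)\<close>.\<close>

definition Delta :: "nat \<Rightarrow> (nat \<Rightarrow> real) set" where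
  "Delta k = {t. (\<forall>i<k. 0 \<le> t i \<and> t i \<le> 1) \<and> (\<forall>i j. i \<le> j \<and> j < k \<longrightarrow> t j \<le> t i) \<and> (\<forall>i\<ge>k. t i = 0)}"

definition Cube :: "nat \<Rightarrow> (nat \<Rightarrow> real) set" where
  "Cube k = {t. (\<forall>i<k. 0 \<le> t i \<and> t i \<le> 1) \<and> (\<forall>i\<ge>k. t i = 0)}"

definition vert :: "nat \<Rightarrow> nat \<Rightarrow> real" where
  "vert i = (\<lambda>j. if j < i then 1 else 0)"

definition bary :: "nat \<Rightarrow> (nat \<Rightarrow> real) \<Rightarrow> nat \<Rightarrow> real" where
  "bary k t l = (if l = 0 then 1 else t (l - 1)) - (if l = k then 0 else t l)"

text \<open>The affine map on \<open>Delta k\<close> that sends the vertex \<open>vert l\<close> to \<open>w l\<close> for \<open>l \<le> k\<close>;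
  \<open>bary k t\<close> are the barycentric coordinates of \<open>t\<close>.\<close>

definition affine_simplex :: "nat \<Rightarrow> (nat \<Rightarrow> nat \<Rightarrow> real) \<Rightarrow> (nat \<Rightarrow> real) \<Rightarrow> nat \<Rightarrow> real" where
  "affine_simplex k w t = (\<lambda>i. \<Sum>l\<le>k. bary k t l * w l i)"

text \<open>A singular simplex carries its dimension, since the map alone does not determine it
  (consider constant maps with value \<^const>\<open>undefined\<close>).\<close>

type_synonym 'm ssimplex = "nat \<times> ((nat \<Rightarrow> real) \<Rightarrow> 'm)"
type_synonym 'm chain = "'m ssimplex \<Rightarrow>\<^sub>0 real"

definition mk_simplex :: "nat \<Rightarrow> ((nat \<Rightarrow> real) \<Rightarrow> 'm) \<Rightarrow> 'm ssimplex" where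
  "mk_simplex k s = (k, restrict s (Delta k))"

definition smooth_simplices :: "'m mfd \<Rightarrow> nat \<Rightarrow> 'm ssimplex set" where
  "smooth_simplices M k =
     {(k, s) | s. s \<in> extensional (Delta k) \<and> smooth_on_set (eucl k) M (Delta k) s}"

definition chains_deg :: "'m mfd \<Rightarrow> nat \<Rightarrow> 'm chain set" where
  "chains_deg M k = {a. Poly_Mapping.keys a \<subseteq> smooth_simplices M k}"

definition chains :: "'m mfd \<Rightarrow> 'm chain set" where
  "chains M = {a. Poly_Mapping.keys a \<subseteq> (\<Union>k. smooth_simplices M k)}"

definition gen :: "'b \<Rightarrow> 'b \<Rightarrow>\<^sub>0 real" where
  "gen s = Poly_Mapping.single s 1"

definition pm_scale :: "real \<Rightarrow> ('b \<Rightarrow>\<^sub>0 real) \<Rightarrow> 'b \<Rightarrow>\<^sub>0 real" where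
  "pm_scale c a = Poly_Mapping.map ((*) c) a"

definition lin_extend :: "('b \<Rightarrow> 'c \<Rightarrow>\<^sub>0 real) \<Rightarrow> ('b \<Rightarrow>\<^sub>0 real) \<Rightarrow> 'c \<Rightarrow>\<^sub>0 real" where
  "lin_extend F a = (\<Sum>s\<in>Poly_Mapping.keys a. pm_scale (Poly_Mapping.lookup a s) (F s))"

definition face :: "nat \<Rightarrow> 'm ssimplex \<Rightarrow> 'm ssimplex" where
  "face i = (\<lambda>(k, s). mk_simplex (k - 1)
     (\<lambda>t. s (affine_simplex (k - 1) (\<lambda>l. vert (if l < i then l else Suc l)) t)))"

definition boundary :: "'m chain \<Rightarrow> 'm chain" where
  "boundary = lin_extend (\<lambda>(k, s).
     if k = 0 then 0 else (\<Sum>i\<le>k. pm_scale ((-1) ^ i) (gen (face i (k, s)))))"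

definition rs_shuffles :: "nat \<Rightarrow> nat \<Rightarrow> (nat \<Rightarrow> nat) set" where
  "rs_shuffles r s = {\<kappa>. \<kappa> permutes {..<r + s} \<and>
     strict_mono_on {..<r} \<kappa> \<and> strict_mono_on {r..<r + s} \<kappa>}"

definition simplex_prod :: "'g lgroup \<Rightarrow> 'g ssimplex \<Rightarrow> 'g ssimplex \<Rightarrow> 'g chain" where
  "simplex_prod G = (\<lambda>(r, \<sigma>) (s, \<nu>). \<Sum>\<kappa>\<in>rs_shuffles r s.
     pm_scale (of_int (sign \<kappa>)) (gen (mk_simplex (r + s)
       (\<lambda>t. \<sigma> (\<lambda>i. if i < r then t (\<kappa> i) else 0) \<otimes>\<^bsub>G\<^esub>
            \<nu> (\<lambda>i. if i < s then t (\<kappa> (r + i)) else 0)))))"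

definition chain_prod :: "'g lgroup \<Rightarrow> 'g chain \<Rightarrow> 'g chain \<Rightarrow> 'g chain" where
  "chain_prod G a b = lin_extend (\<lambda>\<sigma>. lin_extend (\<lambda>\<nu>. simplex_prod G \<sigma> \<nu>) b) a"

definition point_simplex :: "'m \<Rightarrow> 'm ssimplex" where
  "point_simplex g = mk_simplex 0 (\<lambda>_. g)"

definition chain_unit :: "'g lgroup \<Rightarrow> 'g chain" where
  "chain_unit G = gen (point_simplex \<one>\<^bsub>G\<^esub>)"

text \<open>The tensor square of the space of chains has the pairs of simplices as a basis.\<close>

definition coproduct :: "'m chain \<Rightarrow> ('m ssimplex \<times> 'm ssimplex) \<Rightarrow>\<^sub>0 real" where
  "coproduct = lin_extend (\<lambda>(k, s). \<Sum>i\<le>k. gen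
     (mk_simplex i (\<lambda>t. s (affine_simplex i vert t)),
      mk_simplex (k - i) (\<lambda>t. s (affine_simplex (k - i) (\<lambda>l. vert (l + i)) t))))"

text \<open>Rank of the \<open>n \<times> k\<close> matrix \<open>J\<close>: the maximal number of linearly independent columns.\<close>

definition mat_rank :: "nat \<Rightarrow> nat \<Rightarrow> (nat \<Rightarrow> nat \<Rightarrow> real) \<Rightarrow> nat" where
  "mat_rank n k J = Max (card ` {S. S \<subseteq> {..<k} \<and>
     (\<forall>c :: nat \<Rightarrow> real. (\<forall>a<n. (\<Sum>i\<in>S. c i * J a i) = 0) \<longrightarrow> (\<forall>i\<in>S. c i = 0))})"

text \<open>The differential at \<open>t\<close> is the Jacobian, in a chart around \<open>s t\<close>, of a smooth extension \<open>F\<close> of \<open>s\<close>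
  near \<open>t\<close>. Its rank depends neither on the chart nor on \<open>F\<close>, as the simplex is the closure of its
  interior.\<close>

definition thin :: "'m mfd \<Rightarrow> 'm ssimplex \<Rightarrow> bool" where
  "thin M = (\<lambda>(k, s). \<forall>t\<in>Delta k. \<exists>W F V \<psi>.
     t \<in> W \<and> smooth_map (eucl k) M W F \<and> (\<forall>u\<in>W \<inter> Delta k. F u = s u) \<and>
     (V, \<psi>) \<in> charts M \<and> s t \<in> V \<and>
     mat_rank (mdim M) k (\<lambda>a i. deriv (\<lambda>r. \<psi> (F (t(i := r))) a) (t i)) < k)"

section \<open>Alternating and subdivision invariant cochains\<close>

text \<open>A cochain is given by its values on simplices.\<close>

definition perm_coords :: "nat \<Rightarrow> (nat \<Rightarrow> nat) \<Rightarrow> (nat \<Rightarrow> real) \<Rightarrow> nat \<Rightarrow> real" where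
  "perm_coords k \<kappa> t = (\<lambda>i. if i < k then t (\<kappa> i) else 0)"

definition tau :: "nat \<Rightarrow> ('m ssimplex \<Rightarrow> real) \<Rightarrow> ((nat \<Rightarrow> real) \<Rightarrow> 'm) \<Rightarrow> real" where
  "tau k c \<theta> = (\<Sum>\<kappa> | \<kappa> permutes {..<k}.
     of_int (sign \<kappa>) * c (mk_simplex k (\<lambda>t. \<theta> (perm_coords k \<kappa> t))))"

definition alternating :: "'m mfd \<Rightarrow> nat \<Rightarrow> ('m ssimplex \<Rightarrow> real) \<Rightarrow> bool" where
  "alternating M k c \<longleftrightarrow>
     (\<forall>\<theta> \<kappa>. smooth_on_set (eucl k) M (Cube k) \<theta> \<and> \<kappa> permutes {..<k} \<longrightarrow>
        tau k c (\<lambda>u. \<theta> (perm_coords k \<kappa> u)) = of_int (sign \<kappa>) * tau k c \<theta>)"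

text \<open>Finite abstract simplicial complexes on natural numbers: every finite totally ordered vertex
  set is order isomorphic to a set of natural numbers. A map on the realization that is affine on
  simplices is given by the images \<open>p v\<close> of the vertices.\<close>

definition finite_complex :: "nat set set \<Rightarrow> bool" where
  "finite_complex K \<longleftrightarrow> finite K \<and> (\<forall>S\<in>K. finite S \<and> S \<noteq> {}) \<and>
     (\<forall>S\<in>K. \<forall>T. T \<subseteq> S \<and> T \<noteq> {} \<longrightarrow> T \<in> K)"

definition realization :: "nat set set \<Rightarrow> (nat \<Rightarrow> real) set" where
  "realization K = {w. (\<forall>v. 0 \<le> w v) \<and> {v. w v \<noteq> 0} \<in> K \<and> (\<Sum>v | w v \<noteq> 0. w v) = 1}"

definition affine_realization_map :: "(nat \<Rightarrow> nat \<Rightarrow> real) \<Rightarrow> (nat \<Rightarrow> real) \<Rightarrow> nat \<Rightarrow> real" where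
  "affine_realization_map p w = (\<lambda>i. \<Sum>v | w v \<noteq> 0. w v * p v i)"

definition cube_triangulation :: "nat \<Rightarrow> nat set set \<Rightarrow> (nat \<Rightarrow> nat \<Rightarrow> real) \<Rightarrow> bool" where
  "cube_triangulation k K p \<longleftrightarrow> finite_complex K \<and>
     (\<exists>g. homeomorphism (realization K) (Cube k) (affine_realization_map p) g)"

definition ordered_vertex :: "(nat \<Rightarrow> nat \<Rightarrow> real) \<Rightarrow> nat set \<Rightarrow> nat \<Rightarrow> nat \<Rightarrow> real" where
  "ordered_vertex p S l = p (sorted_list_of_set S ! l)"

text \<open>The linear part of \<open>affine_simplex k w\<close> maps the \<open>j\<close>-th unit vector to \<open>w (Suc j) - w j\<close>.\<close>

definition simplex_orientation :: "nat \<Rightarrow> (nat \<Rightarrow> nat \<Rightarrow> real) \<Rightarrow> real" where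
  "simplex_orientation k w = sgn (\<Sum>\<kappa> | \<kappa> permutes {..<k}.
     of_int (sign \<kappa>) * (\<Prod>j<k. w (Suc j) (\<kappa> j) - w j (\<kappa> j)))"

definition subdivision_invariant :: "'m mfd \<Rightarrow> nat \<Rightarrow> ('m ssimplex \<Rightarrow> real) \<Rightarrow> bool" where
  "subdivision_invariant M k c \<longleftrightarrow>
     (\<forall>K p \<theta>. cube_triangulation k K p \<and> smooth_on_set (eucl k) M (Cube k) \<theta> \<longrightarrow>
        tau k c \<theta> = (\<Sum>S | S \<in> K \<and> card S = Suc k.
          simplex_orientation k (ordered_vertex p S) *
          c (mk_simplex k (\<lambda>t. \<theta> (affine_simplex k (ordered_vertex p S) t)))))"

section \<open>Tensor products of real vector spaces\<close>

text \<open>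
  The elements are the finite sums of evaluations \<open>B \<mapsto> B a b\<close> on bilinear forms \<open>B\<close>. Over a field
  this is the algebraic tensor product: bilinear forms separate its points.
\<close>

typedef (overloaded) ('a::real_vector, 'b::real_vector) tensor =
  "{T :: ('a \<Rightarrow> 'b \<Rightarrow> real) \<Rightarrow> real.
     \<exists>xs :: ('a \<times> 'b) list. T = (\<lambda>B. if bilinear B then (\<Sum>(a, b)\<leftarrow>xs. B a b) else 0)}"
  by blast

setup_lifting type_definition_tensor

lift_definition tens :: "'a::real_vector \<Rightarrow> 'b::real_vector \<Rightarrow> ('a, 'b) tensor" (infixr "\<otimes>\<^sub>t" 75)
  is "\<lambda>a b B. if bilinear B then B a b else 0"
proof -
  fix a :: 'a and b :: 'b
  show "\<exists>xs. (\<lambda>B. if bilinear B then B a b else 0) =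
      (\<lambda>B. if bilinear B then (\<Sum>(a, b)\<leftarrow>xs. B a b) else 0)"
    by (rule exI[of _ "[(a, b)]"]) (simp add: fun_eq_iff)
qed

instantiation tensor :: (real_vector, real_vector) real_vector
begin

lift_definition zero_tensor :: "('a, 'b) tensor" is "\<lambda>B. 0"
  by (rule exI[of _ "[]"]) (simp add: fun_eq_iff)

lift_definition plus_tensor :: "('a, 'b) tensor \<Rightarrow> ('a, 'b) tensor \<Rightarrow> ('a, 'b) tensor"
  is "\<lambda>S T B. S B + T B"
proof -
  fix S T :: "('a \<Rightarrow> 'b \<Rightarrow> real) \<Rightarrow> real"
  assume "\<exists>xs. S = (\<lambda>B. if bilinear B then (\<Sum>(a, b)\<leftarrow>xs. B a b) else 0)"
    and "\<exists>xs. T = (\<lambda>B. if bilinear B then (\<Sum>(a, b)\<leftarrow>xs. B a b) else 0)"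
  then obtain xs ys where "S = (\<lambda>B. if bilinear B then (\<Sum>(a, b)\<leftarrow>xs. B a b) else 0)"
    and "T = (\<lambda>B. if bilinear B then (\<Sum>(a, b)\<leftarrow>ys. B a b) else 0)" by blast
  then show "\<exists>xs. (\<lambda>B. S B + T B) = (\<lambda>B. if bilinear B then (\<Sum>(a, b)\<leftarrow>xs. B a b) else 0)"
    by (intro exI[of _ "xs @ ys"]) (simp add: fun_eq_iff)
qed

lift_definition scaleR_tensor :: "real \<Rightarrow> ('a, 'b) tensor \<Rightarrow> ('a, 'b) tensor"
  is "\<lambda>c T B. c * T B"
proof -
  fix c :: real and T :: "('a \<Rightarrow> 'b \<Rightarrow> real) \<Rightarrow> real"
  assume "\<exists>xs. T = (\<lambda>B. if bilinear B then (\<Sum>(a, b)\<leftarrow>xs. B a b) else 0)"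
  then obtain xs where T: "T = (\<lambda>B. if bilinear B then (\<Sum>(a, b)\<leftarrow>xs. B a b) else 0)" by blast
  have "c * (\<Sum>(a, b)\<leftarrow>xs. B a b) = (\<Sum>(a, b)\<leftarrow>map (\<lambda>(a, b). (c *\<^sub>R a, b)) xs. B a b)"
    if "bilinear B" for B :: "'a \<Rightarrow> 'b \<Rightarrow> real"
    using that by (induction xs) (auto simp: bilinear_lmul algebra_simps)
  then show "\<exists>xs. (\<lambda>B. c * T B) = (\<lambda>B. if bilinear B then (\<Sum>(a, b)\<leftarrow>xs. B a b) else 0)"
    unfolding T by (intro exI[of _ "map (\<lambda>(a, b). (c *\<^sub>R a, b)) xs"]) (simp add: fun_eq_iff)
qed

definition uminus_tensor :: "('a, 'b) tensor \<Rightarrow> ('a, 'b) tensor" where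
  "uminus_tensor T = (-1) *\<^sub>R T"

definition minus_tensor :: "('a, 'b) tensor \<Rightarrow> ('a, 'b) tensor \<Rightarrow> ('a, 'b) tensor" where
  "minus_tensor S T = S + - T"

instance
proof
  fix S T R :: "('a, 'b) tensor" and c d :: real
  show "S + T + R = S + (T + R)" by transfer (simp add: fun_eq_iff)
  show "S + T = T + S" by transfer (simp add: fun_eq_iff)
  show "0 + S = S" by transfer simp
  show "- S + S = 0" unfolding uminus_tensor_def by transfer simp
  show "S - T = S + - T" by (rule minus_tensor_def)
  show "c *\<^sub>R (S + T) = c *\<^sub>R S + c *\<^sub>R T" by transfer (simp add: fun_eq_iff algebra_simps)
  show "(c + d) *\<^sub>R S = c *\<^sub>R S + d *\<^sub>R S" by transfer (simp add: fun_eq_iff algebra_simps)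
  show "c *\<^sub>R d *\<^sub>R S = (c * d) *\<^sub>R S" by transfer (simp add: fun_eq_iff)
  show "1 *\<^sub>R S = S" by transfer simp
qed

end

lemma bilinear_tens: "bilinear (\<otimes>\<^sub>t)"
  unfolding bilinear_def linear_iff
  by (intro conjI allI; transfer)
    (auto simp: fun_eq_iff bilinear_ladd bilinear_radd bilinear_lmul bilinear_rmul)

lemma span_tens: "span {a \<otimes>\<^sub>t b | a b. True} = UNIV"
proof -
  have "\<exists>xs. T = (\<Sum>(a, b)\<leftarrow>xs. a \<otimes>\<^sub>t b)" for T :: "('a, 'b) tensor"
  proof -
    obtain xs where xs: "Rep_tensor T = (\<lambda>B. if bilinear B then (\<Sum>(a, b)\<leftarrow>xs. B a b) else 0)"
      using Rep_tensor[of T] by blast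
    have "Rep_tensor (\<Sum>(a, b)\<leftarrow>xs. a \<otimes>\<^sub>t b) = (\<lambda>B. if bilinear B then (\<Sum>(a, b)\<leftarrow>xs. B a b) else 0)"
      for xs :: "('a \<times> 'b) list"
      by (induction xs) (auto simp: zero_tensor.rep_eq plus_tensor.rep_eq tens.rep_eq fun_eq_iff)
    then show ?thesis using xs by (metis Rep_tensor_inject)
  qed
  moreover have "(\<Sum>(a, b)\<leftarrow>xs. a \<otimes>\<^sub>t b) \<in> span {a \<otimes>\<^sub>t b | a b. True}" for xs :: "('a \<times> 'b) list"
    by (induction xs) (auto intro!: span_add span_zero intro: span_base)
  ultimately show ?thesis by (metis UNIV_eq_I)
qed

section \<open>Finite dimensional cochain complexes\<close>

text \<open>The underlying vector space is the whole type; \<open>gr C i\<close> is the subspace of degree \<open>i\<close>.\<close>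

record 'v cplx =
  gr :: "int \<Rightarrow> 'v set"
  dif :: "'v \<Rightarrow> 'v"

definition fd_complex :: "('v::real_vector) cplx \<Rightarrow> bool" where
  "fd_complex C \<longleftrightarrow>
     (\<exists>B :: 'v set. finite B \<and> span B = UNIV) \<and>
     (\<forall>i. subspace (gr C i)) \<and>
     (\<forall>v. \<exists>!c. (\<forall>i. c i \<in> gr C i) \<and> finite {i. c i \<noteq> 0} \<and> v = (\<Sum>i | c i \<noteq> 0. c i)) \<and>
     linear (dif C) \<and> (\<forall>i. dif C ` gr C i \<subseteq> gr C (i + 1)) \<and> (\<forall>v. dif C (dif C v) = 0)"

definition End_deg :: "('v::real_vector) cplx \<Rightarrow> int \<Rightarrow> ('v \<Rightarrow> 'v) set" where
  "End_deg C k = {T. linear T \<and> (\<forall>i. T ` gr C i \<subseteq> gr C (i + k))}"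

definition ksign :: "int \<Rightarrow> real" where
  "ksign n = (if even n then 1 else -1)"

text \<open>The graded commutator \<open>[S, T]\<close> of \<open>S\<close> of degree \<open>p\<close> and \<open>T\<close> of degree \<open>q\<close>.\<close>

definition gcomm :: "int \<Rightarrow> int \<Rightarrow> ('v \<Rightarrow> 'v) \<Rightarrow> ('v \<Rightarrow> 'v) \<Rightarrow> 'v \<Rightarrow> ('v::real_vector)" where
  "gcomm p q S T = (\<lambda>v. S (T v) - ksign (p * q) *\<^sub>R T (S v))"

definition cochain_map :: "('v::real_vector) cplx \<Rightarrow> ('w::real_vector) cplx \<Rightarrow> ('v \<Rightarrow> 'w) \<Rightarrow> bool" where
  "cochain_map C C' \<phi> \<longleftrightarrow> linear \<phi> \<and> (\<forall>i. \<phi> ` gr C i \<subseteq> gr C' i) \<and> (\<forall>v. \<phi> (dif C v) = dif C' (\<phi> v))"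

text \<open>The map \<open>v \<otimes> w \<mapsto> (-1)\<^bsup>|v| q\<^esup> \<phi> v \<otimes> \<psi> w\<close> for \<open>\<psi>\<close> of degree \<open>q\<close>, with its Koszul sign; for \<open>q = 0\<close> this is the plain tensor
  product of maps.\<close>

definition nat_tensor ::
  "('v::real_vector) cplx \<Rightarrow> int \<Rightarrow> ('v \<Rightarrow> 'a::real_vector) \<Rightarrow> ('w::real_vector \<Rightarrow> 'b::real_vector) \<Rightarrow>
   ('v, 'w) tensor \<Rightarrow> ('a, 'b) tensor" where
  "nat_tensor C q \<phi> \<psi> =
     (THE F. linear F \<and> (\<forall>i. \<forall>v\<in>gr C i. \<forall>w. F (v \<otimes>\<^sub>t w) = ksign (i * q) *\<^sub>R (\<phi> v \<otimes>\<^sub>t \<psi> w)))"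

definition cplx_tensor :: "('v::real_vector) cplx \<Rightarrow> ('w::real_vector) cplx \<Rightarrow> ('v, 'w) tensor cplx" where
  "cplx_tensor C C' = \<lparr>
     gr = (\<lambda>n. span {v \<otimes>\<^sub>t w | v w. \<exists>i j. i + j = n \<and> v \<in> gr C i \<and> w \<in> gr C' j}),
     dif = (\<lambda>z. nat_tensor C 0 (dif C) (\<lambda>w. w) z + nat_tensor C 1 (\<lambda>v. v) (dif C') z)\<rparr>"

definition cplx_unit :: "real cplx" where
  "cplx_unit = \<lparr>gr = (\<lambda>i. if i = 0 then UNIV else {0}), dif = (\<lambda>_. 0)\<rparr>"

definition tens_assoc ::
  "(('u::real_vector, 'v::real_vector) tensor, 'w::real_vector) tensor \<Rightarrow> ('u, ('v, 'w) tensor) tensor" where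
  "tens_assoc = (THE F. linear F \<and> (\<forall>u v w. F ((u \<otimes>\<^sub>t v) \<otimes>\<^sub>t w) = u \<otimes>\<^sub>t (v \<otimes>\<^sub>t w)))"

definition tens_lunit :: "(real, 'v::real_vector) tensor \<Rightarrow> 'v" where
  "tens_lunit = (THE F. linear F \<and> (\<forall>r v. F (r \<otimes>\<^sub>t v) = r *\<^sub>R v))"

definition tens_runit :: "('v::real_vector, real) tensor \<Rightarrow> 'v" where
  "tens_runit = (THE F. linear F \<and> (\<forall>v r. F (v \<otimes>\<^sub>t r) = r *\<^sub>R v))"

text \<open>Calculus in the finite dimensional space \<open>End(V)\<close>: derivative and smoothness of all matrix
  entries \<open>T \<mapsto> l (T v)\<close>, with \<open>l\<close> a linear functional on \<open>V\<close>.\<close>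

definition has_End_derivative :: "(real \<Rightarrow> 'v \<Rightarrow> 'v::real_vector) \<Rightarrow> ('v \<Rightarrow> 'v) \<Rightarrow> real \<Rightarrow> bool" where
  "has_End_derivative F T t \<longleftrightarrow> linear T \<and>
     (\<forall>l v. linear l \<longrightarrow> ((\<lambda>s. l (F s v) :: real) has_real_derivative l (T v)) (at t))"

definition smooth_End :: "'m mfd \<Rightarrow> ('m \<Rightarrow> 'v \<Rightarrow> 'v::real_vector) \<Rightarrow> bool" where
  "smooth_End M F \<longleftrightarrow> (\<forall>l v. linear l \<longrightarrow> smooth_real M (\<lambda>p. l (F p v)))"

definition basis_of_type :: "('v::real_vector) set \<Rightarrow> bool" where
  "basis_of_type B \<longleftrightarrow> independent B \<and> span B = UNIV"

section \<open>Modules over singular chains\<close>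

type_synonym ('g, 'v) dgmod = "'v cplx \<times> ('g chain \<Rightarrow> 'v \<Rightarrow> 'v)"

definition dg_module :: "'g lgroup \<Rightarrow> ('g, 'v::real_vector) dgmod \<Rightarrow> bool" where
  "dg_module G = (\<lambda>(C, \<rho>).
     (\<forall>a\<in>chains (mfd_of G). \<forall>b\<in>chains (mfd_of G). \<rho> (a + b) = (\<lambda>v. \<rho> a v + \<rho> b v)) \<and>
     (\<forall>c. \<forall>a\<in>chains (mfd_of G). \<rho> (pm_scale c a) = (\<lambda>v. c *\<^sub>R \<rho> a v)) \<and>
     (\<forall>k. \<forall>a\<in>chains_deg (mfd_of G) k. \<rho> a \<in> End_deg C (- int k)) \<and>
     (\<forall>k. \<forall>a\<in>chains_deg (mfd_of G) k. \<rho> (boundary a) = gcomm 1 (- int k) (dif C) (\<rho> a)) \<and>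
     (\<forall>a\<in>chains (mfd_of G). \<forall>b\<in>chains (mfd_of G). \<rho> (chain_prod G a b) = \<rho> a \<circ> \<rho> b) \<and>
     \<rho> (chain_unit G) = id)"

text \<open>
  The smoothness condition quantifies over manifolds with points in \<open>nat \<Rightarrow> real\<close>. This loses
  nothing: a second countable Hausdorff manifold has at most continuum many points, hence is
  diffeomorphic to one carried by a subset of \<open>nat \<Rightarrow> real\<close>.
\<close>

definition Mod_obj :: "'g lgroup \<Rightarrow> ('g, 'v::real_vector) dgmod \<Rightarrow> bool" where
  "Mod_obj G V \<longleftrightarrow> (let (C, \<rho>) = V; N = mfd_of G in
     dg_module G V \<and>
     fd_complex C \<and>
     (\<forall>k. \<forall>\<sigma>\<in>smooth_simplices N k. thin N \<sigma> \<longrightarrow> \<rho> (gen \<sigma>) = (\<lambda>_. 0)) \<and>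
     (\<forall>(M :: (nat \<Rightarrow> real) mfd) k s.
        smooth_manifold M \<and> smooth_on_set (prod_mfd M (eucl k)) N (topspace (mtop M) \<times> Delta k) s \<longrightarrow>
        smooth_End M (\<lambda>p. \<rho> (gen (mk_simplex k (\<lambda>t. s (p, t)))))) \<and>
     (\<exists>B. basis_of_type B \<and> (\<forall>b\<in>B. \<forall>b'\<in>B. \<forall>k.
        alternating N k (\<lambda>\<sigma>. representation B (\<rho> (gen \<sigma>) b) b') \<and>
        subdivision_invariant N k (\<lambda>\<sigma>. representation B (\<rho> (gen \<sigma>) b) b'))))"

definition Mod_hom ::
  "'g lgroup \<Rightarrow> ('g, 'v::real_vector) dgmod \<Rightarrow> ('g, 'w::real_vector) dgmod \<Rightarrow> ('v \<Rightarrow> 'w) \<Rightarrow> bool" where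
  "Mod_hom G V W \<phi> \<longleftrightarrow> cochain_map (fst V) (fst W) \<phi> \<and>
     (\<forall>a\<in>chains (mfd_of G). \<forall>v. \<phi> (snd V a v) = snd W a (\<phi> v))"

text \<open>The tensor product of two objects of \<open>Mod\<close> need not satisfy \<open>Mod_obj\<close>: the factors need not vanish on
  the front and back faces of a thin simplex.\<close>

definition mod_tensor ::
  "('g, 'v::real_vector) dgmod \<Rightarrow> ('g, 'w::real_vector) dgmod \<Rightarrow> ('g, ('v, 'w) tensor) dgmod" where
  "mod_tensor V W = (cplx_tensor (fst V) (fst W),
     \<lambda>a z. \<Sum>(\<sigma>, \<nu>)\<in>Poly_Mapping.keys (coproduct a). Poly_Mapping.lookup (coproduct a) (\<sigma>, \<nu>) *\<^sub>R
       nat_tensor (fst V) (- int (fst \<nu>)) (snd V (gen \<sigma>)) (snd W (gen \<nu>)) z)"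

text \<open>The monoidal unit is the counit: 1 on simplices of dimension 0, and 0 on all others.\<close>

definition mod_unit :: "('g, real) dgmod" where
  "mod_unit = (cplx_unit,
     \<lambda>a r. (\<Sum>\<sigma>\<in>Poly_Mapping.keys a. if fst \<sigma> = 0 then Poly_Mapping.lookup a \<sigma> else 0) * r)"

section \<open>The DG Lie algebra \<open>\<bbbT>\<g>\<close> and its representations\<close>

text \<open>The bracket and the differential are only considered on homogeneous elements.\<close>

record 'a dgla =
  lcarrier :: "'a set"
  lgr :: "int \<Rightarrow> 'a set"
  ladd :: "'a \<Rightarrow> 'a \<Rightarrow> 'a"
  lscale :: "real \<Rightarrow> 'a \<Rightarrow> 'a"
  lbracket :: "'a \<Rightarrow> 'a \<Rightarrow> 'a"
  ldif :: "'a \<Rightarrow> 'a"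

text \<open>DG Lie algebra morphisms \<open>L \<rightarrow> End(V)\<close>.\<close>

definition dgla_rep :: "'a dgla \<Rightarrow> ('v::real_vector) cplx \<Rightarrow> ('a \<Rightarrow> 'v \<Rightarrow> 'v) \<Rightarrow> bool" where
  "dgla_rep L C \<theta> \<longleftrightarrow>
     (\<forall>a\<in>lcarrier L. \<forall>b\<in>lcarrier L. \<theta> (ladd L a b) = (\<lambda>v. \<theta> a v + \<theta> b v)) \<and>
     (\<forall>c. \<forall>a\<in>lcarrier L. \<theta> (lscale L c a) = (\<lambda>v. c *\<^sub>R \<theta> a v)) \<and>
     (\<forall>p. \<forall>a\<in>lgr L p. \<theta> a \<in> End_deg C p) \<and>
     (\<forall>p. \<forall>a\<in>lgr L p. \<theta> (ldif L a) = gcomm 1 p (dif C) (\<theta> a)) \<and>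
     (\<forall>p q. \<forall>a\<in>lgr L p. \<forall>b\<in>lgr L q. \<theta> (lbracket L a b) = gcomm p q (\<theta> a) (\<theta> b))"

text \<open>The pair \<open>(x, y)\<close> stands for \<open>L\<^sub>x + i\<^sub>y\<close>; thus \<open>[i\<^sub>y, L\<^sub>x] = - i\<^bsub>[x,y]\<^esub> = i\<^bsub>[y,x]\<^esub>\<close>.\<close>

type_synonym 'g telem = "'g vfield \<times> 'g vfield"

definition T_L :: "'g vfield \<Rightarrow> 'g telem" where
  "T_L x = (x, vf_zero)"

definition T_i :: "'g vfield \<Rightarrow> 'g telem" where
  "T_i y = (vf_zero, y)"

definition Tg :: "'g lgroup \<Rightarrow> 'g telem dgla" where
  "Tg G = \<lparr>
     lcarrier = lie_alg G \<times> lie_alg G,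
     lgr = (\<lambda>p. if p = 0 then T_L ` lie_alg G else if p = -1 then T_i ` lie_alg G
                else {(vf_zero, vf_zero)}),
     ladd = (\<lambda>(x, y) (x', y'). (vf_add x x', vf_add y y')),
     lscale = (\<lambda>c (x, y). (vf_scale c x, vf_scale c y)),
     lbracket = (\<lambda>(x, y) (x', y'). (vf_bracket x x', vf_add (vf_bracket x y') (vf_bracket y x'))),
     ldif = (\<lambda>(x, y). (y, vf_zero))\<rparr>"

type_synonym ('g, 'v) trep = "'v cplx \<times> ('g telem \<Rightarrow> 'v \<Rightarrow> 'v)"

definition Rep_obj :: "'g lgroup \<Rightarrow> ('g, 'v::real_vector) trep \<Rightarrow> bool" where
  "Rep_obj G V \<longleftrightarrow> fd_complex (fst V) \<and> dgla_rep (Tg G) (fst V) (snd V)"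

definition Rep_hom ::
  "'g lgroup \<Rightarrow> ('g, 'v::real_vector) trep \<Rightarrow> ('g, 'w::real_vector) trep \<Rightarrow> ('v \<Rightarrow> 'w) \<Rightarrow> bool" where
  "Rep_hom G V W \<phi> \<longleftrightarrow> cochain_map (fst V) (fst W) \<phi> \<and>
     (\<forall>a\<in>lcarrier (Tg G). \<forall>v. \<phi> (snd V a v) = snd W a (\<phi> v))"

definition Rep_iso ::
  "'g lgroup \<Rightarrow> ('g, 'v::real_vector) trep \<Rightarrow> ('g, 'w::real_vector) trep \<Rightarrow> ('v \<Rightarrow> 'w) \<Rightarrow> bool" where
  "Rep_iso G V W \<phi> \<longleftrightarrow> Rep_obj G V \<and> Rep_obj G W \<and> Rep_hom G V W \<phi> \<and>
     (\<exists>\<psi>. Rep_hom G W V \<psi> \<and> \<psi> \<circ> \<phi> = id \<and> \<phi> \<circ> \<psi> = id)"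

definition rep_tensor ::
  "('g, 'v::real_vector) trep \<Rightarrow> ('g, 'w::real_vector) trep \<Rightarrow> ('g, ('v, 'w) tensor) trep" where
  "rep_tensor V W = (cplx_tensor (fst V) (fst W), \<lambda>(x, y) z.
     (nat_tensor (fst V) 0 (snd V (T_L x)) (\<lambda>w. w) z + nat_tensor (fst V) 0 (\<lambda>v. v) (snd W (T_L x)) z) +
     (nat_tensor (fst V) 0 (snd V (T_i y)) (\<lambda>w. w) z + nat_tensor (fst V) (-1) (\<lambda>v. v) (snd W (T_i y)) z))"

definition rep_unit :: "('g, real) trep" where
  "rep_unit = (cplx_unit, \<lambda>_ _. 0)"

section \<open>The functor \<open>\<D>\<close>\<close>

definition exp_simplex :: "'g lgroup \<Rightarrow> 'g vfield \<Rightarrow> 'g ssimplex" where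
  "exp_simplex G x = mk_simplex 1 (\<lambda>s. lie_exp G (vf_scale (s 0) x))"

definition D_L :: "'g lgroup \<Rightarrow> ('g chain \<Rightarrow> 'v \<Rightarrow> 'v::real_vector) \<Rightarrow> 'g vfield \<Rightarrow> 'v \<Rightarrow> 'v" where
  "D_L G \<rho> x = (THE T. has_End_derivative
     (\<lambda>t. \<rho> (gen (point_simplex (lie_exp G (vf_scale t x))))) T 0)"

definition D_i :: "'g lgroup \<Rightarrow> ('g chain \<Rightarrow> 'v \<Rightarrow> 'v::real_vector) \<Rightarrow> 'g vfield \<Rightarrow> 'v \<Rightarrow> 'v" where
  "D_i G \<rho> x = (THE T. has_End_derivative (\<lambda>t. \<rho> (gen (exp_simplex G (vf_scale t x)))) T 0)"

definition D_obj :: "'g lgroup \<Rightarrow> ('g, 'v::real_vector) dgmod \<Rightarrow> ('g, 'v) trep" where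
  "D_obj G V = (fst V, \<lambda>(x, y) v. D_L G (snd V) x v + D_i G (snd V) y v)"

definition D_hom :: "('v \<Rightarrow> 'w) \<Rightarrow> 'v \<Rightarrow> 'w" where
  "D_hom \<phi> = \<phi>"

text \<open>The monoidal structure of \<open>\<D>\<close>: \<open>\<D>(V) \<otimes> \<D>(W) \<rightarrow> \<D>(V \<otimes> W)\<close> and \<open>1 \<rightarrow> \<D>(1)\<close> are the identities of the
  underlying vector spaces.\<close>

definition D_mult :: "('v::real_vector, 'w::real_vector) tensor \<Rightarrow> ('v, 'w) tensor" where
  "D_mult = id"

definition D_one :: "real \<Rightarrow> real" where
  "D_one = id"

end

theory Submission
  imports Defs "HOL-Combinatorics.Permutations"
begin

text \<open>
  The degree 0 part is ordinary Lie theory. On points of \<open>G\<close> the structure map is a group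
  representation with smooth matrix entries, so \<open>L\<^sub>x\<close> is its derivative, and evaluating derivations
  at the unit gives linearity in \<open>x\<close> and \<open>[L\<^sub>x, L\<^sub>y] = L\<^bsub>[x,y]\<^esub>\<close> (\<open>vf_entry\<close>, \<open>DL_bracket\<close>).

  The operators \<open>i\<^sub>x\<close> rest on one property of a matrix entry \<open>c(\<sigma>) = l(\<rho>(\<sigma>) v)\<close>: it is smooth in families
  of simplices and vanishes on thin ones. Therefore the lowest order behaviour of \<open>c\<close> on shrinking
  simplices depends only on first order data at the unit.

  \<^item> For a curve \<open>p\<close> with \<open>p(0) = 1\<close>, the derivative at \<open>t = 0\<close> of \<open>c\<close> on the path \<open>s \<mapsto> p(ts)\<close> is a linear
    function of the velocity \<open>p'(0)\<close> (\<open>cochain_derivative_first_order\<close>). In coordinates \<open>p(u) = u P(u)\<close> by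
    Hadamard's lemma; the path is the member \<open>a = b = t\<close> of the family \<open>s \<mapsto> a s P(b s)\<close>, and for
    \<open>a = 0\<close> this path is constant, hence thin, so that only the direction of \<open>a\<close> contributes, and
    there only \<open>P(0)\<close> matters. This gives existence of \<open>i\<^sub>x\<close> and its linearity in \<open>x\<close>. Applied to the
    conjugated curves \<open>exp(ax) exp(ty) exp(-ax)\<close> and differentiated in \<open>a\<close> it gives
    \<open>[L\<^sub>x, i\<^sub>y] = i\<^bsub>[x,y]\<^esub>\<close> (\<open>Di_bracket\<close>).

  \<^item> The product of the paths \<open>u \<mapsto> exp(s u x)\<close> and \<open>u \<mapsto> exp(t u y)\<close> is the square
    \<open>exp(s u\<^sub>0 x) exp(t u\<^sub>1 y)\<close>, cut into two triangles by the shuffles, so its value is \<open>\<tau>(c)\<close> of that square.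
    The mixed derivative of \<open>\<tau>(c)\<close> at \<open>s = t = 0\<close> depends only on the first order part of the square
    (\<open>tau_mixed_derivative_first_order\<close>): the other contributions come from squares that factor through
    one of the maps \<open>u\<^sub>0\<close>, \<open>u\<^sub>1\<close>, \<open>u\<^sub>0 u\<^sub>1\<close> to the line, and these are thin. The squares
    \<open>exp(ax) exp(by)\<close> and \<open>exp(by) exp(ax)\<close> have the same first order part, and interchanging the
    coordinates of a square changes the sign of \<open>\<tau>(c)\<close>. Hence \<open>i\<^sub>x i\<^sub>y + i\<^sub>y i\<^sub>x = 0\<close> (\<open>Di_Di\<close>).

  The relations \<open>[d, L\<^sub>x] = 0\<close> and \<open>[d, i\<^sub>x] = L\<^sub>x\<close> are the derivatives of the boundary formulas for points and
  for paths. Functoriality holds since a linear map commutes with derivatives. For monoidality, the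
  coproduct of a point \<open>g\<close> is \<open>g \<otimes> g\<close> and that of a path \<open>\<sigma>\<close> is \<open>\<sigma>(0) \<otimes> \<sigma> + \<sigma> \<otimes> \<sigma>(1)\<close>; by the product rule,
  and since a constant path is thin, the derivatives act on \<open>V \<otimes> W\<close> by the graded Leibniz rule
  (\<open>D_obj_mod_tensor\<close>). So all structure maps are identities and coherence is immediate.

  The analysis needed for this is built from the definition of smoothness by iterated partial
  derivatives: the chain rule, cutoff functions, Hadamard's lemma, the description of smooth maps into
  a manifold by smooth functions, and the theorem of Picard and Lindeloef, which
  yields the exponential map.
\<close>

section \<open>Functions of class C-k on open subsets of Euclidean space\<close>

abbreviation Rn :: "nat \<Rightarrow> (nat \<Rightarrow> real) set" where
  "Rn n \<equiv> topspace (Euclidean_space n)"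

abbreviation open_Rn :: "nat \<Rightarrow> (nat \<Rightarrow> real) set \<Rightarrow> bool" where
  "open_Rn n \<equiv> openin (Euclidean_space n)"

lemma Rn_upd: "x \<in> Rn n \<Longrightarrow> i < n \<Longrightarrow> x(i := s) \<in> Rn n"
  by (simp add: topspace_Euclidean_space)

lemma open_Rn_subset: "open_Rn n U \<Longrightarrow> U \<subseteq> Rn n"
  by (rule openin_subset)

lemma open_Rn_obtain:
  assumes "open_Rn n U"
  obtains T where "open T" "U = T \<inter> Rn n"
proof -
  obtain T where "openin (powertop_real UNIV) T" "U = T \<inter> {x. \<forall>i\<ge>n. x i = 0}"
    using assms unfolding Euclidean_space_def openin_subtopology by blast
  then show thesis using that[of T] by (simp add: euclidean_product_topology topspace_Euclidean_space)
qed

lemma open_Rn_Int_open: "open T \<Longrightarrow> open_Rn n (T \<inter> Rn n)"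
  by (auto simp: Euclidean_space_def openin_subtopology euclidean_product_topology)

lemma open_Rn_iff:
  "open_Rn n U \<longleftrightarrow> U \<subseteq> Rn n \<and> (\<forall>x\<in>U. \<exists>e>0. \<forall>y\<in>Rn n. (\<forall>i<n. \<bar>y i - x i\<bar> < e) \<longrightarrow> y \<in> U)"
  (is "?L \<longleftrightarrow> ?R")
proof
  assume L: ?L
  then obtain T where T: "open T" "U = T \<inter> Rn n" by (rule open_Rn_obtain)
  have "\<exists>e>0. \<forall>y\<in>Rn n. (\<forall>i<n. \<bar>y i - x i\<bar> < e) \<longrightarrow> y \<in> U" if x: "x \<in> U" for x
  proof -
    have "openin (product_topology (\<lambda>i::nat. euclideanreal) UNIV) T" "x \<in> T"
      using T x by (auto simp: euclidean_product_topology)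
    then obtain X where X: "x \<in> (\<Pi>\<^sub>E i\<in>UNIV. X i)" "\<And>i. openin euclideanreal (X i)"
        "(\<Pi>\<^sub>E i\<in>UNIV. X i) \<subseteq> T"
      using product_topology_open_contains_basis[of "\<lambda>i::nat. euclideanreal" UNIV T x] by blast
    have "\<exists>e>0. ball (x i) e \<subseteq> X i" for i
      using X(1,2) by (auto simp: PiE_iff open_contains_ball)
    then obtain e where e: "\<And>i. e i > 0" "\<And>i. ball (x i) (e i) \<subseteq> X i" by metis
    define d where "d = Min (insert 1 (e ` {..<n}))"
    have d: "d > 0" "\<And>i. i < n \<Longrightarrow> d \<le> e i" unfolding d_def using e(1) by auto
    have "y \<in> U" if y: "y \<in> Rn n" "\<forall>i<n. \<bar>y i - x i\<bar> < d" for y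
    proof -
      have "y i \<in> X i" for i
      proof (cases "i < n")
        case True
        then have "y i \<in> ball (x i) (e i)" using y(2) d(2)[OF True] by (force simp: dist_real_def)
        then show ?thesis using e(2) by blast
      next
        case False
        then have "y i = x i" using y(1) x T by (simp add: topspace_Euclidean_space)
        then show ?thesis using e by (metis centre_in_ball subsetD)
      qed
      then show ?thesis using X(3) T y(1) by auto
    qed
    then show ?thesis using d(1) by blast
  qed
  then show ?R using open_Rn_subset[OF L] by blast
next
  assume R: ?R
  show ?L
  proof (subst openin_subopen, intro ballI)
    fix x assume x: "x \<in> U"
    then obtain e where e: "e > 0" "\<And>y. y \<in> Rn n \<Longrightarrow> (\<forall>i<n. \<bar>y i - x i\<bar> < e) \<Longrightarrow> y \<in> U"
      using R by blast
    define B where "B = (\<Pi>\<^sub>E i\<in>UNIV. if i < n then ball (x i) e else UNIV)"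
    have "open B" unfolding B_def by (rule open_PiE) auto
    moreover have "x \<in> B \<inter> Rn n" using x R e(1) by (auto simp: B_def)
    moreover have "B \<inter> Rn n \<subseteq> U"
    proof
      fix y assume y: "y \<in> B \<inter> Rn n"
      then have "y i \<in> ball (x i) e" if "i < n" for i
        using that by (auto simp: B_def PiE_iff dest!: spec[of _ i])
      then show "y \<in> U" using e(2) y by (force simp: dist_real_def abs_minus_commute)
    qed
    ultimately show "\<exists>T. open_Rn n T \<and> x \<in> T \<and> T \<subseteq> U" using open_Rn_Int_open by blast
  qed
qed

lemma open_Rn_eventually_upd:
  assumes "open_Rn n U" "x \<in> U" "i < n"
  shows "eventually (\<lambda>s. x(i := s) \<in> U) (nhds (x i))"
proof -
  obtain e where e: "e > 0" "\<And>y. y \<in> Rn n \<Longrightarrow> (\<forall>i<n. \<bar>y i - x i\<bar> < e) \<Longrightarrow> y \<in> U"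
    using assms(1,2) unfolding open_Rn_iff by blast
  have "x \<in> Rn n" using assms open_Rn_subset by blast
  then show ?thesis
    unfolding eventually_nhds_metric using e assms(3)
    by (intro exI[of _ e]) (auto simp: dist_real_def intro!: e(2) Rn_upd)
qed

lemma has_derivative_transform_upd:
  assumes "open_Rn n U" "x \<in> U" "i < n" "\<And>y. y \<in> U \<Longrightarrow> f y = g y"
    and "((\<lambda>s. f (x(i := s))) has_real_derivative D) (at (x i))"
  shows "((\<lambda>s. g (x(i := s))) has_real_derivative D) (at (x i))"
proof -
  have "eventually (\<lambda>s. f (x(i := s)) = g (x(i := s))) (nhds (x i))"
    using open_Rn_eventually_upd[OF assms(1-3)] assms(4) by (auto elim: eventually_mono)
  then have "((\<lambda>s. f (x(i := s))) has_real_derivative D) (at (x i)) \<longleftrightarrow>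
    ((\<lambda>s. g (x(i := s))) has_real_derivative D) (at (x i))" by (rule DERIV_cong_ev[OF refl _ refl])
  then show ?thesis using assms(5) by blast
qed

lemma C_k_on_SucE:
  assumes "C_k_on n (Suc k) U f" "i < n"
  obtains g where "\<And>x. x \<in> U \<Longrightarrow> ((\<lambda>s. f (x(i := s))) has_real_derivative g x) (at (x i))"
    "C_k_on n k U g"
  using assms unfolding C_k_on.simps(2) by blast

lemma C_k_on_SucI:
  assumes "continuous_on U f"
    and "\<And>i. i < n \<Longrightarrow> \<exists>g. (\<forall>x\<in>U. ((\<lambda>s. f (x(i := s))) has_real_derivative g x) (at (x i))) \<and> C_k_on n k U g"
  shows "C_k_on n (Suc k) U f"
  using assms unfolding C_k_on.simps(2) by blast

lemma C_k_on_cong: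
  assumes "open_Rn n U" "\<And>y. y \<in> U \<Longrightarrow> f y = g y" "C_k_on n k U f"
  shows "C_k_on n k U g"
proof -
  have c: "continuous_on U g" if "continuous_on U f"
    using that assms(2) by (metis continuous_on_cong)
  show ?thesis
  proof (cases k)
    case 0
    then show ?thesis using assms c by simp
  next
    case (Suc m)
    have "\<exists>h. (\<forall>x\<in>U. ((\<lambda>s. g (x(i := s))) has_real_derivative h x) (at (x i))) \<and> C_k_on n m U h"
      if i: "i < n" for i
    proof -
      obtain h where h: "\<And>x. x \<in> U \<Longrightarrow> ((\<lambda>s. f (x(i := s))) has_real_derivative h x) (at (x i))"
        "C_k_on n m U h" by (rule C_k_on_SucE[OF assms(3)[unfolded Suc] i]) (rule that)
      show ?thesis
        using has_derivative_transform_upd[OF assms(1) _ i assms(2) h(1)] h(2) by blast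
    qed
    moreover have "continuous_on U g" using assms(3) c by (simp add: Suc)
    ultimately show ?thesis unfolding Suc by (intro C_k_on_SucI)
  qed
qed

definition pd :: "nat \<Rightarrow> ((nat \<Rightarrow> real) \<Rightarrow> real) \<Rightarrow> (nat \<Rightarrow> real) \<Rightarrow> real" where
  "pd i f x = deriv (\<lambda>s. f (x(i := s))) (x i)"

lemma pd_eqI: "((\<lambda>s. f (x(i := s))) has_real_derivative D) (at (x i)) \<Longrightarrow> pd i f x = D"
  unfolding pd_def by (rule DERIV_imp_deriv)

lemma C_k_on_Suc_iff:
  assumes "open_Rn n U"
  shows "C_k_on n (Suc k) U f \<longleftrightarrow> continuous_on U f \<and>
    (\<forall>i<n. (\<forall>x\<in>U. ((\<lambda>s. f (x(i := s))) has_real_derivative pd i f x) (at (x i))) \<and>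
       C_k_on n k U (pd i f))"
    (is "?L \<longleftrightarrow> ?R")
proof
  assume L: ?L
  show ?R
  proof (intro conjI allI impI)
    show "continuous_on U f" using L by simp
    fix i assume i: "i < n"
    obtain g where g: "\<And>x. x \<in> U \<Longrightarrow> ((\<lambda>s. f (x(i := s))) has_real_derivative g x) (at (x i))"
        "C_k_on n k U g"
      by (rule C_k_on_SucE[OF L i]) (rule that)
    have eq: "g x = pd i f x" if "x \<in> U" for x using pd_eqI[OF g(1)[OF that]] by simp
    show "\<forall>x\<in>U. ((\<lambda>s. f (x(i := s))) has_real_derivative pd i f x) (at (x i))"
      using g(1) eq by simp
    show "C_k_on n k U (pd i f)" using C_k_on_cong[OF assms eq g(2)] by blast
  qed
next
  assume ?R
  then show ?L by (intro C_k_on_SucI) auto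
qed

lemma C_k_on_imp_continuous_on: "C_k_on n k U f \<Longrightarrow> continuous_on U f"
  by (cases k) auto

lemma C_k_on_Suc_imp: "C_k_on n (Suc k) U f \<Longrightarrow> C_k_on n k U f"
proof (induction k arbitrary: f)
  case (Suc k)
  then have c: "continuous_on U f" by simp
  have "\<exists>g. (\<forall>x\<in>U. ((\<lambda>s. f (x(i := s))) has_real_derivative g x) (at (x i))) \<and> C_k_on n k U g"
    if "i < n" for i
    using Suc.prems Suc.IH that by (subst (asm) C_k_on.simps(2)) blast
  then show ?case using c by simp
qed simp

lemma C_k_on_subset: "C_k_on n k U f \<Longrightarrow> U' \<subseteq> U \<Longrightarrow> C_k_on n k U' f"
proof (induction k arbitrary: f)
  case 0
  then show ?case using continuous_on_subset by auto
next
  case (Suc k)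
  have "\<exists>g. (\<forall>x\<in>U'. ((\<lambda>s. f (x(i := s))) has_real_derivative g x) (at (x i))) \<and> C_k_on n k U' g"
    if "i < n" for i
    using Suc.prems Suc.IH that by (subst (asm) C_k_on.simps(2)) (meson subsetD)
  moreover have "continuous_on U' f" using Suc.prems continuous_on_subset by auto
  ultimately show ?case by simp
qed

lemma C_k_on_const: "C_k_on n k U (\<lambda>x. c)"
proof (induction k arbitrary: c)
  case (Suc k)
  show ?case using Suc[of 0] by (auto intro!: exI[of _ "\<lambda>x. 0"])
qed simp

lemma C_k_on_coord: "C_k_on n k U (\<lambda>x. x j)"
proof (cases k)
  case 0
  then show ?thesis by (auto intro: continuous_on_product_then_coordinatewise)
next
  case (Suc m)
  have "((\<lambda>s. (x(i := s)) j) has_real_derivative (if i = j then 1 else 0)) (at (x i))"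
    for i and x :: "nat \<Rightarrow> real" by auto
  then show ?thesis unfolding Suc
    by (auto simp del: fun_upd_apply intro!: exI[of _ "\<lambda>x. if _ = j then 1 else 0"] C_k_on_const
        intro: continuous_on_product_then_coordinatewise)
qed

lemma C_k_on_add: "C_k_on n k U f \<Longrightarrow> C_k_on n k U g \<Longrightarrow> C_k_on n k U (\<lambda>x. f x + g x)"
proof (induction k arbitrary: f g)
  case 0
  then show ?case by (auto intro: continuous_on_add)
next
  case (Suc k)
  have "\<exists>h. (\<forall>x\<in>U. ((\<lambda>s. f (x(i := s)) + g (x(i := s))) has_real_derivative h x) (at (x i))) \<and> C_k_on n k U h"
    if i: "i < n" for i
  proof -
    obtain f' where f': "\<And>x. x \<in> U \<Longrightarrow> ((\<lambda>s. f (x(i := s))) has_real_derivative f' x) (at (x i))"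
      "C_k_on n k U f'" by (rule C_k_on_SucE[OF Suc.prems(1) i]) (rule that)
    obtain g' where g': "\<And>x. x \<in> U \<Longrightarrow> ((\<lambda>s. g (x(i := s))) has_real_derivative g' x) (at (x i))"
      "C_k_on n k U g'" by (rule C_k_on_SucE[OF Suc.prems(2) i]) (rule that)
    note D = f' g'
    then show ?thesis by (intro exI[of _ "\<lambda>x. f' x + g' x"] conjI ballI DERIV_add Suc.IH) auto
  qed
  then show ?case using Suc.prems by (auto intro: continuous_on_add)
qed

lemma C_k_on_mult: "C_k_on n k U f \<Longrightarrow> C_k_on n k U g \<Longrightarrow> C_k_on n k U (\<lambda>x. f x * g x)"
proof (induction k arbitrary: f g)
  case 0
  then show ?case by (auto intro: continuous_on_mult)
next
  case (Suc k)
  have fg: "C_k_on n k U f" "C_k_on n k U g" using Suc.prems C_k_on_Suc_imp by blast+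
  have "\<exists>h. (\<forall>x\<in>U. ((\<lambda>s. f (x(i := s)) * g (x(i := s))) has_real_derivative h x) (at (x i))) \<and> C_k_on n k U h"
    if i: "i < n" for i
  proof -
    obtain f' where f': "\<And>x. x \<in> U \<Longrightarrow> ((\<lambda>s. f (x(i := s))) has_real_derivative f' x) (at (x i))"
      "C_k_on n k U f'" by (rule C_k_on_SucE[OF Suc.prems(1) i]) (rule that)
    obtain g' where g': "\<And>x. x \<in> U \<Longrightarrow> ((\<lambda>s. g (x(i := s))) has_real_derivative g' x) (at (x i))"
      "C_k_on n k U g'" by (rule C_k_on_SucE[OF Suc.prems(2) i]) (rule that)
    note D = f' g'
    have "((\<lambda>s. f (x(i := s)) * g (x(i := s))) has_real_derivative f' x * g x + f x * g' x) (at (x i))"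
      if "x \<in> U" for x
      using DERIV_mult[OF D(1)[OF that] D(3)[OF that]] by (simp add: ac_simps)
    moreover have "C_k_on n k U (\<lambda>x. f' x * g x + f x * g' x)"
      using fg D by (intro C_k_on_add Suc.IH)
    ultimately show ?thesis by (intro exI[of _ "\<lambda>x. f' x * g x + f x * g' x"] conjI ballI)
  qed
  then show ?case using Suc.prems by (auto intro: continuous_on_mult)
qed

lemma C_k_on_sum:
  "(\<And>a. a \<in> A \<Longrightarrow> C_k_on n k U (f a)) \<Longrightarrow> C_k_on n k U (\<lambda>x. \<Sum>a\<in>A. f a x)"
  by (induction A rule: infinite_finite_induct) (auto intro: C_k_on_const C_k_on_add)

lemma C_k_on_inverse:
  assumes "open_Rn n U" "C_k_on n k U f" "\<And>x. x \<in> U \<Longrightarrow> f x \<noteq> 0"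
  shows "C_k_on n k U (\<lambda>x. inverse (f x))"
  using assms(2)
proof (induction k)
  case 0
  then show ?case using assms(3) by (auto intro!: continuous_on_inverse)
next
  case (Suc k)
  note * = Suc.prems[unfolded C_k_on_Suc_iff[OF assms(1)]]
  have I: "C_k_on n k U (\<lambda>x. inverse (f x))" by (rule Suc.IH[OF C_k_on_Suc_imp[OF Suc.prems]])
  have "\<exists>h. (\<forall>x\<in>U. ((\<lambda>s. inverse (f (x(i := s)))) has_real_derivative h x) (at (x i))) \<and> C_k_on n k U h"
    if i: "i < n" for i
  proof (intro exI conjI ballI)
    show "C_k_on n k U (\<lambda>x. (-1) * (inverse (f x) * pd i f x * inverse (f x)))"
      using * i I by (intro C_k_on_mult C_k_on_const) auto
    fix x assume x: "x \<in> U"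
    show "((\<lambda>s. inverse (f (x(i := s)))) has_real_derivative
        (-1) * (inverse (f x) * pd i f x * inverse (f x))) (at (x i))"
      using DERIV_inverse'[of "\<lambda>s. f (x(i := s))" "pd i f x" "x i" UNIV] * i x assms(3)[OF x] by simp
  qed
  moreover have "continuous_on U (\<lambda>x. inverse (f x))"
    using * assms(3) by (auto intro!: continuous_on_inverse)
  ultimately show ?case by simp
qed

lemma mvt_unordered:
  fixes g g' :: "real \<Rightarrow> real"
  assumes "\<And>s. min a b \<le> s \<Longrightarrow> s \<le> max a b \<Longrightarrow> (g has_real_derivative g' s) (at s)"
  shows "\<exists>\<xi>. min a b \<le> \<xi> \<and> \<xi> \<le> max a b \<and> g b - g a = (b - a) * g' \<xi>"
proof -
  consider "a < b" | "a = b" | "b < a" by linarith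
  then show ?thesis
  proof cases
    case 1
    then show ?thesis using MVT2[of a b g g'] assms by (auto simp: min_def max_def intro: less_imp_le)
  next
    case 3
    then obtain z where "b < z" "z < a" "g a - g b = (a - b) * g' z"
      using MVT2[of b a g g'] assms by (auto simp: min_def max_def)
    then show ?thesis using 3 by (intro exI[of _ z]) (auto simp: algebra_simps)
  qed auto
qed

text \<open>
  The increment is telescoped over the coordinates and the mean value theorem is applied to each
  one. Continuity of the partial derivatives makes the quotients \<open>q j\<close> continuous at \<open>y0\<close>. This is
  the total differentiability that the chain rule needs.
\<close>

lemma increment_formula:
  assumes V: "open_Rn m V" and y0: "y0 \<in> V" and f: "C_k_on m (Suc 0) V f"
  obtains q where "\<And>y. y \<in> Rn m \<Longrightarrow> f y - f y0 = (\<Sum>j<m. (y j - y0 j) * q j y)"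
    and "\<And>e. e > 0 \<Longrightarrow> \<exists>d>0. \<forall>y\<in>Rn m. (\<forall>j<m. \<bar>y j - y0 j\<bar> < d) \<longrightarrow> (\<forall>j<m. \<bar>q j y - pd j f y0\<bar> < e)"
proof -
  note f' = f[unfolded C_k_on_Suc_iff[OF V]]
  have y0R: "y0 \<in> Rn m" using y0 V open_Rn_subset by blast
  define z where "z l y = (\<lambda>i. if i < l then y i else y0 i :: real)" for l :: nat and y
  have zS: "z (Suc j) y = (z j y)(j := y j)" "z j y = (z j y)(j := y0 j)" for j y
    by (auto simp: z_def fun_eq_iff)
  have z0: "z 0 y = y0" for y by (simp add: z_def)
  have zm: "z m y = y" if "y \<in> Rn m" for y
    using that y0R by (auto simp: z_def fun_eq_iff topspace_Euclidean_space)
  define q where "q j y = (if y j = y0 j then pd j f y0 else (f (z (Suc j) y) - f (z j y)) / (y j - y0 j))"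
    for j y
  have tele: "f y - f y0 = (\<Sum>j<m. (y j - y0 j) * q j y)" if "y \<in> Rn m" for y
  proof -
    have "(y j - y0 j) * q j y = f (z (Suc j) y) - f (z j y)" for j
      unfolding q_def using zS[of j y] by auto
    then have "(\<Sum>j<m. (y j - y0 j) * q j y) = (\<Sum>j<m. f (z (Suc j) y) - f (z j y))" by simp
    also have "\<dots> = f (z m y) - f (z 0 y)" by (rule sum_lessThan_telescope)
    finally show ?thesis using zm[OF that] z0 by simp
  qed
  have app: "\<exists>d>0. \<forall>y\<in>Rn m. (\<forall>j<m. \<bar>y j - y0 j\<bar> < d) \<longrightarrow> (\<forall>j<m. \<bar>q j y - pd j f y0\<bar> < e)"
    if e: "e > 0" for e
  proof -
    have "open_Rn m {y \<in> V. \<forall>j<m. \<bar>pd j f y - pd j f y0\<bar> < e}"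
    proof -
      obtain T where T: "open T" "V = T \<inter> Rn m" using V by (rule open_Rn_obtain)
      have "open_Rn m {y \<in> V. \<bar>pd j f y - pd j f y0\<bar> < e}" if "j < m" for j
      proof -
        have "continuous_on V (\<lambda>y. \<bar>pd j f y - pd j f y0\<bar>)"
          using f' that by (auto intro!: continuous_intros)
        then obtain A where A: "open A" "A \<inter> V = (\<lambda>y. \<bar>pd j f y - pd j f y0\<bar>) -` {..<e} \<inter> V"
          unfolding continuous_on_open_invariant by (meson open_lessThan)
        have "{y \<in> V. \<bar>pd j f y - pd j f y0\<bar> < e} = (A \<inter> T) \<inter> Rn m" using A(2) T(2) by auto
        then show ?thesis using A(1) T(1) open_Rn_Int_open[of "A \<inter> T" m] by auto
      qed
      then have "open_Rn m (V \<inter> (\<Inter>j\<in>{..<m}. {y \<in> V. \<bar>pd j f y - pd j f y0\<bar> < e}))"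
        using V by (cases "m = 0") (auto intro!: openin_Int openin_INT2)
      moreover have "V \<inter> (\<Inter>j\<in>{..<m}. {y \<in> V. \<bar>pd j f y - pd j f y0\<bar> < e}) = {y \<in> V. \<forall>j<m. \<bar>pd j f y - pd j f y0\<bar> < e}"
        by auto
      ultimately show ?thesis by simp
    qed
    moreover have "y0 \<in> {y \<in> V. \<forall>j<m. \<bar>pd j f y - pd j f y0\<bar> < e}" using y0 e by simp
    ultimately obtain d where d: "d > 0"
      "\<And>y. y \<in> Rn m \<Longrightarrow> (\<forall>j<m. \<bar>y j - y0 j\<bar> < d) \<Longrightarrow> y \<in> V \<and> (\<forall>j<m. \<bar>pd j f y - pd j f y0\<bar> < e)"
      unfolding open_Rn_iff by (metis (no_types, lifting) mem_Collect_eq)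
    have "\<bar>q j y - pd j f y0\<bar> < e" if y: "y \<in> Rn m" "\<forall>j<m. \<bar>y j - y0 j\<bar> < d" and j: "j < m" for y j
    proof (cases "y j = y0 j")
      case False
      have near: "(z j y)(j := s) \<in> V \<and> \<bar>pd j f ((z j y)(j := s)) - pd j f y0\<bar> < e"
        if s: "min (y0 j) (y j) \<le> s" "s \<le> max (y0 j) (y j)" for s
      proof -
        have "(z j y)(j := s) \<in> Rn m" using y(1) y0R j by (auto simp: z_def topspace_Euclidean_space)
        moreover have "\<bar>((z j y)(j := s)) i - y0 i\<bar> < d" if "i < m" for i
        proof (cases "i = j")
          case True
          then have "\<bar>s - y0 j\<bar> \<le> \<bar>y j - y0 j\<bar>" using s by linarith
          also have "\<dots> < d" using y(2) j by simp
          finally show ?thesis using True by simp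
        next
          case False
          then show ?thesis using y(2) that d(1) by (simp add: z_def)
        qed
        ultimately show ?thesis using d(2)[of "(z j y)(j := s)"] j by blast
      qed
      have "((\<lambda>s. f ((z j y)(j := s))) has_real_derivative pd j f ((z j y)(j := s))) (at s)"
        if s: "min (y0 j) (y j) \<le> s" "s \<le> max (y0 j) (y j)" for s
      proof -
        let ?w = "(z j y)(j := s)"
        have "((\<lambda>r. f (?w(j := r))) has_real_derivative pd j f ?w) (at (?w j))"
          using f' near[OF s] j by blast
        then show ?thesis by simp
      qed
      from mvt_unordered[OF this] obtain \<xi> where xi: "min (y0 j) (y j) \<le> \<xi>" "\<xi> \<le> max (y0 j) (y j)"
        "f ((z j y)(j := y j)) - f ((z j y)(j := y0 j)) = (y j - y0 j) * pd j f ((z j y)(j := \<xi>))"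
        by blast
      then have "q j y = pd j f ((z j y)(j := \<xi>))"
        unfolding q_def using False by (simp flip: zS)
      then show ?thesis using near xi by simp
    qed (simp add: q_def e)
    then show ?thesis using d(1) by blast
  qed
  show thesis by (rule that[OF tele app])
qed

lemma chain_rule_Rn:
  assumes V: "open_Rn m V" and f: "C_k_on m (Suc 0) V f" and G0: "G s0 \<in> V"
    and GR: "eventually (\<lambda>s. G s \<in> Rn m) (nhds s0)"
    and G': "\<And>j. j < m \<Longrightarrow> ((\<lambda>s. G s j) has_real_derivative d j) (at s0)"
  shows "((\<lambda>s. f (G s)) has_real_derivative (\<Sum>j<m. pd j f (G s0) * d j)) (at s0)"
proof -
  obtain q where q: "\<And>y. y \<in> Rn m \<Longrightarrow> f y - f (G s0) = (\<Sum>j<m. (y j - G s0 j) * q j y)"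
    "\<And>e. e > 0 \<Longrightarrow> \<exists>d>0. \<forall>y\<in>Rn m. (\<forall>j<m. \<bar>y j - G s0 j\<bar> < d) \<longrightarrow> (\<forall>j<m. \<bar>q j y - pd j f (G s0)\<bar> < e)"
    using increment_formula[OF V G0 f] by blast
  have qlim: "((\<lambda>s. q j (G s)) \<longlongrightarrow> pd j f (G s0)) (at s0)" if j: "j < m" for j
    unfolding tendsto_iff
  proof (intro allI impI)
    fix e :: real assume "e > 0"
    then obtain r where r: "r > 0" "\<forall>y\<in>Rn m. (\<forall>j<m. \<bar>y j - G s0 j\<bar> < r) \<longrightarrow> (\<forall>j<m. \<bar>q j y - pd j f (G s0)\<bar> < e)"
      using q(2) by blast
    have "eventually (\<lambda>s. \<bar>G s i - G s0 i\<bar> < r) (at s0)" if "i < m" for i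
    proof -
      have "isCont (\<lambda>s. G s i) s0" using G'[OF that] DERIV_isCont by blast
      then show ?thesis using r(1) by (auto simp: isCont_def tendsto_iff dist_real_def)
    qed
    then have "eventually (\<lambda>s. \<forall>i\<in>{..<m}. \<bar>G s i - G s0 i\<bar> < r) (at s0)"
      by (subst eventually_ball_finite_distrib) auto
    moreover have "eventually (\<lambda>s. G s \<in> Rn m) (at s0)" using GR by (auto simp: eventually_at_filter elim: eventually_mono)
    ultimately show "eventually (\<lambda>s. dist (q j (G s)) (pd j f (G s0)) < e) (at s0)"
      by eventually_elim (use r(2) j in \<open>auto simp: dist_real_def\<close>)
  qed
  have "((\<lambda>s. \<Sum>j<m. (G s j - G s0 j) / (s - s0) * q j (G s)) \<longlongrightarrow> (\<Sum>j<m. d j * pd j f (G s0))) (at s0)"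
    using G' qlim by (intro tendsto_sum tendsto_mult) (auto simp: has_field_derivative_iff)
  moreover have "eventually (\<lambda>s. (\<Sum>j<m. (G s j - G s0 j) / (s - s0) * q j (G s)) = (f (G s) - f (G s0)) / (s - s0)) (at s0)"
  proof -
    have "eventually (\<lambda>s. G s \<in> Rn m) (at s0)" using GR by (auto simp: eventually_at_filter elim: eventually_mono)
    then show ?thesis by eventually_elim (simp add: q(1) sum_divide_distrib)
  qed
  ultimately show ?thesis unfolding has_field_derivative_iff
    by (simp add: Lim_transform_eventually mult.commute)
qed

lemma continuous_on_Rn_map:
  assumes "\<And>j. j < m \<Longrightarrow> continuous_on U (\<lambda>x. G x j)" "\<And>x. x \<in> U \<Longrightarrow> G x \<in> Rn m"
  shows "continuous_on U G"
proof (rule continuous_on_coordinatewise_then_product)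
  fix j show "continuous_on U (\<lambda>x. G x j)"
  proof (cases "j < m")
    case False
    then have "\<forall>x\<in>U. G x j = 0" using assms(2) by (auto simp: topspace_Euclidean_space)
    then show ?thesis by (metis continuous_on_cong continuous_on_const)
  qed (use assms in auto)
qed

text \<open>
  By the chain rule the partial derivatives of a composition are sums of products of functions of
  class \<open>k\<close>, to which the induction hypothesis applies.
\<close>

lemma C_k_on_compose:
  assumes U: "open_Rn n U" and V: "open_Rn m V" and GV: "\<And>x. x \<in> U \<Longrightarrow> G x \<in> V"
    and "\<And>j. j < m \<Longrightarrow> C_k_on n k U (\<lambda>x. G x j)" and "C_k_on m k V f"
  shows "C_k_on n k U (\<lambda>x. f (G x))"
  using assms(4,5)
proof (induction k arbitrary: f)
  case 0
  have "continuous_on U G"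
    using 0 GV open_Rn_subset[OF V] by (intro continuous_on_Rn_map[where m = m]) auto
  then show ?case using continuous_on_compose2[of V f U G] 0(2) GV by auto
next
  case (Suc k)
  have "continuous_on U G"
    using Suc.prems(1) GV open_Rn_subset[OF V] by (intro continuous_on_Rn_map[where m = m]) auto
  then have c: "continuous_on U (\<lambda>x. f (G x))"
    using continuous_on_compose2[of V f U G] Suc.prems(2) GV by auto
  note f' = Suc.prems(2)[unfolded C_k_on_Suc_iff[OF V]]
  have G': "(\<forall>x\<in>U. ((\<lambda>s. G (x(i := s)) j) has_real_derivative pd i (\<lambda>x. G x j) x) (at (x i))) \<and>
      C_k_on n k U (pd i (\<lambda>x. G x j))" if "j < m" "i < n" for i j
    using Suc.prems(1)[OF that(1), unfolded C_k_on_Suc_iff[OF U]] that(2) by blast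
  have f1: "C_k_on m (Suc 0) V f"
    using f' by (auto simp: C_k_on_Suc_iff[OF V] intro: C_k_on_imp_continuous_on)
  have "\<exists>g. (\<forall>x\<in>U. ((\<lambda>s. f (G (x(i := s)))) has_real_derivative g x) (at (x i))) \<and> C_k_on n k U g"
    if i: "i < n" for i
  proof (intro exI conjI ballI)
    show "C_k_on n k U (\<lambda>x. \<Sum>j<m. pd j f (G x) * pd i (\<lambda>x. G x j) x)"
    proof (rule C_k_on_sum, rule C_k_on_mult)
      fix j assume "j \<in> {..<m}"
      then have j: "j < m" by simp
      show "C_k_on n k U (pd i (\<lambda>x. G x j))" using G'[OF j i] by blast
      show "C_k_on n k U (\<lambda>x. pd j f (G x))"
      proof (rule Suc.IH)
        show "C_k_on m k V (pd j f)" using f' j by blast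
        show "C_k_on n k U (\<lambda>x. G x l)" if "l < m" for l
          by (rule C_k_on_Suc_imp[OF Suc.prems(1)[OF that]])
      qed
    qed
    fix x assume x: "x \<in> U"
    have ev: "eventually (\<lambda>s. G (x(i := s)) \<in> Rn m) (nhds (x i))"
      using open_Rn_eventually_upd[OF U x i] GV open_Rn_subset[OF V] by (auto elim!: eventually_mono)
    show "((\<lambda>s. f (G (x(i := s)))) has_real_derivative (\<Sum>j<m. pd j f (G x) * pd i (\<lambda>x. G x j) x)) (at (x i))"
      using chain_rule_Rn[OF V f1, of "\<lambda>s. G (x(i := s))" "x i" "\<lambda>j. pd i (\<lambda>x. G x j) x"] GV[OF x] ev G' x i
      by simp
  qed
  then show ?case using c by simp
qed

section \<open>Smooth functions\<close>

lemma Rn_iff: "x \<in> Rn n \<longleftrightarrow> (\<forall>i\<ge>n. x i = 0)"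
  by (simp add: topspace_Euclidean_space)

lemma smooth_fun_C_k: "smooth_fun n U f \<Longrightarrow> C_k_on n k U f"
  by (simp add: smooth_fun_def)

lemma smooth_fun_continuous_on: "smooth_fun n U f \<Longrightarrow> continuous_on U f"
  using smooth_fun_C_k[of n U f 0] by simp

lemma smooth_fun_cong:
  "open_Rn n U \<Longrightarrow> (\<And>y. y \<in> U \<Longrightarrow> f y = g y) \<Longrightarrow> smooth_fun n U f \<Longrightarrow> smooth_fun n U g"
  unfolding smooth_fun_def by (meson C_k_on_cong)

lemma smooth_fun_subset: "smooth_fun n U f \<Longrightarrow> U' \<subseteq> U \<Longrightarrow> smooth_fun n U' f"
  unfolding smooth_fun_def using C_k_on_subset by blast

lemma smooth_fun_pd:
  assumes "open_Rn n U" "smooth_fun n U f" "i < n"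
  shows "smooth_fun n U (pd i f)"
    and "x \<in> U \<Longrightarrow> ((\<lambda>s. f (x(i := s))) has_real_derivative pd i f x) (at (x i))"
  using assms unfolding smooth_fun_def by (metis C_k_on_Suc_iff)+

lemma smooth_fun_const: "smooth_fun n U (\<lambda>x. c)"
  by (simp add: smooth_fun_def C_k_on_const)

lemma smooth_fun_coord: "smooth_fun n U (\<lambda>x. x j)"
  by (simp add: smooth_fun_def C_k_on_coord)

lemma smooth_fun_add: "smooth_fun n U f \<Longrightarrow> smooth_fun n U g \<Longrightarrow> smooth_fun n U (\<lambda>x. f x + g x)"
  by (simp add: smooth_fun_def C_k_on_add)

lemma smooth_fun_mult: "smooth_fun n U f \<Longrightarrow> smooth_fun n U g \<Longrightarrow> smooth_fun n U (\<lambda>x. f x * g x)"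
  by (simp add: smooth_fun_def C_k_on_mult)

lemma smooth_fun_uminus: "smooth_fun n U f \<Longrightarrow> smooth_fun n U (\<lambda>x. - f x)"
  using smooth_fun_mult[OF smooth_fun_const[of n U "-1"], of f] by simp

lemma smooth_fun_diff: "smooth_fun n U f \<Longrightarrow> smooth_fun n U g \<Longrightarrow> smooth_fun n U (\<lambda>x. f x - g x)"
  using smooth_fun_add[OF _ smooth_fun_uminus[of n U g], of f] by simp

lemma smooth_fun_sum:
  "(\<And>a. a \<in> A \<Longrightarrow> smooth_fun n U (f a)) \<Longrightarrow> smooth_fun n U (\<lambda>x. \<Sum>a\<in>A. f a x)"
  by (simp add: smooth_fun_def C_k_on_sum)

lemma smooth_fun_prod:
  "(\<And>a. a \<in> A \<Longrightarrow> smooth_fun n U (f a)) \<Longrightarrow> smooth_fun n U (\<lambda>x. \<Prod>a\<in>A. f a x)"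
  by (induction A rule: infinite_finite_induct) (auto intro: smooth_fun_const smooth_fun_mult)

lemma smooth_fun_inverse:
  "open_Rn n U \<Longrightarrow> smooth_fun n U f \<Longrightarrow> (\<And>x. x \<in> U \<Longrightarrow> f x \<noteq> 0) \<Longrightarrow> smooth_fun n U (\<lambda>x. inverse (f x))"
  by (simp add: smooth_fun_def C_k_on_inverse)

lemma smooth_fun_compose:
  assumes "open_Rn n U" "open_Rn m V" "\<And>x. x \<in> U \<Longrightarrow> G x \<in> V"
    and "\<And>j. j < m \<Longrightarrow> smooth_fun n U (\<lambda>x. G x j)" "smooth_fun m V f"
  shows "smooth_fun n U (\<lambda>x. f (G x))"
  unfolding smooth_fun_def
proof
  fix k show "C_k_on n k U (\<lambda>x. f (G x))"
    by (rule C_k_on_compose[OF assms(1-3)]) (use assms(4,5) in \<open>auto simp: smooth_fun_def\<close>)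
qed

lemmas smooth_fun_intros = smooth_fun_const smooth_fun_coord smooth_fun_add smooth_fun_mult
  smooth_fun_uminus smooth_fun_diff smooth_fun_sum smooth_fun_prod

lemma continuous_on_open_Rn_local:
  assumes U: "open_Rn n U"
    and "\<And>x. x \<in> U \<Longrightarrow> \<exists>U'. open_Rn n U' \<and> x \<in> U' \<and> continuous_on U' f"
  shows "continuous_on U f"
  unfolding continuous_on_def
proof
  fix x assume x: "x \<in> U"
  then obtain U' where U': "open_Rn n U'" "x \<in> U'" "continuous_on U' f" using assms(2) by blast
  obtain T where T: "open T" "U' = T \<inter> Rn n" using U'(1) by (rule open_Rn_obtain)
  have "(f \<longlongrightarrow> f x) (at x within T \<inter> Rn n)" using U' T by (simp add: continuous_on_def)
  then have "(f \<longlongrightarrow> f x) (at x within T \<inter> U)"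
    by (rule tendsto_within_subset) (use open_Rn_subset[OF U] in auto)
  moreover have "at x within T \<inter> U = at x within U"
    by (rule at_within_nhd[of x T]) (use U' T in auto)
  ultimately show "(f \<longlongrightarrow> f x) (at x within U)" by simp
qed

lemma C_k_on_local:
  assumes U: "open_Rn n U"
    and "\<And>x. x \<in> U \<Longrightarrow> \<exists>U'. open_Rn n U' \<and> x \<in> U' \<and> C_k_on n k U' f"
  shows "C_k_on n k U f"
  using assms(2)
proof (induction k arbitrary: f)
  case 0
  then show ?case by simp (rule continuous_on_open_Rn_local[OF U], simp)
next
  case (Suc k)
  have "continuous_on U f"
  proof (rule continuous_on_open_Rn_local[OF U])
    fix x assume "x \<in> U"
    then show "\<exists>U'. open_Rn n U' \<and> x \<in> U' \<and> continuous_on U' f"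
      using Suc.prems C_k_on_imp_continuous_on by metis
  qed
  moreover have "C_k_on n k U (pd i f)" if "i < n" for i
  proof (rule Suc.IH)
    fix x assume "x \<in> U"
    then obtain U' where "open_Rn n U'" "x \<in> U'" "C_k_on n (Suc k) U' f" using Suc.prems by metis
    then show "\<exists>U'. open_Rn n U' \<and> x \<in> U' \<and> C_k_on n k U' (pd i f)"
      using that by (auto simp only: C_k_on_Suc_iff)
  qed
  moreover have "((\<lambda>s. f (x(i := s))) has_real_derivative pd i f x) (at (x i))" if i: "i < n" "x \<in> U" for i x
  proof -
    obtain U' where "open_Rn n U'" "x \<in> U'" "C_k_on n (Suc k) U' f" using Suc.prems i by metis
    then show ?thesis using i by (auto simp only: C_k_on_Suc_iff)
  qed
  ultimately show ?case unfolding C_k_on_Suc_iff[OF U] by blast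
qed

lemma smooth_fun_local:
  assumes "open_Rn n U"
    and "\<And>x. x \<in> U \<Longrightarrow> \<exists>U'. open_Rn n U' \<and> x \<in> U' \<and> smooth_fun n U' f"
  shows "smooth_fun n U f"
  unfolding smooth_fun_def
proof (intro allI C_k_on_local[OF assms(1)])
  fix k x assume "x \<in> U"
  then show "\<exists>U'. open_Rn n U' \<and> x \<in> U' \<and> C_k_on n k U' f"
    using assms(2) unfolding smooth_fun_def by metis
qed

text \<open>
  Iterated derivatives of an explicit function usually stay in an explicit family \<open>P\<close> of functions.
  Then no formula for the higher derivatives is needed.
\<close>

lemma smooth_fun_coinduct:
  assumes "P f"
    and cont: "\<And>f. P f \<Longrightarrow> continuous_on U f"
    and step: "\<And>f i. P f \<Longrightarrow> i < n \<Longrightarrow> \<exists>g. P g \<and>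
      (\<forall>x\<in>U. ((\<lambda>s. f (x(i := s))) has_real_derivative g x) (at (x i)))"
  shows "smooth_fun n U f"
proof -
  have "C_k_on n k U f" if "P f" for k f
    using that
  proof (induction k arbitrary: f)
    case 0
    then show ?case using cont by simp
  next
    case (Suc k)
    show ?case
    proof (rule C_k_on_SucI[OF cont[OF Suc.prems]])
      fix i assume "i < n"
      then obtain g where g: "P g" "\<forall>x\<in>U. ((\<lambda>s. f (x(i := s))) has_real_derivative g x) (at (x i))"
        using step[OF Suc.prems] by metis
      show "\<exists>g. (\<forall>x\<in>U. ((\<lambda>s. f (x(i := s))) has_real_derivative g x) (at (x i))) \<and> C_k_on n k U g"
        using g(2) Suc.IH[OF g(1)] by metis
    qed
  qed
  then show ?thesis using assms(1) by (simp add: smooth_fun_def)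
qed

lemma smooth_chain_rule:
  assumes "open_Rn m V" "smooth_fun m V f" "G s0 \<in> V"
    and "eventually (\<lambda>s. G s \<in> Rn m) (nhds s0)"
    and "\<And>j. j < m \<Longrightarrow> ((\<lambda>s. G s j) has_real_derivative d j) (at s0)"
  shows "((\<lambda>s. f (G s)) has_real_derivative (\<Sum>j<m. pd j f (G s0) * d j)) (at s0)"
  by (rule chain_rule_Rn[OF assms(1) smooth_fun_C_k[OF assms(2)] assms(3-5)])

definition smooth1 :: "(real \<Rightarrow> real) \<Rightarrow> bool" where
  "smooth1 h \<longleftrightarrow> smooth_fun 1 (Rn 1) (\<lambda>x. h (x 0))"

lemma smooth1_compose:
  assumes "smooth1 h" "open_Rn n U" "smooth_fun n U f"
  shows "smooth_fun n U (\<lambda>x. h (f x))"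
proof -
  let ?G = "\<lambda>x (j::nat). if j = 0 then f x else 0"
  have "smooth_fun n U (\<lambda>x. (\<lambda>x. h (x 0)) (?G x))"
  proof (rule smooth_fun_compose[OF assms(2), where m = 1 and V = "Rn 1" and G = ?G])
    show "smooth_fun n U (\<lambda>x. ?G x j)" if "j < 1" for j using that assms(3) by simp
    show "smooth_fun 1 (Rn 1) (\<lambda>x. h (x 0))" using assms(1) by (simp add: smooth1_def)
  qed (auto simp: Rn_iff)
  then show ?thesis by simp
qed

section \<open>Cutoff functions\<close>

text \<open>
  The derivative of \<open>exp (- 1 / t) / t ^ m\<close> is a combination of two functions of the same
  form. So this family, extended by 0, is closed under differentiation.
\<close>

definition flat :: "nat \<Rightarrow> real \<Rightarrow> real" where
  "flat m t = (if t \<le> 0 then 0 else exp (- inverse t) * inverse t ^ m)"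

lemma power_le_fact_exp: "0 \<le> x \<Longrightarrow> x ^ m \<le> fact m * exp (x::real)"
proof -
  assume x: "0 \<le> x"
  have s: "(\<lambda>n. x^n /\<^sub>R fact n) sums exp x" by (rule exp_converges)
  have "(\<Sum>n\<in>{m}. x^n /\<^sub>R fact n) \<le> suminf (\<lambda>n. x^n /\<^sub>R fact n)"
    using x s by (intro sum_le_suminf) (auto simp: sums_iff)
  then show ?thesis using s by (simp add: sums_iff field_simps)
qed

lemma flat_bound: "\<bar>flat m t\<bar> \<le> fact (Suc m) * \<bar>t\<bar>"
proof (cases "t \<le> 0")
  case False
  have "inverse t ^ Suc m \<le> fact (Suc m) * exp (inverse t)"
    using False by (intro power_le_fact_exp) auto
  then have "exp (- inverse t) * inverse t ^ Suc m \<le> exp (- inverse t) * (fact (Suc m) * exp (inverse t))"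
    by (intro mult_left_mono) auto
  also have "\<dots> = fact (Suc m) * exp (- inverse t + inverse t)" by (simp only: exp_add mult_ac)
  finally have "exp (- inverse t) * inverse t ^ Suc m \<le> fact (Suc m)" by simp
  then have "t * (exp (- inverse t) * inverse t ^ Suc m) \<le> t * fact (Suc m)"
    using False by (intro mult_left_mono) auto
  moreover have "t * (exp (- inverse t) * inverse t ^ Suc m) = flat m t"
    using False by (simp add: flat_def)
  moreover have "0 \<le> flat m t" using False by (simp add: flat_def)
  ultimately have "flat m t \<le> t * fact (Suc m)" "0 \<le> flat m t" by linarith+
  then show ?thesis using False by (simp add: mult.commute del: fact_Suc)
qed (simp add: flat_def mult_le_0_iff del: fact_Suc)

lemma flat_tendsto_0: "(flat m \<longlongrightarrow> 0) (at 0)"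
proof (rule tendsto_0_le[where K = "fact (Suc m)"])
  show "((\<lambda>t. t) \<longlongrightarrow> 0) (at (0::real))" by simp
  show "eventually (\<lambda>t. norm (flat m t) \<le> norm t * fact (Suc m)) (at 0)"
    using flat_bound[of m] by (simp add: mult.commute del: fact_Suc)
qed

lemma DERIV_flat: "(flat m has_real_derivative flat (m + 2) t - real m * flat (Suc m) t) (at t)"
proof -
  consider "t < 0" | "t = 0" | "t > 0" by linarith
  then show ?thesis
  proof cases
    case 1
    have "((\<lambda>t. 0) has_real_derivative 0) (at t)" by simp
    then have "(flat m has_real_derivative 0) (at t)"
      by (rule has_field_derivative_transform_within_open[where S = "{..<0}"]) (use 1 in \<open>auto simp: flat_def\<close>)
    then show ?thesis using 1 by (simp add: flat_def)
  next
    case 2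
    have "((\<lambda>s. (flat m s - flat m 0) / (s - 0)) \<longlongrightarrow> 0) (at 0)"
      by (rule Lim_transform_eventually[OF flat_tendsto_0[of "Suc m"]])
        (auto simp: flat_def eventually_at_filter field_simps)
    then show ?thesis using 2 by (simp add: has_field_derivative_iff flat_def)
  next
    case 3
    have inv: "(inverse has_real_derivative - (inverse t * inverse t)) (at t)"
      using 3 DERIV_inverse[of t UNIV] by (simp add: power2_eq_square)
    have "((\<lambda>t. exp (- inverse t)) has_real_derivative exp (- inverse t) * (inverse t * inverse t)) (at t)"
      using DERIV_fun_exp[OF DERIV_minus[OF inv]] by simp
    moreover have "((\<lambda>t. inverse t ^ m) has_real_derivative - (real m * inverse t ^ Suc m)) (at t)"
    proof (cases m)
      case (Suc k)
      then show ?thesis using DERIV_power_Suc[OF inv, of k] by (simp add: ac_simps)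
    qed simp
    ultimately have "((\<lambda>t. exp (- inverse t) * inverse t ^ m) has_real_derivative
        exp (- inverse t) * (inverse t * inverse t) * inverse t ^ m + - (real m * inverse t ^ Suc m) * exp (- inverse t)) (at t)"
      by (rule DERIV_mult)
    then have "((\<lambda>t. exp (- inverse t) * inverse t ^ m) has_real_derivative
        flat (m + 2) t - real m * flat (Suc m) t) (at t)"
      using 3 by (simp add: flat_def ac_simps)
    then show ?thesis
      by (rule has_field_derivative_transform_within_open[where S = "{0<..}"]) (use 3 in \<open>auto simp: flat_def\<close>)
  qed
qed

lemma smooth1_flat: "smooth1 (flat m)"
proof -
  have "C_k_on 1 k (Rn 1) (\<lambda>x. flat m (x 0))" for k
  proof (induction k arbitrary: m)
    case 0
    have "continuous_on UNIV (flat m)" for m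
      using DERIV_flat by (intro DERIV_continuous_on) blast
    then have "continuous_on (Rn 1) (\<lambda>x. flat m (x 0))"
      by (rule continuous_on_compose2) (auto intro: continuous_on_product_then_coordinatewise)
    then show ?case by simp
  next
    case (Suc k)
    show ?case
    proof (rule C_k_on_SucI[OF C_k_on_imp_continuous_on[OF Suc.IH]], intro exI conjI ballI)
      show "C_k_on 1 k (Rn 1) (\<lambda>x. flat (m + 2) (x 0) + (- real m) * flat (Suc m) (x 0))"
        by (intro C_k_on_add C_k_on_mult C_k_on_const Suc.IH)
      fix i and x :: "nat \<Rightarrow> real" assume "i < (1::nat)"
      then show "((\<lambda>s. flat m ((x(i := s)) 0)) has_real_derivative
          flat (m + 2) (x 0) + (- real m) * flat (Suc m) (x 0)) (at (x i))"
        using DERIV_flat[of m "x 0"] by simp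
    qed
  qed
  then show ?thesis by (simp add: smooth1_def smooth_fun_def)
qed

definition step_fun :: "real \<Rightarrow> real" where
  "step_fun t = flat 0 t * inverse (flat 0 t + flat 0 (1 - t))"

lemma flat_nonneg: "0 \<le> flat m t" and flat_pos: "0 < t \<Longrightarrow> 0 < flat m t"
  by (auto simp: flat_def)

lemma smooth1_step: "smooth1 step_fun"
  unfolding smooth1_def step_fun_def
proof (intro smooth_fun_mult smooth_fun_inverse)
  show "smooth_fun 1 (Rn 1) (\<lambda>x. flat 0 (x 0))" using smooth1_flat by (simp add: smooth1_def)
  show "smooth_fun 1 (Rn 1) (\<lambda>x. flat 0 (x 0) + flat 0 (1 - x 0))"
    by (intro smooth_fun_add smooth1_compose[OF smooth1_flat] smooth_fun_intros) auto
  fix x :: "nat \<Rightarrow> real"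
  show "flat 0 (x 0) + flat 0 (1 - x 0) \<noteq> 0"
    using flat_nonneg[of 0 "x 0"] flat_nonneg[of 0 "1 - x 0"] flat_pos[of "x 0" 0] flat_pos[of "1 - x 0" 0]
    by linarith
qed auto

lemma step_fun_eq_1: "t \<ge> 1 \<Longrightarrow> step_fun t = 1"
  using flat_pos[of t 0] by (simp add: step_fun_def) (simp add: flat_def)

lemma step_fun_eq_0: "t \<le> 0 \<Longrightarrow> step_fun t = 0"
  by (simp add: step_fun_def flat_def)

lemma step_fun_bounds: "0 \<le> step_fun t" "step_fun t \<le> 1"
  using flat_nonneg[of 0 t] flat_nonneg[of 0 "1 - t"]
  by (auto simp: step_fun_def field_simps divide_simps)

text \<open>
  Equal to 1 on the box of radius \<open>e\<close> and to 0 outside the box of radius \<open>2 * e\<close>. The square under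
  the step function replaces an absolute value, which would not be smooth.
\<close>

definition box_cutoff :: "nat \<Rightarrow> real \<Rightarrow> (nat \<Rightarrow> real) \<Rightarrow> (nat \<Rightarrow> real) \<Rightarrow> real" where
  "box_cutoff n e a y = (\<Prod>j<n. step_fun (2 - ((y j - a j) / e)\<^sup>2))"

lemma smooth_box_cutoff: "open_Rn n U \<Longrightarrow> smooth_fun n U (box_cutoff m e a)"
  unfolding box_cutoff_def power2_eq_square divide_inverse
  by (intro smooth_fun_intros smooth1_compose[OF smooth1_step])

lemma box_cutoff_eq_1:
  assumes "e > 0" "\<And>j. j < n \<Longrightarrow> \<bar>y j - a j\<bar> \<le> e"
  shows "box_cutoff n e a y = 1"
  unfolding box_cutoff_def
proof (rule prod.neutral, rule ballI, rule step_fun_eq_1)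
  fix j assume "j \<in> {..<n}"
  then have "\<bar>(y j - a j) / e\<bar> \<le> 1" using assms by (simp add: abs_divide)
  then have "((y j - a j) / e)\<^sup>2 \<le> 1" by (simp only: abs_square_le_1)
  then show "1 \<le> 2 - ((y j - a j) / e)\<^sup>2" by linarith
qed

lemma box_cutoff_eq_0:
  assumes "e > 0" "j < n" "\<bar>y j - a j\<bar> \<ge> 2 * e"
  shows "box_cutoff n e a y = 0"
proof -
  have "\<bar>(y j - a j) / e\<bar> \<ge> \<bar>2\<bar>" using assms by (simp add: abs_divide field_simps)
  then have "((y j - a j) / e)\<^sup>2 \<ge> 2\<^sup>2" by (simp only: abs_le_square_iff)
  then have "step_fun (2 - ((y j - a j) / e)\<^sup>2) = 0" by (intro step_fun_eq_0) simp
  then show ?thesis using assms(2) by (auto simp: box_cutoff_def)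
qed

text \<open>
  A smooth bounded map of the line that is the identity near 0. It retracts Euclidean space into a
  coordinate box and so makes local parametrizations global.
\<close>

definition squash :: "real \<Rightarrow> real \<Rightarrow> real" where
  "squash e t = t * step_fun (2 - (t / e)\<^sup>2)"

lemma smooth_squash: "open_Rn n U \<Longrightarrow> smooth_fun n U f \<Longrightarrow> smooth_fun n U (\<lambda>x. squash e (f x))"
  unfolding squash_def power2_eq_square divide_inverse
  by (intro smooth_fun_intros smooth1_compose[OF smooth1_step])

lemma squash_eq: "e > 0 \<Longrightarrow> \<bar>t\<bar> \<le> e \<Longrightarrow> squash e t = t"
  using box_cutoff_eq_1[of e 1 "\<lambda>_. t" "\<lambda>_. 0"] by (simp add: squash_def box_cutoff_def)

lemma squash_bound: "e > 0 \<Longrightarrow> \<bar>squash e t\<bar> \<le> 2 * e"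
proof (cases "\<bar>t\<bar> \<ge> 2 * e")
  case True
  then show "e > 0 \<Longrightarrow> ?thesis"
    using box_cutoff_eq_0[of e 0 1 "\<lambda>_. t" "\<lambda>_. 0"] by (auto simp: squash_def box_cutoff_def)
next
  case False
  have "\<bar>squash e t\<bar> \<le> \<bar>t\<bar> * 1"
    unfolding squash_def abs_mult using step_fun_bounds by (intro mult_left_mono) auto
  then show ?thesis using False by simp
qed

subsection \<open>Hadamard\<close>

section \<open>Parameter integrals and Hadamard's lemma\<close>

lemma smooth_param_integral:
  assumes "smooth_fun (Suc n) (Rn (Suc n)) g"
  shows "smooth_fun n (Rn n) (\<lambda>x. integral {0..1} (\<lambda>\<tau>. g (x(n := \<tau>))))"
proof -
  have cts: "continuous_on (Rn n \<times> cbox 0 1) (\<lambda>(x, \<tau>). g (x(n := \<tau>)))"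
    if "smooth_fun (Suc n) (Rn (Suc n)) g" for g
  proof -
    have "continuous_on (Rn n \<times> cbox (0::real) 1) (\<lambda>p. (fst p)(n := snd p))"
    proof (rule continuous_on_coordinatewise_then_product)
      fix i
      show "continuous_on (Rn n \<times> cbox (0::real) 1) (\<lambda>p. ((fst p)(n := snd p)) i)"
        using continuous_on_snd[OF continuous_on_id, of "Rn n \<times> cbox (0::real) 1"]
          continuous_on_product_then_coordinatewise[OF continuous_on_fst[OF continuous_on_id,
            of "Rn n \<times> cbox (0::real) 1"], of i]
        by (cases "i = n") simp_all
    qed
    then have "continuous_on (Rn n \<times> cbox (0::real) 1) (\<lambda>p. g ((fst p)(n := snd p)))"
      by (rule continuous_on_compose2[OF smooth_fun_continuous_on[OF that]])
        (auto simp: Rn_iff)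
    then show ?thesis by (simp add: case_prod_unfold)
  qed
  define P where "P f \<longleftrightarrow> (\<exists>g. smooth_fun (Suc n) (Rn (Suc n)) g \<and>
      f = (\<lambda>x. integral {0..1} (\<lambda>\<tau>. g (x(n := \<tau>)))))" for f :: "(nat \<Rightarrow> real) \<Rightarrow> real"
  show ?thesis
  proof (rule smooth_fun_coinduct[of P])
    show "P (\<lambda>x. integral {0..1} (\<lambda>\<tau>. g (x(n := \<tau>))))" using assms P_def by blast
    fix f assume "P f"
    then obtain g where g: "smooth_fun (Suc n) (Rn (Suc n)) g"
      and f: "f = (\<lambda>x. integral {0..1} (\<lambda>\<tau>. g (x(n := \<tau>))))" unfolding P_def by blast
    show "continuous_on (Rn n) f"
      using integral_continuous_on_param[OF cts[OF g]] by (simp add: f)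
    fix i assume i: "i < n"
    show "\<exists>h. P h \<and> (\<forall>x\<in>Rn n. ((\<lambda>s. f (x(i := s))) has_real_derivative h x) (at (x i)))"
    proof (intro exI conjI ballI)
      have g': "smooth_fun (Suc n) (Rn (Suc n)) (pd i g)"
        using smooth_fun_pd(1)[OF _ g] i by simp
      then show "P (\<lambda>x. integral {0..1} (\<lambda>\<tau>. pd i g (x(n := \<tau>))))" unfolding P_def by blast
      fix x assume x: "x \<in> Rn n"
      have D: "((\<lambda>s. integral (cbox 0 1) (\<lambda>\<tau>. g (x(i := s, n := \<tau>)))) has_field_derivative
          integral (cbox 0 1) (\<lambda>\<tau>. pd i g (x(i := x i, n := \<tau>)))) (at (x i) within UNIV)"
      proof (rule leibniz_rule_field_derivative)
        fix s \<tau> :: real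
        have "x(i := s, n := \<tau>) \<in> Rn (Suc n)" using x i by (auto simp: Rn_iff)
        from smooth_fun_pd(2)[OF _ g _ this, of i]
        show "((\<lambda>s. g (x(i := s, n := \<tau>))) has_real_derivative pd i g (x(i := s, n := \<tau>))) (at s within UNIV)"
          using i by (simp add: fun_upd_twist[of n i])
      next
        have ii: "continuous_on (UNIV \<times> cbox (0::real) 1) (\<lambda>(s, \<tau>). h (x(i := s, n := \<tau>)))"
          if h: "smooth_fun (Suc n) (Rn (Suc n)) h" for h
        proof -
          have "continuous_on (UNIV \<times> cbox (0::real) 1) (\<lambda>p. x(i := fst p))"
          proof (rule continuous_on_coordinatewise_then_product)
            fix j
            show "continuous_on (UNIV \<times> cbox (0::real) 1) (\<lambda>p. (x(i := fst p)) j)"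
              using continuous_on_fst[OF continuous_on_id, of "UNIV \<times> cbox (0::real) 1"]
              by (cases "j = i") simp_all
          qed
          then have "continuous_on (UNIV \<times> cbox (0::real) 1) (\<lambda>p. (x(i := fst p), snd p))"
            by (intro continuous_on_Pair continuous_on_snd continuous_on_id)
          then have "continuous_on (UNIV \<times> cbox (0::real) 1)
              (\<lambda>p. (\<lambda>(x, \<tau>). h (x(n := \<tau>))) (x(i := fst p), snd p))"
            by (rule continuous_on_compose2[OF cts[OF h]]) (use x i in \<open>auto simp: Rn_iff\<close>)
          then show ?thesis by (simp add: case_prod_unfold)
        qed
        show "continuous_on (UNIV \<times> cbox 0 1) (\<lambda>(s, \<tau>). pd i g (x(i := s, n := \<tau>)))"
          by (rule ii[OF g'])
        fix s :: real
        have "continuous_on (cbox 0 1) (\<lambda>\<tau>. (\<lambda>(s, \<tau>). g (x(i := s, n := \<tau>))) (s, \<tau>))"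
          by (rule continuous_on_compose2[OF ii[OF g]]) (auto intro!: continuous_intros)
        then show "(\<lambda>\<tau>. g (x(i := s, n := \<tau>))) integrable_on cbox 0 1"
          by (intro integrable_continuous) (simp only: prod.case)
      qed auto
      then show "((\<lambda>s. f (x(i := s))) has_real_derivative integral {0..1} (\<lambda>\<tau>. pd i g (x(n := \<tau>)))) (at (x i))"
        by (simp add: f)
    qed
  qed
qed

text \<open>
  Here \<open>g x\<close> is the mean of \<open>pd i f\<close> over the segment from \<open>x(i := 0)\<close> to \<open>x\<close>.
\<close>

lemma hadamard:
  assumes f: "smooth_fun n (Rn n) f" and i: "i < n"
  obtains g where "smooth_fun n (Rn n) g" "\<And>x. x \<in> Rn n \<Longrightarrow> f x = f (x(i := 0)) + x i * g x"
    "\<And>x. x \<in> Rn n \<Longrightarrow> x i = 0 \<Longrightarrow> g x = pd i f x"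
proof -
  define h where "h y = pd i f (y(i := y n * y i, n := 0))" for y
  have f': "smooth_fun n (Rn n) (pd i f)" using smooth_fun_pd(1)[OF _ f i] by simp
  have h: "smooth_fun (Suc n) (Rn (Suc n)) h"
    unfolding h_def
  proof (rule smooth_fun_compose[OF _ _ _ _ f'])
    fix j assume "j < n"
    then show "smooth_fun (Suc n) (Rn (Suc n)) (\<lambda>y. (y(i := y n * y i, n := 0)) j)"
      by (cases "j = i") (auto intro: smooth_fun_intros)
  qed (use i in \<open>auto simp: Rn_iff\<close>)
  define g where "g x = integral {0..1} (\<lambda>\<tau>. h (x(n := \<tau>)))" for x
  have hx: "h (x(n := \<tau>)) = pd i f (x(i := \<tau> * x i))" if "x \<in> Rn n" for x \<tau>
  proof -
    have "x n = 0" using that by (simp add: Rn_iff)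
    then have "(x(n := \<tau>))(i := (x(n := \<tau>)) n * (x(n := \<tau>)) i, n := 0) = x(i := \<tau> * x i)"
      using i by (auto simp: fun_eq_iff)
    then show ?thesis by (simp add: h_def)
  qed
  show thesis
  proof (rule that[of g])
    show "smooth_fun n (Rn n) g" unfolding g_def by (rule smooth_param_integral[OF h])
    fix x assume x: "x \<in> Rn n"
    have "((\<lambda>\<tau>. f (x(i := \<tau> * x i))) has_real_derivative pd i f (x(i := \<tau> * x i)) * x i) (at \<tau>)" for \<tau>
    proof -
      have "((\<lambda>s. f (x(i := s))) has_real_derivative pd i f (x(i := \<tau> * x i))) (at (\<tau> * x i))"
        using smooth_fun_pd(2)[OF _ f i Rn_upd[OF x i, of "\<tau> * x i"]] by simp
      moreover have "((\<lambda>\<tau>. \<tau> * x i) has_real_derivative x i) (at \<tau>)"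
        by (auto intro!: derivative_eq_intros)
      ultimately show ?thesis by (rule DERIV_chain2)
    qed
    then have "((\<lambda>\<tau>. pd i f (x(i := \<tau> * x i)) * x i) has_integral
        f (x(i := 1 * x i)) - f (x(i := 0 * x i))) {0..1}"
      by (intro fundamental_theorem_of_calculus)
        (auto simp del: fun_upd_apply simp: has_real_derivative_iff_has_vector_derivative[symmetric]
          intro: has_field_derivative_at_within)
    from integral_unique[OF this]
    have "f x - f (x(i := 0)) = integral {0..1} (\<lambda>\<tau>. pd i f (x(i := \<tau> * x i)) * x i)"
      by (simp del: integral_mult_left)
    then show "f x = f (x(i := 0)) + x i * g x" by (simp add: g_def hx[OF x] algebra_simps)
    assume "x i = 0"
    then have "x(i := \<tau> * x i) = x" for \<tau> by auto
    then show "g x = pd i f x" by (simp add: g_def hx[OF x])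
  qed
qed

section \<open>Charts and smooth functions on a manifold\<close>

lemma smooth_fun_cong_iff:
  "open_Rn n U \<Longrightarrow> (\<And>y. y \<in> U \<Longrightarrow> f y = g y) \<Longrightarrow> smooth_fun n U f \<longleftrightarrow> smooth_fun n U g"
  by (metis smooth_fun_cong)

lemma open_Rn_Collect_abs_less:
  "open_Rn d {y \<in> Rn d. \<forall>i<d. \<bar>y i - a i\<bar> < (e::real)}"
proof (cases "0 < e")
  case True
  show ?thesis
    unfolding open_Rn_iff
  proof (intro conjI ballI)
    fix x assume x: "x \<in> {y \<in> Rn d. \<forall>i<d. \<bar>y i - a i\<bar> < e}"
    define r where "r = Min (insert 1 ((\<lambda>i. e - \<bar>x i - a i\<bar>) ` {..<d}))"
    have r: "r > 0" "\<And>i. i < d \<Longrightarrow> r \<le> e - \<bar>x i - a i\<bar>" unfolding r_def using x by auto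
    show "\<exists>r>0. \<forall>y\<in>Rn d. (\<forall>i<d. \<bar>y i - x i\<bar> < r) \<longrightarrow> y \<in> {y \<in> Rn d. \<forall>i<d. \<bar>y i - a i\<bar> < e}"
    proof (intro exI conjI ballI impI CollectI allI)
      fix y i assume y: "y \<in> Rn d" "\<forall>i<d. \<bar>y i - x i\<bar> < r" and i: "i < d"
      then show "\<bar>y i - a i\<bar> < e" using r(2)[OF i] y(2)[rule_format, OF i] by linarith
    qed (use r in auto)
  qed auto
next
  case False
  then have "{y \<in> Rn d. \<forall>i<d. \<bar>y i - a i\<bar> < e} = (if d = 0 then Rn d else {})"
    by (auto simp: not_less)
  then show ?thesis by (auto split: if_splits)
qed

lemma open_Rn_closed_box:
  assumes "open_Rn d W" "a \<in> W"
  obtains e where "e > 0" "{y \<in> Rn d. \<forall>i<d. \<bar>y i - a i\<bar> \<le> 2 * e} \<subseteq> W"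
proof -
  obtain r where r: "r > 0" "\<And>y. y \<in> Rn d \<Longrightarrow> (\<forall>i<d. \<bar>y i - a i\<bar> < r) \<Longrightarrow> y \<in> W"
    using assms unfolding open_Rn_iff by blast
  have "{y \<in> Rn d. \<forall>i<d. \<bar>y i - a i\<bar> \<le> 2 * (r / 3)} \<subseteq> W"
    using r by (auto intro!: r(2))
  then show thesis using that[of "r / 3"] r(1) by simp
qed

lemma compactin_Rn_box:
  "compactin (Euclidean_space d) {y \<in> Rn d. \<forall>i<d. \<bar>y i - a i\<bar> \<le> (r::real)}"
proof -
  have "{y \<in> Rn d. \<forall>i<d. \<bar>y i - a i\<bar> \<le> r} = (\<Pi>\<^sub>E i\<in>UNIV. if i < d then {a i - r..a i + r} else {0})"
    (is "?L = ?R")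
  proof (intro Set.set_eqI iffI)
    fix y assume "y \<in> ?L"
    then show "y \<in> ?R" by (auto simp: Rn_iff PiE_iff abs_le_iff)
  next
    fix y assume y: "y \<in> ?R"
    have "y i = 0" if "i \<ge> d" for i
      using y that by (auto simp: PiE_iff dest!: spec[of _ i])
    moreover have "\<bar>y i - a i\<bar> \<le> r" if "i < d" for i
      using y that by (auto simp: PiE_iff abs_le_iff dest!: spec[of _ i])
    ultimately show "y \<in> ?L" by (auto simp: Rn_iff)
  qed
  moreover have "compactin (powertop_real UNIV) (\<Pi>\<^sub>E i\<in>UNIV. if i < d then {a i - r..a i + r} else {0})"
    by (subst compactin_PiE) auto
  ultimately have "compactin (powertop_real UNIV) {y \<in> Rn d. \<forall>i<d. \<bar>y i - a i\<bar> \<le> r}" by simp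
  then show ?thesis
    unfolding Euclidean_space_def by (auto simp: compactin_subtopology)
qed

lemma openin_preimage_subtopology:
  assumes "openin X W" "continuous_map (subtopology X W) Y F" "openin Y V"
  shows "openin X {z \<in> W. F z \<in> V}"
proof -
  have "topspace (subtopology X W) = W" using openin_subset[OF assms(1)] by auto
  then have "openin (subtopology X W) {z \<in> W. F z \<in> V}"
    using openin_continuous_map_preimage[OF assms(2,3)] by metis
  then show ?thesis using assms(1) openin_open_subtopology by blast
qed

lemma smooth_map_eucl_iff:
  "smooth_map (eucl n) N W F \<longleftrightarrow> open_Rn n W \<and>
     continuous_map (subtopology (Euclidean_space n) W) (mtop N) F \<and>
     (\<forall>(V, \<psi>)\<in>charts N. \<forall>a<mdim N. smooth_fun n {z \<in> W. F z \<in> V} (\<lambda>z. \<psi> (F z) a))"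
  if N: "\<And>V \<psi>. (V, \<psi>) \<in> charts N \<Longrightarrow> openin (mtop N) V"
proof (cases "open_Rn n W \<and> continuous_map (subtopology (Euclidean_space n) W) (mtop N) F")
  case True
  then have W: "open_Rn n W" and cF: "continuous_map (subtopology (Euclidean_space n) W) (mtop N) F"
    by auto
  have eq: "smooth_fun n ((\<lambda>x. x) ` {p \<in> Rn n \<inter> W. F p \<in> V}) (\<lambda>x. \<psi> (F (inv_into (Rn n) (\<lambda>x. x) x)) a)
    \<longleftrightarrow> smooth_fun n {z \<in> W. F z \<in> V} (\<lambda>z. \<psi> (F z) a)" if "(V, \<psi>) \<in> charts N" for V \<psi> a
  proof -
    have WR: "W \<subseteq> Rn n" by (rule open_Rn_subset[OF W])
    have op: "open_Rn n {z \<in> W. F z \<in> V}"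
      by (rule openin_preimage_subtopology[OF W cF N[OF that]])
    have im: "(\<lambda>x. x) ` {p \<in> Rn n \<inter> W. F p \<in> V} = {z \<in> W. F z \<in> V}" using WR by auto
    have inv: "inv_into (Rn n) (\<lambda>x. x) x = x" if "x \<in> Rn n" for x
      using inv_into_f_f[of "\<lambda>x. x" "Rn n" x] that by simp
    have e: "\<psi> (F (inv_into (Rn n) (\<lambda>x. x) z)) a = \<psi> (F z) a" if "z \<in> {z \<in> W. F z \<in> V}" for z
      using inv that WR by auto
    show ?thesis
      unfolding im by (rule smooth_fun_cong_iff[OF op]) (rule e)
  qed
  show ?thesis
    unfolding smooth_map_def using True eq by (simp add: eucl_def) fast
next
  case False
  then show ?thesis unfolding smooth_map_def by (auto simp: eucl_def)
qed

locale manifold =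
  fixes N :: "'m mfd"
  assumes mfd: "smooth_manifold N"
begin

abbreviation "dm \<equiv> mdim N"

lemma chart_open: "(U, \<phi>) \<in> charts N \<Longrightarrow> openin (mtop N) U"
  and chart_image_open: "(U, \<phi>) \<in> charts N \<Longrightarrow> open_Rn dm (\<phi> ` U)"
  and chart_homeo: "(U, \<phi>) \<in> charts N \<Longrightarrow>
    homeomorphic_map (subtopology (mtop N) U) (subtopology (Euclidean_space dm) (\<phi> ` U)) \<phi>"
  using mfd unfolding smooth_manifold_def by fast+

lemma smooth_map_eucl:
  "smooth_map (eucl n) N W F \<longleftrightarrow> open_Rn n W \<and>
     continuous_map (subtopology (Euclidean_space n) W) (mtop N) F \<and>
     (\<forall>(V, \<psi>)\<in>charts N. \<forall>a<dm. smooth_fun n {z \<in> W. F z \<in> V} (\<lambda>z. \<psi> (F z) a))"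
  by (rule smooth_map_eucl_iff) (rule chart_open)

lemma chart_transition:
  "(U, \<phi>) \<in> charts N \<Longrightarrow> (V, \<psi>) \<in> charts N \<Longrightarrow> a < dm \<Longrightarrow>
    smooth_fun dm (\<phi> ` (U \<inter> V)) (\<lambda>x. \<psi> (inv_into U \<phi> x) a)"
  using mfd unfolding smooth_manifold_def by fast

lemma chart_at:
  assumes "p \<in> topspace (mtop N)"
  obtains U \<phi> where "(U, \<phi>) \<in> charts N" "p \<in> U"
  using mfd assms unfolding smooth_manifold_def by blast

lemma chart_subset: "(U, \<phi>) \<in> charts N \<Longrightarrow> U \<subseteq> topspace (mtop N)"
  using chart_open openin_subset by blast

lemma topspace_chart: "(U, \<phi>) \<in> charts N \<Longrightarrow> topspace (subtopology (mtop N) U) = U"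
  using chart_subset by auto

lemma topspace_chart_image:
  "(U, \<phi>) \<in> charts N \<Longrightarrow> topspace (subtopology (Euclidean_space dm) (\<phi> ` U)) = \<phi> ` U"
  using open_Rn_subset[OF chart_image_open] by (simp add: inf.absorb_iff2)

lemma chart_inj: "(U, \<phi>) \<in> charts N \<Longrightarrow> inj_on \<phi> U"
  using homeomorphic_imp_injective_map[OF chart_homeo] topspace_chart by metis

lemma chart_inv [simp]: "(U, \<phi>) \<in> charts N \<Longrightarrow> p \<in> U \<Longrightarrow> inv_into U \<phi> (\<phi> p) = p"
  using chart_inj by (simp add: inv_into_f_f)

lemma chart_image_open_sub:
  assumes c: "(U, \<phi>) \<in> charts N" and Q: "openin (mtop N) Q" "Q \<subseteq> U"
  shows "open_Rn dm (\<phi> ` Q)"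
proof -
  have "openin (subtopology (mtop N) U) Q"
    using Q chart_open[OF c] by (simp add: openin_open_subtopology)
  then have "openin (subtopology (Euclidean_space dm) (\<phi> ` U)) (\<phi> ` Q)"
    using homeomorphic_map_openness_eq[OF chart_homeo[OF c]] by blast
  then show ?thesis using chart_image_open[OF c] openin_open_subtopology by blast
qed

lemma chart_preimage_open:
  assumes c: "(U, \<phi>) \<in> charts N" and W: "open_Rn dm W"
  shows "openin (mtop N) {p \<in> U. \<phi> p \<in> W}"
proof -
  have "continuous_map (subtopology (mtop N) U) (subtopology (Euclidean_space dm) (\<phi> ` U)) \<phi>"
    using chart_homeo[OF c] homeomorphic_imp_continuous_map by blast
  then have "continuous_map (subtopology (mtop N) U) (Euclidean_space dm) \<phi>"
    using continuous_map_in_subtopology by blast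
  then show ?thesis by (rule openin_preimage_subtopology[OF chart_open[OF c] _ W])
qed

lemma chart_inv_continuous:
  assumes c: "(U, \<phi>) \<in> charts N"
  shows "continuous_map (subtopology (Euclidean_space dm) (\<phi> ` U)) (mtop N) (inv_into U \<phi>)"
proof -
  obtain g where g: "homeomorphic_maps (subtopology (mtop N) U) (subtopology (Euclidean_space dm) (\<phi> ` U)) \<phi> g"
    using chart_homeo[OF c] homeomorphic_map_maps by blast
  then have "continuous_map (subtopology (Euclidean_space dm) (\<phi> ` U)) (subtopology (mtop N) U) g"
    and gi: "\<And>p. p \<in> U \<Longrightarrow> g (\<phi> p) = p"
    using topspace_chart[OF c] unfolding homeomorphic_maps_def by auto
  then have "continuous_map (subtopology (Euclidean_space dm) (\<phi> ` U)) (mtop N) g"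
    using continuous_map_in_subtopology by blast
  then show ?thesis
    by (rule continuous_map_eq) (use gi c topspace_chart_image[OF c] in auto)
qed

lemma Cinf_chart:
  "f \<in> Cinf N \<Longrightarrow> (U, \<phi>) \<in> charts N \<Longrightarrow> smooth_fun dm (\<phi> ` U) (\<lambda>x. f (inv_into U \<phi> x))"
  unfolding Cinf_def smooth_real_def by fast

text \<open>
  A function on a chart, cut off in the box of radius \<open>2 * e\<close> around \<open>a\<close> and extended by 0.
\<close>

definition chart_ext :: "'m set \<Rightarrow> ('m \<Rightarrow> nat \<Rightarrow> real) \<Rightarrow> real \<Rightarrow> (nat \<Rightarrow> real) \<Rightarrow> ((nat \<Rightarrow> real) \<Rightarrow> real) \<Rightarrow> 'm \<Rightarrow> real" where
  "chart_ext U \<phi> e a g q = (if q \<in> U then box_cutoff dm e a (\<phi> q) * g (\<phi> q) else 0)"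

text \<open>
  Outside the chart domain the function vanishes near every point because the closed box is compact,
  hence closed in the Hausdorff manifold.
\<close>

lemma chart_ext_Cinf:
  assumes c: "(U, \<phi>) \<in> charts N" and e: "0 < e"
    and box: "{y \<in> Rn dm. \<forall>i<dm. \<bar>y i - a i\<bar> \<le> 2 * e} \<subseteq> \<phi> ` U"
    and g: "smooth_fun dm (\<phi> ` U) g"
  shows "chart_ext U \<phi> e a g \<in> Cinf N"
proof -
  let ?B = "{y \<in> Rn dm. \<forall>i<dm. \<bar>y i - a i\<bar> \<le> 2 * e}"
  define K where "K = inv_into U \<phi> ` ?B"
  have "compactin (subtopology (Euclidean_space dm) (\<phi> ` U)) ?B"
    using compactin_Rn_box[of dm a "2 * e"] box by (simp add: compactin_subtopology)
  then have "compactin (mtop N) K"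
    unfolding K_def using chart_inv_continuous[OF c] by (rule image_compactin)
  then have K: "closedin (mtop N) K"
    using mfd unfolding smooth_manifold_def by (auto intro: compactin_imp_closedin)
  have K0: "chart_ext U \<phi> e a g q = 0" if "q \<notin> K" for q
  proof (cases "q \<in> U")
    case True
    then have "\<phi> q \<notin> ?B" using that c unfolding K_def by (metis (no_types, lifting) chart_inv imageI)
    moreover have "\<phi> q \<in> Rn dm" using True open_Rn_subset[OF chart_image_open[OF c]] by auto
    ultimately obtain i where "i < dm" "\<bar>\<phi> q i - a i\<bar> \<ge> 2 * e" by force
    then show ?thesis using box_cutoff_eq_0[OF e] by (simp add: chart_ext_def)
  qed (simp add: chart_ext_def)
  have sm: "smooth_fun dm (\<psi> ` V) (\<lambda>x. chart_ext U \<phi> e a g (inv_into V \<psi> x))"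
    if c': "(V, \<psi>) \<in> charts N" for V \<psi>
  proof (rule smooth_fun_local[OF chart_image_open[OF c']])
    fix x assume "x \<in> \<psi> ` V"
    then obtain q where q: "q \<in> V" "x = \<psi> q" by blast
    show "\<exists>U'. open_Rn dm U' \<and> x \<in> U' \<and> smooth_fun dm U' (\<lambda>x. chart_ext U \<phi> e a g (inv_into V \<psi> x))"
    proof (cases "q \<in> U")
      case True
      have op: "open_Rn dm (\<psi> ` (V \<inter> U))"
        using chart_open[OF c] chart_open[OF c'] by (intro chart_image_open_sub[OF c']) auto
      have "smooth_fun dm (\<psi> ` (V \<inter> U)) (\<lambda>x. (\<lambda>y. box_cutoff dm e a y * g y) (\<phi> (inv_into V \<psi> x)))"
      proof (rule smooth_fun_compose[OF op chart_image_open[OF c], where G = "\<lambda>x. \<phi> (inv_into V \<psi> x)"])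
        show "\<phi> (inv_into V \<psi> x) \<in> \<phi> ` U" if "x \<in> \<psi> ` (V \<inter> U)" for x using that c' by auto
        show "smooth_fun dm (\<psi> ` (V \<inter> U)) (\<lambda>x. \<phi> (inv_into V \<psi> x) j)" if "j < dm" for j
          using chart_transition[OF c' c that] .
        show "smooth_fun dm (\<phi> ` U) (\<lambda>y. box_cutoff dm e a y * g y)"
          by (intro smooth_fun_mult smooth_box_cutoff chart_image_open[OF c] g)
      qed
      then have "smooth_fun dm (\<psi> ` (V \<inter> U)) (\<lambda>x. chart_ext U \<phi> e a g (inv_into V \<psi> x))"
        by (rule smooth_fun_cong[OF op, rotated]) (use c' in \<open>auto simp: chart_ext_def\<close>)
      then show ?thesis using op q True by blast
    next
      case False
      have "q \<notin> K" using False box inv_into_into[of _ \<phi> U] unfolding K_def by blast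
      have op: "open_Rn dm (\<psi> ` (V - K))"
        using K chart_open[OF c'] by (intro chart_image_open_sub[OF c']) auto
      have "smooth_fun dm (\<psi> ` (V - K)) (\<lambda>x. chart_ext U \<phi> e a g (inv_into V \<psi> x))"
        by (rule smooth_fun_cong[OF op _ smooth_fun_const[where c = 0]]) (use K0 c' in auto)
      then show ?thesis using op q \<open>q \<notin> K\<close> by blast
    qed
  qed
  have "chart_ext U \<phi> e a g p = 0" if "p \<notin> topspace (mtop N)" for p
    using that chart_subset[OF c] by (auto simp: chart_ext_def)
  then show ?thesis unfolding Cinf_def smooth_real_def using sm by auto
qed

lemma chart_ext_eq:
  "q \<in> U \<Longrightarrow> e > 0 \<Longrightarrow> (\<And>i. i < dm \<Longrightarrow> \<bar>\<phi> q i - a i\<bar> \<le> e) \<Longrightarrow> chart_ext U \<phi> e a g q = g (\<phi> q)"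
  using box_cutoff_eq_1[of e dm "\<phi> q" a] by (simp add: chart_ext_def)

lemma chart_box:
  assumes c: "(U, \<phi>) \<in> charts N" and p: "p \<in> U" "p \<in> Q" and Q: "openin (mtop N) Q"
  obtains e where "e > 0" "{y \<in> Rn dm. \<forall>i<dm. \<bar>y i - \<phi> p i\<bar> \<le> 2 * e} \<subseteq> \<phi> ` (U \<inter> Q)"
proof -
  have "open_Rn dm (\<phi> ` (U \<inter> Q))"
    using chart_open[OF c] Q by (intro chart_image_open_sub[OF c]) auto
  then show thesis using open_Rn_closed_box[of dm "\<phi> ` (U \<inter> Q)" "\<phi> p"] p that by blast
qed

lemma bump_function:
  assumes Q: "openin (mtop N) Q" and p: "p \<in> Q"
  obtains f where "f \<in> Cinf N" "f p = 1" "\<And>q. q \<notin> Q \<Longrightarrow> f q = 0"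
proof -
  obtain U \<phi> where c: "(U, \<phi>) \<in> charts N" "p \<in> U"
    using chart_at Q p openin_subset by blast
  obtain e where e: "e > 0" "{y \<in> Rn dm. \<forall>i<dm. \<bar>y i - \<phi> p i\<bar> \<le> 2 * e} \<subseteq> \<phi> ` (U \<inter> Q)"
    using chart_box[OF c p Q] by blast
  define f where "f = chart_ext U \<phi> e (\<phi> p) (\<lambda>_. 1)"
  show thesis
  proof (rule that)
    show "f \<in> Cinf N" unfolding f_def
      by (rule chart_ext_Cinf[OF c(1) e(1)]) (use e(2) in \<open>auto intro: smooth_fun_const\<close>)
    show "f p = 1" unfolding f_def by (subst chart_ext_eq) (use c e in auto)
    fix q assume q: "q \<notin> Q"
    show "f q = 0"
    proof (cases "q \<in> U")
      case True
      then have "\<phi> q \<notin> \<phi> ` (U \<inter> Q)" using q chart_inj[OF c(1)] by (auto simp: inj_on_def)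
      moreover have "\<phi> q \<in> Rn dm" using True open_Rn_subset[OF chart_image_open[OF c(1)]] by auto
      ultimately obtain i where "i < dm" "\<bar>\<phi> q i - \<phi> p i\<bar> \<ge> 2 * e" using e(2) by force
      then show ?thesis using box_cutoff_eq_0[OF e(1)] by (simp add: f_def chart_ext_def)
    qed (simp add: f_def chart_ext_def)
  qed
qed

lemma smooth_map_compose_Cinf:
  assumes F: "smooth_map (eucl n) N W F" and f: "f \<in> Cinf N"
  shows "smooth_fun n W (\<lambda>z. f (F z))"
proof -
  note F' = F[unfolded smooth_map_eucl]
  have W: "open_Rn n W" and cF: "continuous_map (subtopology (Euclidean_space n) W) (mtop N) F"
    using F' by auto
  have tW: "topspace (subtopology (Euclidean_space n) W) = W" using open_Rn_subset[OF W] by auto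
  show ?thesis
  proof (rule smooth_fun_local[OF W])
    fix z assume z: "z \<in> W"
    then have "F z \<in> topspace (mtop N)" using cF tW continuous_map_image_subset_topspace by blast
    then obtain U \<phi> where c: "(U, \<phi>) \<in> charts N" "F z \<in> U" by (rule chart_at)
    have op: "open_Rn n {z \<in> W. F z \<in> U}"
      by (rule openin_preimage_subtopology[OF W cF chart_open[OF c(1)]])
    have "smooth_fun n {z \<in> W. F z \<in> U} (\<lambda>z. (\<lambda>x. f (inv_into U \<phi> x)) (\<phi> (F z)))"
      by (rule smooth_fun_compose[where G = "\<lambda>z. \<phi> (F z)", OF op chart_image_open[OF c(1)] _ _ Cinf_chart[OF f c(1)]])
        (use F' c(1) in auto)
    then have "smooth_fun n {z \<in> W. F z \<in> U} (\<lambda>z. f (F z))"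
      by (rule smooth_fun_cong[OF op, rotated]) (use c in auto)
    then show "\<exists>U'. open_Rn n U' \<and> z \<in> U' \<and> smooth_fun n U' (\<lambda>z. f (F z))"
      using op z c by blast
  qed
qed

text \<open>
  Bump functions make the topology of the manifold the initial topology of its smooth functions.
\<close>

lemma continuous_map_Cinf:
  assumes W: "open_Rn n W" and im: "\<And>z. z \<in> W \<Longrightarrow> F z \<in> topspace (mtop N)"
    and sm: "\<And>f. f \<in> Cinf N \<Longrightarrow> continuous_on W (\<lambda>z. f (F z))"
  shows "continuous_map (subtopology (Euclidean_space n) W) (mtop N) F"
proof -
  have tW: "topspace (subtopology (Euclidean_space n) W) = W" using open_Rn_subset[OF W] by auto
  have "open_Rn n {z \<in> W. F z \<in> Q}" if Q: "openin (mtop N) Q" for Q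
  proof (subst openin_subopen, intro ballI)
    fix z assume z: "z \<in> {z \<in> W. F z \<in> Q}"
    then obtain f where f: "f \<in> Cinf N" "f (F z) = 1" "\<And>q. q \<notin> Q \<Longrightarrow> f q = 0"
      using bump_function[OF Q] by blast
    obtain T where T: "open T" "W = T \<inter> Rn n" using W by (rule open_Rn_obtain)
    obtain A where A: "open A" "A \<inter> W = (\<lambda>z. f (F z)) -` {0<..} \<inter> W"
      using sm[OF f(1)] unfolding continuous_on_open_invariant by (meson open_greaterThan)
    have "A \<inter> W = (A \<inter> T) \<inter> Rn n" using T by auto
    then have "open_Rn n (A \<inter> W)" using open_Rn_Int_open[of "A \<inter> T" n] A T by auto
    moreover have "z \<in> A \<inter> W" using A(2) z f(2) by auto
    moreover have "A \<inter> W \<subseteq> {z \<in> W. F z \<in> Q}" using A(2) f(3) by force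
    ultimately show "\<exists>T. open_Rn n T \<and> z \<in> T \<and> T \<subseteq> {z \<in> W. F z \<in> Q}" by blast
  qed
  then show ?thesis
    unfolding continuous_map_def tW using im W by (auto simp: openin_open_subtopology)
qed

text \<open>
  Smooth maps into a manifold are recognized by smooth functions. This removes charts from almost all
  later arguments.
\<close>

lemma smooth_map_eucl_Cinf_iff:
  "smooth_map (eucl n) N W F \<longleftrightarrow> open_Rn n W \<and> (\<forall>z\<in>W. F z \<in> topspace (mtop N)) \<and>
     (\<forall>f\<in>Cinf N. smooth_fun n W (\<lambda>z. f (F z)))" (is "?L \<longleftrightarrow> ?R")
proof
  assume L: ?L
  note F' = L[unfolded smooth_map_eucl]
  have "topspace (subtopology (Euclidean_space n) W) = W"
    using open_Rn_subset[of n W] F' by auto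
  then show ?R using smooth_map_compose_Cinf[OF L] F' continuous_map_image_subset_topspace by fast
next
  assume R: ?R
  then have W: "open_Rn n W" by blast
  have tW: "topspace (subtopology (Euclidean_space n) W) = W" using open_Rn_subset[OF W] by auto
  have cF: "continuous_map (subtopology (Euclidean_space n) W) (mtop N) F"
    using R smooth_fun_continuous_on by (intro continuous_map_Cinf) blast+
  have op: "open_Rn n {z \<in> W. F z \<in> V}" if "openin (mtop N) V" for V
    by (rule openin_preimage_subtopology[OF W cF that])
  have "smooth_fun n {z \<in> W. F z \<in> V} (\<lambda>z. \<psi> (F z) j)" if c: "(V, \<psi>) \<in> charts N" and j: "j < dm" for V \<psi> j
  proof (rule smooth_fun_local[OF op[OF chart_open[OF c]]])
    fix z assume z: "z \<in> {z \<in> W. F z \<in> V}"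
    then obtain e where e: "e > 0" "{y \<in> Rn dm. \<forall>i<dm. \<bar>y i - \<psi> (F z) i\<bar> \<le> 2 * e} \<subseteq> \<psi> ` (V \<inter> V)"
      using chart_box[OF c, of "F z" V] chart_open[OF c] by blast
    let ?c = "chart_ext V \<psi> e (\<psi> (F z)) (\<lambda>y. y j)"
    have "?c \<in> Cinf N" using e by (intro chart_ext_Cinf[OF c e(1)]) (auto intro: smooth_fun_coord)
    then have sc: "smooth_fun n W (\<lambda>z. ?c (F z))" using R by blast
    let ?A = "{q \<in> V. \<psi> q \<in> {y \<in> Rn dm. \<forall>i<dm. \<bar>y i - \<psi> (F z) i\<bar> < e}}"
    have A: "openin (mtop N) ?A" by (rule chart_preimage_open[OF c open_Rn_Collect_abs_less])
    have "smooth_fun n {z \<in> W. F z \<in> ?A} (\<lambda>z. \<psi> (F z) j)"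
      by (rule smooth_fun_cong[OF op[OF A] _ smooth_fun_subset[OF sc]]) (auto intro!: chart_ext_eq e(1) less_imp_le)
    moreover have "\<psi> (F z) \<in> Rn dm" using z open_Rn_subset[OF chart_image_open[OF c]] by auto
    then have "z \<in> {z \<in> W. F z \<in> ?A}" using z e(1) by simp
    ultimately show "\<exists>U'. open_Rn n U' \<and> z \<in> U' \<and> smooth_fun n U' (\<lambda>z. \<psi> (F z) j)" using op[OF A] by blast
  qed
  then show ?L unfolding smooth_map_eucl using W cF by auto
qed

end

section \<open>Ordinary differential equations\<close>

text \<open>
  The one-dimensional statement is applied to one coordinate after the other.
\<close>

lemma hadamard_n:
  assumes f: "smooth_fun n (Rn n) f" and b: "b \<in> Rn n"
  obtains g where "\<And>j. j < n \<Longrightarrow> smooth_fun n (Rn n) (g j)"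
    "\<And>y. y \<in> Rn n \<Longrightarrow> f y = f b + (\<Sum>j<n. (y j - b j) * g j y)"
proof -
  define f0 where "f0 y = f (\<lambda>i. y i + b i)" for y
  have shift: "(\<lambda>i. y i + b i) \<in> Rn n" "(\<lambda>i. y i - b i) \<in> Rn n" if "y \<in> Rn n" for y
    using that b by (auto simp: Rn_iff)
  have f0: "smooth_fun n (Rn n) f0"
    unfolding f0_def
    by (rule smooth_fun_compose[OF _ _ _ _ f, where G = "\<lambda>y i. y i + b i"])
      (auto intro: shift smooth_fun_intros)
  have "\<exists>g. smooth_fun n (Rn n) g \<and> (\<forall>x\<in>Rn n. f0 x = f0 (x(i := 0)) + x i * g x)" if "i < n" for i
    using hadamard[OF f0 that] by metis
  then obtain g where g: "\<And>i. i < n \<Longrightarrow> smooth_fun n (Rn n) (g i)"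
    "\<And>i x. i < n \<Longrightarrow> x \<in> Rn n \<Longrightarrow> f0 x = f0 (x(i := 0)) + x i * g i x" by metis
  define tr where "tr i y = (\<lambda>j. if j < i then y j else 0 :: real)" for i :: nat and y
  have tr: "tr i y \<in> Rn n" if "y \<in> Rn n" for i y using that by (auto simp: tr_def Rn_iff)
  have "f0 y = f0 (\<lambda>_. 0) + (\<Sum>j<n. y j * g j (tr (Suc j) y))" if y: "y \<in> Rn n" for y
  proof -
    have "f0 (tr (Suc j) y) - f0 (tr j y) = y j * g j (tr (Suc j) y)" if "j < n" for j
    proof -
      have "(tr (Suc j) y)(j := 0) = tr j y" by (auto simp: tr_def fun_eq_iff)
      moreover have "tr (Suc j) y j = y j" by (simp add: tr_def)
      ultimately show ?thesis using g(2)[OF that tr[OF y], of "Suc j"] by simp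
    qed
    then have "(\<Sum>j<n. y j * g j (tr (Suc j) y)) = (\<Sum>j<n. f0 (tr (Suc j) y) - f0 (tr j y))" by simp
    also have "\<dots> = f0 (tr n y) - f0 (tr 0 y)" by (rule sum_lessThan_telescope)
    also have "tr n y = y" using y by (auto simp: tr_def Rn_iff fun_eq_iff)
    also have "tr 0 y = (\<lambda>_. 0)" by (simp add: tr_def)
    finally show ?thesis by simp
  qed
  note f0_eq = this
  show thesis
  proof (rule that[of "\<lambda>j y. g j (tr (Suc j) (\<lambda>i. y i - b i))"])
    fix j assume j: "j < n"
    show "smooth_fun n (Rn n) (\<lambda>y. g j (tr (Suc j) (\<lambda>i. y i - b i)))"
    proof (rule smooth_fun_compose[OF _ _ _ _ g(1)[OF j], where G = "\<lambda>y. tr (Suc j) (\<lambda>i. y i - b i)"])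
      show "smooth_fun n (Rn n) (\<lambda>y. tr (Suc j) (\<lambda>i. y i - b i) l)" for l
        by (cases "l < Suc j") (auto simp: tr_def intro!: smooth_fun_intros)
    qed (auto intro: tr shift)
  next
    fix y assume y: "y \<in> Rn n"
    have "f y = f0 (\<lambda>i. y i - b i)" "f b = f0 (\<lambda>_. 0)" by (auto simp: f0_def)
    then show "f y = f b + (\<Sum>j<n. (y j - b j) * g j (tr (Suc j) (\<lambda>i. y i - b i)))"
      using f0_eq[OF shift(2)[OF y]] by simp
  qed
qed

lemma open_Rn_outside_box: "open_Rn n {y \<in> Rn n. \<exists>i<n. r < \<bar>y i - b i\<bar>}"
  unfolding open_Rn_iff
proof (intro conjI ballI)
  fix x assume "x \<in> {y \<in> Rn n. \<exists>i<n. r < \<bar>y i - b i\<bar>}"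
  then obtain i where i: "i < n" "r < \<bar>x i - b i\<bar>" by blast
  show "\<exists>e>0. \<forall>y\<in>Rn n. (\<forall>i<n. \<bar>y i - x i\<bar> < e) \<longrightarrow> y \<in> {y \<in> Rn n. \<exists>i<n. r < \<bar>y i - b i\<bar>}"
  proof (intro exI[of _ "\<bar>x i - b i\<bar> - r"] conjI ballI impI)
    fix y assume "y \<in> Rn n" "\<forall>j<n. \<bar>y j - x j\<bar> < \<bar>x i - b i\<bar> - r"
    moreover from this have "\<bar>y i - x i\<bar> < \<bar>x i - b i\<bar> - r" using i by blast
    ultimately show "y \<in> {y \<in> Rn n. \<exists>i<n. r < \<bar>y i - b i\<bar>}" using i by (smt (verit) mem_Collect_eq)
  qed (use i in auto)
qed auto

text \<open>
  Makes a function on an open set globally smooth, hence bounded and Lipschitz, without changing it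
  near \<open>b\<close>.
\<close>

definition cut_ext :: "nat \<Rightarrow> (nat \<Rightarrow> real) set \<Rightarrow> real \<Rightarrow> (nat \<Rightarrow> real) \<Rightarrow> ((nat \<Rightarrow> real) \<Rightarrow> real) \<Rightarrow> (nat \<Rightarrow> real) \<Rightarrow> real" where
  "cut_ext n W e b g y = (if y \<in> W then box_cutoff n e b y * g y else 0)"

lemma cut_ext_outside:
  assumes "e > 0" "i < n" "2 * e \<le> \<bar>y i - b i\<bar>"
  shows "cut_ext n W e b g y = 0"
  using box_cutoff_eq_0[of e i n y b] assms by (simp add: cut_ext_def)

lemma cut_ext_inside:
  assumes "e > 0" "y \<in> W" "\<And>i. i < n \<Longrightarrow> \<bar>y i - b i\<bar> \<le> e"
  shows "cut_ext n W e b g y = g y"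
  using box_cutoff_eq_1[of e n y b] assms by (simp add: cut_ext_def)

lemma smooth_cut_ext:
  assumes W: "open_Rn n W" and e: "e > 0" and box: "{y \<in> Rn n. \<forall>i<n. \<bar>y i - b i\<bar> \<le> 2 * e} \<subseteq> W"
    and g: "smooth_fun n W g"
  shows "smooth_fun n (Rn n) (cut_ext n W e b g)"
proof (rule smooth_fun_local)
  fix y assume y: "y \<in> Rn n"
  show "\<exists>U'. open_Rn n U' \<and> y \<in> U' \<and> smooth_fun n U' (cut_ext n W e b g)"
  proof (cases "y \<in> W")
    case True
    have "smooth_fun n W (\<lambda>y. box_cutoff n e b y * g y)"
      by (intro smooth_fun_mult smooth_box_cutoff W g)
    then have "smooth_fun n W (cut_ext n W e b g)"
      by (rule smooth_fun_cong[OF W, rotated]) (simp add: cut_ext_def)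
    then show ?thesis using W True by blast
  next
    case False
    let ?O = "{y \<in> Rn n. \<exists>i<n. 2 * e < \<bar>y i - b i\<bar>}"
    have op: "open_Rn n ?O" by (rule open_Rn_outside_box)
    have "smooth_fun n ?O (cut_ext n W e b g)"
      by (rule smooth_fun_cong[OF op _ smooth_fun_const[where c = 0]]) (auto simp: cut_ext_outside[OF e])
    moreover have "y \<in> ?O" using False box y by force
    ultimately show ?thesis using op by blast
  qed
qed auto

lemma smooth_bounded_of_support:
  assumes f: "smooth_fun n (Rn n) f" and z: "\<And>y. y \<in> Rn n \<Longrightarrow> (\<exists>i<n. r < \<bar>y i - b i\<bar>) \<Longrightarrow> f y = 0"
  obtains B where "B \<ge> 0" "\<And>y. y \<in> Rn n \<Longrightarrow> \<bar>f y\<bar> \<le> B"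
proof -
  let ?K = "{y \<in> Rn n. \<forall>i<n. \<bar>y i - b i\<bar> \<le> r}"
  have "continuous_map (Euclidean_space n) euclideanreal f"
    using smooth_fun_continuous_on[OF f] continuous_map_Euclidean_space_iff by blast
  then have "compactin euclideanreal (f ` ?K)"
    by (rule image_compactin[OF compactin_Rn_box])
  then have "bounded (f ` ?K)" using compact_imp_bounded by simp
  then obtain B where B: "\<And>y. y \<in> ?K \<Longrightarrow> \<bar>f y\<bar> \<le> B" unfolding bounded_iff by auto
  show thesis
  proof (rule that[of "max 0 B"])
    fix y assume y: "y \<in> Rn n"
    show "\<bar>f y\<bar> \<le> max 0 B"
      using B[of y] z[of y] y by (cases "y \<in> ?K") (auto simp: not_le)
  qed simp
qed

lemma smooth_lipschitz_of_support:
  assumes f: "smooth_fun n (Rn n) f" and z: "\<And>y. y \<in> Rn n \<Longrightarrow> (\<exists>i<n. r < \<bar>y i - b i\<bar>) \<Longrightarrow> f y = 0"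
  obtains L where "L \<ge> 0"
    "\<And>y z K. y \<in> Rn n \<Longrightarrow> z \<in> Rn n \<Longrightarrow> (\<And>i. i < n \<Longrightarrow> \<bar>y i - z i\<bar> \<le> K) \<Longrightarrow> \<bar>f y - f z\<bar> \<le> L * K"
proof -
  have pz: "pd i f y = 0" if "i < n" and y: "y \<in> {y \<in> Rn n. \<exists>i<n. r < \<bar>y i - b i\<bar>}" for i y
  proof (rule pd_eqI)
    have "((\<lambda>s. (\<lambda>_. 0) (y(i := s))) has_real_derivative 0) (at (y i))" by simp
    then show "((\<lambda>s. f (y(i := s))) has_real_derivative 0) (at (y i))"
      by (rule has_derivative_transform_upd[OF open_Rn_outside_box y that(1), rotated]) (use z in auto)
  qed
  have "\<exists>B\<ge>0. \<forall>y\<in>Rn n. \<bar>pd i f y\<bar> \<le> B" if "i < n" for i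
  proof -
    have "smooth_fun n (Rn n) (pd i f)" by (rule smooth_fun_pd(1)[OF _ f that]) simp
    then obtain B where "B \<ge> 0" "\<And>y. y \<in> Rn n \<Longrightarrow> \<bar>pd i f y\<bar> \<le> B"
      by (rule smooth_bounded_of_support[of n _ r b]) (use pz[OF \<open>i < n\<close>] in auto)
    then show ?thesis by auto
  qed
  then obtain B where B: "\<And>i. i < n \<Longrightarrow> B i \<ge> 0" "\<And>i y. i < n \<Longrightarrow> y \<in> Rn n \<Longrightarrow> \<bar>pd i f y\<bar> \<le> B i" by metis
  show thesis
  proof (rule that[of "\<Sum>i<n. B i"])
    show "0 \<le> sum B {..<n}" using B by (intro sum_nonneg) auto
    fix y z :: "nat \<Rightarrow> real" and K :: real
    assume yz: "y \<in> Rn n" "z \<in> Rn n" and K: "\<And>i. i < n \<Longrightarrow> \<bar>y i - z i\<bar> \<le> K"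
    define G where "G \<tau> = (\<lambda>i. z i + \<tau> * (y i - z i))" for \<tau> :: real
    have GR: "G \<tau> \<in> Rn n" for \<tau> using yz by (auto simp: G_def Rn_iff)
    have "((\<lambda>\<tau>. f (G \<tau>)) has_real_derivative (\<Sum>i<n. pd i f (G \<tau>) * (y i - z i))) (at \<tau>)" for \<tau>
      by (rule smooth_chain_rule[OF _ f]) (simp_all add: GR, auto simp: G_def intro!: derivative_eq_intros)
    then obtain \<tau> where "f (G 1) - f (G 0) = (1 - 0) * (\<Sum>i<n. pd i f (G \<tau>) * (y i - z i))"
      using mvt_unordered[of 0 1 "\<lambda>\<tau>. f (G \<tau>)" "\<lambda>\<tau>. \<Sum>i<n. pd i f (G \<tau>) * (y i - z i)"] by blast
    moreover have "G 1 = y" "G 0 = z" by (auto simp: G_def)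
    ultimately have "\<bar>f y - f z\<bar> = \<bar>\<Sum>i<n. pd i f (G \<tau>) * (y i - z i)\<bar>" by simp
    also have "\<dots> \<le> (\<Sum>i<n. \<bar>pd i f (G \<tau>) * (y i - z i)\<bar>)" by (rule sum_abs)
    also have "\<dots> \<le> (\<Sum>i<n. B i * K)"
      using B GR K by (intro sum_mono) (auto simp: abs_mult intro!: mult_mono)
    finally show "\<bar>f y - f z\<bar> \<le> sum B {..<n} * K" by (simp add: sum_distrib_right)
  qed
qed

text \<open>
  The function \<open>u\<close> times \<open>exp (- C t)\<close> is nonincreasing to the right of \<open>t0\<close>, and symmetrically to the left.
\<close>

lemma gronwall_zero:
  fixes u :: "real \<Rightarrow> real"
  assumes d: "\<And>t. \<bar>t - t0\<bar> < r \<Longrightarrow> (u has_real_derivative u' t) (at t)"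
    and b: "\<And>t. \<bar>t - t0\<bar> < r \<Longrightarrow> \<bar>u' t\<bar> \<le> C * u t" and z: "u t0 = 0" and t: "\<bar>t - t0\<bar> < r"
  shows "u t \<le> 0"
proof (cases "t0 \<le> t")
  case True
  have "u t * exp (- C * t) \<le> u t0 * exp (- C * t0)"
  proof (rule DERIV_nonpos_imp_nonincreasing[OF True])
    fix s assume s: "t0 \<le> s" "s \<le> t"
    then have s': "\<bar>s - t0\<bar> < r" using t by auto
    have "((\<lambda>t. u t * exp (- C * t)) has_real_derivative (u' s - C * u s) * exp (- C * s)) (at s)"
      by (auto intro!: derivative_eq_intros d[OF s'] simp: algebra_simps)
    moreover have "(u' s - C * u s) * exp (- C * s) \<le> 0"
      using b[OF s'] by (intro mult_nonpos_nonneg) auto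
    ultimately show "\<exists>y. ((\<lambda>t. u t * exp (- C * t)) has_real_derivative y) (at s) \<and> y \<le> 0" by blast
  qed
  then show ?thesis using z by (simp add: mult_le_0_iff)
next
  case False
  then have le: "t \<le> t0" by simp
  have "u t * exp (C * t) \<le> u t0 * exp (C * t0)"
  proof (rule DERIV_nonneg_imp_nondecreasing[OF le])
    fix s assume s: "t \<le> s" "s \<le> t0"
    then have s': "\<bar>s - t0\<bar> < r" using t by auto
    have "((\<lambda>t. u t * exp (C * t)) has_real_derivative (u' s + C * u s) * exp (C * s)) (at s)"
      by (auto intro!: derivative_eq_intros d[OF s'] simp: algebra_simps)
    moreover have "(u' s + C * u s) * exp (C * s) \<ge> 0"
      using b[OF s'] by (intro mult_nonneg_nonneg) auto
    ultimately show "\<exists>y. ((\<lambda>t. u t * exp (C * t)) has_real_derivative y) (at s) \<and> y \<ge> 0" by blast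
  qed
  then show ?thesis using z by (simp add: mult_le_0_iff)
qed

text \<open>
  The integral equation is solved by Banach's fixed point theorem in the complete metric space of
  bounded continuous functions. The time is truncated to the interval where the operator contracts.
\<close>

lemma picard_local:
  fixes F :: "nat \<Rightarrow> (nat \<Rightarrow> real) \<Rightarrow> real"
  assumes a: "a \<in> Rn n" and cF: "\<And>j. j < n \<Longrightarrow> continuous_on (Rn n) (F j)"
    and M: "\<And>j y. j < n \<Longrightarrow> y \<in> Rn n \<Longrightarrow> \<bar>F j y\<bar> \<le> M"
    and L: "L \<ge> 0" "\<And>j y z K. j < n \<Longrightarrow> y \<in> Rn n \<Longrightarrow> z \<in> Rn n \<Longrightarrow>
      (\<And>i. i < n \<Longrightarrow> \<bar>y i - z i\<bar> \<le> K) \<Longrightarrow> \<bar>F j y - F j z\<bar> \<le> L * K"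
  obtains y e where "e > 0" "y 0 = a" "\<And>t. y t \<in> Rn n"
    "\<And>j t. j < n \<Longrightarrow> \<bar>t\<bar> < e \<Longrightarrow> ((\<lambda>s. y s j) has_real_derivative F j (y t)) (at t)"
proof -
  define e where "e = 1 / (2 * (real n * L + 1))"
  have nL: "real n * L \<ge> 0" using L(1) by simp
  then have e: "e > 0" "e * (real n * L) \<le> 1 / 2" by (auto simp: e_def field_simps)
  \<comment> \<open>The \<open>n\<close> components of a curve are encoded as one bounded continuous function on the plane: component \<open>j\<close>
    is its restriction to the line \<open>{real j} \<times> UNIV\<close>, and the tent functions \<open>hat\<close> interpolate between these lines.\<close>
  define hat where "hat x = max 0 (1 - \<bar>x\<bar>)" for x :: real
  have hat: "0 \<le> hat x" "hat x \<le> 1" "hat (real i - real j) = (if i = j then 1 else 0)" for x i j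
    by (auto simp: hat_def)
  have ch: "continuous_on A hat" for A unfolding hat_def by (intro continuous_intros)
  define c where "c t = max (- e) (min e t)" for t :: real
  have c: "\<bar>c t\<bar> \<le> e" "\<bar>t\<bar> \<le> e \<Longrightarrow> c t = t" for t using e by (auto simp: c_def)
  have cc: "continuous_on UNIV c" unfolding c_def by (intro continuous_intros)
  define cv where "cv u t = (\<lambda>j. if j < n then u (real j, t) else 0)" for u :: "real \<times> real \<Rightarrow> real" and t
  have cvR: "cv u t \<in> Rn n" for u t by (auto simp: cv_def Rn_iff)
  define T where "T u p = (\<Sum>j<n. hat (fst p - real j) *
      (a j + c (snd p) * integral {0..1} (\<lambda>\<tau>. F j (cv u (\<tau> * c (snd p))))))"
    for u and p :: "real \<times> real"
  have T_at: "T u (real i, t) = a i + c t * integral {0..1} (\<lambda>\<tau>. F i (cv u (\<tau> * c t)))" if "i < n" for u i t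
    using that by (simp add: T_def hat(3) if_distrib[of "\<lambda>x. x * _"] cong: if_cong)
  have cont_F: "continuous_on UNIV (\<lambda>t. F j (cv u t))" if j: "j < n" and u: "continuous_on UNIV u" for j u
  proof (rule continuous_on_compose2[OF cF[OF j]])
    show "continuous_on UNIV (cv u)"
    proof (rule continuous_on_Rn_map[where m = n])
      fix i assume "i < n"
      have "continuous_on UNIV (\<lambda>t. u (real i, t))"
        by (rule continuous_on_compose2[OF u]) (auto intro!: continuous_intros)
      then show "continuous_on UNIV (\<lambda>t. cv u t i)" using \<open>i < n\<close> by (simp add: cv_def)
    qed (rule cvR)
  qed (use cvR in auto)
  have cont_int: "(\<lambda>\<tau>. F j (cv u (\<tau> * s))) integrable_on {0..1}" if "j < n" "continuous_on UNIV u" for j u s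
    by (intro integrable_continuous_real continuous_on_compose2[OF cont_F[OF that]])
      (auto intro!: continuous_intros)
  have bound_int: "\<bar>integral {0..1} h\<bar> \<le> B"
    if "h integrable_on {0..1}" "\<And>\<tau>. \<bar>h \<tau>\<bar> \<le> B" for h :: "real \<Rightarrow> real" and B
  proof -
    have "norm (integral {0..1} h) \<le> integral {0..1} (\<lambda>_::real. B)"
      by (rule integral_norm_bound_integral) (use that in auto)
    then show ?thesis by simp
  qed
  have cont_T: "continuous_on UNIV (T u)" if u: "continuous_on UNIV u" for u
  proof -
    have "continuous_on UNIV (\<lambda>p. integral {0..1} (\<lambda>\<tau>. F j (cv u (\<tau> * c (snd p)))))" if j: "j < n" for j
    proof -
      have "continuous_on (UNIV \<times> cbox 0 1) (\<lambda>p. F j (cv u (snd p * c (fst p))))"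
        by (rule continuous_on_compose2[OF cont_F[OF j u]])
          (auto intro!: continuous_intros continuous_on_compose2[OF cc])
      then have "continuous_on (UNIV \<times> cbox 0 1) (\<lambda>(t, \<tau>). F j (cv u (\<tau> * c t)))"
        by (simp add: case_prod_unfold)
      from integral_continuous_on_param[OF this]
      have "continuous_on UNIV (\<lambda>t. integral {0..1} (\<lambda>\<tau>. F j (cv u (\<tau> * c t))))" by simp
      then show ?thesis by (rule continuous_on_compose2) (auto intro: continuous_on_snd continuous_on_id)
    qed
    moreover have "continuous_on UNIV (\<lambda>p. c (snd p))"
      by (rule continuous_on_compose2[OF cc]) (auto intro: continuous_on_snd continuous_on_id)
    moreover have "continuous_on UNIV (\<lambda>p. hat (fst p - real j))" for j
      by (rule continuous_on_compose2[OF ch[of UNIV]]) (auto intro!: continuous_intros)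
    ultimately show ?thesis unfolding T_def
      by (intro continuous_on_sum continuous_on_mult continuous_on_add continuous_on_const) auto
  qed
  have bound_T: "\<bar>T u p\<bar> \<le> (\<Sum>j<n. \<bar>a j\<bar> + e * \<bar>M\<bar>)" if u: "continuous_on UNIV u" for u p
    unfolding T_def
  proof (rule order_trans[OF sum_abs sum_mono])
    fix j assume "j \<in> {..<n}"
    then have j: "j < n" by simp
    let ?I = "integral {0..1} (\<lambda>\<tau>. F j (cv u (\<tau> * c (snd p))))"
    have "\<bar>?I\<bar> \<le> \<bar>M\<bar>"
      using M[OF j cvR] by (intro bound_int cont_int[OF j u]) (meson abs_ge_self order_trans)
    then have "\<bar>c (snd p) * ?I\<bar> \<le> e * \<bar>M\<bar>"
      unfolding abs_mult using c(1) e(1) by (intro mult_mono) auto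
    then have "\<bar>a j + c (snd p) * ?I\<bar> \<le> \<bar>a j\<bar> + e * \<bar>M\<bar>" by linarith
    then have "hat (fst p - real j) * \<bar>a j + c (snd p) * ?I\<bar> \<le> 1 * (\<bar>a j\<bar> + e * \<bar>M\<bar>)"
      using hat by (intro mult_mono) auto
    then show "\<bar>hat (fst p - real j) * (a j + c (snd p) * ?I)\<bar> \<le> \<bar>a j\<bar> + e * \<bar>M\<bar>"
      using hat(1) by (simp add: abs_mult)
  qed
  define TT where "TT u = Bcontfun (T (apply_bcontfun u))" for u :: "(real \<times> real) \<Rightarrow>\<^sub>C real"
  have app: "apply_bcontfun (TT u) = T (apply_bcontfun u)" for u
  proof -
    have cu: "continuous_on UNIV (apply_bcontfun u)" by simp
    have "T (apply_bcontfun u) \<in> bcontfun"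
      unfolding bcontfun_def using cont_T[OF cu] bound_T[OF cu] by (auto simp: bounded_iff)
    then show ?thesis unfolding TT_def by (rule Bcontfun_inverse)
  qed
  have "\<exists>!u. TT u = u"
  proof (rule banach_fix_type[where c = "1/2"])
    show "\<forall>u v. dist (TT u) (TT v) \<le> 1 / 2 * dist u v"
    proof (intro allI)
      fix u v :: "(real \<times> real) \<Rightarrow>\<^sub>C real"
      have cu: "continuous_on UNIV (apply_bcontfun u)" "continuous_on UNIV (apply_bcontfun v)" by auto
      show "dist (TT u) (TT v) \<le> 1 / 2 * dist u v"
      proof (rule dist_bound)
        fix p
        show "dist (apply_bcontfun (TT u) p) (apply_bcontfun (TT v) p) \<le> 1 / 2 * dist u v"
        proof -
          have uv: "\<bar>cv (apply_bcontfun u) t i - cv (apply_bcontfun v) t i\<bar> \<le> dist u v" for t i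
            using dist_bounded[of u "(real i, t)" v] by (simp add: cv_def dist_real_def)
          let ?f = "\<lambda>u j \<tau>. F j (cv (apply_bcontfun u) (\<tau> * c (snd p)))"
          have "dist (apply_bcontfun (TT u) p) (apply_bcontfun (TT v) p) =
              \<bar>\<Sum>j<n. hat (fst p - real j) * (c (snd p) * (integral {0..1} (?f u j) - integral {0..1} (?f v j)))\<bar>"
            unfolding app T_def dist_real_def sum_subtractf[symmetric]
            by (simp add: algebra_simps)
          also have "\<dots> \<le> (\<Sum>j<n. e * (L * dist u v))"
          proof (rule order_trans[OF sum_abs sum_mono])
            fix j assume "j \<in> {..<n}"
            then have j: "j < n" by simp
            have "\<bar>integral {0..1} (\<lambda>\<tau>. ?f u j \<tau> - ?f v j \<tau>)\<bar> \<le> L * dist u v"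
              using L(2)[OF j cvR cvR uv] cu
              by (intro bound_int integrable_diff cont_int[OF j]) auto
            then have "\<bar>integral {0..1} (?f u j) - integral {0..1} (?f v j)\<bar> \<le> L * dist u v"
              using integral_diff[OF cont_int[OF j cu(1)] cont_int[OF j cu(2)]] by simp
            then have "\<bar>c (snd p)\<bar> * \<bar>integral {0..1} (?f u j) - integral {0..1} (?f v j)\<bar> \<le> e * (L * dist u v)"
              using c(1) e(1) by (intro mult_mono) auto
            then have "hat (fst p - real j) * (\<bar>c (snd p)\<bar> * \<bar>integral {0..1} (?f u j) - integral {0..1} (?f v j)\<bar>)
                \<le> 1 * (e * (L * dist u v))"
              by (intro mult_mono[OF hat(2)]) (use hat(1) in auto)
            then show "\<bar>hat (fst p - real j) * (c (snd p) * (integral {0..1} (?f u j) - integral {0..1} (?f v j)))\<bar>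
                \<le> e * (L * dist u v)"
              using hat(1) by (simp add: abs_mult)
          qed
          also have "\<dots> = e * (real n * L) * dist u v" by simp
          also have "\<dots> \<le> 1 / 2 * dist u v" using e(2) by (intro mult_right_mono) auto
          finally show ?thesis .
        qed
      qed
    qed
  qed auto
  then obtain u where u: "TT u = u" by blast
  have cu: "continuous_on UNIV (apply_bcontfun u)" by simp
  have fix_eq: "apply_bcontfun u p = T (apply_bcontfun u) p" for p using u app by metis
  define y where "y = cv (apply_bcontfun u)"
  have yR: "y t \<in> Rn n" for t unfolding y_def by (rule cvR)
  show thesis
  proof (rule that[OF e(1), of y])
    show "y t \<in> Rn n" for t by (rule yR)
    have "c 0 = 0" using c(2)[of 0] e(1) by simp
    then have "y 0 j = a j" for j
      using a by (cases "j < n") (auto simp: y_def cv_def fix_eq[of "(real j, 0)"] T_at Rn_iff)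
    then show "y 0 = a" by auto
    fix j t assume j: "j < n" and t: "\<bar>t\<bar> < e"
    define H where "H s = integral {- e..s} (\<lambda>r. F j (y r))" for s
    have cFy: "continuous_on A (\<lambda>r. F j (y r))" for A
      unfolding y_def by (rule continuous_on_subset[OF cont_F[OF j cu]]) simp
    have H: "(H has_real_derivative F j (y s)) (at s within {-e..e})" if "\<bar>s\<bar> \<le> e" for s
      unfolding H_def by (rule integral_has_real_derivative[OF cFy]) (use that in auto)
    have yH: "y s j = a j + (H s - H 0)" if s: "\<bar>s\<bar> \<le> e" for s
    proof -
      have "((\<lambda>\<tau>. H (\<tau> * s)) has_real_derivative F j (y (\<tau> * s)) * s) (at \<tau> within {0..1})"
        if "\<tau> \<in> {0..1}" for \<tau>
      proof -
        have "\<bar>\<tau> * s\<bar> \<le> e" if "\<tau> \<in> {0..1}" for \<tau>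
          using mult_mono[of "\<bar>\<tau>\<bar>" 1 "\<bar>s\<bar>" e] s that by (simp add: abs_mult)
        note le = this
        have "\<tau>' * s \<in> {-e..e}" if "\<tau>' \<in> {0..1}" for \<tau>'
          using le[OF that] unfolding abs_le_iff by simp
        then have im: "(\<lambda>\<tau>. \<tau> * s) ` {0..1} \<subseteq> {-e..e}" and ts: "\<bar>\<tau> * s\<bar> \<le> e"
          using that le by auto
        have "(H has_real_derivative F j (y (\<tau> * s))) (at (\<tau> * s) within (\<lambda>\<tau>. \<tau> * s) ` {0..1})"
          by (rule DERIV_subset[OF H[OF ts] im])
        moreover have "((\<lambda>\<tau>. \<tau> * s) has_real_derivative s) (at \<tau> within {0..1})"
          by (auto intro!: derivative_eq_intros)
        ultimately show ?thesis using DERIV_image_chain[of H _ "\<lambda>\<tau>. \<tau> * s" \<tau> "{0..1}" s] by (simp add: o_def)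
      qed
      then have "((\<lambda>\<tau>. F j (y (\<tau> * s)) * s) has_integral H (1 * s) - H (0 * s)) {0..1}"
        by (intro fundamental_theorem_of_calculus)
          (auto simp: has_real_derivative_iff_has_vector_derivative[symmetric])
      from integral_unique[OF this] have "s * integral {0..1} (\<lambda>\<tau>. F j (y (\<tau> * s))) = H s - H 0"
        by (simp add: mult.commute)
      moreover have "y s j = T (apply_bcontfun u) (real j, s)"
        using j by (simp add: y_def cv_def flip: fix_eq)
      ultimately show ?thesis using c(2)[OF s] by (simp add: T_at[OF j] y_def)
    qed
    have "((\<lambda>s. a j + (H s - H 0)) has_real_derivative F j (y t)) (at t within {-e..e})"
      using H[of t] t by (auto intro!: derivative_eq_intros)
    moreover have "at t within {-e..e} = at t"
      using t by (intro at_within_interior) (auto simp: abs_less_iff)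
    ultimately have "((\<lambda>s. a j + (H s - H 0)) has_real_derivative F j (y t)) (at t)" by simp
    then show "((\<lambda>s. y s j) has_real_derivative F j (y t)) (at t)"
      by (rule has_field_derivative_transform_within_open[where S = "{-e<..<e}"])
        (use t yH in \<open>auto simp: abs_less_iff\<close>)
  qed
qed

section \<open>Vector fields and integral curves\<close>

lemma DERIV_tendsto_nhds: "(g has_real_derivative D) (at t) \<Longrightarrow> (g \<longlongrightarrow> g t) (nhds t)"
  using DERIV_isCont[of g D t] tendsto_at_iff_tendsto_nhds[of g t] by (simp add: isCont_def)

context manifold
begin

lemma CinfI:
  "(\<And>U \<phi>. (U, \<phi>) \<in> charts N \<Longrightarrow> smooth_fun dm (\<phi> ` U) (\<lambda>x. f (inv_into U \<phi> x))) \<Longrightarrow>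
   (\<And>p. p \<notin> topspace (mtop N) \<Longrightarrow> f p = 0) \<Longrightarrow> f \<in> Cinf N"
  unfolding Cinf_def smooth_real_def by auto

lemma Cinf_outside: "f \<in> Cinf N \<Longrightarrow> p \<notin> topspace (mtop N) \<Longrightarrow> f p = 0"
  unfolding Cinf_def by blast

lemma Cinf_add: "f \<in> Cinf N \<Longrightarrow> g \<in> Cinf N \<Longrightarrow> (\<lambda>p. f p + g p) \<in> Cinf N"
  by (rule CinfI) (auto intro: smooth_fun_add Cinf_chart simp: Cinf_outside)

lemma Cinf_mult: "f \<in> Cinf N \<Longrightarrow> g \<in> Cinf N \<Longrightarrow> (\<lambda>p. f p * g p) \<in> Cinf N"
  by (rule CinfI) (auto intro: smooth_fun_mult Cinf_chart simp: Cinf_outside)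

lemma Cinf_scale: "f \<in> Cinf N \<Longrightarrow> (\<lambda>p. c * f p) \<in> Cinf N"
  by (rule CinfI) (auto intro: smooth_fun_mult smooth_fun_const Cinf_chart simp: Cinf_outside)

lemma Cinf_zero: "(\<lambda>p. 0) \<in> Cinf N"
  by (rule CinfI) (auto intro: smooth_fun_const)

lemma Cinf_sum: "(\<And>a. a \<in> A \<Longrightarrow> f a \<in> Cinf N) \<Longrightarrow> (\<lambda>p. \<Sum>a\<in>A. f a p) \<in> Cinf N"
  by (induction A rule: infinite_finite_induct) (auto intro: Cinf_zero Cinf_add)

lemma vf_Cinf: "X \<in> vector_fields N \<Longrightarrow> f \<in> Cinf N \<Longrightarrow> X f \<in> Cinf N"
  and vf_add_fun: "X \<in> vector_fields N \<Longrightarrow> f \<in> Cinf N \<Longrightarrow> g \<in> Cinf N \<Longrightarrow>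
    X (\<lambda>p. f p + g p) = (\<lambda>p. X f p + X g p)"
  and vf_scale_fun: "X \<in> vector_fields N \<Longrightarrow> f \<in> Cinf N \<Longrightarrow> X (\<lambda>p. c * f p) = (\<lambda>p. c * X f p)"
  and vf_mult_fun: "X \<in> vector_fields N \<Longrightarrow> f \<in> Cinf N \<Longrightarrow> g \<in> Cinf N \<Longrightarrow>
    X (\<lambda>p. f p * g p) = (\<lambda>p. f p * X g p + g p * X f p)"
  unfolding vector_fields_def by blast+

lemma vf_zero_fun: "X \<in> vector_fields N \<Longrightarrow> X (\<lambda>p. 0) = (\<lambda>p. 0)"
  using vf_scale_fun[of X "\<lambda>p. 0" 0] Cinf_zero by simp

lemma vf_sum_fun:
  assumes X: "X \<in> vector_fields N"
  shows "(\<And>a. a \<in> A \<Longrightarrow> f a \<in> Cinf N) \<Longrightarrow> X (\<lambda>p. \<Sum>a\<in>A. f a p) = (\<lambda>p. \<Sum>a\<in>A. X (f a) p)"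
proof (induction A rule: infinite_finite_induct)
  case (insert a A)
  then have "X (\<lambda>p. f a p + (\<Sum>a\<in>A. f a p)) = (\<lambda>p. X (f a) p + X (\<lambda>p. \<Sum>a\<in>A. f a p) p)"
    by (intro vf_add_fun[OF X] Cinf_sum) auto
  then show ?case using insert by simp
qed (use vf_zero_fun[OF X] in auto)

text \<open>
  A derivation applied to the product of \<open>f - g\<close> with a bump function at \<open>p\<close> supported in \<open>Q\<close>,
  which is the zero function, gives the locality.
\<close>

lemma vf_local:
  assumes X: "X \<in> vector_fields N" and fg: "f \<in> Cinf N" "g \<in> Cinf N"
    and Q: "openin (mtop N) Q" "p \<in> Q" "\<And>q. q \<in> Q \<Longrightarrow> f q = g q"
  shows "X f p = X g p"
proof -
  obtain bmp where bmp: "bmp \<in> Cinf N" "bmp p = 1" "\<And>q. q \<notin> Q \<Longrightarrow> bmp q = 0"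
    using bump_function[OF Q(1,2)] by blast
  let ?h = "\<lambda>p. f p + (- 1) * g p"
  have h: "?h \<in> Cinf N" by (intro Cinf_add Cinf_scale fg)
  have "(\<lambda>p. bmp p * ?h p) = (\<lambda>p. 0)" using bmp(3) Q(3) by (auto simp: fun_eq_iff)
  then have "(\<lambda>p. bmp p * X ?h p + ?h p * X bmp p) = (\<lambda>p. 0)"
    using vf_mult_fun[OF X bmp(1) h] vf_zero_fun[OF X] by simp
  then have "bmp p * X ?h p + ?h p * X bmp p = 0" by (rule fun_cong)
  then have "X ?h p = 0" using bmp(2) Q(2,3) by simp
  moreover have "X ?h = (\<lambda>p. X f p + X (\<lambda>p. (- 1) * g p) p)"
    by (rule vf_add_fun[OF X fg(1) Cinf_scale[OF fg(2)]])
  moreover have "X (\<lambda>p. (- 1) * g p) = (\<lambda>p. (- 1) * X g p)"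
    by (rule vf_scale_fun[OF X fg(2)])
  ultimately show ?thesis by simp
qed

lemma vf_locally_const:
  assumes X: "X \<in> vector_fields N" and f: "f \<in> Cinf N"
    and Q: "openin (mtop N) Q" "p \<in> Q" "\<And>q. q \<in> Q \<Longrightarrow> f q = c"
  shows "X f p = 0"
proof (cases "c = 0")
  case True
  then show ?thesis using vf_local[OF X f Cinf_zero Q(1,2)] Q(3) vf_zero_fun[OF X] by simp
next
  case False
  have "X (\<lambda>p. f p * f p) p = X (\<lambda>p. c * f p) p"
    by (rule vf_local[OF X Cinf_mult[OF f f] Cinf_scale[OF f] Q(1,2)]) (simp add: Q(3))
  then have "f p * X f p + f p * X f p = c * X f p"
    using vf_mult_fun[OF X f f] vf_scale_fun[OF X f] by simp
  then show ?thesis using Q(2,3) False by simp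
qed

text \<open>
  Hadamard's lemma writes \<open>f\<close> near \<open>q\<close> as its value at \<open>q\<close> plus the sum of the products of
  \<open>\<phi> p j - \<phi> q j\<close> with smooth functions whose values at \<open>q\<close> are the partial derivatives. Only
  these values survive, as the first factors vanish at \<open>q\<close>.
\<close>

lemma vf_chart_formula:
  assumes X: "X \<in> vector_fields N" and ch: "(U, \<phi>) \<in> charts N" and q: "q \<in> U"
    and c: "\<And>j. j < dm \<Longrightarrow> c j \<in> Cinf N"
    and Q: "openin (mtop N) Q" "q \<in> Q" "\<And>p j. p \<in> Q \<Longrightarrow> j < dm \<Longrightarrow> c j p = \<phi> p j"
    and f: "f \<in> Cinf N"
  shows "X f q = (\<Sum>j<dm. pd j (\<lambda>x. f (inv_into U \<phi> x)) (\<phi> q) * X (c j) q)"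
proof -
  define b where "b = \<phi> q"
  define fh where "fh = (\<lambda>x. f (inv_into U \<phi> x))"
  let ?W = "\<phi> ` U"
  have W: "open_Rn dm ?W" by (rule chart_image_open[OF ch])
  have bW: "b \<in> ?W" "b \<in> Rn dm" using q open_Rn_subset[OF W] by (auto simp: b_def)
  obtain e where e: "e > 0" "{y \<in> Rn dm. \<forall>i<dm. \<bar>y i - b i\<bar> \<le> 2 * e} \<subseteq> ?W"
    using open_Rn_closed_box[OF W bW(1)] by blast
  have fh: "smooth_fun dm ?W fh" unfolding fh_def by (rule Cinf_chart[OF f ch])
  define ft where "ft = cut_ext dm ?W e b fh"
  have ft: "smooth_fun dm (Rn dm) ft" unfolding ft_def by (rule smooth_cut_ext[OF W e fh])
  obtain g where g: "\<And>j. j < dm \<Longrightarrow> smooth_fun dm (Rn dm) (g j)"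
    "\<And>y. y \<in> Rn dm \<Longrightarrow> ft y = ft b + (\<Sum>j<dm. (y j - b j) * g j y)"
    using hadamard_n[OF ft bW(2)] by blast
  let ?B = "{y \<in> Rn dm. \<forall>i<dm. \<bar>y i - b i\<bar> < e}"
  have ftB: "ft y = fh y" if "y \<in> ?B" for y
    unfolding ft_def by (rule cut_ext_inside[OF e(1)]) (use that e in \<open>force+\<close>)
  have bB: "b \<in> ?B" using bW e by auto
  have gb: "g j b = pd j fh b" if j: "j < dm" for j
  proof -
    have "((\<lambda>s. fh (b(j := s))) has_real_derivative g j b) (at (b j))"
    proof (rule has_derivative_transform_upd[OF open_Rn_Collect_abs_less bB j])
      show "ft y = fh y" if "y \<in> ?B" for y by (rule ftB[OF that])
      have "continuous_on (Rn dm) (g j)" by (rule smooth_fun_continuous_on[OF g(1)[OF j]])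
      have d: "((\<lambda>s. g j (b(j := s))) has_real_derivative pd j (g j) b) (at (b j))"
        by (rule smooth_fun_pd(2)[OF _ g(1)[OF j] j bW(2)]) simp
      have "ft (b(j := s)) = ft b + (s - b j) * g j (b(j := s))" for s
      proof -
        have "(\<Sum>i<dm. ((b(j := s)) i - b i) * g i (b(j := s))) = (\<Sum>i<dm. if i = j then (s - b j) * g j (b(j := s)) else 0)"
          by (intro sum.cong) auto
        then show ?thesis using g(2)[OF Rn_upd[OF bW(2) j]] j by simp
      qed
      moreover have "((\<lambda>s. ft b + (s - b j) * g j (b(j := s))) has_real_derivative g j b) (at (b j))"
        using d by (auto intro!: derivative_eq_intros simp del: fun_upd_apply)
      ultimately show "((\<lambda>s. ft (b(j := s))) has_real_derivative g j b) (at (b j))" by simp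
    qed
    then show ?thesis using pd_eqI by metis
  qed
  define one where "one = chart_ext U \<phi> e b (\<lambda>_. 1)"
  define G where "G j = chart_ext U \<phi> e b (g j)" for j
  define k where "k j = (\<lambda>p. c j p + (- b j) * one p)" for j
  have one: "one \<in> Cinf N" unfolding one_def by (rule chart_ext_Cinf[OF ch e smooth_fun_const])
  have G: "G j \<in> Cinf N" if "j < dm" for j
    unfolding G_def using smooth_fun_subset[OF g(1)[OF that] open_Rn_subset[OF W]]
    by (rule chart_ext_Cinf[OF ch e])
  have k: "k j \<in> Cinf N" if "j < dm" for j
    unfolding k_def by (intro Cinf_add Cinf_scale one c that)
  define A where "A = {p \<in> U. \<phi> p \<in> ?B} \<inter> Q"
  have A: "openin (mtop N) A" "q \<in> A"
    unfolding A_def using chart_preimage_open[OF ch open_Rn_Collect_abs_less] Q q bB by (auto simp: b_def)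
  have inA: "one p = 1" "\<And>j. G j p = g j (\<phi> p)" "\<phi> p \<in> ?B" "p \<in> U" "p \<in> Q" if "p \<in> A" for p
  proof -
    have p: "p \<in> U" "\<phi> p \<in> ?B" "p \<in> Q" using that by (auto simp: A_def)
    then have le: "\<And>i. i < dm \<Longrightarrow> \<bar>\<phi> p i - b i\<bar> \<le> e" by (simp add: less_imp_le)
    show "one p = 1" unfolding one_def by (rule chart_ext_eq[OF p(1) e(1)]) (rule le)
    show "G j p = g j (\<phi> p)" for j unfolding G_def by (rule chart_ext_eq[OF p(1) e(1)]) (rule le)
  qed (use that in \<open>auto simp: A_def\<close>)
  have Xone: "X one q = 0" by (rule vf_locally_const[OF X one A, where c = 1]) (use inA in auto)
  have Xk: "X (k j) q = X (c j) q" if "j < dm" for j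
  proof -
    have "X (k j) = (\<lambda>p. X (c j) p + X (\<lambda>p. (- b j) * one p) p)"
      unfolding k_def by (rule vf_add_fun[OF X c[OF that] Cinf_scale[OF one]])
    moreover have "X (\<lambda>p. (- b j) * one p) = (\<lambda>p. (- b j) * X one p)" by (rule vf_scale_fun[OF X one])
    ultimately show ?thesis using Xone by simp
  qed
  have kq: "k j q = 0" if "j < dm" for j
    unfolding k_def using inA(1)[OF A(2)] Q that by (simp add: b_def)
  have kG: "(\<lambda>p. k j p * G j p) \<in> Cinf N" if "j < dm" for j
    by (intro Cinf_mult k G that)
  have "X f q = X (\<lambda>p. f q * one p + (\<Sum>j<dm. k j p * G j p)) q"
  proof (rule vf_local[OF X f _ A])
    show "(\<lambda>p. f q * one p + (\<Sum>j<dm. k j p * G j p)) \<in> Cinf N"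
      by (intro Cinf_add Cinf_scale one Cinf_sum) (simp add: kG)
    fix p assume p: "p \<in> A"
    have "f p = fh (\<phi> p)" using inA(4)[OF p] ch by (simp add: fh_def)
    also have "\<dots> = ft (\<phi> p)" using ftB inA(3)[OF p] by simp
    also have "\<dots> = ft b + (\<Sum>j<dm. (\<phi> p j - b j) * g j (\<phi> p))"
      using g(2) inA(3)[OF p] by blast
    also have "ft b = f q" using ftB[OF bB] q ch by (simp add: fh_def b_def)
    also have "(\<Sum>j<dm. (\<phi> p j - b j) * g j (\<phi> p)) = (\<Sum>j<dm. k j p * G j p)"
      using inA[OF p] Q(3) by (intro sum.cong) (auto simp: k_def)
    finally show "f p = f q * one p + (\<Sum>j<dm. k j p * G j p)" using inA(1)[OF p] by simp
  qed
  also have "\<dots> = f q * X one q + (\<Sum>j<dm. X (\<lambda>p. k j p * G j p) q)"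
    using vf_add_fun[OF X Cinf_scale[OF one] Cinf_sum[of "{..<dm}" "\<lambda>j p. k j p * G j p"]]
      vf_scale_fun[OF X one] vf_sum_fun[OF X, of "{..<dm}" "\<lambda>j p. k j p * G j p"] kG by simp
  also have "\<dots> = (\<Sum>j<dm. pd j fh b * X (c j) q)"
    using Xone by (simp add: vf_mult_fun[OF X k G] kq Xk inA(2)[OF A(2)] gb flip: b_def)
  finally show ?thesis unfolding fh_def b_def .
qed

text \<open>
  The set of times allows for local solutions and for glueing them; outside \<open>I\<close> the curve is arbitrary.
\<close>

definition icurve :: "'m vfield \<Rightarrow> real set \<Rightarrow> (real \<Rightarrow> 'm) \<Rightarrow> bool" where
  "icurve X I \<gamma> \<longleftrightarrow> (\<forall>t\<in>I. \<gamma> t \<in> topspace (mtop N) \<and>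
     (\<forall>f\<in>Cinf N. ((\<lambda>s. f (\<gamma> s)) has_real_derivative X f (\<gamma> t)) (at t)))"

lemma integral_curve_iff: "integral_curve N X \<gamma> \<longleftrightarrow> icurve X UNIV \<gamma>"
  unfolding integral_curve_def icurve_def by auto

lemma icurve_eventually:
  assumes \<gamma>: "icurve X I \<gamma>" and t: "t \<in> I" and Q: "openin (mtop N) Q" "\<gamma> t \<in> Q"
  shows "eventually (\<lambda>s. \<gamma> s \<in> Q) (nhds t)"
proof -
  obtain f where f: "f \<in> Cinf N" "f (\<gamma> t) = 1" "\<And>q. q \<notin> Q \<Longrightarrow> f q = 0"
    using bump_function[OF Q] by blast
  have "((\<lambda>s. f (\<gamma> s)) has_real_derivative X f (\<gamma> t)) (at t)" using \<gamma> t f(1) unfolding icurve_def by blast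
  from DERIV_tendsto_nhds[OF this] have "((\<lambda>s. f (\<gamma> s)) \<longlongrightarrow> 1) (nhds t)" using f(2) by simp
  then have "eventually (\<lambda>s. 0 < f (\<gamma> s)) (nhds t)" by (rule order_tendstoD) simp
  then show ?thesis by eventually_elim (use f(3) in force)
qed

text \<open>
  Cutting off the coefficients in a chart provides the global bounds and Lipschitz estimates that
  the existence and uniqueness theorems for differential equations ask for.
\<close>

lemma vf_in_chart:
  assumes X: "X \<in> vector_fields N" and p: "p \<in> topspace (mtop N)"
  obtains U \<phi> e F M L where "(U, \<phi>) \<in> charts N" "p \<in> U" "e > 0"
    "{y \<in> Rn dm. \<forall>i<dm. \<bar>y i - \<phi> p i\<bar> < e} \<subseteq> \<phi> ` U"
    "\<And>j. continuous_on (Rn dm) (F j)"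
    "\<And>j y. j < dm \<Longrightarrow> y \<in> Rn dm \<Longrightarrow> \<bar>F j y\<bar> \<le> M"
    "L \<ge> 0" "\<And>j y z K. j < dm \<Longrightarrow> y \<in> Rn dm \<Longrightarrow> z \<in> Rn dm \<Longrightarrow>
      (\<forall>i<dm. \<bar>y i - z i\<bar> \<le> K) \<Longrightarrow> \<bar>F j y - F j z\<bar> \<le> L * K"
    "\<And>f q. f \<in> Cinf N \<Longrightarrow> q \<in> U \<Longrightarrow> (\<forall>i<dm. \<bar>\<phi> q i - \<phi> p i\<bar> < e) \<Longrightarrow>
      X f q = (\<Sum>j<dm. pd j (\<lambda>x. f (inv_into U \<phi> x)) (\<phi> q) * F j (\<phi> q))"
    "\<And>I \<gamma> j t. icurve X I \<gamma> \<Longrightarrow> t \<in> I \<Longrightarrow> j < dm \<Longrightarrow> \<gamma> t \<in> U \<Longrightarrow> (\<forall>i<dm. \<bar>\<phi> (\<gamma> t) i - \<phi> p i\<bar> < e) \<Longrightarrow>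
      ((\<lambda>s. \<phi> (\<gamma> s) j) has_real_derivative F j (\<phi> (\<gamma> t))) (at t)"
proof -
  obtain U \<phi> where ch: "(U, \<phi>) \<in> charts N" and pU: "p \<in> U" using p by (rule chart_at)
  let ?W = "\<phi> ` U"
  have W: "open_Rn dm ?W" by (rule chart_image_open[OF ch])
  define a where "a = \<phi> p"
  obtain e where e: "e > 0" "{y \<in> Rn dm. \<forall>i<dm. \<bar>y i - a i\<bar> \<le> 2 * e} \<subseteq> ?W"
    using open_Rn_closed_box[OF W] pU a_def by blast
  define c where "c j = chart_ext U \<phi> e a (\<lambda>y. y j)" for j
  have c: "c j \<in> Cinf N" for j unfolding c_def by (rule chart_ext_Cinf[OF ch e smooth_fun_coord])
  let ?B = "{y \<in> Rn dm. \<forall>i<dm. \<bar>y i - a i\<bar> < e}"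
  define Q where "Q = {q \<in> U. \<phi> q \<in> ?B}"
  have Q: "openin (mtop N) Q" unfolding Q_def by (rule chart_preimage_open[OF ch open_Rn_Collect_abs_less])
  have QI: "q \<in> Q" if "q \<in> U" "\<forall>i<dm. \<bar>\<phi> q i - a i\<bar> < e" for q
    using that open_Rn_subset[OF W] by (auto simp: Q_def)
  have cQ: "c j q = \<phi> q j" if "q \<in> Q" for q j
    unfolding c_def by (rule chart_ext_eq) (use that e in \<open>auto simp: Q_def intro: less_imp_le\<close>)
  define F where "F j = cut_ext dm ?W e a (\<lambda>y. X (c j) (inv_into U \<phi> y))" for j
  have F: "smooth_fun dm (Rn dm) (F j)" for j
    unfolding F_def by (rule smooth_cut_ext[OF W e Cinf_chart[OF vf_Cinf[OF X c] ch]])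
  have Fz: "F j y = 0" if "\<exists>i<dm. 2 * e < \<bar>y i - a i\<bar>" for j y
    unfolding F_def using that cut_ext_outside[OF e(1)] by force
  have FQ: "F j (\<phi> q) = X (c j) q" if "q \<in> Q" for j q
  proof -
    have "F j (\<phi> q) = X (c j) (inv_into U \<phi> (\<phi> q))"
      unfolding F_def by (rule cut_ext_inside[OF e(1)]) (use that in \<open>auto simp: Q_def intro: less_imp_le\<close>)
    then show ?thesis using that ch by (simp add: Q_def)
  qed
  have "\<exists>B\<ge>0. \<forall>y\<in>Rn dm. \<bar>F j y\<bar> \<le> B" for j
    by (rule smooth_bounded_of_support[OF F[of j] Fz[of _ j]]) auto
  then obtain Mf where Mf: "\<And>j. Mf j \<ge> 0" "\<And>j y. y \<in> Rn dm \<Longrightarrow> \<bar>F j y\<bar> \<le> Mf j" by metis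
  have "\<exists>L\<ge>0. \<forall>y\<in>Rn dm. \<forall>z\<in>Rn dm. \<forall>K. (\<forall>i<dm. \<bar>y i - z i\<bar> \<le> K) \<longrightarrow> \<bar>F j y - F j z\<bar> \<le> L * K" for j
  proof (rule smooth_lipschitz_of_support[OF F[of j] Fz[of _ j]])
    fix L :: real
    assume "L \<ge> 0" "\<And>y z K. y \<in> Rn dm \<Longrightarrow> z \<in> Rn dm \<Longrightarrow> (\<And>i. i < dm \<Longrightarrow> \<bar>y i - z i\<bar> \<le> K) \<Longrightarrow> \<bar>F j y - F j z\<bar> \<le> L * K"
    then show ?thesis by (intro exI[of _ L]) auto
  qed
  then obtain Lf where Lf: "\<And>j. Lf j \<ge> 0" "\<And>j y z K. y \<in> Rn dm \<Longrightarrow> z \<in> Rn dm \<Longrightarrow>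
      (\<forall>i<dm. \<bar>y i - z i\<bar> \<le> K) \<Longrightarrow> \<bar>F j y - F j z\<bar> \<le> Lf j * K" by metis
  show thesis
  proof (rule that[of U \<phi> e F "\<Sum>j<dm. Mf j" "\<Sum>j<dm. Lf j"])
    show "(U, \<phi>) \<in> charts N" "p \<in> U" "e > 0" by (fact ch pU e(1))+
    show "{y \<in> Rn dm. \<forall>i<dm. \<bar>y i - \<phi> p i\<bar> < e} \<subseteq> \<phi> ` U"
      using e unfolding a_def by force
    show "continuous_on (Rn dm) (F j)" for j by (rule smooth_fun_continuous_on[OF F])
    show "0 \<le> (\<Sum>j<dm. Lf j)" using Lf(1) by (simp add: sum_nonneg)
    show "\<bar>F j y\<bar> \<le> sum Mf {..<dm}" if "j < dm" "y \<in> Rn dm" for j y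
    proof (rule order_trans[OF Mf(2)[OF that(2)]])
      show "Mf j \<le> sum Mf {..<dm}" using that(1) Mf(1) by (intro member_le_sum) auto
    qed
    show "\<bar>F j y - F j z\<bar> \<le> sum Lf {..<dm} * K"
      if "j < dm" "y \<in> Rn dm" "z \<in> Rn dm" "\<forall>i<dm. \<bar>y i - z i\<bar> \<le> K" for j y z K
    proof -
      have "\<bar>y j - z j\<bar> \<le> K" using that by blast
      then have "0 \<le> K" by linarith
      moreover have "Lf j \<le> sum Lf {..<dm}" using that(1) Lf(1) by (intro member_le_sum) auto
      ultimately have "Lf j * K \<le> sum Lf {..<dm} * K" by (rule mult_right_mono[rotated])
      moreover have "\<bar>F j y - F j z\<bar> \<le> Lf j * K" using Lf(2)[OF that(2,3)] that(4) by blast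
      ultimately show ?thesis by linarith
    qed
    show "X f q = (\<Sum>j<dm. pd j (\<lambda>x. f (inv_into U \<phi> x)) (\<phi> q) * F j (\<phi> q))"
      if "f \<in> Cinf N" "q \<in> U" "\<forall>i<dm. \<bar>\<phi> q i - \<phi> p i\<bar> < e" for f q
    proof -
      have q: "q \<in> Q" using QI[OF that(2)] that(3) by (simp add: a_def)
      show ?thesis unfolding FQ[OF q]
        by (rule vf_chart_formula[OF X ch that(2) c Q q _ that(1)]) (rule cQ)
    qed
    show "((\<lambda>s. \<phi> (\<gamma> s) j) has_real_derivative F j (\<phi> (\<gamma> t))) (at t)"
      if \<gamma>: "icurve X I \<gamma>" and t: "t \<in> I" and U: "\<gamma> t \<in> U" "\<forall>i<dm. \<bar>\<phi> (\<gamma> t) i - \<phi> p i\<bar> < e" for I \<gamma> j t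
    proof -
      have q: "\<gamma> t \<in> Q" using QI[OF U(1)] U(2) by (simp add: a_def)
      have "eventually (\<lambda>s. c j (\<gamma> s) = \<phi> (\<gamma> s) j) (nhds t)"
        using icurve_eventually[OF \<gamma> t Q q] by eventually_elim (rule cQ)
      then have "((\<lambda>s. c j (\<gamma> s)) has_real_derivative X (c j) (\<gamma> t)) (at t) \<longleftrightarrow>
          ((\<lambda>s. \<phi> (\<gamma> s) j) has_real_derivative X (c j) (\<gamma> t)) (at t)"
        by (rule DERIV_cong_ev[OF refl _ refl])
      moreover have "((\<lambda>s. c j (\<gamma> s)) has_real_derivative X (c j) (\<gamma> t)) (at t)"
        using \<gamma> t c unfolding icurve_def by blast
      ultimately show ?thesis by (simp add: FQ[OF q])
    qed
  qed
qed

text \<open>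
  The sum of the squared coordinate differences satisfies the hypothesis of Gronwall's lemma.
\<close>

lemma icurve_unique_local:
  assumes X: "X \<in> vector_fields N" and \<gamma>: "icurve X I \<gamma>" and \<delta>: "icurve X I \<delta>"
    and I: "open I" "t0 \<in> I" and eq: "\<gamma> t0 = \<delta> t0"
  shows "eventually (\<lambda>t. \<gamma> t = \<delta> t) (nhds t0)"
proof -
  have p: "\<gamma> t0 \<in> topspace (mtop N)" using \<gamma> I(2) unfolding icurve_def by blast
  obtain U \<phi> e F M L where *: "(U, \<phi>) \<in> charts N" "\<gamma> t0 \<in> U" "e > 0"
    and B: "{y \<in> Rn dm. \<forall>i<dm. \<bar>y i - \<phi> (\<gamma> t0) i\<bar> < e} \<subseteq> \<phi> ` U"
    and cF: "\<And>j. continuous_on (Rn dm) (F j)"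
    and M: "\<And>j y. j < dm \<Longrightarrow> y \<in> Rn dm \<Longrightarrow> \<bar>F j y\<bar> \<le> M"
    and L: "L \<ge> 0" "\<And>j y z K. j < dm \<Longrightarrow> y \<in> Rn dm \<Longrightarrow> z \<in> Rn dm \<Longrightarrow>
      (\<forall>i<dm. \<bar>y i - z i\<bar> \<le> K) \<Longrightarrow> \<bar>F j y - F j z\<bar> \<le> L * K"
    and form: "\<And>f q. f \<in> Cinf N \<Longrightarrow> q \<in> U \<Longrightarrow> (\<forall>i<dm. \<bar>\<phi> q i - \<phi> (\<gamma> t0) i\<bar> < e) \<Longrightarrow>
      X f q = (\<Sum>j<dm. pd j (\<lambda>x. f (inv_into U \<phi> x)) (\<phi> q) * F j (\<phi> q))"
    and D: "\<And>I \<gamma>' j t. icurve X I \<gamma>' \<Longrightarrow> t \<in> I \<Longrightarrow> j < dm \<Longrightarrow> \<gamma>' t \<in> U \<Longrightarrow>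
      (\<forall>i<dm. \<bar>\<phi> (\<gamma>' t) i - \<phi> (\<gamma> t0) i\<bar> < e) \<Longrightarrow>
      ((\<lambda>s. \<phi> (\<gamma>' s) j) has_real_derivative F j (\<phi> (\<gamma>' t))) (at t)"
    by (rule vf_in_chart[OF X p]) (rule that)
  let ?B = "{y \<in> Rn dm. \<forall>i<dm. \<bar>y i - \<phi> (\<gamma> t0) i\<bar> < e}"
  define Q where "Q = {q \<in> U. \<phi> q \<in> ?B}"
  have UR: "\<phi> q \<in> Rn dm" if "q \<in> U" for q
    using open_Rn_subset[OF chart_image_open[OF *(1)]] that by auto
  have Q: "openin (mtop N) Q" "\<gamma> t0 \<in> Q" "\<delta> t0 \<in> Q"
    unfolding Q_def using chart_preimage_open[OF *(1) open_Rn_Collect_abs_less] * UR eq by auto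
  have "eventually (\<lambda>t. \<gamma> t \<in> Q \<and> \<delta> t \<in> Q \<and> t \<in> I) (nhds t0)"
    by (intro eventually_conj icurve_eventually[OF \<gamma> I(2) Q(1,2)] icurve_eventually[OF \<delta> I(2) Q(1,3)]
        eventually_nhds_in_open I)
  then obtain r where r: "r > 0" "\<And>t. \<bar>t - t0\<bar> < r \<Longrightarrow> \<gamma> t \<in> Q \<and> \<delta> t \<in> Q \<and> t \<in> I"
    unfolding eventually_nhds_metric dist_real_def by blast
  define w where "w t j = \<phi> (\<gamma> t) j - \<phi> (\<delta> t) j" for t j
  define w' where "w' t j = F j (\<phi> (\<gamma> t)) - F j (\<phi> (\<delta> t))" for t j
  define u where "u t = (\<Sum>j<dm. (w t j)\<^sup>2)" for t
  have wD: "((\<lambda>t. w t j) has_real_derivative w' t j) (at t)" if "j < dm" "\<bar>t - t0\<bar> < r" for j t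
    unfolding w_def w'_def using D[OF \<gamma> _ that(1), of t] D[OF \<delta> _ that(1), of t] r(2)[OF that(2)]
    by (intro DERIV_diff) (auto simp: Q_def)
  have uD: "(u has_real_derivative (\<Sum>j<dm. 2 * w t j * w' t j)) (at t)" if "\<bar>t - t0\<bar> < r" for t
    unfolding u_def by (rule DERIV_sum) (use wD[OF _ that] in \<open>auto intro!: derivative_eq_intros\<close>)
  have wu: "\<bar>w t j\<bar> \<le> sqrt (u t)" if "j < dm" for t j
  proof -
    have "(w t j)\<^sup>2 \<le> u t" unfolding u_def using that by (intro member_le_sum) auto
    then show ?thesis by (metis real_sqrt_abs real_sqrt_le_iff)
  qed
  have u0: "0 \<le> u t" for t unfolding u_def by (intro sum_nonneg) auto
  have bound: "\<bar>\<Sum>j<dm. 2 * w t j * w' t j\<bar> \<le> (real dm * (2 * L)) * u t" if t: "\<bar>t - t0\<bar> < r" for t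
  proof -
    have "\<bar>2 * w t j * w' t j\<bar> \<le> 2 * L * u t" if j: "j < dm" for j
    proof -
      have "\<bar>w' t j\<bar> \<le> L * sqrt (u t)"
        unfolding w'_def using wu[of _ t] r(2)[OF t] UR
        by (intro L(2)[OF j]) (auto simp: Q_def w_def)
      then have "\<bar>w t j\<bar> * \<bar>w' t j\<bar> \<le> sqrt (u t) * (L * sqrt (u t))"
        using wu[OF j] u0 by (intro mult_mono) auto
      also have "\<dots> = L * u t" using u0 by (simp add: algebra_simps)
      finally show ?thesis by (simp add: abs_mult)
    qed
    then have "(\<Sum>j<dm. \<bar>2 * w t j * w' t j\<bar>) \<le> (\<Sum>j<dm. 2 * L * u t)" by (intro sum_mono) auto
    from order_trans[OF sum_abs this] show ?thesis by (simp add: mult.assoc)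
  qed
  have "u t0 = 0" using eq by (simp add: u_def w_def)
  have "\<gamma> t = \<delta> t" if t: "\<bar>t - t0\<bar> < r" for t
  proof -
    have "u t \<le> 0" by (rule gronwall_zero[OF uD bound \<open>u t0 = 0\<close> t])
    then have "\<phi> (\<gamma> t) j = \<phi> (\<delta> t) j" if "j < dm" for j
      using wu[OF that, of t] u0[of t] by (auto simp: w_def)
    moreover have "\<phi> (\<gamma> t) j = \<phi> (\<delta> t) j" if "\<not> j < dm" for j
      using r(2)[OF t] that by (auto simp: Q_def Rn_iff)
    ultimately have "\<phi> (\<gamma> t) = \<phi> (\<delta> t)" by auto
    then show ?thesis using r(2)[OF t] chart_inj[OF *(1)] by (auto simp: Q_def inj_on_def)
  qed
  then show ?thesis unfolding eventually_nhds_metric dist_real_def using r(1) by blast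
qed

text \<open>
  The set of times where the curves agree is open by local uniqueness, and it is closed because
  the curves are continuous and a manifold is a Hausdorff space.
\<close>

lemma icurve_unique:
  assumes X: "X \<in> vector_fields N" and \<gamma>: "icurve X I \<gamma>" and \<delta>: "icurve X I \<delta>"
    and I: "open I" "connected I" "t0 \<in> I" and eq: "\<gamma> t0 = \<delta> t0" and t: "t \<in> I"
  shows "\<gamma> t = \<delta> t"
proof -
  define E where "E = {t \<in> I. \<gamma> t = \<delta> t}"
  have "open E"
  proof (subst open_subopen, intro ballI)
    fix s assume "s \<in> E"
    then have "s \<in> I" "\<gamma> s = \<delta> s" by (auto simp: E_def)
    then have "eventually (\<lambda>t. \<gamma> t = \<delta> t \<and> t \<in> I) (nhds s)"
      by (intro eventually_conj icurve_unique_local[OF X \<gamma> \<delta> I(1)] eventually_nhds_in_open I)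
    then show "\<exists>T. open T \<and> s \<in> T \<and> T \<subseteq> E" unfolding eventually_nhds E_def by blast
  qed
  moreover have "open (I - E)"
  proof (subst open_subopen, intro ballI)
    fix s assume s: "s \<in> I - E"
    then have ne: "\<gamma> s \<noteq> \<delta> s" and sI: "s \<in> I" by (auto simp: E_def)
    have tp: "\<gamma> s \<in> topspace (mtop N)" "\<delta> s \<in> topspace (mtop N)"
      using \<gamma> \<delta> sI unfolding icurve_def by blast+
    then obtain Q Q' where Q: "openin (mtop N) Q" "openin (mtop N) Q'" "\<gamma> s \<in> Q" "\<delta> s \<in> Q'" "disjnt Q Q'"
    proof -
      have "Hausdorff_space (mtop N)" using mfd unfolding smooth_manifold_def by blast
      then show ?thesis using tp ne that unfolding Hausdorff_space_def by meson
    qed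
    have "eventually (\<lambda>t. \<gamma> t \<in> Q \<and> \<delta> t \<in> Q' \<and> t \<in> I) (nhds s)"
      by (intro eventually_conj icurve_eventually[OF \<gamma> sI Q(1,3)] icurve_eventually[OF \<delta> sI Q(2,4)]
          eventually_nhds_in_open I sI)
    then obtain T where "open T" "s \<in> T" "\<And>t. t \<in> T \<Longrightarrow> \<gamma> t \<in> Q \<and> \<delta> t \<in> Q' \<and> t \<in> I"
      unfolding eventually_nhds by blast
    moreover from this(3) have "T \<subseteq> I - E" using Q(5) by (force simp: E_def disjnt_iff)
    ultimately show "\<exists>T. open T \<and> s \<in> T \<and> T \<subseteq> I - E" by blast
  qed
  ultimately have "E = {} \<or> I - E = {}"
    using connectedD[OF I(2), of E "I - E"] by (auto simp: E_def)
  moreover have "t0 \<in> E" using I eq by (auto simp: E_def)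
  ultimately show ?thesis using t by (auto simp: E_def)
qed

lemma icurve_exists_local:
  assumes X: "X \<in> vector_fields N" and p: "p \<in> topspace (mtop N)"
  obtains \<gamma> r where "r > 0" "icurve X {-r<..<r} \<gamma>" "\<gamma> 0 = p"
proof -
  obtain U \<phi> e F M L where *: "(U, \<phi>) \<in> charts N" "p \<in> U" "e > 0"
    and B: "{y \<in> Rn dm. \<forall>i<dm. \<bar>y i - \<phi> (p) i\<bar> < e} \<subseteq> \<phi> ` U"
    and cF: "\<And>j. continuous_on (Rn dm) (F j)"
    and M: "\<And>j y. j < dm \<Longrightarrow> y \<in> Rn dm \<Longrightarrow> \<bar>F j y\<bar> \<le> M"
    and L: "L \<ge> 0" "\<And>j y z K. j < dm \<Longrightarrow> y \<in> Rn dm \<Longrightarrow> z \<in> Rn dm \<Longrightarrow>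
      (\<forall>i<dm. \<bar>y i - z i\<bar> \<le> K) \<Longrightarrow> \<bar>F j y - F j z\<bar> \<le> L * K"
    and form: "\<And>f q. f \<in> Cinf N \<Longrightarrow> q \<in> U \<Longrightarrow> (\<forall>i<dm. \<bar>\<phi> q i - \<phi> (p) i\<bar> < e) \<Longrightarrow>
      X f q = (\<Sum>j<dm. pd j (\<lambda>x. f (inv_into U \<phi> x)) (\<phi> q) * F j (\<phi> q))"
    and D: "\<And>I \<gamma>' j t. icurve X I \<gamma>' \<Longrightarrow> t \<in> I \<Longrightarrow> j < dm \<Longrightarrow> \<gamma>' t \<in> U \<Longrightarrow>
      (\<forall>i<dm. \<bar>\<phi> (\<gamma>' t) i - \<phi> (p) i\<bar> < e) \<Longrightarrow>
      ((\<lambda>s. \<phi> (\<gamma>' s) j) has_real_derivative F j (\<phi> (\<gamma>' t))) (at t)"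
    by (rule vf_in_chart[OF X p]) (rule that)
  have W: "open_Rn dm (\<phi> ` U)" by (rule chart_image_open[OF *(1)])
  have a: "\<phi> p \<in> Rn dm" using open_Rn_subset[OF W] *(2) by auto
  obtain r0 y where y: "r0 > 0" "y 0 = \<phi> p" "\<And>t. y t \<in> Rn dm"
    "\<And>j t. j < dm \<Longrightarrow> \<bar>t\<bar> < r0 \<Longrightarrow> ((\<lambda>s. y s j) has_real_derivative F j (y t)) (at t)"
  proof (rule picard_local[where F = F and L = L and M = M, OF a])
    show "continuous_on (Rn dm) (F j)" for j by (rule cF)
    show "L \<ge> 0" by (rule L(1))
    show "\<bar>F j y - F j z\<bar> \<le> L * K" if "j < dm" "y \<in> Rn dm" "z \<in> Rn dm" "\<And>i. i < dm \<Longrightarrow> \<bar>y i - z i\<bar> \<le> K" for j y z K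
      using L(2) that by blast
    show "\<bar>F j y\<bar> \<le> M" if "j < dm" "y \<in> Rn dm" for j y by (rule M[OF that])
  qed (rule that)
  have "eventually (\<lambda>t. \<bar>y t j - \<phi> p j\<bar> < e) (nhds 0)" if "j < dm" for j
  proof -
    have "((\<lambda>s. y s j) has_real_derivative F j (y 0)) (at 0)" using y(4)[OF that, of 0] y(1) by simp
    from DERIV_tendsto_nhds[OF this] have "((\<lambda>s. y s j) \<longlongrightarrow> \<phi> p j) (nhds 0)" using y(2) by simp
    then show ?thesis using *(3) by (simp add: tendsto_iff dist_real_def)
  qed
  then have "eventually (\<lambda>t. \<forall>j\<in>{..<dm}. \<bar>y t j - \<phi> p j\<bar> < e) (nhds 0)"
    by (subst eventually_ball_finite_distrib) auto
  then obtain r1 where r1: "r1 > 0" "\<And>t j. \<bar>t\<bar> < r1 \<Longrightarrow> j < dm \<Longrightarrow> \<bar>y t j - \<phi> p j\<bar> < e"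
    unfolding eventually_nhds_metric dist_real_def by auto
  define r where "r = min r0 r1"
  define \<gamma> where "\<gamma> t = inv_into U \<phi> (y t)" for t
  have yU: "y t \<in> \<phi> ` U" if "\<bar>t\<bar> < r" for t
    using B y(3) r1(2) that by (auto simp: r_def)
  have \<gamma>U: "\<gamma> t \<in> U" "\<phi> (\<gamma> t) = y t" if "\<bar>t\<bar> < r" for t
    unfolding \<gamma>_def using yU[OF that] by (auto simp: inv_into_into f_inv_into_f)
  show thesis
  proof (rule that[of r \<gamma>])
    show "r > 0" using y(1) r1(1) by (simp add: r_def)
    show "\<gamma> 0 = p" unfolding \<gamma>_def y(2) using * by simp
    show "icurve X {-r<..<r} \<gamma>"
      unfolding icurve_def
    proof (intro ballI conjI)
      fix t assume "t \<in> {-r<..<r}"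
      then have t: "\<bar>t\<bar> < r" by auto
      show "\<gamma> t \<in> topspace (mtop N)" using \<gamma>U(1)[OF t] chart_subset[OF *(1)] by blast
      fix f assume f: "f \<in> Cinf N"
      have "((\<lambda>s. (\<lambda>x. f (inv_into U \<phi> x)) (y s)) has_real_derivative
          (\<Sum>j<dm. pd j (\<lambda>x. f (inv_into U \<phi> x)) (y t) * F j (y t))) (at t)"
        by (rule smooth_chain_rule[where G = y, OF W Cinf_chart[OF f *(1)] yU[OF t]])
          (use y(3,4) t in \<open>auto simp: r_def\<close>)
      moreover have "X f (\<gamma> t) = (\<Sum>j<dm. pd j (\<lambda>x. f (inv_into U \<phi> x)) (\<phi> (\<gamma> t)) * F j (\<phi> (\<gamma> t)))"
        by (rule form[OF f \<gamma>U(1)[OF t]]) (use r1(2) t \<gamma>U(2)[OF t] in \<open>auto simp: r_def\<close>)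
      ultimately show "((\<lambda>s. f (\<gamma> s)) has_real_derivative X f (\<gamma> t)) (at t)"
        using \<gamma>U(2)[OF t] by (simp add: \<gamma>_def)
    qed
  qed
qed

end

section \<open>Lie groups and one-parameter subgroups\<close>

lemma open_Rn_concat:
  assumes A: "open_Rn m A" and B: "open_Rn n B"
  shows "open_Rn (m + n) {concat_coords m x y | x y. x \<in> A \<and> y \<in> B}"
  unfolding open_Rn_iff
proof (intro conjI ballI)
  have AR: "A \<subseteq> Rn m" "B \<subseteq> Rn n" using A B by (auto dest: open_Rn_subset)
  show "{concat_coords m x y | x y. x \<in> A \<and> y \<in> B} \<subseteq> Rn (m + n)"
    using AR by (auto simp: concat_coords_def Rn_iff subset_iff)
  fix z assume "z \<in> {concat_coords m x y | x y. x \<in> A \<and> y \<in> B}"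
  then obtain x y where z: "z = concat_coords m x y" "x \<in> A" "y \<in> B" by blast
  obtain d where d: "d > 0" "\<And>w. w \<in> Rn m \<Longrightarrow> (\<forall>i<m. \<bar>w i - x i\<bar> < d) \<Longrightarrow> w \<in> A"
    using A z(2) unfolding open_Rn_iff by blast
  obtain e where e: "e > 0" "\<And>w. w \<in> Rn n \<Longrightarrow> (\<forall>i<n. \<bar>w i - y i\<bar> < e) \<Longrightarrow> w \<in> B"
    using B z(3) unfolding open_Rn_iff by blast
  show "\<exists>r>0. \<forall>w\<in>Rn (m + n). (\<forall>i<m + n. \<bar>w i - z i\<bar> < r) \<longrightarrow> w \<in> {concat_coords m x y | x y. x \<in> A \<and> y \<in> B}"
  proof (intro exI[of _ "min d e"] conjI ballI impI)
    show "0 < min d e" using d e by simp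
    fix w assume w: "w \<in> Rn (m + n)" "\<forall>i<m + n. \<bar>w i - z i\<bar> < min d e"
    let ?x = "\<lambda>i. if i < m then w i else 0" and ?y = "\<lambda>i. w (i + m)"
    have "?x \<in> A"
    proof (rule d(2))
      show "\<forall>i<m. \<bar>?x i - x i\<bar> < d"
      proof (intro allI impI)
        fix i assume "i < m"
        then show "\<bar>?x i - x i\<bar> < d" using w(2)[rule_format, of i] by (simp add: z(1) concat_coords_def)
      qed
    qed (simp add: Rn_iff)
    moreover have "?y \<in> B"
    proof (rule e(2))
      show "?y \<in> Rn n" using w(1) by (simp add: Rn_iff)
      show "\<forall>i<n. \<bar>?y i - y i\<bar> < e"
      proof (intro allI impI)
        fix i assume "i < n"
        then show "\<bar>?y i - y i\<bar> < e" using w(2)[rule_format, of "i + m"] by (simp add: z(1) concat_coords_def)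
      qed
    qed
    moreover have "w = concat_coords m ?x ?y" by (auto simp: concat_coords_def)
    ultimately show "w \<in> {concat_coords m x y | x y. x \<in> A \<and> y \<in> B}" by blast
  qed
qed

context manifold
begin

lemma icurve_subset: "icurve X I \<gamma> \<Longrightarrow> J \<subseteq> I \<Longrightarrow> icurve X J \<gamma>"
  unfolding icurve_def by blast

lemma icurve_affine:
  assumes "icurve X I \<gamma>" "\<And>t. t \<in> J \<Longrightarrow> c * t + b \<in> I"
  shows "icurve (vf_scale c X) J (\<lambda>t. \<gamma> (c * t + b))"
  unfolding icurve_def
proof (intro ballI conjI)
  fix t assume t: "t \<in> J"
  show "\<gamma> (c * t + b) \<in> topspace (mtop N)" using assms t unfolding icurve_def by blast
  fix f assume f: "f \<in> Cinf N"
  have "((\<lambda>s. f (\<gamma> s)) has_real_derivative X f (\<gamma> (c * t + b))) (at (c * t + b))"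
    using assms t f unfolding icurve_def by blast
  moreover have "((\<lambda>t. c * t + b) has_real_derivative c) (at t)" by (auto intro!: derivative_eq_intros)
  ultimately have "((\<lambda>t. f (\<gamma> (c * t + b))) has_real_derivative X f (\<gamma> (c * t + b)) * c) (at t)"
    by (rule DERIV_chain2)
  then show "((\<lambda>t. f (\<gamma> (c * t + b))) has_real_derivative vf_scale c X f (\<gamma> (c * t + b))) (at t)"
    by (simp add: vf_scale_def mult.commute)
qed

lemma icurve_shift:
  assumes "icurve X I \<gamma>" "\<And>t. t \<in> J \<Longrightarrow> t + b \<in> I"
  shows "icurve X J (\<lambda>t. \<gamma> (t + b))"
  using icurve_affine[of X I \<gamma> J 1 b] assms by (simp add: vf_scale_def)

lemma icurve_transform:
  assumes "icurve X I \<gamma>" "open I" "\<And>t. t \<in> I \<Longrightarrow> \<gamma> t = \<delta> t"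
  shows "icurve X I \<delta>"
  unfolding icurve_def
proof (intro ballI conjI)
  fix t assume t: "t \<in> I"
  show "\<delta> t \<in> topspace (mtop N)" using assms(1,3) t unfolding icurve_def by metis
  fix f assume "f \<in> Cinf N"
  then have "((\<lambda>s. f (\<gamma> s)) has_real_derivative X f (\<gamma> t)) (at t)" using assms(1) t unfolding icurve_def by blast
  then have "((\<lambda>s. f (\<delta> s)) has_real_derivative X f (\<gamma> t)) (at t)"
    by (rule has_field_derivative_transform_within_open[OF _ assms(2) t]) (simp add: assms(3))
  then show "((\<lambda>s. f (\<delta> s)) has_real_derivative X f (\<delta> t)) (at t)" using assms(3)[OF t] by simp
qed

text \<open>
  The derivative of \<open>f\<close> along the curve is \<open>X f\<close> along the curve, a function of the same form.
\<close>

lemma icurve_smooth: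
  assumes X: "X \<in> vector_fields N" and \<gamma>: "icurve X UNIV \<gamma>" and f: "f \<in> Cinf N"
  shows "smooth1 (\<lambda>t. f (\<gamma> t))"
  unfolding smooth1_def
proof (rule smooth_fun_coinduct[where P = "\<lambda>h. \<exists>f\<in>Cinf N. h = (\<lambda>x. f (\<gamma> (x 0)))"])
  show "\<exists>f'\<in>Cinf N. (\<lambda>x. f (\<gamma> (x 0))) = (\<lambda>x. f' (\<gamma> (x 0)))" using f by blast
  have D: "((\<lambda>s. f (\<gamma> s)) has_real_derivative X f (\<gamma> t)) (at t)" if "f \<in> Cinf N" for f t
    using \<gamma> that unfolding icurve_def by blast
  fix h :: "(nat \<Rightarrow> real) \<Rightarrow> real" assume "\<exists>f\<in>Cinf N. h = (\<lambda>x. f (\<gamma> (x 0)))"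
  then obtain f where f: "f \<in> Cinf N" and h: "h = (\<lambda>x. f (\<gamma> (x 0)))" by blast
  have "continuous_on UNIV (\<lambda>t. f (\<gamma> t))" using D[OF f] by (intro DERIV_continuous_on) blast
  then show "continuous_on (Rn 1) h" unfolding h
    by (rule continuous_on_compose2) (auto intro: continuous_on_product_then_coordinatewise)
  fix i :: nat assume "i < 1"
  then show "\<exists>g. (\<exists>f\<in>Cinf N. g = (\<lambda>x. f (\<gamma> (x 0)))) \<and>
      (\<forall>x\<in>Rn 1. ((\<lambda>s. h (x(i := s))) has_real_derivative g x) (at (x i)))"
    using D[OF f] vf_Cinf[OF X f] by (intro exI[of _ "\<lambda>x. X f (\<gamma> (x 0))"]) (auto simp: h)
qed

lemma vector_fieldsI:
  assumes "\<And>f. f \<in> Cinf N \<Longrightarrow> X f \<in> Cinf N" "\<And>f. f \<notin> Cinf N \<Longrightarrow> X f = (\<lambda>_. 0)"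
    "\<And>f g. f \<in> Cinf N \<Longrightarrow> g \<in> Cinf N \<Longrightarrow> X (\<lambda>p. f p + g p) = (\<lambda>p. X f p + X g p)"
    "\<And>c f. f \<in> Cinf N \<Longrightarrow> X (\<lambda>p. c * f p) = (\<lambda>p. c * X f p)"
    "\<And>f g. f \<in> Cinf N \<Longrightarrow> g \<in> Cinf N \<Longrightarrow> X (\<lambda>p. f p * g p) = (\<lambda>p. f p * X g p + g p * X f p)"
  shows "X \<in> vector_fields N"
  using assms unfolding vector_fields_def by auto

lemma vf_outside: "X \<in> vector_fields N \<Longrightarrow> f \<notin> Cinf N \<Longrightarrow> X f = (\<lambda>_. 0)"
  unfolding vector_fields_def by blast

lemma vector_fields_zero: "vf_zero \<in> vector_fields N"
  by (rule vector_fieldsI) (auto simp: vf_zero_def intro: Cinf_zero)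

lemma vector_fields_add: "X \<in> vector_fields N \<Longrightarrow> Y \<in> vector_fields N \<Longrightarrow> vf_add X Y \<in> vector_fields N"
  by (rule vector_fieldsI)
    (auto simp: vf_add_def vf_add_fun vf_scale_fun vf_mult_fun vf_outside algebra_simps intro: Cinf_add vf_Cinf)

lemma vector_fields_scale: "X \<in> vector_fields N \<Longrightarrow> vf_scale c X \<in> vector_fields N"
  by (rule vector_fieldsI)
    (auto simp: vf_scale_def vf_add_fun vf_scale_fun vf_mult_fun vf_outside algebra_simps intro: Cinf_scale vf_Cinf)

lemma vector_fields_bracket:
  assumes X: "X \<in> vector_fields N" and Y: "Y \<in> vector_fields N"
  shows "vf_bracket X Y \<in> vector_fields N"
proof (rule vector_fieldsI)
  fix f assume f: "f \<in> Cinf N"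
  have "(\<lambda>p. X (Y f) p + (-1) * Y (X f) p) \<in> Cinf N"
    by (rule Cinf_add[OF vf_Cinf[OF X vf_Cinf[OF Y f]] Cinf_scale[OF vf_Cinf[OF Y vf_Cinf[OF X f]]]])
  then show "vf_bracket X Y f \<in> Cinf N" by (simp add: vf_bracket_def)
  fix c
  have "X (Y (\<lambda>p. c * f p)) = (\<lambda>p. c * X (Y f) p)"
    unfolding vf_scale_fun[OF Y f] by (rule vf_scale_fun[OF X vf_Cinf[OF Y f]])
  moreover have "Y (X (\<lambda>p. c * f p)) = (\<lambda>p. c * Y (X f) p)"
    unfolding vf_scale_fun[OF X f] by (rule vf_scale_fun[OF Y vf_Cinf[OF X f]])
  ultimately show "vf_bracket X Y (\<lambda>p. c * f p) = (\<lambda>p. c * vf_bracket X Y f p)"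
    by (simp only: vf_bracket_def right_diff_distrib)
next
  fix f assume "f \<notin> Cinf N"
  then show "vf_bracket X Y f = (\<lambda>_. 0)"
    by (simp add: vf_bracket_def vf_outside[OF X] vf_outside[OF Y] vf_zero_fun[OF X] vf_zero_fun[OF Y])
next
  fix f g assume fg: "f \<in> Cinf N" "g \<in> Cinf N"
  note c = vf_Cinf[OF X fg(1)] vf_Cinf[OF X fg(2)] vf_Cinf[OF Y fg(1)] vf_Cinf[OF Y fg(2)]
  have "X (Y (\<lambda>p. f p + g p)) = (\<lambda>p. X (Y f) p + X (Y g) p)"
    unfolding vf_add_fun[OF Y fg] by (rule vf_add_fun[OF X c(3,4)])
  moreover have "Y (X (\<lambda>p. f p + g p)) = (\<lambda>p. Y (X f) p + Y (X g) p)"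
    unfolding vf_add_fun[OF X fg] by (rule vf_add_fun[OF Y c(1,2)])
  ultimately show "vf_bracket X Y (\<lambda>p. f p + g p) = (\<lambda>p. vf_bracket X Y f p + vf_bracket X Y g p)"
    by (simp only: vf_bracket_def) (simp add: fun_eq_iff)
  have "X (Y (\<lambda>p. f p * g p)) = (\<lambda>p. X (\<lambda>p. f p * Y g p) p + X (\<lambda>p. g p * Y f p) p)"
    unfolding vf_mult_fun[OF Y fg] by (rule vf_add_fun[OF X Cinf_mult[OF fg(1) c(4)] Cinf_mult[OF fg(2) c(3)]])
  moreover have "Y (X (\<lambda>p. f p * g p)) = (\<lambda>p. Y (\<lambda>p. f p * X g p) p + Y (\<lambda>p. g p * X f p) p)"
    unfolding vf_mult_fun[OF X fg] by (rule vf_add_fun[OF Y Cinf_mult[OF fg(1) c(2)] Cinf_mult[OF fg(2) c(1)]])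
  ultimately show "vf_bracket X Y (\<lambda>p. f p * g p) = (\<lambda>p. f p * vf_bracket X Y g p + g p * vf_bracket X Y f p)"
    unfolding vf_mult_fun[OF X fg(1) c(4)] vf_mult_fun[OF X fg(2) c(3)]
      vf_mult_fun[OF Y fg(1) c(2)] vf_mult_fun[OF Y fg(2) c(1)]
    by (simp only: vf_bracket_def) (simp add: fun_eq_iff algebra_simps)
qed

end

locale liegrp =
  fixes G :: "'g lgroup" (structure)
  assumes lie: "lie_group G"
begin

sublocale group G using lie by (simp add: lie_group_def)

sublocale manifold "mfd_of G"
  using lie by unfold_locales (simp add: lie_group_def)

lemma top_carrier: "topspace (mtop (mfd_of G)) = carrier G"
  using lie by (simp add: lie_group_def)

abbreviation smG :: "nat \<Rightarrow> (nat \<Rightarrow> real) set \<Rightarrow> ((nat \<Rightarrow> real) \<Rightarrow> 'g) \<Rightarrow> bool" where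
  "smG n W F \<equiv> smooth_map (eucl n) (mfd_of G) W F"

abbreviation "CG \<equiv> Cinf (mfd_of G)"

lemma smG_iff: "smG n W F \<longleftrightarrow> open_Rn n W \<and> (\<forall>z\<in>W. F z \<in> carrier G) \<and> (\<forall>f\<in>CG. smooth_fun n W (\<lambda>z. f (F z)))"
  using smooth_map_eucl_Cinf_iff by (simp add: top_carrier)

lemma smG_carrier: "smG n W F \<Longrightarrow> z \<in> W \<Longrightarrow> F z \<in> carrier G"
  by (simp add: smG_iff)

lemma smG_const: "open_Rn n W \<Longrightarrow> p \<in> carrier G \<Longrightarrow> smG n W (\<lambda>_. p)"
  by (simp add: smG_iff smooth_fun_const)

lemma smG_compose:
  assumes "smG m V F" "open_Rn n W" "\<And>z. z \<in> W \<Longrightarrow> H z \<in> V"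
    "\<And>j. j < m \<Longrightarrow> smooth_fun n W (\<lambda>z. H z j)"
  shows "smG n W (\<lambda>z. F (H z))"
  unfolding smG_iff
proof (intro conjI ballI)
  fix f assume f: "f \<in> CG"
  show "smooth_fun n W (\<lambda>z. f (F (H z)))"
    by (rule smooth_fun_compose[where f = "\<lambda>z. f (F z)" and G = H and V = V and m = m])
      (use assms f in \<open>auto simp: smG_iff\<close>)
qed (use assms in \<open>auto simp: smG_iff\<close>)

lemma smG_chart_inv: "(U, \<phi>) \<in> charts (mfd_of G) \<Longrightarrow> smG dm (\<phi> ` U) (inv_into U \<phi>)"
  unfolding smG_iff
proof (intro conjI ballI)
  assume ch: "(U, \<phi>) \<in> charts (mfd_of G)"
  show "open_Rn dm (\<phi> ` U)" by (rule chart_image_open[OF ch])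
  show "inv_into U \<phi> z \<in> carrier G" if "z \<in> \<phi> ` U" for z
    using inv_into_into[OF that] chart_subset[OF ch] top_carrier by blast
  show "smooth_fun dm (\<phi> ` U) (\<lambda>z. f (inv_into U \<phi> z))" if "f \<in> CG" for f
    by (rule Cinf_chart[OF that ch])
qed

text \<open>
  Smoothness of the multiplication is given in product charts, so it has to be read there; this is
  the only place where the product manifold \<open>G \<times> G\<close> is unfolded.
\<close>

lemma smG_mult:
  assumes F: "smG n W F" and F': "smG n W F'"
  shows "smG n W (\<lambda>z. F z \<otimes> F' z)"
proof -
  let ?N = "mfd_of G"
  note e1 = F[unfolded smooth_map_eucl] and e2 = F'[unfolded smooth_map_eucl]
  have W: "open_Rn n W" using e1 by blast
  have mult: "smooth_map (prod_mfd ?N ?N) ?N (carrier G \<times> carrier G) (\<lambda>(p, q). p \<otimes> q)"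
    using lie by (simp add: lie_group_def)
  have mc: "continuous_map (subtopology (prod_topology (mtop ?N) (mtop ?N)) (carrier G \<times> carrier G)) (mtop ?N) (\<lambda>(p, q). p \<otimes> q)"
    and mo: "openin (prod_topology (mtop ?N) (mtop ?N)) (carrier G \<times> carrier G)"
    using mult by (auto simp: smooth_map_def prod_mfd_def)
  have "smooth_fun n W (\<lambda>z. f (F z \<otimes> F' z))" if f: "f \<in> CG" for f
  proof (rule smooth_fun_local[OF W])
    fix z0 assume z0: "z0 \<in> W"
    have c0: "F z0 \<in> carrier G" "F' z0 \<in> carrier G" using F F' z0 smG_carrier by blast+
    obtain U \<phi> where U: "(U, \<phi>) \<in> charts ?N" "F z0 \<in> U" using chart_at c0 top_carrier by metis
    obtain V \<psi> where V: "(V, \<psi>) \<in> charts ?N" "F' z0 \<in> V" using chart_at c0 top_carrier by metis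
    obtain Y \<omega> where Y: "(Y, \<omega>) \<in> charts ?N" "F z0 \<otimes> F' z0 \<in> Y" using chart_at c0 top_carrier m_closed by metis
    have "openin (prod_topology (mtop ?N) (mtop ?N)) {p \<in> carrier G \<times> carrier G. (\<lambda>(p, q). p \<otimes> q) p \<in> Y}"
      by (rule openin_preimage_subtopology[OF mo mc chart_open[OF Y(1)]])
    moreover have "(F z0, F' z0) \<in> {p \<in> carrier G \<times> carrier G. (\<lambda>(p, q). p \<otimes> q) p \<in> Y}"
      using c0 Y by simp
    ultimately have "\<exists>A B. openin (mtop ?N) A \<and> openin (mtop ?N) B \<and> F z0 \<in> A \<and> F' z0 \<in> B \<and>
      A \<times> B \<subseteq> {p \<in> carrier G \<times> carrier G. (\<lambda>(p, q). p \<otimes> q) p \<in> Y}"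
      by (simp only: openin_prod_topology_alt)
    then obtain A B where AB: "openin (mtop ?N) A" "openin (mtop ?N) B" "F z0 \<in> A" "F' z0 \<in> B"
      "A \<times> B \<subseteq> {p \<in> carrier G \<times> carrier G. (\<lambda>(p, q). p \<otimes> q) p \<in> Y}"
      by blast
    define A' where "A' = A \<inter> U"
    define B' where "B' = B \<inter> V"
    have A': "openin (mtop ?N) A'" "A' \<subseteq> U" "F z0 \<in> A'" and B': "openin (mtop ?N) B'" "B' \<subseteq> V" "F' z0 \<in> B'"
      using AB U V chart_open[OF U(1)] chart_open[OF V(1)] by (auto simp: A'_def B'_def)
    have AB': "p \<in> carrier G" "q \<in> carrier G" "p \<otimes> q \<in> Y" if "p \<in> A'" "q \<in> B'" for p q
      using AB(5) that by (auto simp: A'_def B'_def)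
    define ch where "ch = (\<lambda>(p, q). concat_coords dm (\<phi> p) (\<psi> q))"
    have chart: "(U \<times> V, ch) \<in> charts (prod_mfd ?N ?N)"
      unfolding prod_mfd_def ch_def using U(1) V(1) by auto
    have UR: "\<phi> p \<in> Rn dm" if "p \<in> U" for p using open_Rn_subset[OF chart_image_open[OF U(1)]] that by auto
    have VR: "\<psi> p \<in> Rn dm" if "p \<in> V" for p using open_Rn_subset[OF chart_image_open[OF V(1)]] that by auto
    have inv: "inv_into (U \<times> V) ch (ch (p, q)) = (p, q)" if "p \<in> U" "q \<in> V" for p q
    proof (rule inv_into_f_f)
      show "inj_on ch (U \<times> V)"
      proof (rule inj_onI, clarify)
        fix p q p' q' assume *: "p \<in> U" "q \<in> V" "p' \<in> U" "q' \<in> V" "ch (p, q) = ch (p', q')"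
        have "\<phi> p i = \<phi> p' i" for i
          using fun_cong[OF *(5), of i] UR[OF *(1)] UR[OF *(3)]
          by (cases "i < dm") (auto simp: ch_def concat_coords_def Rn_iff)
        moreover have "\<psi> q i = \<psi> q' i" for i
          using fun_cong[OF *(5), of "i + dm"] by (auto simp: ch_def concat_coords_def)
        ultimately have "\<phi> p = \<phi> p'" "\<psi> q = \<psi> q'" by auto
        then show "p = p' \<and> q = q'"
          using * chart_inj[OF U(1)] chart_inj[OF V(1)] by (auto simp: inj_on_def)
      qed
    qed (use that in auto)
    define P where "P = {concat_coords dm x y | x y. x \<in> \<phi> ` A' \<and> y \<in> \<psi> ` B'}"
    have P: "open_Rn (dm + dm) P"
      unfolding P_def by (intro open_Rn_concat chart_image_open_sub[OF U(1)] chart_image_open_sub[OF V(1)] A' B')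
    have Pmem: "ch (p, q) \<in> P" if "p \<in> A'" "q \<in> B'" for p q
      using that unfolding P_def ch_def by auto
    have msm: "smooth_fun (dm + dm) P (\<lambda>x. \<omega> ((\<lambda>(p, q). p \<otimes> q) (inv_into (U \<times> V) ch x)) a)" if a: "a < dm" for a
    proof -
      have "smooth_fun (mdim (prod_mfd ?N ?N))
          (ch ` {p \<in> (U \<times> V) \<inter> (carrier G \<times> carrier G). (\<lambda>(p, q). p \<otimes> q) p \<in> Y})
          (\<lambda>x. \<omega> ((\<lambda>(p, q). p \<otimes> q) (inv_into (U \<times> V) ch x)) a)"
        using mult chart Y(1) a unfolding smooth_map_def by fast
      then have "smooth_fun (dm + dm)
          (ch ` {p \<in> (U \<times> V) \<inter> (carrier G \<times> carrier G). (\<lambda>(p, q). p \<otimes> q) p \<in> Y})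
          (\<lambda>x. \<omega> ((\<lambda>(p, q). p \<otimes> q) (inv_into (U \<times> V) ch x)) a)" by (simp add: prod_mfd_def)
      then show ?thesis
      proof (rule smooth_fun_subset)
        show "P \<subseteq> ch ` {p \<in> (U \<times> V) \<inter> (carrier G \<times> carrier G). (\<lambda>(p, q). p \<otimes> q) p \<in> Y}"
        proof
          fix x assume "x \<in> P"
          then obtain p q where pq: "p \<in> A'" "q \<in> B'" "x = ch (p, q)" unfolding P_def ch_def by auto
          then show "x \<in> ch ` {p \<in> (U \<times> V) \<inter> (carrier G \<times> carrier G). (\<lambda>(p, q). p \<otimes> q) p \<in> Y}"
            using AB'[OF pq(1,2)] A'(2) B'(2) by (intro image_eqI[of _ _ "(p, q)"]) auto
        qed
      qed
    qed
    define W' where "W' = {z \<in> W. F z \<in> A'} \<inter> {z \<in> W. F' z \<in> B'}"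
    have "open_Rn n {z \<in> W. F z \<in> A'}" using e1 by (intro openin_preimage_subtopology[OF W _ A'(1)]) blast
    moreover have "open_Rn n {z \<in> W. F' z \<in> B'}" using e2 by (intro openin_preimage_subtopology[OF W _ B'(1)]) blast
    ultimately have W': "open_Rn n W'" "z0 \<in> W'" unfolding W'_def using z0 A' B' by auto
    have W'D: "z \<in> W" "F z \<in> A'" "F' z \<in> B'" "F z \<in> U" "F' z \<in> V" if "z \<in> W'" for z
      using that A'(2) B'(2) by (auto simp: W'_def)
    have s1: "smooth_fun n W' (\<lambda>z. \<phi> (F z) j)" if "j < dm" for j
    proof -
      have "smooth_fun n {z \<in> W. F z \<in> U} (\<lambda>z. \<phi> (F z) j)" using e1 U(1) that by blast
      then show ?thesis by (rule smooth_fun_subset) (use W'D in auto)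
    qed
    have s2: "smooth_fun n W' (\<lambda>z. \<psi> (F' z) j)" if "j < dm" for j
    proof -
      have "smooth_fun n {z \<in> W. F' z \<in> V} (\<lambda>z. \<psi> (F' z) j)" using e2 V(1) that by blast
      then show ?thesis by (rule smooth_fun_subset) (use W'D in auto)
    qed
    have s3: "smooth_fun n W' (\<lambda>z. ch (F z, F' z) j)" if "j < dm + dm" for j
      using s1[of j] s2[of "j - dm"] that by (cases "j < dm") (simp_all add: ch_def concat_coords_def)
    have s4: "smooth_fun n W' (\<lambda>z. \<omega> (F z \<otimes> F' z) a)" if a: "a < dm" for a
    proof -
      have "smooth_fun n W' (\<lambda>z. (\<lambda>x. \<omega> ((\<lambda>(p, q). p \<otimes> q) (inv_into (U \<times> V) ch x)) a) (ch (F z, F' z)))"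
        by (rule smooth_fun_compose[OF W'(1) P, where G = "\<lambda>z. ch (F z, F' z)"])
          (use W'D Pmem s3 msm[OF a] in auto)
      then show ?thesis by (rule smooth_fun_cong[OF W'(1), rotated]) (use W'D inv in auto)
    qed
    have "smooth_fun n W' (\<lambda>z. (\<lambda>y. f (inv_into Y \<omega> y)) (\<omega> (F z \<otimes> F' z)))"
      by (rule smooth_fun_compose[OF W'(1) chart_image_open[OF Y(1)], where G = "\<lambda>z. \<omega> (F z \<otimes> F' z)"])
        (use W'D AB' s4 Cinf_chart[OF f Y(1)] in auto)
    then have "smooth_fun n W' (\<lambda>z. f (F z \<otimes> F' z))"
      by (rule smooth_fun_cong[OF W'(1), rotated]) (use W'D AB' Y(1) in auto)
    then show "\<exists>U'. open_Rn n U' \<and> z0 \<in> U' \<and> smooth_fun n U' (\<lambda>z. f (F z \<otimes> F' z))"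
      using W' by blast
  qed
  then show ?thesis unfolding smG_iff using W F F' smG_carrier by auto
qed

lemma left_translate_Cinf:
  assumes g: "g \<in> carrier G" and f: "f \<in> CG"
  shows "left_translate G g f \<in> CG"
proof (rule CinfI)
  fix U \<phi> assume ch: "(U, \<phi>) \<in> charts (mfd_of G)"
  have "smG dm (\<phi> ` U) (\<lambda>x. g \<otimes> inv_into U \<phi> x)"
    by (intro smG_mult smG_const smG_chart_inv ch chart_image_open g)
  then have "smooth_fun dm (\<phi> ` U) (\<lambda>x. f (g \<otimes> inv_into U \<phi> x))" using f by (simp add: smG_iff)
  moreover have "inv_into U \<phi> x \<in> carrier G" if "x \<in> \<phi> ` U" for x
    using inv_into_into[OF that] chart_subset[OF ch] top_carrier by auto
  ultimately show "smooth_fun dm (\<phi> ` U) (\<lambda>x. left_translate G g f (inv_into U \<phi> x))"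
    by (elim smooth_fun_cong[OF chart_image_open[OF ch], rotated]) (simp add: left_translate_def)
qed (simp add: left_translate_def top_carrier)

lemma lie_alg_vf: "X \<in> lie_alg G \<Longrightarrow> X \<in> vector_fields (mfd_of G)"
  by (simp add: lie_alg_def)

lemma lie_alg_translate:
  "X \<in> lie_alg G \<Longrightarrow> g \<in> carrier G \<Longrightarrow> f \<in> CG \<Longrightarrow> X (left_translate G g f) = left_translate G g (X f)"
  by (simp add: lie_alg_def)

lemma lie_alg_zero: "vf_zero \<in> lie_alg G"
  unfolding lie_alg_def using vector_fields_zero by (auto simp: vf_zero_def left_translate_def)

lemma lie_alg_add: "X \<in> lie_alg G \<Longrightarrow> Y \<in> lie_alg G \<Longrightarrow> vf_add X Y \<in> lie_alg G"
  unfolding lie_alg_def using vector_fields_add by (auto simp: vf_add_def left_translate_def fun_eq_iff)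

lemma lie_alg_scale: "X \<in> lie_alg G \<Longrightarrow> vf_scale c X \<in> lie_alg G"
  unfolding lie_alg_def using vector_fields_scale by (auto simp: vf_scale_def left_translate_def fun_eq_iff)

lemma lie_alg_bracket:
  assumes X: "X \<in> lie_alg G" and Y: "Y \<in> lie_alg G"
  shows "vf_bracket X Y \<in> lie_alg G"
proof -
  have "vf_bracket X Y (left_translate G g f) = left_translate G g (vf_bracket X Y f)"
    if "g \<in> carrier G" "f \<in> CG" for g f
  proof -
    have "X (Y (left_translate G g f)) = left_translate G g (X (Y f))"
      "Y (X (left_translate G g f)) = left_translate G g (Y (X f))"
      using that by (simp_all only: lie_alg_translate[OF X] lie_alg_translate[OF Y]
        vf_Cinf[OF lie_alg_vf[OF X]] vf_Cinf[OF lie_alg_vf[OF Y]])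
    then show ?thesis unfolding vf_bracket_def by (auto simp: left_translate_def fun_eq_iff)
  qed
  then show ?thesis
    using vector_fields_bracket[OF lie_alg_vf[OF X] lie_alg_vf[OF Y]] by (auto simp: lie_alg_def)
qed

lemma icurve_translate:
  assumes X: "X \<in> lie_alg G" and g: "g \<in> carrier G" and \<gamma>: "icurve X I \<gamma>"
  shows "icurve X I (\<lambda>t. g \<otimes> \<gamma> t)"
  unfolding icurve_def
proof (intro ballI conjI)
  fix t assume t: "t \<in> I"
  then have c: "\<gamma> t \<in> carrier G" using \<gamma> top_carrier by (auto simp: icurve_def)
  then show "g \<otimes> \<gamma> t \<in> topspace (mtop (mfd_of G))" using g top_carrier by simp
  fix f assume f: "f \<in> CG"
  have "((\<lambda>s. left_translate G g f (\<gamma> s)) has_real_derivative X (left_translate G g f) (\<gamma> t)) (at t)"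
    using \<gamma> t left_translate_Cinf[OF g f] unfolding icurve_def by blast
  moreover have "X (left_translate G g f) (\<gamma> t) = X f (g \<otimes> \<gamma> t)"
    by (subst lie_alg_translate[OF X g f]) (simp add: left_translate_def c)
  moreover have "eventually (\<lambda>s. left_translate G g f (\<gamma> s) = f (g \<otimes> \<gamma> s)) (nhds t)"
    using icurve_eventually[OF \<gamma> t openin_topspace] c top_carrier
    by (auto simp: left_translate_def elim: eventually_mono)
  ultimately show "((\<lambda>s. f (g \<otimes> \<gamma> s)) has_real_derivative X f (g \<otimes> \<gamma> t)) (at t)"
    using DERIV_cong_ev[OF refl _ refl, of "\<lambda>s. left_translate G g f (\<gamma> s)" "\<lambda>s. f (g \<otimes> \<gamma> s)" t] by simp
qed

text \<open>
  Left invariance lets a solution on a short interval be continued by translation.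
\<close>

lemma integral_curve_exists:
  assumes X: "X \<in> lie_alg G"
  shows "\<exists>\<gamma>. icurve X UNIV \<gamma> \<and> \<gamma> 0 = \<one>"
proof -
  have "\<one> \<in> topspace (mtop (mfd_of G))" by (simp add: top_carrier)
  then obtain \<gamma>0 r where r: "r > 0" and \<gamma>0: "icurve X {-r<..<r} \<gamma>0" "\<gamma>0 0 = \<one>"
    using icurve_exists_local[OF lie_alg_vf[OF X]] by metis
  define h where "h = r / 2"
  have h: "h > 0" using r by (simp add: h_def)
  define c where "c = \<gamma>0 h"
  have carr: "\<gamma>0 t \<in> carrier G" if "t \<in> {-r<..<r}" for t
    using \<gamma>0(1) that top_carrier by (auto simp: icurve_def)
  have c: "c \<in> carrier G" unfolding c_def using r by (intro carr) (auto simp: h_def)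
  have step: "\<gamma>0 (s + h) = c \<otimes> \<gamma>0 s" if "s \<in> {-h<..<h}" for s
  proof -
    have A: "icurve X {-h<..<h} (\<lambda>s. \<gamma>0 (s + h))"
      by (rule icurve_shift[OF \<gamma>0(1)]) (auto simp: h_def)
    have B: "icurve X {-h<..<h} (\<lambda>s. c \<otimes> \<gamma>0 s)"
      by (rule icurve_translate[OF X c icurve_subset[OF \<gamma>0(1)]]) (use r in \<open>auto simp: h_def\<close>)
    have "\<gamma>0 (0 + h) = c \<otimes> \<gamma>0 0" using c \<gamma>0(2) by (simp add: c_def)
    from icurve_unique[OF lie_alg_vf[OF X] A B _ _ _ this that] show ?thesis using h by simp
  qed
  \<comment> \<open>With \<open>c\<close> the value of the local solution at time \<open>h\<close>, the solution is multiplied by \<open>c\<close> in each time step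
    of length \<open>h\<close>; neighbouring pieces agree on their overlap by uniqueness.\<close>
  define \<gamma> where "\<gamma> t = c [^] (\<lfloor>t / h\<rfloor>) \<otimes> \<gamma>0 (t - of_int \<lfloor>t / h\<rfloor> * h)" for t
  have \<gamma>_eq: "\<gamma> t = c [^] n \<otimes> \<gamma>0 (t - of_int n * h)" if t: "of_int n * h - h < t" "t < of_int n * h + h" for n :: int and t
  proof -
    have "of_int n - 1 < t / h" "t / h < of_int n + 1" using t h by (auto simp: field_simps)
    then have "\<lfloor>t / h\<rfloor> = n \<or> \<lfloor>t / h\<rfloor> = n - 1" by linarith
    then show ?thesis
    proof
      assume fl: "\<lfloor>t / h\<rfloor> = n - 1"
      then have "t / h < of_int n" by linarith
      then have "t < of_int n * h" using h by (simp add: field_simps)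
      then have s: "t - of_int n * h \<in> {-h<..<h}" using t h by auto
      have e1: "c [^] n = c [^] (n - 1) \<otimes> c" using int_pow_mult[OF c, of "n - 1" 1] c by simp
      have e2: "t - of_int (n - 1) * h = t - of_int n * h + h" by (simp add: algebra_simps)
      have "\<gamma>0 (t - of_int n * h) \<in> carrier G" using s r by (intro carr) (auto simp: h_def)
      then show ?thesis unfolding \<gamma>_def fl e2 step[OF s] e1 using c by (simp add: m_assoc)
    qed (simp add: \<gamma>_def)
  qed
  have "icurve X UNIV \<gamma>"
    unfolding icurve_def
  proof
    fix t :: real
    define n where "n = \<lfloor>t / h\<rfloor>"
    define J where "J = {of_int n * h - h<..<of_int n * h + h}"
    have "of_int n \<le> t / h" "t / h < of_int n + 1" unfolding n_def by linarith+
    then have tJ: "t \<in> J" using h by (auto simp: J_def field_simps)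
    have "icurve X J (\<lambda>t. c [^] n \<otimes> \<gamma>0 (t + - (of_int n * h)))"
      by (intro icurve_translate[OF X] icurve_shift[OF \<gamma>0(1)] int_pow_closed c) (use r in \<open>auto simp: J_def h_def\<close>)
    then have "icurve X J \<gamma>"
      by (rule icurve_transform) (auto simp: J_def \<gamma>_eq)
    then show "\<gamma> t \<in> topspace (mtop (mfd_of G)) \<and>
        (\<forall>f\<in>CG. ((\<lambda>s. f (\<gamma> s)) has_real_derivative X f (\<gamma> t)) (at t))"
      using tJ unfolding icurve_def by blast
  qed
  moreover have "\<gamma> 0 = \<one>" using \<gamma>_eq[of 0 0] h \<gamma>0(2) by simp
  ultimately show ?thesis by blast
qed

text \<open>
  The one-parameter subgroup \<open>t \<mapsto> exp(t X)\<close>.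
\<close>

definition expc :: "'g vfield \<Rightarrow> real \<Rightarrow> 'g" where
  "expc X = (THE \<gamma>. integral_curve (mfd_of G) X \<gamma> \<and> \<gamma> 0 = \<one>)"

lemma expc_eqI:
  assumes X: "X \<in> lie_alg G" and \<gamma>: "icurve X UNIV \<gamma>" "\<gamma> 0 = \<one>"
  shows "expc X = \<gamma>"
  unfolding expc_def integral_curve_iff
proof (rule the_equality)
  fix \<delta> assume "icurve X UNIV \<delta> \<and> \<delta> 0 = \<one>"
  then show "\<delta> = \<gamma>"
    using icurve_unique[OF lie_alg_vf[OF X], of UNIV \<delta> \<gamma> 0] \<gamma> by (auto simp: fun_eq_iff)
qed (use \<gamma> in blast)

lemma expc: assumes X: "X \<in> lie_alg G" shows "icurve X UNIV (expc X)" "expc X 0 = \<one>"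
  using integral_curve_exists[OF X] expc_eqI[OF X] by metis+

lemma expc_carrier: "X \<in> lie_alg G \<Longrightarrow> expc X t \<in> carrier G"
  using expc(1) top_carrier by (auto simp: icurve_def)

lemma lie_exp_scale: assumes X: "X \<in> lie_alg G" shows "lie_exp G (vf_scale t X) = expc X t"
proof -
  have "icurve (vf_scale t X) UNIV (\<lambda>s. expc X (t * s + 0))"
    by (rule icurve_affine[OF expc(1)[OF X]]) simp
  then have "expc (vf_scale t X) = (\<lambda>s. expc X (t * s))"
    using expc(2)[OF X] by (intro expc_eqI lie_alg_scale X) auto
  then show ?thesis unfolding lie_exp_def expc_def by simp
qed

lemma DERIV_expc_translate:
  assumes X: "X \<in> lie_alg G" and g: "g \<in> carrier G" and f: "f \<in> CG"
  shows "((\<lambda>s. f (g \<otimes> expc X s)) has_real_derivative X f (g \<otimes> expc X t)) (at t)"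
  using icurve_translate[OF X g expc(1)[OF X]] f unfolding icurve_def by blast

lemma DERIV_expc:
  assumes X: "X \<in> lie_alg G" and f: "f \<in> CG"
  shows "((\<lambda>s. f (expc X s)) has_real_derivative X f (expc X t)) (at t)"
  using expc(1)[OF X] f unfolding icurve_def by blast

lemma smG_expc:
  assumes X: "X \<in> lie_alg G" and W: "open_Rn n W" and a: "smooth_fun n W a"
  shows "smG n W (\<lambda>z. expc X (a z))"
  unfolding smG_iff using W expc_carrier[OF X]
    smooth1_compose[OF icurve_smooth[OF lie_alg_vf[OF X] expc(1)[OF X]] W a] by blast

end

section \<open>Simplices, thin simplices and smooth cochains\<close>

definition rvec :: "real list \<Rightarrow> nat \<Rightarrow> real" where
  "rvec xs i = (if i < length xs then xs ! i else 0)"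

lemma rvec_Rn: "length xs = n \<Longrightarrow> rvec xs \<in> Rn n"
  by (simp add: rvec_def Rn_iff)

lemma rvec_upd: "i < length xs \<Longrightarrow> (rvec xs)(i := s) = rvec (xs[i := s])"
  by (auto simp: rvec_def fun_eq_iff nth_list_update)

lemma smooth_fun_vec:
  assumes "open_Rn n U" "open_Rn m V" "length gs = m"
    "\<And>x. x \<in> U \<Longrightarrow> rvec (map (\<lambda>g. g x) gs) \<in> V"
    "\<And>g. g \<in> set gs \<Longrightarrow> smooth_fun n U g" "smooth_fun m V f"
  shows "smooth_fun n U (\<lambda>x. f (rvec (map (\<lambda>g. g x) gs)))"
proof (rule smooth_fun_compose[OF assms(1,2), where G = "\<lambda>x. rvec (map (\<lambda>g. g x) gs)"])
  fix j assume j: "j < m"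
  then have "smooth_fun n U (gs ! j)" using assms(3,5) by simp
  then show "smooth_fun n U (\<lambda>x. rvec (map (\<lambda>g. g x) gs) j)" using j assms(3) by (simp add: rvec_def)
qed (use assms in auto)

definition smooth2 :: "(real \<Rightarrow> real \<Rightarrow> real) \<Rightarrow> bool" where
  "smooth2 f \<longleftrightarrow> smooth_fun 2 (Rn 2) (\<lambda>x. f (x 0) (x 1))"

lemma smooth2_compose:
  assumes "smooth2 f" "open_Rn n U" "smooth_fun n U g" "smooth_fun n U h"
  shows "smooth_fun n U (\<lambda>x. f (g x) (h x))"
  using smooth_fun_vec[of n U 2 "Rn 2" "[g, h]" "\<lambda>x. f (x 0) (x 1)"] assms
  by (auto simp: smooth2_def rvec_Rn rvec_def)

lemma smooth1_vecI: "smooth_fun 1 (Rn 1) f \<Longrightarrow> smooth1 (\<lambda>t. f (rvec [t]))"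
  unfolding smooth1_def using smooth_fun_vec[of 1 "Rn 1" 1 "Rn 1" "[\<lambda>x. x 0]" f]
  by (simp add: rvec_Rn smooth_fun_coord)

lemma smooth2_vecI: "smooth_fun 2 (Rn 2) f \<Longrightarrow> smooth2 (\<lambda>s t. f (rvec [s, t]))"
proof -
  assume f: "smooth_fun 2 (Rn 2) f"
  have "smooth_fun 2 (Rn 2) (\<lambda>x. f (rvec (map (\<lambda>g. g x) [\<lambda>x. x 0, \<lambda>x. x 1])))"
    by (rule smooth_fun_vec[where m = 2 and V = "Rn 2"]) (use f in \<open>auto simp: rvec_Rn smooth_fun_coord\<close>)
  then show ?thesis by (simp add: smooth2_def)
qed

lemma smooth1_DERIV: "smooth1 f \<Longrightarrow> (f has_real_derivative deriv f t) (at t)"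
proof -
  assume "smooth1 f"
  from smooth_fun_pd(2)[OF _ this[unfolded smooth1_def], of 0 "rvec [t]"]
  have "(f has_real_derivative pd 0 (\<lambda>x. f (x 0)) (rvec [t])) (at t)" by (simp add: rvec_Rn rvec_def)
  then show ?thesis using DERIV_imp_deriv by metis
qed

lemma smooth1_hadamard:
  assumes f: "smooth1 f" and 0: "f 0 = 0"
  obtains P where "smooth1 P" "\<And>t. f t = t * P t" "P 0 = deriv f 0"
proof -
  obtain g where g: "smooth_fun 1 (Rn 1) g"
    "\<And>x. x \<in> Rn 1 \<Longrightarrow> f (x 0) = f ((x(0 := 0)) 0) + x 0 * g x"
    "\<And>x. x \<in> Rn 1 \<Longrightarrow> x 0 = 0 \<Longrightarrow> g x = pd 0 (\<lambda>x. f (x 0)) x"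
    by (rule hadamard[OF f[unfolded smooth1_def], of 0]) auto
  show thesis
  proof (rule that[of "\<lambda>t. g (rvec [t])"])
    show "smooth1 (\<lambda>t. g (rvec [t]))" by (rule smooth1_vecI[OF g(1)])
    show "f t = t * g (rvec [t])" for t
      using g(2)[of "rvec [t]"] 0 by (simp add: rvec_Rn) (simp add: rvec_def)
    have "pd 0 (\<lambda>x. f (x 0)) (rvec [0]) = deriv f 0" by (simp add: pd_def rvec_def)
    then show "g (rvec [0]) = deriv f 0" using g(3)[of "rvec [0]"] by (simp add: rvec_Rn) (simp add: rvec_def)
  qed
qed

text \<open>
  Hadamard's lemma in both variables. The terms \<open>P\<close> and \<open>Q\<close> carry the behaviour on the two axes and
  \<open>s * t * B s t\<close> is the part that vanishes on them.
\<close>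

lemma smooth2_hadamard:
  assumes f: "smooth2 f" and 0: "f 0 0 = 0"
  obtains P Q B where "smooth1 P" "smooth1 Q" "smooth2 B"
    "\<And>s t. f s t = s * P s + t * Q t + s * t * B s t"
    "P 0 = pd 0 (\<lambda>x. f (x 0) (x 1)) (\<lambda>_. 0)" "Q 0 = pd 1 (\<lambda>x. f (x 0) (x 1)) (\<lambda>_. 0)"
proof -
  obtain E where E: "smooth_fun 2 (Rn 2) E"
    "\<And>x. x \<in> Rn 2 \<Longrightarrow> f (x 0) (x 1) = f ((x(1 := 0)) 0) ((x(1 := 0)) 1) + x 1 * E x"
    "\<And>x. x \<in> Rn 2 \<Longrightarrow> x 1 = 0 \<Longrightarrow> E x = pd 1 (\<lambda>x. f (x 0) (x 1)) x"
    by (rule hadamard[OF f[unfolded smooth2_def], of 1]) auto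
  obtain B where B: "smooth_fun 2 (Rn 2) B" "\<And>x. x \<in> Rn 2 \<Longrightarrow> E x = E (x(0 := 0)) + x 0 * B x"
    by (rule hadamard[OF E(1), of 0]) auto
  have f1: "smooth1 (\<lambda>s. f s 0)"
    unfolding smooth1_def by (rule smooth2_compose[OF f]) (auto intro: smooth_fun_intros)
  from smooth1_hadamard[OF f1 0] obtain P where P: "smooth1 P" "\<And>s. f s 0 = s * P s" "P 0 = deriv (\<lambda>s. f s 0) 0"
    by metis
  show thesis
  proof (rule that[of P "\<lambda>t. E (rvec [0, t])" "\<lambda>s t. B (rvec [s, t])"])
    show "smooth1 P" by (rule P(1))
    have "smooth_fun 1 (Rn 1) (\<lambda>x. (\<lambda>s t. E (rvec [s, t])) 0 (x 0))"
      by (rule smooth2_compose[OF smooth2_vecI[OF E(1)]]) (auto intro: smooth_fun_intros)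
    then show "smooth1 (\<lambda>t. E (rvec [0, t]))" by (simp add: smooth1_def)
    show "smooth2 (\<lambda>s t. B (rvec [s, t]))" by (rule smooth2_vecI[OF B(1)])
    fix s t
    have "f s t = f s 0 + t * E (rvec [s, t])"
      using E(2)[of "rvec [s, t]"] by (simp add: rvec_Rn) (simp add: rvec_def)
    also have "E (rvec [s, t]) = E (rvec [0, t]) + s * B (rvec [s, t])"
      using B(2)[of "rvec [s, t]"] by (simp add: rvec_Rn rvec_upd) (simp add: rvec_def)
    finally show "f s t = s * P s + t * E (rvec [0, t]) + s * t * B (rvec [s, t])"
      by (simp add: P(2) algebra_simps)
  next
    have z: "(rvec [0, 0]) = (\<lambda>_. 0)" by (auto simp: rvec_def fun_eq_iff less_Suc_eq)
    show "P 0 = pd 0 (\<lambda>x. f (x 0) (x 1)) (\<lambda>_. 0)" by (simp add: P(3) pd_def)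
    show "E (rvec [0, 0]) = pd 1 (\<lambda>x. f (x 0) (x 1)) (\<lambda>_. 0)"
      using E(3)[of "rvec [0, 0]"] by (simp add: z Rn_iff)
  qed
qed

lemma mat_rank_less:
  assumes "i < k" "c i \<noteq> (0::real)" "\<And>a. a < n \<Longrightarrow> (\<Sum>i<k. c i * J a i) = 0"
  shows "mat_rank n k J < k"
proof -
  let ?S = "{S. S \<subseteq> {..<k} \<and> (\<forall>c :: nat \<Rightarrow> real. (\<forall>a<n. (\<Sum>i\<in>S. c i * J a i) = 0) \<longrightarrow> (\<forall>i\<in>S. c i = 0))}"
  have fin: "finite ?S" by (rule finite_subset[of _ "Pow {..<k}"]) auto
  have "{} \<in> ?S" by auto
  then have ne: "card ` ?S \<noteq> {}" by blast
  have "card S < k" if "S \<in> ?S" for S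
  proof -
    have "S \<noteq> {..<k}" using that assms by auto
    then have "S \<subset> {..<k}" using that by blast
    then show ?thesis using psubset_card_mono[of "{..<k}" S] by simp
  qed
  then show ?thesis unfolding mat_rank_def using fin ne by (subst Max_less_iff) auto
qed

lemma mk_simplex_cong: "(\<And>t. t \<in> Delta k \<Longrightarrow> s t = s' t) \<Longrightarrow> mk_simplex k s = mk_simplex k s'"
  by (auto simp: mk_simplex_def intro: restrict_ext)

lemma Delta_Rn: "Delta k \<subseteq> Rn k"
  by (auto simp: Delta_def Rn_iff)

text \<open>
  The two triangles of the square are exchanged by interchanging the coordinates, hence
  \<open>\<tau>\<close> changes sign under this interchange.
\<close>

lemma tau_2: "tau 2 c \<theta> = c (mk_simplex 2 \<theta>) - c (mk_simplex 2 (\<lambda>t. \<theta> (rvec [t 1, t 0])))"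
proof -
  have "{..<2::nat} = {0, 1}" by auto
  then have perms: "{\<kappa>. \<kappa> permutes {..<2::nat}} = {id, Transposition.transpose 0 1}"
    by (auto simp: permutes_doubleton_iff)
  have ne: "id \<noteq> Transposition.transpose (0::nat) 1"
    by (metis id_apply transpose_apply_first zero_neq_one)
  have "mk_simplex 2 (\<lambda>t. \<theta> (perm_coords 2 id t)) = mk_simplex 2 \<theta>"
  proof (rule mk_simplex_cong)
    fix t assume "t \<in> Delta 2"
    then have "perm_coords 2 id t = t" by (auto simp: perm_coords_def Delta_def fun_eq_iff)
    then show "\<theta> (perm_coords 2 id t) = \<theta> t" by simp
  qed
  moreover have "perm_coords 2 (Transposition.transpose 0 1) t = rvec [t 1, t 0]" for t
    by (auto simp: perm_coords_def rvec_def fun_eq_iff less_Suc_eq numeral_2_eq_2)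
  ultimately show ?thesis unfolding tau_def perms using ne by (simp add: sign_swap_id)
qed

context liegrp
begin

abbreviation "NG \<equiv> mfd_of G"

lemma mk_simplex_smooth:
  assumes "smG k (Rn k) F"
  shows "mk_simplex k F \<in> smooth_simplices NG k"
  unfolding smooth_simplices_def mk_simplex_def smooth_on_set_def using assms Delta_Rn
  by (auto intro!: exI[of _ "Rn k"] exI[of _ F])

lemma thin_const:
  assumes p: "p \<in> carrier G"
  shows "thin NG (mk_simplex 1 (\<lambda>_. p))"
  unfolding thin_def mk_simplex_def prod.case
proof
  fix t assume t: "t \<in> Delta 1"
  obtain V \<psi> where V: "(V, \<psi>) \<in> charts NG" "p \<in> V" using chart_at p top_carrier by metis
  show "\<exists>W F V \<psi>. t \<in> W \<and> smG 1 W F \<and> (\<forall>u\<in>W \<inter> Delta 1. F u = restrict (\<lambda>_. p) (Delta 1) u) \<and>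
      (V, \<psi>) \<in> charts NG \<and> restrict (\<lambda>_. p) (Delta 1) t \<in> V \<and>
      mat_rank dm 1 (\<lambda>a i. deriv (\<lambda>r. \<psi> (F (t(i := r))) a) (t i)) < 1"
  proof (intro exI conjI)
    show "smG 1 (Rn 1) (\<lambda>_. p)" by (rule smG_const[OF _ p]) simp
    show "mat_rank dm 1 (\<lambda>a i. deriv (\<lambda>r. \<psi> ((\<lambda>_. p) (t(i := r))) a) (t i)) < 1"
      by (rule mat_rank_less[of 0 _ "\<lambda>_. 1"]) auto
  qed (use t V Delta_Rn in auto)
qed

text \<open>
  The Jacobian is a column times the row of the two partial derivatives of \<open>f\<close>, so its rank is at most 1.
\<close>

lemma thin_through_curve:
  assumes \<gamma>: "smG 1 (Rn 1) (\<lambda>z. \<gamma> (z 0))" and f: "smooth2 f"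
  shows "thin NG (mk_simplex 2 (\<lambda>t. \<gamma> (f (t 0) (t 1))))"
  unfolding thin_def mk_simplex_def prod.case
proof
  fix t assume t: "t \<in> Delta 2"
  let ?F = "\<lambda>t. \<gamma> (f (t 0) (t 1))"
  have \<gamma>c: "\<gamma> v \<in> carrier G" for v using smG_carrier[OF \<gamma>, of "rvec [v]"] by (simp add: rvec_Rn) (simp add: rvec_def)
  obtain V \<psi> where V: "(V, \<psi>) \<in> charts NG" "?F t \<in> V" using chart_at \<gamma>c top_carrier by metis
  have F: "smG 2 (Rn 2) ?F"
    using smG_compose[OF \<gamma>, of 2 "Rn 2" "\<lambda>z. rvec [f (z 0) (z 1)]"] smooth2_compose[OF f, of 2 "Rn 2" "\<lambda>x. x 0" "\<lambda>x. x 1"]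
    by (simp add: rvec_Rn smooth_fun_coord) (simp add: rvec_def)
  define v0 where "v0 = f (t 0) (t 1)"
  have t2: "t \<in> Rn 2" using t Delta_Rn by blast
  define fd where "fd i = pd i (\<lambda>x. f (x 0) (x 1)) t" for i
  have fD: "((\<lambda>r. f ((t(i := r)) 0) ((t(i := r)) 1)) has_real_derivative fd i) (at (t i))" if "i < 2" for i
    unfolding fd_def using smooth_fun_pd(2)[OF _ f[unfolded smooth2_def] that t2] by simp
  have J: "\<exists>D. \<forall>i<2. deriv (\<lambda>r. \<psi> (?F (t(i := r))) a) (t i) = D * fd i" if a: "a < dm" for a
  proof -
    have op: "open_Rn 1 {z \<in> Rn 1. \<gamma> (z 0) \<in> V}"
      using \<gamma> unfolding smooth_map_eucl by (auto intro: openin_preimage_subtopology chart_open[OF V(1)])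
    have sm: "smooth_fun 1 {z \<in> Rn 1. \<gamma> (z 0) \<in> V} (\<lambda>z. \<psi> (\<gamma> (z 0)) a)"
      using \<gamma> V(1) a unfolding smooth_map_eucl by blast
    have mem: "rvec [v0] \<in> {z \<in> Rn 1. \<gamma> (z 0) \<in> V}" using V(2) by (auto simp: rvec_Rn v0_def) (simp add: rvec_def)
    obtain D where D: "((\<lambda>r. \<psi> (\<gamma> r) a) has_real_derivative D) (at v0)"
      using smooth_fun_pd(2)[OF op sm _ mem, of 0] by (simp add: rvec_def)
    have "((\<lambda>r. \<psi> (?F (t(i := r))) a) has_real_derivative D * fd i) (at (t i))" if "i < 2" for i
    proof (rule DERIV_chain2[OF _ fD[OF that]])
      show "((\<lambda>r. \<psi> (\<gamma> r) a) has_real_derivative D) (at (f ((t(i := t i)) 0) ((t(i := t i)) 1)))"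
        using D by (simp add: v0_def)
    qed
    then show ?thesis using DERIV_imp_deriv by blast
  qed
  show "\<exists>W F V \<psi>. t \<in> W \<and> smG 2 W F \<and> (\<forall>u\<in>W \<inter> Delta 2. F u = restrict ?F (Delta 2) u) \<and>
      (V, \<psi>) \<in> charts NG \<and> restrict ?F (Delta 2) t \<in> V \<and>
      mat_rank dm 2 (\<lambda>a i. deriv (\<lambda>r. \<psi> (F (t(i := r))) a) (t i)) < 2"
  proof (intro exI conjI)
    \<comment> \<open>A nontrivial relation between the two columns of the Jacobian.\<close>
    define c where "c i = (if fd 0 = 0 \<and> fd 1 = 0 then 1 else if i = (0::nat) then fd 1 else - fd 0)" for i
    have lt2: "{..<2::nat} = {0, 1}" by auto
    have cJ: "(\<Sum>i<2. c i * deriv (\<lambda>r. \<psi> (?F (t(i := r))) a) (t i)) = 0" if a: "a < dm" for a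
    proof -
      obtain D where D: "\<forall>i<2. deriv (\<lambda>r. \<psi> (?F (t(i := r))) a) (t i) = D * fd i" using J[OF a] by blast
      have "(\<Sum>i<2. c i * deriv (\<lambda>r. \<psi> (?F (t(i := r))) a) (t i)) = (\<Sum>i<2. c i * (D * fd i))"
        using D by (intro sum.cong) auto
      also have "\<dots> = 0" by (simp add: lt2 c_def)
      finally show ?thesis .
    qed
    show "mat_rank dm 2 (\<lambda>a i. deriv (\<lambda>r. \<psi> (?F (t(i := r))) a) (t i)) < 2"
    proof (cases "c 0 = 0")
      case True
      then have "c 1 \<noteq> 0" by (auto simp: c_def split: if_splits)
      then show ?thesis using mat_rank_less[of 1 2 c, OF _ _ cJ] by simp
    next
      case False
      then show ?thesis using mat_rank_less[of 0 2 c, OF _ _ cJ] by simp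
    qed
    show "smG 2 (Rn 2) ?F" by (rule F)
  qed (use t V Delta_Rn in auto)
qed

text \<open>
  The two properties of the matrix entries of a module from which its infinitesimal operators are
  derived. Families are parametrized by open sets \<open>W\<close> of Euclidean space, and their members are maps
  on all of \<open>Rn k\<close>; \<open>F\<close> takes the parameters and the simplex coordinates as one vector.
\<close>

definition smooth_cochain :: "('g ssimplex \<Rightarrow> real) \<Rightarrow> bool" where
  "smooth_cochain c \<longleftrightarrow>
     (\<forall>n k W F. open_Rn n W \<and> smG (n + k) {concat_coords n p t | p t. p \<in> W \<and> t \<in> Rn k} F \<longrightarrow>
        smooth_fun n W (\<lambda>p. c (mk_simplex k (\<lambda>t. F (concat_coords n p t))))) \<and>
     (\<forall>k. \<forall>\<sigma>\<in>smooth_simplices NG k. thin NG \<sigma> \<longrightarrow> c \<sigma> = 0)"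

lemma smooth_cochain_family:
  assumes c: "smooth_cochain c" and F: "smG (n + k) (Rn (n + k)) F"
  shows "smooth_fun n (Rn n) (\<lambda>p. c (mk_simplex k (\<lambda>t. F (concat_coords n p t))))"
proof -
  have "{concat_coords n p t | p t. p \<in> Rn n \<and> t \<in> Rn k} = Rn (n + k)"
  proof (intro Set.set_eqI iffI)
    fix z assume z: "z \<in> Rn (n + k)"
    have "z = concat_coords n (\<lambda>i. if i < n then z i else 0) (\<lambda>i. z (i + n))" by (auto simp: concat_coords_def)
    moreover have "(\<lambda>i. if i < n then z i else 0) \<in> Rn n" "(\<lambda>i. z (i + n)) \<in> Rn k" using z by (auto simp: Rn_iff)
    ultimately show "z \<in> {concat_coords n p t | p t. p \<in> Rn n \<and> t \<in> Rn k}" by blast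
  qed (auto simp: concat_coords_def Rn_iff)
  note eq = this
  have "open_Rn n (Rn n) \<and> smG (n + k) {concat_coords n p t | p t. p \<in> Rn n \<and> t \<in> Rn k} F \<longrightarrow>
      smooth_fun n (Rn n) (\<lambda>p. c (mk_simplex k (\<lambda>t. F (concat_coords n p t))))"
    using c unfolding smooth_cochain_def by blast
  then show ?thesis using F unfolding eq by simp
qed

lemma smooth_cochain_thin:
  "smooth_cochain c \<Longrightarrow> smG k (Rn k) F \<Longrightarrow> thin NG (mk_simplex k F) \<Longrightarrow> c (mk_simplex k F) = 0"
  unfolding smooth_cochain_def using mk_simplex_smooth by blast

lemma smooth_cochain_const: "smooth_cochain c \<Longrightarrow> p \<in> carrier G \<Longrightarrow> c (mk_simplex 1 (\<lambda>_. p)) = 0"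
  by (rule smooth_cochain_thin[OF _ smG_const thin_const]) auto

text \<open>
  Both triangles of a square that factors through a curve are thin.
\<close>

lemma tau_thin:
  assumes c: "smooth_cochain c" and \<gamma>: "smG 1 (Rn 1) (\<lambda>z. \<gamma> (z 0))" and f: "smooth2 f"
    and \<theta>: "\<And>u. \<theta> u = \<gamma> (f (u 0) (u 1))"
  shows "tau 2 c \<theta> = 0"
proof -
  have *: "c (mk_simplex 2 (\<lambda>t. \<gamma> (f (t 0) (t 1)))) = 0" if f: "smooth2 f" for f
  proof (rule smooth_cochain_thin[OF c _ thin_through_curve[OF \<gamma> f]])
    show "smG 2 (Rn 2) (\<lambda>t. \<gamma> (f (t 0) (t 1)))"
      using smG_compose[OF \<gamma>, of 2 "Rn 2" "\<lambda>z. rvec [f (z 0) (z 1)]"] smooth2_compose[OF f, of 2 "Rn 2" "\<lambda>x. x 0" "\<lambda>x. x 1"]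
      by (simp add: rvec_Rn smooth_fun_coord) (simp add: rvec_def)
  qed
  have "smooth2 (\<lambda>s t. f t s)"
    unfolding smooth2_def by (rule smooth2_compose[OF f]) (auto intro: smooth_fun_coord)
  moreover have "\<theta> = (\<lambda>u. \<gamma> (f (u 0) (u 1)))" by (rule ext) (rule \<theta>)
  ultimately show ?thesis using *[OF f] *[of "\<lambda>s t. f t s"] by (simp add: tau_2 rvec_def)
qed

lemma tau_family:
  assumes c: "smooth_cochain c" and F: "smG (n + 2) (Rn (n + 2)) F"
  shows "smooth_fun n (Rn n) (\<lambda>p. tau 2 c (\<lambda>u. F (concat_coords n p u)))"
proof -
  define H where "H z = (\<lambda>i. if i < n then z i else if i = n then z (Suc n) else if i = Suc n then z n else 0 :: real)" for z
  have FH: "smG (n + 2) (Rn (n + 2)) (\<lambda>z. F (H z))"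
  proof (rule smG_compose[OF F])
    show "smooth_fun (n + 2) (Rn (n + 2)) (\<lambda>z. H z j)" for j
      by (cases "j < n"; cases "j = n"; cases "j = Suc n")
        (simp_all add: H_def smooth_fun_coord smooth_fun_const)
  qed (auto simp: H_def Rn_iff)
  have "F (H (concat_coords n p t)) = F (concat_coords n p (rvec [t 1, t 0]))" for p t
  proof -
    have "H (concat_coords n p t) = concat_coords n p (rvec [t 1, t 0])"
      by (auto simp: H_def concat_coords_def rvec_def fun_eq_iff less_Suc_eq)
    then show ?thesis by simp
  qed
  then show ?thesis unfolding tau_2
    using smooth_fun_diff[OF smooth_cochain_family[OF c F] smooth_cochain_family[OF c FH]] by simp
qed

text \<open>
  The parametrization \<open>h\<close> is defined on all of Euclidean space, by squashing it into a coordinate box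
  around the unit, and the coordinates \<open>\<psi> j\<close> are smooth on all of \<open>G\<close>, by cutting them off. They are
  inverse to each other near the unit only, which suffices for derivatives at the unit.
\<close>

lemma local_coords:
  obtains h \<psi> where "smG dm (Rn dm) h" "h (\<lambda>_. 0) = \<one>" "\<And>j. \<psi> j \<in> CG" "\<And>j. \<psi> j \<one> = 0"
    "\<And>m A. smG m (Rn m) A \<Longrightarrow> A (\<lambda>_. 0) = \<one> \<Longrightarrow>
      \<exists>d>0. \<forall>z\<in>Rn m. (\<forall>i<m. \<bar>z i\<bar> < d) \<longrightarrow> A z = h (\<lambda>j. if j < dm then \<psi> j (A z) else 0)"
proof -
  obtain U \<phi> where U: "(U, \<phi>) \<in> charts NG" "\<one> \<in> U" using chart_at one_closed top_carrier by metis
  let ?W = "\<phi> ` U"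
  have W: "open_Rn dm ?W" by (rule chart_image_open[OF U(1)])
  define a where "a = \<phi> \<one>"
  have aR: "a \<in> Rn dm" using open_Rn_subset[OF W] U by (auto simp: a_def)
  obtain e where e: "e > 0" "{y \<in> Rn dm. \<forall>i<dm. \<bar>y i - a i\<bar> \<le> 2 * e} \<subseteq> ?W"
    using open_Rn_closed_box[OF W] U a_def by blast
  define sq where "sq w = (\<lambda>j. if j < dm then a j + squash e (w j) else 0)" for w
  have sqW: "sq w \<in> ?W" for w using e squash_bound[OF e(1)] by (auto simp: sq_def Rn_iff intro!: subsetD[OF e(2)])
  define h where "h w = inv_into U \<phi> (sq w)" for w
  have h: "smG dm (Rn dm) h"
    unfolding h_def
  proof (rule smG_compose[OF smG_chart_inv[OF U(1)]])
    show "smooth_fun dm (Rn dm) (\<lambda>w. sq w j)" if "j < dm" for j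
      using that by (auto simp: sq_def intro!: smooth_fun_intros smooth_squash)
  qed (auto intro: sqW)
  define \<psi> where "\<psi> j = chart_ext U \<phi> e a (\<lambda>y. y j - a j)" for j
  define Q where "Q = {q \<in> U. \<phi> q \<in> {y \<in> Rn dm. \<forall>i<dm. \<bar>y i - a i\<bar> < e}}"
  have Q: "openin (mtop NG) Q" unfolding Q_def by (rule chart_preimage_open[OF U(1) open_Rn_Collect_abs_less])
  have \<psi>Q: "\<psi> j q = \<phi> q j - a j" if "q \<in> Q" for q j
    unfolding \<psi>_def by (rule chart_ext_eq) (use that e in \<open>auto simp: Q_def intro: less_imp_le\<close>)
  have one: "\<one> \<in> Q" unfolding Q_def using U aR e(1) by (simp add: a_def)
  have hQ: "h (\<lambda>j. if j < dm then \<psi> j q else 0) = q" if q: "q \<in> Q" for q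
  proof -
    have qR: "\<phi> q \<in> Rn dm" and qe: "\<And>i. i < dm \<Longrightarrow> \<bar>\<phi> q i - a i\<bar> < e" and qU: "q \<in> U"
      using q by (auto simp: Q_def)
    have "sq (\<lambda>j. if j < dm then \<psi> j q else 0) = \<phi> q"
    proof
      fix j
      show "sq (\<lambda>j. if j < dm then \<psi> j q else 0) j = \<phi> q j"
      proof (cases "j < dm")
        case True
        then have "squash e (\<phi> q j - a j) = \<phi> q j - a j" using qe[OF True] by (intro squash_eq[OF e(1)]) simp
        then show ?thesis using True by (simp add: sq_def \<psi>Q[OF q])
      qed (use qR in \<open>simp add: sq_def Rn_iff\<close>)
    qed
    then show ?thesis using U(1) qU by (simp add: h_def)
  qed
  have \<psi>1: "\<psi> j \<one> = 0" for j using \<psi>Q[OF one] by (simp add: a_def)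
  show thesis
  proof (rule that[of h \<psi>])
    show "smG dm (Rn dm) h" by (rule h)
    show "\<psi> j \<one> = 0" for j by (rule \<psi>1)
    have "(\<lambda>j. if j < dm then \<psi> j \<one> else 0) = (\<lambda>_. 0)" by (auto simp: \<psi>1 fun_eq_iff)
    then show "h (\<lambda>_. 0) = \<one>" using hQ[OF one] by simp
    show "\<psi> j \<in> CG" for j unfolding \<psi>_def
      by (intro chart_ext_Cinf[OF U(1) e] smooth_fun_intros)
    fix m A assume A: "smG m (Rn m) A" "A (\<lambda>_. 0) = \<one>"
    have "open_Rn m {z \<in> Rn m. A z \<in> Q}"
      using A(1) unfolding smooth_map_eucl by (intro openin_preimage_subtopology[OF _ _ Q]) auto
    from this[unfolded open_Rn_iff]
    have nb: "\<forall>x\<in>{z \<in> Rn m. A z \<in> Q}. \<exists>e>0. \<forall>y\<in>Rn m. (\<forall>i<m. \<bar>y i - x i\<bar> < e) \<longrightarrow> y \<in> {z \<in> Rn m. A z \<in> Q}"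
      by (rule conjunct2)
    have "(\<lambda>_. 0) \<in> {z \<in> Rn m. A z \<in> Q}" using A(2) one by (simp add: Rn_iff)
    from bspec[OF nb this] obtain d where d: "d > 0" "\<And>z. z \<in> Rn m \<Longrightarrow> (\<forall>i<m. \<bar>z i\<bar> < d) \<Longrightarrow> z \<in> {z \<in> Rn m. A z \<in> Q}"
      by auto
    show "\<exists>d>0. \<forall>z\<in>Rn m. (\<forall>i<m. \<bar>z i\<bar> < d) \<longrightarrow> A z = h (\<lambda>j. if j < dm then \<psi> j (A z) else 0)"
    proof (intro exI[of _ d] conjI ballI impI)
      fix z assume "z \<in> Rn m" "\<forall>i<m. \<bar>z i\<bar> < d"
      then have "A z \<in> Q" using d(2)[of z] by simp
      then show "A z = h (\<lambda>j. if j < dm then \<psi> j (A z) else 0)" using hQ by simp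
    qed (rule d(1))
  qed
qed

end

section \<open>First order behaviour of smooth cochains at the unit\<close>

lemma pd_cong_open:
  assumes "open_Rn n U" "x \<in> U" "i < n" "\<And>y. y \<in> U \<Longrightarrow> f y = g y"
  shows "pd i f x = pd i g x"
  unfolding pd_def
proof (rule deriv_cong_ev)
  show "eventually (\<lambda>s. f (x(i := s)) = g (x(i := s))) (nhds (x i))"
    using open_Rn_eventually_upd[OF assms(1-3)] assms(4) by (auto elim: eventually_mono)
qed simp

lemma tau_cong:
  assumes "\<And>u. u \<in> Cube 2 \<Longrightarrow> \<theta> u = \<theta>' u"
  shows "tau 2 c \<theta> = tau 2 c \<theta>'"
proof -
  have lt2: "i = 0 \<or> i = 1" if "i < (2::nat)" for i using that by auto
  have "t \<in> Cube 2" "rvec [t 1, t 0] \<in> Cube 2" if "t \<in> Delta 2" for t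
    using that by (auto simp: Delta_def Cube_def rvec_def dest!: lt2)
  then have "mk_simplex 2 \<theta> = mk_simplex 2 \<theta>'"
    "mk_simplex 2 (\<lambda>t. \<theta> (rvec [t 1, t 0])) = mk_simplex 2 (\<lambda>t. \<theta>' (rvec [t 1, t 0]))"
    using assms by (auto intro!: mk_simplex_cong)
  then show ?thesis by (simp add: tau_2)
qed

context liegrp
begin

text \<open>
  Here \<open>\<alpha> j\<close> is the derivative, in direction \<open>j\<close> at 0, of the value of \<open>c\<close> on straight segments from
  the origin in the coordinates \<open>h\<close>. A curve through the unit can be replaced by the straight line
  with the same velocity.
\<close>

lemma cochain_derivative_first_order:
  assumes c: "smooth_cochain c"
  obtains \<alpha> \<psi> where "\<And>j. \<psi> j \<in> CG"
    "\<And>p. smG 1 (Rn 1) (\<lambda>z. p (z 0)) \<Longrightarrow> p 0 = \<one> \<Longrightarrow>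
      ((\<lambda>t. c (mk_simplex 1 (\<lambda>s. p (t * s 0)))) has_real_derivative
        (\<Sum>j<dm. \<alpha> j * deriv (\<lambda>t. \<psi> j (p t)) 0)) (at 0)"
proof -
  obtain h \<psi> where h: "smG dm (Rn dm) h" "h (\<lambda>_. 0) = \<one>"
    and \<psi>: "\<And>j. \<psi> j \<in> CG" "\<And>j. \<psi> j \<one> = 0"
    and loc: "\<And>m A. smG m (Rn m) A \<Longrightarrow> A (\<lambda>_. 0) = \<one> \<Longrightarrow>
      \<exists>d>0. \<forall>z\<in>Rn m. (\<forall>i<m. \<bar>z i\<bar> < d) \<longrightarrow> A z = h (\<lambda>j. if j < dm then \<psi> j (A z) else 0)"
    by (rule local_coords) (rule that)
  define H where "H y = c (mk_simplex 1 (\<lambda>s. h (\<lambda>j. if j < dm then s 0 * y j else 0)))" for y :: "nat \<Rightarrow> real"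
  have HF: "smG (dm + 1) (Rn (dm + 1)) (\<lambda>z. h (\<lambda>j. if j < dm then z dm * z j else 0))"
    by (rule smG_compose[OF h(1)]) (auto simp: Rn_iff intro!: smooth_fun_intros)
  have H: "smooth_fun dm (Rn dm) H"
    using smooth_cochain_family[OF c HF] unfolding H_def by (simp add: concat_coords_def cong: if_cong)
  show thesis
  proof (rule that[of \<psi> "\<lambda>j. pd j H (\<lambda>_. 0)"])
    show "\<psi> j \<in> CG" for j by (rule \<psi>(1))
    fix p assume p: "smG 1 (Rn 1) (\<lambda>z. p (z 0))" and p0: "p 0 = \<one>"
    have "smooth1 (\<lambda>t. \<psi> j (p t))" for j using p \<psi>(1) by (simp add: smG_iff smooth1_def)
    then have "\<exists>P. smooth1 P \<and> (\<forall>t. \<psi> j (p t) = t * P t) \<and> P 0 = deriv (\<lambda>t. \<psi> j (p t)) 0" for j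
      by (rule smooth1_hadamard) (use p0 \<psi>(2) in auto)
    then obtain P where P: "\<And>j. smooth1 (P j)" "\<And>j t. \<psi> j (p t) = t * P j t"
      "\<And>j. P j 0 = deriv (\<lambda>t. \<psi> j (p t)) 0" by metis
    \<comment> \<open>The path at time \<open>t\<close> is the member \<open>x 0 = x 1 = t\<close> of this two-parameter family.\<close>
    define K where "K x = c (mk_simplex 1 (\<lambda>s. h (\<lambda>j. if j < dm then x 0 * s 0 * P j (x 1 * s 0) else 0)))" for x :: "nat \<Rightarrow> real"
    have KF: "smG (2 + 1) (Rn (2 + 1)) (\<lambda>z. h (\<lambda>j. if j < dm then z 0 * z 2 * P j (z 1 * z 2) else 0))"
      by (rule smG_compose[OF h(1)]) (auto simp: Rn_iff intro!: smooth_fun_intros smooth1_compose[OF P(1)])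
    have K: "smooth_fun 2 (Rn 2) K"
      using smooth_cochain_family[OF c KF] unfolding K_def by (simp add: concat_coords_def cong: if_cong)
    obtain d where d: "d > 0" "\<And>z. z \<in> Rn 1 \<Longrightarrow> (\<forall>i<1. \<bar>z i\<bar> < d) \<Longrightarrow> p (z 0) = h (\<lambda>j. if j < dm then \<psi> j (p (z 0)) else 0)"
      using loc[OF p] p0 by metis
    have eq: "c (mk_simplex 1 (\<lambda>s. p (t * s 0))) = K (rvec [t, t])" if t: "\<bar>t\<bar> < d" for t
    proof -
      have "p (t * s 0) = h (\<lambda>j. if j < dm then t * s 0 * P j (t * s 0) else 0)" if "s \<in> Delta 1" for s
      proof -
        have "\<bar>s 0\<bar> \<le> 1" using that by (auto simp: Delta_def)
        then have "\<bar>t\<bar> * \<bar>s 0\<bar> \<le> \<bar>t\<bar> * 1" by (intro mult_left_mono) auto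
        then have "\<bar>t * s 0\<bar> < d" using t by (simp add: abs_mult)
        then show ?thesis using d(2)[of "rvec [t * s 0]"] by (simp add: rvec_Rn P(2)[symmetric] cong: if_cong) (simp add: rvec_def cong: if_cong)
      qed
      then show ?thesis unfolding K_def by (intro arg_cong[where f = c] mk_simplex_cong) (simp add: rvec_def cong: if_cong)
    qed
    have D: "((\<lambda>t. K (rvec [t, t])) has_real_derivative (\<Sum>j<2. pd j K (rvec [0, 0]) * 1)) (at 0)"
    proof (rule smooth_chain_rule[OF _ K, where G = "\<lambda>t. rvec [t, t]"])
      fix j :: nat assume "j < 2"
      then show "((\<lambda>t. rvec [t, t] j) has_real_derivative 1) (at 0)"
        by (auto simp: rvec_def less_2_cases_iff)
    qed (auto simp: rvec_Rn)
    \<comment> \<open>For \<open>x 0 = 0\<close> the path is constant, hence thin.\<close>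
    have K1: "pd 1 K (rvec [0, 0]) = 0"
    proof (rule pd_eqI)
      have "K ((rvec [0, 0])(1 := s)) = 0" for s
        using smooth_cochain_const[OF c one_closed] h(2) by (simp add: K_def rvec_def cong: if_cong)
      then show "((\<lambda>s. K ((rvec [0, 0])(1 := s))) has_real_derivative 0) (at (rvec [0, 0] 1))" by simp
    qed
    \<comment> \<open>For \<open>x 1 = 0\<close> the path is a straight segment in the coordinates.\<close>
    have K0: "pd 0 K (rvec [0, 0]) = (\<Sum>j<dm. pd j H (\<lambda>_. 0) * P j 0)"
    proof (rule pd_eqI)
      let ?G = "\<lambda>s j. if j < dm then s * P j 0 else 0"
      have "K ((rvec [0, 0])(0 := s)) = H (?G s)" for s
        unfolding K_def H_def by (simp add: rvec_def mult_ac cong: if_cong)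
      moreover have "((\<lambda>s. H (?G s)) has_real_derivative (\<Sum>j<dm. pd j H (?G 0) * P j 0)) (at 0)"
        by (rule smooth_chain_rule[OF _ H, where G = ?G]) (auto simp: Rn_iff intro!: derivative_eq_intros)
      ultimately show "((\<lambda>s. K ((rvec [0, 0])(0 := s))) has_real_derivative (\<Sum>j<dm. pd j H (\<lambda>_. 0) * P j 0)) (at (rvec [0, 0] 0))"
        by (simp add: rvec_def cong: if_cong)
    qed
    have lt2: "{..<2::nat} = {0, 1}" by auto
    have D': "((\<lambda>t. K (rvec [t, t])) has_real_derivative (\<Sum>j<dm. pd j H (\<lambda>_. 0) * P j 0)) (at 0)"
      using D unfolding lt2 using K0 K1 by simp
    have "eventually (\<lambda>t. \<bar>t\<bar> < d) (nhds (0::real))"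
      using d(1) eventually_nhds_metric[of "\<lambda>t. \<bar>t\<bar> < d" "0::real"] by (auto simp: dist_real_def)
    then have "eventually (\<lambda>t. K (rvec [t, t]) = c (mk_simplex 1 (\<lambda>s. p (t * s 0)))) (nhds 0)"
      by eventually_elim (rule eq[symmetric])
    from D' DERIV_cong_ev[OF refl this refl]
    show "((\<lambda>t. c (mk_simplex 1 (\<lambda>s. p (t * s 0)))) has_real_derivative
        (\<Sum>j<dm. pd j H (\<lambda>_. 0) * deriv (\<lambda>t. \<psi> j (p t)) 0)) (at 0)"
      by (simp add: P(3))
  qed
qed

text \<open>
  Both mixed derivatives agree with that of the square \<open>h(x\<^sub>0 u\<^sub>0 p + x\<^sub>1 u\<^sub>1 q)\<close> which is linear
  in the coordinates \<open>h\<close>, with \<open>p\<close> and \<open>q\<close> the common first partial derivatives.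
\<close>

lemma tau_mixed_derivative_first_order:
  assumes c: "smooth_cochain c"
    and A: "smG 2 (Rn 2) (\<lambda>z. A (z 0) (z 1))" "A 0 0 = \<one>"
    and A': "smG 2 (Rn 2) (\<lambda>z. A' (z 0) (z 1))" "A' 0 0 = \<one>"
    and same: "\<And>f i. f \<in> CG \<Longrightarrow> i < 2 \<Longrightarrow>
      pd i (\<lambda>z. f (A (z 0) (z 1))) (\<lambda>_. 0) = pd i (\<lambda>z. f (A' (z 0) (z 1))) (\<lambda>_. 0)"
  shows "pd 0 (pd 1 (\<lambda>x. tau 2 c (\<lambda>u. A (x 0 * u 0) (x 1 * u 1)))) (rvec [0, 0]) =
    pd 0 (pd 1 (\<lambda>x. tau 2 c (\<lambda>u. A' (x 0 * u 0) (x 1 * u 1)))) (rvec [0, 0])"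
proof -
  obtain h \<psi> where h: "smG dm (Rn dm) h" "h (\<lambda>_. 0) = \<one>"
    and \<psi>: "\<And>j. \<psi> j \<in> CG" "\<And>j. \<psi> j \<one> = 0"
    and loc: "\<And>m A. smG m (Rn m) A \<Longrightarrow> A (\<lambda>_. 0) = \<one> \<Longrightarrow>
      \<exists>d>0. \<forall>z\<in>Rn m. (\<forall>i<m. \<bar>z i\<bar> < d) \<longrightarrow> A z = h (\<lambda>j. if j < dm then \<psi> j (A z) else 0)"
    by (rule local_coords) (rule that)
  \<comment> \<open>The value of \<open>\<tau>(c)\<close> on the linear square with edge directions \<open>p\<close> and \<open>q\<close>.\<close>
  define E where "E p q x = tau 2 c (\<lambda>u. h (\<lambda>j. if j < dm then x 0 * u 0 * p j + x 1 * u 1 * q j else 0))"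
    for p q and x :: "nat \<Rightarrow> real"
  have hcurve: "smG 1 (Rn 1) (\<lambda>z. h (\<lambda>j. if j < dm then f j (z 0) else 0))" if "\<And>j. smooth1 (f j)" for f
    by (rule smG_compose[OF h(1)]) (use that in \<open>auto simp: Rn_iff smooth1_def\<close>)
  have main: "pd 0 (pd 1 (\<lambda>x. tau 2 c (\<lambda>u. A (x 0 * u 0) (x 1 * u 1)))) (rvec [0, 0]) =
      pd 0 (pd 1 (E (\<lambda>j. pd 0 (\<lambda>z. \<psi> j (A (z 0) (z 1))) (\<lambda>_. 0)) (\<lambda>j. pd 1 (\<lambda>z. \<psi> j (A (z 0) (z 1))) (\<lambda>_. 0)))) (rvec [0, 0])"
    if A: "smG 2 (Rn 2) (\<lambda>z. A (z 0) (z 1))" "A 0 0 = \<one>" for A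
  proof -
    have "smooth2 (\<lambda>s t. \<psi> j (A s t))" for j using A \<psi>(1) by (simp add: smG_iff smooth2_def)
    then have "\<exists>P Q B. smooth1 P \<and> smooth1 Q \<and> smooth2 B \<and>
        (\<forall>s t. \<psi> j (A s t) = s * P s + t * Q t + s * t * B s t) \<and>
        P 0 = pd 0 (\<lambda>z. \<psi> j (A (z 0) (z 1))) (\<lambda>_. 0) \<and> Q 0 = pd 1 (\<lambda>z. \<psi> j (A (z 0) (z 1))) (\<lambda>_. 0)" for j
      by (rule smooth2_hadamard) (use A \<psi>(2) in auto)
    then have "\<forall>j. \<exists>P Q B. smooth1 P \<and> smooth1 Q \<and> smooth2 B \<and>
        (\<forall>s t. \<psi> j (A s t) = s * P s + t * Q t + s * t * B s t) \<and>
        P 0 = pd 0 (\<lambda>z. \<psi> j (A (z 0) (z 1))) (\<lambda>_. 0) \<and> Q 0 = pd 1 (\<lambda>z. \<psi> j (A (z 0) (z 1))) (\<lambda>_. 0)" by (rule allI)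
    from choice[OF this] obtain P where "\<forall>j. \<exists>Q B. smooth1 (P j) \<and> smooth1 Q \<and> smooth2 B \<and>
        (\<forall>s t. \<psi> j (A s t) = s * (P j) s + t * Q t + s * t * B s t) \<and>
        (P j) 0 = pd 0 (\<lambda>z. \<psi> j (A (z 0) (z 1))) (\<lambda>_. 0) \<and> Q 0 = pd 1 (\<lambda>z. \<psi> j (A (z 0) (z 1))) (\<lambda>_. 0)"
      by (rule exE) (rule that)
    from choice[OF this] obtain Q where "\<forall>j. \<exists>B. smooth1 (P j) \<and> smooth1 (Q j) \<and> smooth2 B \<and>
        (\<forall>s t. \<psi> j (A s t) = s * (P j) s + t * (Q j) t + s * t * B s t) \<and>
        (P j) 0 = pd 0 (\<lambda>z. \<psi> j (A (z 0) (z 1))) (\<lambda>_. 0) \<and> (Q j) 0 = pd 1 (\<lambda>z. \<psi> j (A (z 0) (z 1))) (\<lambda>_. 0)"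
      by (rule exE) (rule that)
    from choice[OF this] obtain B where PQB_all: "\<forall>j. smooth1 (P j) \<and> smooth1 (Q j) \<and> smooth2 (B j) \<and>
        (\<forall>s t. \<psi> j (A s t) = s * (P j) s + t * (Q j) t + s * t * (B j) s t) \<and>
        (P j) 0 = pd 0 (\<lambda>z. \<psi> j (A (z 0) (z 1))) (\<lambda>_. 0) \<and> (Q j) 0 = pd 1 (\<lambda>z. \<psi> j (A (z 0) (z 1))) (\<lambda>_. 0)"
      by (rule exE) (rule that)
    note PQB' = PQB_all[rule_format]
    have P: "\<And>j. smooth1 (P j)" and Q: "\<And>j. smooth1 (Q j)" and B: "\<And>j. smooth2 (B j)"
      and PQB: "\<And>j s t. \<psi> j (A s t) = s * P j s + t * Q j t + s * t * B j s t"
      and P0: "\<And>j. P j 0 = pd 0 (\<lambda>z. \<psi> j (A (z 0) (z 1))) (\<lambda>_. 0)"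
      and Q0: "\<And>j. Q j 0 = pd 1 (\<lambda>z. \<psi> j (A (z 0) (z 1))) (\<lambda>_. 0)"
      using PQB' by (simp_all only: simp_thms)
    define \<Phi> where "\<Phi> x = tau 2 c (\<lambda>u. A (x 0 * u 0) (x 1 * u 1))" for x :: "nat \<Rightarrow> real"
    \<comment> \<open>The parameters that occur in the square are made independent: \<open>\<Phi> x\<close> is the value of \<open>K\<close> at
      \<open>(x 0, x 1, x 0 * x 1, x 0, x 1)\<close>.\<close>
    define K where "K x = tau 2 c (\<lambda>u. h (\<lambda>j. if j < dm then x 0 * u 0 * P j (x 3 * u 0) + x 1 * u 1 * Q j (x 4 * u 1)
        + x 2 * u 0 * u 1 * B j (x 3 * u 0) (x 4 * u 1) else 0))" for x :: "nat \<Rightarrow> real"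
    have KF: "smG (5 + 2) (Rn (5 + 2)) (\<lambda>z. h (\<lambda>j. if j < dm then z 0 * z 5 * P j (z 3 * z 5) + z 1 * z 6 * Q j (z 4 * z 6)
        + z 2 * z 5 * z 6 * B j (z 3 * z 5) (z 4 * z 6) else 0))"
      by (rule smG_compose[OF h(1)])
        (auto simp: Rn_iff intro!: smooth_fun_intros smooth1_compose[OF P] smooth1_compose[OF Q] smooth2_compose[OF B])
    have K: "smooth_fun 5 (Rn 5) K"
      using tau_family[OF c KF] unfolding K_def by (simp add: concat_coords_def cong: if_cong)
    obtain d where d: "d > 0" "\<And>z. z \<in> Rn 2 \<Longrightarrow> (\<forall>i<2. \<bar>z i\<bar> < d) \<Longrightarrow>
        A (z 0) (z 1) = h (\<lambda>j. if j < dm then \<psi> j (A (z 0) (z 1)) else 0)"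
      using loc[OF A(1)] A(2) by metis
    define U where "U = {x \<in> Rn 2. \<forall>i<2. \<bar>x i - 0\<bar> < d}"
    have U: "open_Rn 2 U" unfolding U_def by (rule open_Rn_Collect_abs_less)
    have inU: "rvec [s, t] \<in> U" if "\<bar>s\<bar> < d" "\<bar>t\<bar> < d" for s t
      using that by (auto simp: U_def rvec_Rn less_2_cases_iff) (auto simp: rvec_def)
    have \<Phi>K: "\<Phi> x = K (rvec [x 0, x 1, x 0 * x 1, x 0, x 1])" if x: "x \<in> U" for x
      unfolding \<Phi>_def K_def
    proof (rule tau_cong)
      fix u assume u: "u \<in> Cube 2"
      have small: "\<bar>x i * u i\<bar> < d" if "i < 2" for i
      proof -
        have "\<bar>u i\<bar> \<le> 1" using u that by (auto simp: Cube_def)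
        then have "\<bar>x i\<bar> * \<bar>u i\<bar> \<le> \<bar>x i\<bar> * 1" by (intro mult_left_mono) auto
        then show ?thesis using x that by (auto simp: abs_mult U_def intro: le_less_trans)
      qed
      have "A (x 0 * u 0) (x 1 * u 1) = h (\<lambda>j. if j < dm then \<psi> j (A (x 0 * u 0) (x 1 * u 1)) else 0)"
        using d(2)[of "rvec [x 0 * u 0, x 1 * u 1]"] small[of 0] small[of 1]
        by (simp add: rvec_Rn less_2_cases_iff cong: if_cong) (simp add: rvec_def cong: if_cong)
      then show "A (x 0 * u 0) (x 1 * u 1) = h (\<lambda>j. if j < dm then
          rvec [x 0, x 1, x 0 * x 1, x 0, x 1] 0 * u 0 * P j (rvec [x 0, x 1, x 0 * x 1, x 0, x 1] 3 * u 0) +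
          rvec [x 0, x 1, x 0 * x 1, x 0, x 1] 1 * u 1 * Q j (rvec [x 0, x 1, x 0 * x 1, x 0, x 1] 4 * u 1) +
          rvec [x 0, x 1, x 0 * x 1, x 0, x 1] 2 * u 0 * u 1 *
            B j (rvec [x 0, x 1, x 0 * x 1, x 0, x 1] 3 * u 0) (rvec [x 0, x 1, x 0 * x 1, x 0, x 1] 4 * u 1) else 0)"
        unfolding PQB by (simp add: rvec_def mult_ac cong: if_cong)
    qed
    have Kv: "K (rvec [w, z, r, s, t]) = tau 2 c (\<lambda>u. h (\<lambda>j. if j < dm then w * u 0 * P j (s * u 0) + z * u 1 * Q j (t * u 1)
        + r * u 0 * u 1 * B j (s * u 0) (t * u 1) else 0))" for w z r s t
      by (simp add: K_def rvec_def cong: if_cong)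
    \<comment> \<open>In the next three cases the square factors through \<open>u 0\<close>, through \<open>u 1\<close>, and through \<open>u 0 * u 1\<close>.\<close>
    have T1: "K (rvec [w, 0, 0, s, t]) = 0" for w s t
      unfolding Kv
    proof (rule tau_thin[OF c, where f = "\<lambda>a b. a" and \<gamma> = "\<lambda>v. h (\<lambda>j. if j < dm then w * v * P j (s * v) else 0)"])
      show "smG 1 (Rn 1) (\<lambda>za. h (\<lambda>j. if j < dm then w * za 0 * P j (s * za 0) else 0))"
        by (rule hcurve[of "\<lambda>j v. w * v * P j (s * v)"])
          (auto simp: smooth1_def intro!: smooth_fun_intros smooth1_compose[OF P])
    qed (auto simp: smooth2_def smooth_fun_coord cong: if_cong)
    have T2: "K (rvec [0, z, 0, s, t]) = 0" for z s t
      unfolding Kv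
    proof (rule tau_thin[OF c, where f = "\<lambda>a b. b" and \<gamma> = "\<lambda>v. h (\<lambda>j. if j < dm then z * v * Q j (t * v) else 0)"])
      show "smG 1 (Rn 1) (\<lambda>za. h (\<lambda>j. if j < dm then z * za 0 * Q j (t * za 0) else 0))"
        by (rule hcurve[of "\<lambda>j v. z * v * Q j (t * v)"])
          (auto simp: smooth1_def intro!: smooth_fun_intros smooth1_compose[OF Q])
    qed (auto simp: smooth2_def smooth_fun_coord cong: if_cong)
    have T3: "K (rvec [0, 0, r, 0, 0]) = 0" for r
      unfolding Kv
    proof (rule tau_thin[OF c, where f = "\<lambda>a b. a * b" and \<gamma> = "\<lambda>v. h (\<lambda>j. if j < dm then r * v * B j 0 0 else 0)"])
      show "smG 1 (Rn 1) (\<lambda>z. h (\<lambda>j. if j < dm then r * z 0 * B j 0 0 else 0))"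
        by (rule hcurve[of "\<lambda>j v. r * v * B j 0 0"]) (auto simp: smooth1_def intro!: smooth_fun_intros)
      show "h (\<lambda>j. if j < dm then 0 * u 0 * P j (0 * u 0) + 0 * u 1 * Q j (0 * u 1) + r * u 0 * u 1 * B j (0 * u 0) (0 * u 1) else 0)
          = h (\<lambda>j. if j < dm then r * (u 0 * u 1) * B j 0 0 else 0)" for u
        by (simp add: mult_ac cong: if_cong)
    qed (auto simp: smooth2_def intro!: smooth_fun_intros)
    have lt5: "{..<5::nat} = {0, 1, 2, 3, 4}" by auto
    have lt5': "j = 0 \<or> j = 1 \<or> j = 2 \<or> j = 3 \<or> j = 4" if "j < 5" for j :: nat using that by auto
    have pdK: "smooth_fun 5 (Rn 5) (pd i K)" if "i < 5" for i by (rule smooth_fun_pd(1)[OF _ K that]) simp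
    have R5: "rvec [a1, a2, a3, a4, a5] \<in> Rn 5" for a1 a2 a3 a4 a5 by (rule rvec_Rn) simp
    have z4: "pd 4 K (rvec [s, 0, 0, s, 0]) = 0" for s
    proof (rule pd_eqI)
      have "(rvec [s, 0, 0, s, 0])(4 := t) = rvec [s, 0, 0, s, t]" for t by (subst rvec_upd) (auto simp: numeral_eq_Suc)
      then show "((\<lambda>t. K ((rvec [s, 0, 0, s, 0])(4 := t))) has_real_derivative 0) (at (rvec [s, 0, 0, s, 0] 4))"
        by (simp add: T1)
    qed
    have z2: "pd 2 K (rvec [0, 0, 0, 0, 0]) = 0"
    proof (rule pd_eqI)
      have "(rvec [0, 0, 0, 0, 0])(2 := t) = rvec [0, 0, t, 0, 0]" for t by (subst rvec_upd) (auto simp: numeral_eq_Suc)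
      then show "((\<lambda>t. K ((rvec [0, 0, 0, 0, 0])(2 := t))) has_real_derivative 0) (at (rvec [0, 0, 0, 0, 0] 2))"
        by (simp add: T3)
    qed
    have z1: "pd 1 K (rvec [0, 0, 0, s, 0]) = 0" for s
    proof (rule pd_eqI)
      have "(rvec [0, 0, 0, s, 0])(1 := t) = rvec [0, t, 0, s, 0]" for t by (subst rvec_upd) (auto simp: numeral_eq_Suc)
      then show "((\<lambda>t. K ((rvec [0, 0, 0, s, 0])(1 := t))) has_real_derivative 0) (at (rvec [0, 0, 0, s, 0] 1))"
        by (simp add: T2)
    qed
    have z31: "pd 3 (pd 1 K) (rvec [0, 0, 0, 0, 0]) = 0"
    proof (rule pd_eqI)
      have "(rvec [0, 0, 0, 0, 0])(3 := t) = rvec [0, 0, 0, t, 0]" for t by (subst rvec_upd) (auto simp: numeral_eq_Suc)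
      then show "((\<lambda>t. pd 1 K ((rvec [0, 0, 0, 0, 0])(3 := t))) has_real_derivative 0) (at (rvec [0, 0, 0, 0, 0] 3))"
        by (simp add: z1 del: One_nat_def)
    qed
    \<comment> \<open>Of the five terms of the chain rule, only those of the parameters 1 and 2 remain: parameters 0 and 3 do
      not depend on the variable, and \<open>K\<close> is constant in parameter 4 by thinness.\<close>
    have pd1: "pd 1 \<Phi> (rvec [s, 0]) = pd 1 K (rvec [s, 0, 0, s, 0]) + s * pd 2 K (rvec [s, 0, 0, s, 0])" if s: "\<bar>s\<bar> < d" for s
    proof -
      have "pd 1 \<Phi> (rvec [s, 0]) = pd 1 (\<lambda>x. K (rvec [x 0, x 1, x 0 * x 1, x 0, x 1])) (rvec [s, 0])"
        by (rule pd_cong_open[OF U inU _ \<Phi>K]) (use s d in auto)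
      also have "\<dots> = (\<Sum>j<5. pd j K (rvec [s, 0, s * 0, s, 0]) * rvec [0, 1, s, 0, 1] j)"
      proof (rule pd_eqI)
        have "((\<lambda>t. K (rvec [s, t, s * t, s, t])) has_real_derivative
            (\<Sum>j<5. pd j K (rvec [s, 0, s * 0, s, 0]) * rvec [0, 1, s, 0, 1] j)) (at 0)"
        proof (rule smooth_chain_rule[OF _ K, where G = "\<lambda>t. rvec [s, t, s * t, s, t]"])
          fix j :: nat assume "j < 5"
          then show "((\<lambda>t. rvec [s, t, s * t, s, t] j) has_real_derivative rvec [0, 1, s, 0, 1] j) (at 0)"
            by (auto simp: rvec_def dest!: lt5' intro!: derivative_eq_intros)
        qed (auto simp: R5)
        then show "((\<lambda>t. (\<lambda>x. K (rvec [x 0, x 1, x 0 * x 1, x 0, x 1])) ((rvec [s, 0])(1 := t))) has_real_derivative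
            (\<Sum>j<5. pd j K (rvec [s, 0, s * 0, s, 0]) * rvec [0, 1, s, 0, 1] j)) (at (rvec [s, 0] 1))"
          by (simp add: rvec_upd) (simp add: rvec_def)
      qed
      also have "\<dots> = pd 1 K (rvec [s, 0, 0, s, 0]) + s * pd 2 K (rvec [s, 0, 0, s, 0])"
        unfolding lt5 using z4[of s] by (simp add: rvec_def)
      finally show ?thesis .
    qed
    have M: "((\<lambda>s. f (rvec [s, 0, 0, s, 0])) has_real_derivative
        pd 0 f (rvec [0, 0, 0, 0, 0]) + pd 3 f (rvec [0, 0, 0, 0, 0])) (at 0)"
      if f: "smooth_fun 5 (Rn 5) f" for f
    proof -
      have "((\<lambda>s. f (rvec [s, 0, 0, s, 0])) has_real_derivative
          (\<Sum>j<5. pd j f (rvec [0, 0, 0, 0, 0]) * rvec [1, 0, 0, 1, 0] j)) (at 0)"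
      proof (rule smooth_chain_rule[OF _ f, where G = "\<lambda>s. rvec [s, 0, 0, s, 0]"])
        fix j :: nat assume "j < 5"
        then show "((\<lambda>s. rvec [s, 0, 0, s, 0] j) has_real_derivative rvec [1, 0, 0, 1, 0] j) (at 0)"
          by (auto simp: rvec_def dest!: lt5' intro!: derivative_eq_intros)
      qed (auto simp: R5)
      then show ?thesis unfolding lt5 by (simp add: rvec_def)
    qed
    \<comment> \<open>Differentiating once more, the parameters 2 and 3 contribute nothing by thinness.\<close>
    have D: "((\<lambda>s. pd 1 K (rvec [s, 0, 0, s, 0]) + s * pd 2 K (rvec [s, 0, 0, s, 0])) has_real_derivative
        pd 0 (pd 1 K) (rvec [0, 0, 0, 0, 0])) (at 0)"
      using DERIV_add[OF M[OF pdK[of 1]] DERIV_mult[OF DERIV_ident M[OF pdK[of 2]]]] z31 z2 by (simp del: One_nat_def)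
    have ev: "eventually (\<lambda>s. pd 1 K (rvec [s, 0, 0, s, 0]) + s * pd 2 K (rvec [s, 0, 0, s, 0]) = pd 1 \<Phi> (rvec [s, 0])) (nhds 0)"
    proof -
      have "eventually (\<lambda>s. \<bar>s\<bar> < d) (nhds (0::real))"
        using d(1) eventually_nhds_metric[of "\<lambda>t. \<bar>t\<bar> < d" "0::real"] by (auto simp: dist_real_def)
      then show ?thesis by eventually_elim (rule pd1[symmetric])
    qed
    have "((\<lambda>s. pd 1 \<Phi> (rvec [s, 0])) has_real_derivative pd 0 (pd 1 K) (rvec [0, 0, 0, 0, 0])) (at 0)"
      by (rule iffD1[OF DERIV_cong_ev[OF refl ev refl] D])
    then have "pd 0 (pd 1 \<Phi>) (rvec [0, 0]) = pd 0 (pd 1 K) (rvec [0, 0, 0, 0, 0])"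
      by (intro pd_eqI) (simp add: rvec_upd del: One_nat_def, simp add: rvec_def del: One_nat_def)
    also have "\<dots> = pd 0 (pd 1 (E (\<lambda>j. P j 0) (\<lambda>j. Q j 0))) (rvec [0, 0])"
    proof -
      have "K (rvec [w, z, 0, 0, 0]) = E (\<lambda>j. P j 0) (\<lambda>j. Q j 0) (rvec [w, z])" for w z
        unfolding Kv E_def by (simp add: rvec_def cong: if_cong)
      then have "pd 1 K (rvec [w, 0, 0, 0, 0]) = pd 1 (E (\<lambda>j. P j 0) (\<lambda>j. Q j 0)) (rvec [w, 0])" for w
        by (simp add: pd_def rvec_upd) (simp add: rvec_def)
      note eq = this
      have l: "pd 0 f (rvec [0, 0, 0, 0, 0]) = deriv (\<lambda>w. f (rvec [w, 0, 0, 0, 0])) 0" for f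
        by (simp add: pd_def rvec_upd) (simp add: rvec_def)
      have r: "pd 0 f (rvec [0, 0]) = deriv (\<lambda>w. f (rvec [w, 0])) 0" for f
        by (simp add: pd_def rvec_upd) (simp add: rvec_def)
      show ?thesis by (simp only: l r eq)
    qed
    finally show ?thesis unfolding \<Phi>_def P0 Q0 .
  qed
  have "(\<lambda>j. pd i (\<lambda>z. \<psi> j (A (z 0) (z 1))) (\<lambda>_. 0)) = (\<lambda>j. pd i (\<lambda>z. \<psi> j (A' (z 0) (z 1))) (\<lambda>_. 0))" if "i < 2" for i
    using same[OF \<psi>(1) that] by (intro ext)
  then show ?thesis unfolding main[OF A] main[OF A'] by simp
qed

end

section \<open>Tensor products of graded vector spaces\<close>

lemma linear_functionals_separate:
  fixes x y :: "'a::real_vector"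
  assumes "\<And>l :: 'a \<Rightarrow> real. linear l \<Longrightarrow> l x = l y"
  shows "x = y"
proof (rule ccontr)
  assume "x \<noteq> y"
  then have "independent {x - y}" by simp
  then obtain l :: "'a \<Rightarrow> real" where l: "linear l" "\<forall>z\<in>{x - y}. l z = 1"
    using linear_independent_extend[of "{x - y}" "\<lambda>_. 1"] by blast
  then have "l x - l y = 1" by (simp add: linear_diff)
  then show False using assms[OF l(1)] by simp
qed

text \<open>
  Tensors are defined by their values on real bilinear forms. For a map \<open>B\<close> with values in a vector
  space \<open>'c\<close>, the sum of \<open>B\<close> over a representing list does not depend on the list, as linear functionals
  separate the points of \<open>'c\<close>.
\<close>

lemma tensor_lift:
  fixes B :: "'a::real_vector \<Rightarrow> 'b::real_vector \<Rightarrow> 'c::real_vector"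
  assumes B: "bilinear B"
  obtains F where "linear F" "\<And>a b. F (a \<otimes>\<^sub>t b) = B a b"
proof -
  let ?ev = "\<lambda>xs. \<lambda>B :: 'a \<Rightarrow> 'b \<Rightarrow> real. if bilinear B then (\<Sum>(a, b)\<leftarrow>xs. B a b) else 0"
  define rp where "rp T = (SOME xs. Rep_tensor T = ?ev xs)" for T :: "('a, 'b) tensor"
  have rp: "Rep_tensor T = ?ev (rp T)" for T
  proof -
    have "\<exists>xs. Rep_tensor T = ?ev xs" using Rep_tensor[of T] by (simp only: mem_Collect_eq)
    then show ?thesis unfolding rp_def by (rule someI_ex)
  qed
  have lB: "bilinear (\<lambda>a b. l (B a b))" if "linear l" for l :: "'c \<Rightarrow> real"
    unfolding bilinear_def
  proof (intro conjI allI)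
    fix x y
    have "linear (B x)" "linear (\<lambda>x. B x y)" using B by (auto simp: bilinear_def)
    then show "linear (\<lambda>y. l (B x y))" "linear (\<lambda>x. l (B x y))"
      using linear_compose[of "B x" l] linear_compose[of "\<lambda>x. B x y" l] that by (auto simp: o_def)
  qed
  define F where "F T = (\<Sum>(a, b)\<leftarrow>rp T. B a b)" for T
  have lF: "l (F T) = Rep_tensor T (\<lambda>a b. l (B a b))" if l: "linear l" for l :: "'c \<Rightarrow> real" and T
  proof -
    have "l (\<Sum>(a, b)\<leftarrow>xs. B a b) = (\<Sum>(a, b)\<leftarrow>xs. l (B a b))" for xs
      by (induction xs) (auto simp: linear_0[OF l] linear_add[OF l])
    then show ?thesis unfolding F_def rp using lB[OF l] by simp
  qed
  show thesis
  proof (rule that[of F])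
    show "linear F"
    proof (rule linearI)
      fix S T :: "('a, 'b) tensor" and r :: real
      show "F (S + T) = F S + F T"
        by (rule linear_functionals_separate) (simp add: lF linear_add plus_tensor.rep_eq)
      show "F (r *\<^sub>R S) = r *\<^sub>R F S"
        by (rule linear_functionals_separate) (simp add: lF linear_scale scaleR_tensor.rep_eq)
    qed
    show "F (a \<otimes>\<^sub>t b) = B a b" for a b
      by (rule linear_functionals_separate) (simp add: lF lB tens.rep_eq)
  qed
qed

lemma linear_tens_eqI:
  fixes F F' :: "('a::real_vector, 'b::real_vector) tensor \<Rightarrow> 'c::real_vector"
  assumes "linear F" "linear F'" "\<And>a b. F (a \<otimes>\<^sub>t b) = F' (a \<otimes>\<^sub>t b)"
  shows "F = F'"
proof
  fix T :: "('a, 'b) tensor"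
  have "T \<in> span {a \<otimes>\<^sub>t b | a b. True}" unfolding span_tens by (rule UNIV_I)
  then show "F T = F' T" by (rule linear_eq_on[OF assms(1,2)]) (use assms(3) in auto)
qed

lemmas tens_simps = bilinear_ladd[OF bilinear_tens] bilinear_radd[OF bilinear_tens]
  bilinear_lmul[OF bilinear_tens] bilinear_rmul[OF bilinear_tens]
  bilinear_lzero[OF bilinear_tens] bilinear_rzero[OF bilinear_tens]
  bilinear_lsub[OF bilinear_tens] bilinear_rsub[OF bilinear_tens]

lemma linear_tens_left: "linear (\<lambda>a. a \<otimes>\<^sub>t b)" and linear_tens_right: "linear (\<lambda>b. a \<otimes>\<^sub>t b)"
  using bilinear_tens by (auto simp: bilinear_def)

section \<open>Graded components\<close>

lemma ksign_add: "ksign (a + b) = ksign a * ksign b" and ksign_sq [simp]: "ksign a * ksign a = 1"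
  and ksign_0 [simp]: "ksign 0 = 1"
  by (auto simp: ksign_def)

lemma ksign_sq' [simp]: "ksign a * (ksign a * x) = x"
  by (auto simp: ksign_def)

text \<open>
  The component of degree \<open>i\<close> of a vector, in the decomposition provided by \<open>fd_complex\<close>.
\<close>

definition cmp :: "('v::real_vector) cplx \<Rightarrow> 'v \<Rightarrow> int \<Rightarrow> 'v" where
  "cmp C v = (THE c. (\<forall>i. c i \<in> gr C i) \<and> finite {i. c i \<noteq> 0} \<and> v = (\<Sum>i | c i \<noteq> 0. c i))"

context
  fixes C :: "('v::real_vector) cplx"
  assumes C: "fd_complex C"
begin

lemma gr_subspace: "subspace (gr C i)"
  using C by (simp add: fd_complex_def)

lemma dif_linear: "linear (dif C)" and dif_gr: "v \<in> gr C i \<Longrightarrow> dif C v \<in> gr C (i + 1)"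
  and dif_dif: "dif C (dif C v) = 0"
  using C by (auto simp: fd_complex_def image_subset_iff)

lemma cmp_ex1: "\<exists>!c. (\<forall>i. c i \<in> gr C i) \<and> finite {i. c i \<noteq> 0} \<and> v = (\<Sum>i | c i \<noteq> 0. c i)"
  using C unfolding fd_complex_def by (elim conjE, elim allE)

lemma cmp_spec: "(\<forall>i. cmp C v i \<in> gr C i) \<and> finite {i. cmp C v i \<noteq> 0} \<and> v = (\<Sum>i | cmp C v i \<noteq> 0. cmp C v i)"
  unfolding cmp_def by (rule theI'[OF cmp_ex1])

lemma cmp_gr: "cmp C v i \<in> gr C i"
  using cmp_spec by (rule conjE) (rule spec)

lemma cmp_finite: "finite {i. cmp C v i \<noteq> 0}"
  by (rule conjunct1[OF conjunct2[OF cmp_spec]])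

lemma cmp_sum: "v = (\<Sum>i | cmp C v i \<noteq> 0. cmp C v i)"
  by (rule conjunct2[OF conjunct2[OF cmp_spec]])

lemma cmp_eqI:
  assumes c: "\<And>i. c i \<in> gr C i" and S: "finite S" "\<And>i. i \<notin> S \<Longrightarrow> c i = 0" and v: "v = sum c S"
  shows "cmp C v = c"
proof -
  have sub: "{i. c i \<noteq> 0} \<subseteq> S" using S(2) by auto
  have "sum c S = (\<Sum>i | c i \<noteq> 0. c i)"
    by (rule sum.mono_neutral_right[OF S(1) sub]) auto
  then show ?thesis
    unfolding cmp_def using c finite_subset[OF sub S(1)] v
    by (intro the1_equality[OF cmp_ex1]) auto
qed

lemma cmp_sum_superset: "finite S \<Longrightarrow> {i. cmp C v i \<noteq> 0} \<subseteq> S \<Longrightarrow> v = (\<Sum>i\<in>S. cmp C v i)"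
  by (subst cmp_sum) (rule sum.mono_neutral_left, auto)

lemma cmp_add: "cmp C (v + w) i = cmp C v i + cmp C w i"
proof -
  let ?S = "{i. cmp C v i \<noteq> 0} \<union> {i. cmp C w i \<noteq> 0}"
  have "cmp C (v + w) = (\<lambda>i. cmp C v i + cmp C w i)"
  proof (rule cmp_eqI[where S = ?S])
    show "v + w = (\<Sum>i\<in>?S. cmp C v i + cmp C w i)"
      unfolding sum.distrib using cmp_finite by (intro arg_cong2[where f = "(+)"] cmp_sum_superset) auto
  qed (auto simp: cmp_finite intro: subspace_add[OF gr_subspace] cmp_gr)
  then show ?thesis by simp
qed

lemma cmp_scale: "cmp C (r *\<^sub>R v) i = r *\<^sub>R cmp C v i"
proof -
  have "cmp C (r *\<^sub>R v) = (\<lambda>i. r *\<^sub>R cmp C v i)"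
  proof (rule cmp_eqI[where S = "{i. cmp C v i \<noteq> 0}"])
    show "r *\<^sub>R v = (\<Sum>i | cmp C v i \<noteq> 0. r *\<^sub>R cmp C v i)"
      unfolding scaleR_sum_right[symmetric] by (subst cmp_sum) (rule refl)
  qed (auto simp: cmp_finite intro: subspace_scale[OF gr_subspace] cmp_gr)
  then show ?thesis by simp
qed

lemma cmp_linear: "linear (\<lambda>v. cmp C v i)"
  by (rule linearI) (simp_all add: cmp_add cmp_scale)

lemma cmp_hom: assumes "v \<in> gr C i" shows "cmp C v j = (if j = i then v else 0)"
proof -
  have "cmp C v = (\<lambda>j. if j = i then v else 0)"
    by (rule cmp_eqI[where S = "{i}"]) (use assms subspace_0[OF gr_subspace] in auto)
  then show ?thesis by simp
qed

lemma cmp_support: obtains S where "finite S" "\<And>v i. i \<notin> S \<Longrightarrow> cmp C v i = 0"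
proof -
  obtain B :: "'v set" where B: "finite B" "span B = UNIV"
    using C unfolding fd_complex_def by (elim conjE exE) (rule that)
  let ?S = "\<Union>b\<in>B. {i. cmp C b i \<noteq> 0}"
  have "cmp C v i = 0" if "i \<notin> ?S" for v i
  proof -
    have "v \<in> span B" using B by simp
    then show ?thesis
      using linear_eq_on[OF cmp_linear[of i] linear_zero, of v B] that by auto
  qed
  note z = this
  show thesis
  proof (rule that[of ?S])
    show "finite ?S" using B(1) cmp_finite by (intro finite_UN_I)
    show "cmp C v i = 0" if "i \<notin> ?S" for v i by (rule z[OF that])
  qed
qed

lemma linear_hom_eqI:
  assumes "linear F" "linear F'" "\<And>i v. v \<in> gr C i \<Longrightarrow> F v = F' v"
  shows "F = F'"
proof
  fix v
  have "F v = (\<Sum>i | cmp C v i \<noteq> 0. F (cmp C v i))"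
    by (subst cmp_sum) (rule linear_sum[OF assms(1)])
  also have "\<dots> = (\<Sum>i | cmp C v i \<noteq> 0. F' (cmp C v i))"
    using assms(3) cmp_gr by (intro sum.cong) auto
  also have "\<dots> = F' v" by (subst (3) cmp_sum) (rule linear_sum[OF assms(2), symmetric])
  finally show "F v = F' v" .
qed

text \<open>
  The operator \<open>v \<mapsto> (-1)\<^bsup>|v| q\<^esup> v\<close> turns the Koszul sign, which depends on a degree, into a linear map.
\<close>

lemma parity_operator:
  obtains E where "linear E" "\<And>i v. v \<in> gr C i \<Longrightarrow> E v = ksign (i * q) *\<^sub>R v"
proof -
  obtain S where S: "finite S" "\<And>v i. i \<notin> S \<Longrightarrow> cmp C v i = 0" by (rule cmp_support) (rule that)
  define E where "E v = (\<Sum>i\<in>S. ksign (i * q) *\<^sub>R cmp C v i)" for v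
  show thesis
  proof (rule that[of E])
    show "linear E"
      by (rule linearI) (simp_all add: E_def cmp_add cmp_scale scaleR_add_right sum.distrib scaleR_sum_right mult.commute)
    fix i v assume v: "v \<in> gr C i"
    show "E v = ksign (i * q) *\<^sub>R v"
    proof (cases "i \<in> S")
      case True
      have "E v = (\<Sum>j\<in>S. if j = i then ksign (i * q) *\<^sub>R v else 0)"
        unfolding E_def using v by (intro sum.cong) (auto simp: cmp_hom)
      then show ?thesis using True S(1) by simp
    next
      case False
      then have "v = 0" using S(2)[of i v] cmp_hom[OF v, of i] by simp
      then show ?thesis using \<open>linear E\<close> linear_0 by simp
    qed
  qed
qed

lemma nat_tensor_ex1:
  assumes "linear \<phi>" "linear \<psi>"
  shows "\<exists>!F. linear F \<and> (\<forall>i. \<forall>v\<in>gr C i. \<forall>w. F (v \<otimes>\<^sub>t w) = ksign (i * q) *\<^sub>R (\<phi> v \<otimes>\<^sub>t \<psi> w))"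
proof (rule ex_ex1I)
  obtain E where E: "linear E" "\<And>i v. v \<in> gr C i \<Longrightarrow> E v = ksign (i * q) *\<^sub>R v"
    by (rule parity_operator) (rule that)
  have "bilinear (\<lambda>v w. \<phi> (E v) \<otimes>\<^sub>t \<psi> w)"
    unfolding bilinear_def using linear_compose[OF E(1) assms(1)] assms(2)
    by (auto simp: o_def tens_simps linear_add[OF E(1)] linear_add[OF assms(1)] linear_add[OF assms(2)]
        linear_scale[OF E(1)] linear_scale[OF assms(1)] linear_scale[OF assms(2)] intro!: linearI)
  then obtain F where F: "linear F" "\<And>a b. F (a \<otimes>\<^sub>t b) = \<phi> (E a) \<otimes>\<^sub>t \<psi> b" by (rule tensor_lift) (rule that)
  show "\<exists>F. linear F \<and> (\<forall>i. \<forall>v\<in>gr C i. \<forall>w. F (v \<otimes>\<^sub>t w) = ksign (i * q) *\<^sub>R (\<phi> v \<otimes>\<^sub>t \<psi> w))"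
    using F E(2) assms(1) by (intro exI[of _ F]) (auto simp: linear_scale tens_simps)
  fix F F'
  assume a: "linear F \<and> (\<forall>i. \<forall>v\<in>gr C i. \<forall>w. F (v \<otimes>\<^sub>t w) = ksign (i * q) *\<^sub>R (\<phi> v \<otimes>\<^sub>t \<psi> w))"
    and b: "linear F' \<and> (\<forall>i. \<forall>v\<in>gr C i. \<forall>w. F' (v \<otimes>\<^sub>t w) = ksign (i * q) *\<^sub>R (\<phi> v \<otimes>\<^sub>t \<psi> w))"
  show "F = F'"
  proof (rule linear_tens_eqI)
    fix v w
    have "linear (\<lambda>v. F (v \<otimes>\<^sub>t w))" "linear (\<lambda>v. F' (v \<otimes>\<^sub>t w))"
      using a b linear_compose[OF linear_tens_left] by (auto simp: o_def)
    then have "(\<lambda>v. F (v \<otimes>\<^sub>t w)) = (\<lambda>v. F' (v \<otimes>\<^sub>t w))"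
      by (rule linear_hom_eqI) (use a b in auto)
    then show "F (v \<otimes>\<^sub>t w) = F' (v \<otimes>\<^sub>t w)" by (rule fun_cong)
  qed (use a b in auto)
qed

lemma nat_tensor_spec:
  "linear \<phi> \<Longrightarrow> linear \<psi> \<Longrightarrow> linear (nat_tensor C q \<phi> \<psi>) \<and> (\<forall>i. \<forall>v\<in>gr C i. \<forall>w.
    nat_tensor C q \<phi> \<psi> (v \<otimes>\<^sub>t w) = ksign (i * q) *\<^sub>R (\<phi> v \<otimes>\<^sub>t \<psi> w))"
  unfolding nat_tensor_def by (rule theI'[OF nat_tensor_ex1])

lemma nat_tensor_linear: "linear \<phi> \<Longrightarrow> linear \<psi> \<Longrightarrow> linear (nat_tensor C q \<phi> \<psi>)"
  and nat_tensor_apply: "linear \<phi> \<Longrightarrow> linear \<psi> \<Longrightarrow> v \<in> gr C i \<Longrightarrow>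
    nat_tensor C q \<phi> \<psi> (v \<otimes>\<^sub>t w) = ksign (i * q) *\<^sub>R (\<phi> v \<otimes>\<^sub>t \<psi> w)"
  using nat_tensor_spec by metis+

lemma tensor_hom_eqI:
  fixes F :: "('v, 'w::real_vector) tensor \<Rightarrow> 'c::real_vector"
  assumes F: "linear F" "linear F'" "\<And>i v w. v \<in> gr C i \<Longrightarrow> F (v \<otimes>\<^sub>t w) = F' (v \<otimes>\<^sub>t w)"
  shows "F = F'"
proof (rule linear_tens_eqI[OF F(1,2)])
  fix v w
  have "(\<lambda>v. F (v \<otimes>\<^sub>t w)) = (\<lambda>v. F' (v \<otimes>\<^sub>t w))"
    using F linear_compose[OF linear_tens_left F(1)] linear_compose[OF linear_tens_left F(2)]
    by (intro linear_hom_eqI) (auto simp: o_def)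
  then show "F (v \<otimes>\<^sub>t w) = F' (v \<otimes>\<^sub>t w)" by (rule fun_cong)
qed

lemma nat_tensor_id: "nat_tensor C 0 (\<lambda>v. v) (\<lambda>w :: 'w::real_vector. w) = (\<lambda>z. z)"
proof (rule tensor_hom_eqI)
  show "linear (nat_tensor C 0 (\<lambda>v. v) (\<lambda>w :: 'w. w))" by (rule nat_tensor_linear) (rule linear_ident)+
  fix i v and w :: 'w assume "v \<in> gr C i"
  then show "nat_tensor C 0 (\<lambda>v. v) (\<lambda>w. w) (v \<otimes>\<^sub>t w) = v \<otimes>\<^sub>t w"
    by (subst nat_tensor_apply) (auto intro: linear_ident)
qed (rule linear_ident)

text \<open>
  The operator \<open>S \<otimes> 1 + 1 \<otimes> S'\<close> with the Koszul sign for operators of degree \<open>p\<close>. Both the differential and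
  the action on a tensor product are of this form.
\<close>

definition leib :: "int \<Rightarrow> ('v \<Rightarrow> 'v) \<Rightarrow> ('w \<Rightarrow> 'w) \<Rightarrow> ('v, 'w::real_vector) tensor \<Rightarrow> ('v, 'w) tensor" where
  "leib p S S' z = nat_tensor C 0 S (\<lambda>w. w) z + nat_tensor C p (\<lambda>v. v) S' z"

lemma leib_linear: "linear S \<Longrightarrow> linear S' \<Longrightarrow> linear (leib p S S')"
  unfolding leib_def[abs_def] by (intro linear_compose_add nat_tensor_linear linear_ident)

lemma leib_apply:
  "linear S \<Longrightarrow> linear S' \<Longrightarrow> v \<in> gr C i \<Longrightarrow> leib p S S' (v \<otimes>\<^sub>t w) = S v \<otimes>\<^sub>t w + ksign (i * p) *\<^sub>R (v \<otimes>\<^sub>t S' w)"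
  unfolding leib_def by (simp add: nat_tensor_apply linear_ident)

lemma leib_zero: "leib p (\<lambda>v. 0) (\<lambda>w. 0) = (\<lambda>z. 0)"
  by (rule tensor_hom_eqI) (simp_all add: leib_linear linear_zero leib_apply tens_simps)

lemma leib_add:
  assumes "linear S" "linear S'" "linear R" "linear R'"
  shows "leib p (\<lambda>v. S v + R v) (\<lambda>w. S' w + R' w) = (\<lambda>z. leib p S S' z + leib p R R' z)"
  by (rule tensor_hom_eqI)
    (simp_all add: leib_linear assms linear_compose_add leib_apply tens_simps scaleR_add_right)

lemma leib_scale:
  assumes "linear S" "linear S'"
  shows "leib p (\<lambda>v. r *\<^sub>R S v) (\<lambda>w. r *\<^sub>R S' w) = (\<lambda>z. r *\<^sub>R leib p S S' z)"
  by (rule tensor_hom_eqI)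
    (simp_all add: leib_linear assms linear_compose_scale_right leib_apply tens_simps scaleR_add_right mult.commute)

lemma gcomm_linear: "linear S \<Longrightarrow> linear R \<Longrightarrow> linear (gcomm p q S R)"
  unfolding gcomm_def[abs_def]
  by (intro linear_compose_sub linear_compose_scale_right linear_compose[of R S, unfolded o_def]
      linear_compose[of S R, unfolded o_def])

text \<open>
  In the commutator the mixed terms \<open>S v \<otimes> R' w\<close> and \<open>R v \<otimes> S' w\<close> cancel because of the Koszul signs.
\<close>

lemma gcomm_leib:
  fixes S' :: "'w::real_vector \<Rightarrow> 'w"
  assumes S: "S \<in> End_deg C p" "linear S'" and R: "R \<in> End_deg C q" "linear R'"
  shows "gcomm p q (leib p S S') (leib q R R') = leib (p + q) (gcomm p q S R) (gcomm p q S' R')"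
proof (rule tensor_hom_eqI)
  have l: "linear S" "linear R" using S R by (auto simp: End_deg_def image_subset_iff)
  show "linear (gcomm p q (leib p S S') (leib q R R'))"
    using l S R by (intro gcomm_linear leib_linear)
  show "linear (leib (p + q) (gcomm p q S R) (gcomm p q S' R'))"
    using l S R by (intro gcomm_linear leib_linear)
  fix i v and w :: 'w assume v: "v \<in> gr C i"
  have Sv: "S v \<in> gr C (i + p)" "R v \<in> gr C (i + q)" using S R v by (auto simp: End_deg_def image_subset_iff)
  note lins = linear_add[OF leib_linear[OF l(1) S(2)]] linear_add[OF leib_linear[OF l(2) R(2)]]
    linear_scale[OF leib_linear[OF l(1) S(2)]] linear_scale[OF leib_linear[OF l(2) R(2)]]
  have 1: "leib p S S' (leib q R R' (v \<otimes>\<^sub>t w)) = S (R v) \<otimes>\<^sub>t w + ksign ((i + q) * p) *\<^sub>R (R v \<otimes>\<^sub>t S' w)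
      + ksign (i * q) *\<^sub>R (S v \<otimes>\<^sub>t R' w) + (ksign (i * q) * ksign (i * p)) *\<^sub>R (v \<otimes>\<^sub>t S' (R' w))"
    using leib_apply[OF l(2) R(2) v] leib_apply[OF l(1) S(2) v] leib_apply[OF l(1) S(2) Sv(2)]
    by (simp add: lins scaleR_add_right)
  have 2: "leib q R R' (leib p S S' (v \<otimes>\<^sub>t w)) = R (S v) \<otimes>\<^sub>t w + ksign ((i + p) * q) *\<^sub>R (S v \<otimes>\<^sub>t R' w)
      + ksign (i * p) *\<^sub>R (R v \<otimes>\<^sub>t S' w) + (ksign (i * p) * ksign (i * q)) *\<^sub>R (v \<otimes>\<^sub>t R' (S' w))"
    using leib_apply[OF l(2) R(2) v] leib_apply[OF l(1) S(2) v] leib_apply[OF l(2) R(2) Sv(1)]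
    by (simp add: lins scaleR_add_right)
  have 3: "leib (p + q) (gcomm p q S R) (gcomm p q S' R') (v \<otimes>\<^sub>t w) =
      gcomm p q S R v \<otimes>\<^sub>t w + ksign (i * (p + q)) *\<^sub>R (v \<otimes>\<^sub>t gcomm p q S' R' w)"
    using l S(2) R(2) by (intro leib_apply[OF _ _ v] gcomm_linear)
  show "gcomm p q (leib p S S') (leib q R R') (v \<otimes>\<^sub>t w) = leib (p + q) (gcomm p q S R) (gcomm p q S' R') (v \<otimes>\<^sub>t w)"
    unfolding 3 unfolding gcomm_def 1 2
    by (simp add: tens_simps scaleR_add_right scaleR_diff_right distrib_left distrib_right ksign_add mult_ac)
qed

end

lemma tensor_gr_gen: "v \<in> gr C i \<Longrightarrow> w \<in> gr C' j \<Longrightarrow> v \<otimes>\<^sub>t w \<in> gr (cplx_tensor C C') (i + j)"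
  unfolding cplx_tensor_def by (auto intro!: span_base)

lemma tensor_gr_induct:
  assumes "z \<in> gr (cplx_tensor C C') n" "linear F" "subspace X"
    and "\<And>i j v w. i + j = n \<Longrightarrow> v \<in> gr C i \<Longrightarrow> w \<in> gr C' j \<Longrightarrow> F (v \<otimes>\<^sub>t w) \<in> X"
  shows "F z \<in> X"
proof -
  let ?G = "{v \<otimes>\<^sub>t w | v w. \<exists>i j. i + j = n \<and> v \<in> gr C i \<and> w \<in> gr C' j}"
  have "z \<in> span ?G" using assms(1) by (simp add: cplx_tensor_def)
  then have "F z \<in> span (F ` ?G)" using linear_span_image[OF assms(2), of ?G] by blast
  also have "span (F ` ?G) \<subseteq> X" by (rule span_minimal[OF _ assms(3)]) (use assms(4) in auto)
  finally show ?thesis .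
qed

lemma leib_End_deg:
  assumes C: "fd_complex C" and C': "fd_complex C'" and S: "S \<in> End_deg C p" and S': "S' \<in> End_deg C' p"
  shows "leib C p S S' \<in> End_deg (cplx_tensor C C') p"
proof -
  have l: "linear S" "linear S'" using S S' by (auto simp: End_deg_def image_subset_iff)
  have sub: "subspace (gr (cplx_tensor C C') n)" for n by (simp add: cplx_tensor_def)
  have "leib C p S S' z \<in> gr (cplx_tensor C C') (n + p)" if "z \<in> gr (cplx_tensor C C') n" for n z
  proof (rule tensor_gr_induct[OF that leib_linear[OF C l] sub])
    fix i j v w assume *: "i + j = n" "v \<in> gr C i" "w \<in> gr C' j"
    have "S v \<in> gr C (i + p)" "S' w \<in> gr C' (j + p)" using S S' * by (auto simp: End_deg_def image_subset_iff)
    then have "S v \<otimes>\<^sub>t w \<in> gr (cplx_tensor C C') (n + p)" "v \<otimes>\<^sub>t S' w \<in> gr (cplx_tensor C C') (n + p)"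
      using tensor_gr_gen[of "S v" C "i + p" w C' j] tensor_gr_gen[of v C i "S' w" C' "j + p"] *
      by (auto simp: algebra_simps)
    then show "leib C p S S' (v \<otimes>\<^sub>t w) \<in> gr (cplx_tensor C C') (n + p)"
      unfolding leib_apply[OF C l *(2)] by (intro subspace_add[OF sub] subspace_scale[OF sub])
  qed
  then show ?thesis using leib_linear[OF C l] by (auto simp: End_deg_def image_subset_iff)
qed

lemma dif_cplx_tensor: "dif (cplx_tensor C C') = leib C 1 (dif C) (dif C')"
  if "fd_complex C"
  by (rule ext) (simp add: cplx_tensor_def leib_def[OF that])

lemma dif_End_deg: "fd_complex C \<Longrightarrow> dif C \<in> End_deg C 1"
  by (auto simp: End_deg_def image_subset_iff dif_linear dif_gr)

text \<open>
  The work is in the uniqueness of the decomposition by degree: the projection \<open>P n\<close> to degree \<open>n\<close> is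
  obtained from the universal property.
\<close>

lemma fd_complex_tensor:
  fixes C :: "('v::real_vector) cplx" and C' :: "('w::real_vector) cplx"
  assumes C: "fd_complex C" and C': "fd_complex C'"
  shows "fd_complex (cplx_tensor C C')"
proof -
  let ?T = "cplx_tensor C C'"
  have sub: "subspace (gr ?T n)" for n by (simp add: cplx_tensor_def)
  obtain B where B: "finite B" "span B = (UNIV :: 'v set)"
    using C unfolding fd_complex_def by (elim conjE exE) (rule that)
  obtain B' where B': "finite B'" "span B' = (UNIV :: 'w set)"
    using C' unfolding fd_complex_def by (elim conjE exE) (rule that)
  let ?BB = "(\<lambda>(b, b'). b \<otimes>\<^sub>t b') ` (B \<times> B')"
  have "v \<otimes>\<^sub>t w \<in> span ?BB" for v w
  proof -
    have 1: "b \<otimes>\<^sub>t w \<in> span ?BB" if "b \<in> B" for b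
    proof -
      have "b \<otimes>\<^sub>t w \<in> span ((\<lambda>w. b \<otimes>\<^sub>t w) ` B')"
        using linear_span_image[OF linear_tens_right, of b B'] B'(2) by auto
      also have "\<dots> \<subseteq> span ?BB" using that by (intro span_mono) auto
      finally show ?thesis .
    qed
    have "v \<otimes>\<^sub>t w \<in> span ((\<lambda>v. v \<otimes>\<^sub>t w) ` B)"
      using linear_span_image[OF linear_tens_left, of w B] B(2) by auto
    also have "\<dots> \<subseteq> span ?BB" by (rule span_minimal) (use 1 in auto)
    finally show ?thesis .
  qed
  then have "span {v \<otimes>\<^sub>t w | v w. True} \<subseteq> span ?BB" by (intro span_minimal) auto
  then have fin: "finite ?BB" "span ?BB = UNIV" unfolding span_tens using B(1) B'(1) by auto
  obtain S where S: "finite S" "\<And>v i. i \<notin> S \<Longrightarrow> cmp C v i = 0" by (rule cmp_support[OF C]) (rule that)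
  obtain S' where S': "finite S'" "\<And>v i. i \<notin> S' \<Longrightarrow> cmp C' v i = 0" by (rule cmp_support[OF C']) (rule that)
  have "\<exists>P. linear P \<and> (\<forall>i j. \<forall>v\<in>gr C i. \<forall>w\<in>gr C' j. P (v \<otimes>\<^sub>t w) = (if i + j = n then v \<otimes>\<^sub>t w else 0))" for n
  proof -
    let ?Q = "\<lambda>v w. \<Sum>i\<in>S. cmp C v i \<otimes>\<^sub>t cmp C' w (n - i)"
    have "bilinear ?Q"
      unfolding bilinear_def
      by (auto intro!: linearI simp: cmp_add[OF C] cmp_add[OF C'] cmp_scale[OF C] cmp_scale[OF C']
          tens_simps sum.distrib scaleR_sum_right)
    then obtain P where P: "linear P" "\<And>v w. P (v \<otimes>\<^sub>t w) = ?Q v w" by (rule tensor_lift) (rule that)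
    have "P (v \<otimes>\<^sub>t w) = (if i + j = n then v \<otimes>\<^sub>t w else 0)" if v: "v \<in> gr C i" and w: "w \<in> gr C' j" for i j v w
    proof (cases "i \<in> S")
      case True
      have "P (v \<otimes>\<^sub>t w) = (\<Sum>l\<in>S. if l = i then (if i + j = n then v \<otimes>\<^sub>t w else 0) else 0)"
        unfolding P(2) by (intro sum.cong) (auto simp: cmp_hom[OF C v] cmp_hom[OF C' w] tens_simps)
      then show ?thesis using True S(1) by simp
    next
      case False
      then have "v = 0" using S(2)[of i v] cmp_hom[OF C v, of i] by simp
      then show ?thesis using linear_0[OF P(1)] by (simp add: tens_simps)
    qed
    then show ?thesis using P(1) by blast
  qed
  then obtain P where P: "\<And>n. linear (P n)"
    and Ph: "\<And>n i j v w. v \<in> gr C i \<Longrightarrow> w \<in> gr C' j \<Longrightarrow> P n (v \<otimes>\<^sub>t w) = (if i + j = n then v \<otimes>\<^sub>t w else 0)"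
    by metis
  have Pgr: "P n z = (if m = n then z else 0)" if z: "z \<in> gr ?T m" for m n z
  proof -
    have "P n z - (if m = n then z else 0) \<in> {0}"
    proof (rule tensor_gr_induct[OF z, of "\<lambda>z. P n z - (if m = n then z else 0)"])
      show "linear (\<lambda>z. P n z - (if m = n then z else 0))"
        by (cases "m = n") (auto intro: linear_compose_sub P linear_ident)
    qed (use Ph in auto)
    then show ?thesis by simp
  qed
  define N where "N = (\<lambda>(i, j). i + j) ` (S \<times> S')"
  have N: "finite N" unfolding N_def using S(1) S'(1) by auto
  have hom: "F = F'" if "linear F" "linear F'" "\<And>i j v w. v \<in> gr C i \<Longrightarrow> w \<in> gr C' j \<Longrightarrow> F (v \<otimes>\<^sub>t w) = F' (v \<otimes>\<^sub>t w)"
    for F F' :: "('v, 'w) tensor \<Rightarrow> ('v, 'w) tensor"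
  proof (rule tensor_hom_eqI[OF C that(1,2)])
    fix i v w assume v: "v \<in> gr C i"
    have "(\<lambda>w. F (v \<otimes>\<^sub>t w)) = (\<lambda>w. F' (v \<otimes>\<^sub>t w))"
      using that v linear_compose[OF linear_tens_right that(1)] linear_compose[OF linear_tens_right that(2)]
      by (intro linear_hom_eqI[OF C']) (auto simp: o_def)
    then show "F (v \<otimes>\<^sub>t w) = F' (v \<otimes>\<^sub>t w)" by (rule fun_cong)
  qed
  have Psum: "(\<lambda>z. \<Sum>n\<in>N. P n z) = (\<lambda>z. z)"
  proof (rule hom)
    show "linear (\<lambda>z. \<Sum>n\<in>N. P n z)" using P by (intro linear_compose_sum) auto
    fix i j v w assume vw: "v \<in> gr C i" "w \<in> gr C' j"
    show "(\<Sum>n\<in>N. P n (v \<otimes>\<^sub>t w)) = v \<otimes>\<^sub>t w"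
    proof (cases "i \<in> S \<and> j \<in> S'")
      case True
      then have "i + j \<in> N" unfolding N_def by auto
      then show ?thesis using N by (simp add: Ph[OF vw])
    next
      case False
      then have "v = 0 \<or> w = 0"
        using S(2)[of i v] cmp_hom[OF C vw(1), of i] S'(2)[of j w] cmp_hom[OF C' vw(2), of j] by auto
      then show ?thesis using linear_0[OF P] by (auto simp: tens_simps)
    qed
  qed (rule linear_ident)
  have Pin: "P n z \<in> gr ?T n" for n z
  proof -
    have "P n (P m z) = (if m = n then P m z else 0) \<and> P m z \<in> gr ?T m" for m
    proof -
      have "P m z \<in> span {v \<otimes>\<^sub>t w | v w. \<exists>i j. i + j = m \<and> v \<in> gr C i \<and> w \<in> gr C' j}"
      proof -
        have "z \<in> span {v \<otimes>\<^sub>t w | v w. True}" unfolding span_tens by (rule UNIV_I)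
        then have "P m z \<in> span (P m ` {v \<otimes>\<^sub>t w | v w. True})" using linear_span_image[OF P] by blast
        also have "\<dots> \<subseteq> gr ?T m"
        proof (rule span_minimal[OF _ sub], clarify)
          fix v w
          have "P m (v \<otimes>\<^sub>t w) = (\<Sum>i | cmp C v i \<noteq> 0. \<Sum>j | cmp C' w j \<noteq> 0. P m (cmp C v i \<otimes>\<^sub>t cmp C' w j))"
          proof -
            have "v \<otimes>\<^sub>t w = (\<Sum>i | cmp C v i \<noteq> 0. cmp C v i \<otimes>\<^sub>t w)"
              by (subst cmp_sum[OF C, of v]) (rule linear_sum[OF linear_tens_left])
            moreover have "x \<otimes>\<^sub>t w = (\<Sum>j | cmp C' w j \<noteq> 0. x \<otimes>\<^sub>t cmp C' w j)" for x :: 'v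
              by (subst cmp_sum[OF C', of w]) (rule linear_sum[OF linear_tens_right])
            ultimately show ?thesis by (simp add: linear_sum[OF P])
          qed
          also have "\<dots> \<in> gr ?T m"
          proof (intro subspace_sum[OF sub])
            fix i j
            show "P m (cmp C v i \<otimes>\<^sub>t cmp C' w j) \<in> gr ?T m"
              using tensor_gr_gen[OF cmp_gr[OF C, of v i] cmp_gr[OF C', of w j]]
              by (cases "i + j = m") (auto simp: Ph[OF cmp_gr[OF C] cmp_gr[OF C']] subspace_0[OF sub])
          qed
          finally show "P m (v \<otimes>\<^sub>t w) \<in> gr ?T m" .
        qed
        finally show ?thesis by (simp add: cplx_tensor_def)
      qed
      then have "P m z \<in> gr ?T m" by (simp add: cplx_tensor_def)
      then show ?thesis using Pgr by simp
    qed
    then show ?thesis by blast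
  qed
  have Pout: "P n z = 0" if "n \<notin> N" for n z
  proof -
    have "P n z = (\<Sum>m\<in>N. P n (P m z))"
      using fun_cong[OF Psum, of z] linear_sum[OF P, of n "\<lambda>m. P m z" N] by simp
    also have "\<dots> = 0" using Pgr[OF Pin] that by (intro sum.neutral) auto
    finally show ?thesis .
  qed
  have dec: "\<exists>!c. (\<forall>i. c i \<in> gr ?T i) \<and> finite {i. c i \<noteq> 0} \<and> z = (\<Sum>i | c i \<noteq> 0. c i)" for z
  proof (rule ex1I[of _ "\<lambda>n. P n z"])
    have subN: "{i. P i z \<noteq> 0} \<subseteq> N" using Pout by auto
    have "z = (\<Sum>n\<in>N. P n z)" using fun_cong[OF Psum, of z] by simp
    also have "\<dots> = (\<Sum>i | P i z \<noteq> 0. P i z)" by (rule sum.mono_neutral_right[OF N subN]) auto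
    finally show "(\<forall>i. P i z \<in> gr ?T i) \<and> finite {i. P i z \<noteq> 0} \<and> z = (\<Sum>i | P i z \<noteq> 0. P i z)"
      using Pin finite_subset[OF subN N] by blast
    fix c assume c: "(\<forall>i. c i \<in> gr ?T i) \<and> finite {i. c i \<noteq> 0} \<and> z = (\<Sum>i | c i \<noteq> 0. c i)"
    show "c = (\<lambda>n. P n z)"
    proof
      fix n
      have "P n z = (\<Sum>i | c i \<noteq> 0. P n (c i))" using c linear_sum[OF P] by metis
      also have "\<dots> = (\<Sum>i | c i \<noteq> 0. if i = n then c i else 0)"
        using c Pgr by (intro sum.cong) auto
      also have "\<dots> = c n" using c by (simp add: sum.delta)
      finally show "c n = P n z" by simp
    qed
  qed
  have dE: "dif ?T \<in> End_deg ?T 1"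
    unfolding dif_cplx_tensor[OF C] by (rule leib_End_deg[OF C C' dif_End_deg[OF C] dif_End_deg[OF C']])
  have "dif ?T (dif ?T z) = 0" for z
  proof -
    have "gcomm 1 1 (dif ?T) (dif ?T) = leib C (1 + 1) (gcomm 1 1 (dif C) (dif C)) (gcomm 1 1 (dif C') (dif C'))"
      unfolding dif_cplx_tensor[OF C] by (rule gcomm_leib[OF C dif_End_deg[OF C] dif_linear[OF C'] dif_End_deg[OF C] dif_linear[OF C']])
    also have "\<dots> = (\<lambda>z. 0)"
      by (simp add: gcomm_def[abs_def] dif_dif[OF C] dif_dif[OF C'] leib_zero[OF C])
    finally have "gcomm 1 1 (dif ?T) (dif ?T) z = 0" by (rule fun_cong)
    then have "2 *\<^sub>R dif ?T (dif ?T z) = 0" by (simp add: gcomm_def ksign_def scaleR_2)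
    then show ?thesis by simp
  qed
  then show ?thesis
    unfolding fd_complex_def using fin sub dec dE by (auto simp: End_deg_def image_subset_iff)
qed

section \<open>Derivatives of curves of endomorphisms\<close>

lemma End_derivativeD:
  "has_End_derivative F T t \<Longrightarrow> linear l \<Longrightarrow> ((\<lambda>s. l (F s v) :: real) has_real_derivative l (T v)) (at t)"
  "has_End_derivative F T t \<Longrightarrow> linear T"
  by (auto simp: has_End_derivative_def)

lemma End_derivative_unique:
  assumes "has_End_derivative F T t" "has_End_derivative F T' t"
  shows "T = T'"
proof
  fix v
  show "T v = T' v"
    by (rule linear_functionals_separate) (use assms End_derivativeD(1) DERIV_unique in metis)
qed

lemma End_derivative_const: "linear T \<Longrightarrow> has_End_derivative (\<lambda>s. T) (\<lambda>v. 0) t"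
  by (auto simp: has_End_derivative_def linear_zero linear_0)

lemma finite_basis_exists:
  fixes C :: "('v::real_vector) cplx"
  assumes "fd_complex C"
  obtains B :: "('v::real_vector) set" where "finite B" "independent B" "span B = UNIV"
proof -
  obtain A :: "'v set" where A: "finite A" "span A = UNIV"
    using assms unfolding fd_complex_def by (elim conjE exE) (rule that)
  obtain B where B: "B \<subseteq> A" "independent B" "A \<subseteq> span B" by (rule maximal_independent_subset[of A])
  have "span A \<subseteq> span B" using B(3) by (rule span_minimal) simp
  then show thesis using that[of B] finite_subset[OF B(1) A(1)] B(2) A(2) by blast
qed

lemma basis_expansion:
  assumes "finite B" "independent B" "span B = (UNIV :: 'v::real_vector set)"
  shows "v = (\<Sum>b\<in>B. representation B v b *\<^sub>R b)" "linear (\<lambda>v. representation B v b)"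
proof -
  show "v = (\<Sum>b\<in>B. representation B v b *\<^sub>R b)"
    using sum_representation_eq[of B v B] assms by simp
  show "linear (\<lambda>v. representation B v b)"
    using assms representation_add[of B] representation_scale[of B] by (intro linearI) auto
qed

text \<open>
  The derivatives of the matrix entries with respect to a finite basis determine an endomorphism, and
  linear functionals are finite combinations of coordinates.
\<close>

lemma End_derivative_exists:
  fixes F :: "real \<Rightarrow> 'v::real_vector \<Rightarrow> 'v"
  assumes C: "fd_complex (C :: 'v cplx)" and F: "\<And>s. linear (F s)"
    and D: "\<And>l v. linear l \<Longrightarrow> \<exists>d. ((\<lambda>s. l (F s v) :: real) has_real_derivative d) (at t)"
  shows "\<exists>T. has_End_derivative F T t"
proof -
  obtain B :: "'v set" where B: "finite B" "independent B" "span B = UNIV" by (rule finite_basis_exists[OF C]) (rule that)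
  note be = basis_expansion[OF B]
  define T where "T v = (\<Sum>b\<in>B. deriv (\<lambda>s. representation B (F s v) b) t *\<^sub>R b)" for v
  have T: "((\<lambda>s. l (F s v)) has_real_derivative l (T v)) (at t)" if l: "linear l" for l :: "'v \<Rightarrow> real" and v
  proof -
    have "((\<lambda>s. representation B (F s v) b) has_real_derivative deriv (\<lambda>s. representation B (F s v) b) t) (at t)" for b
      using D[OF be(2)] DERIV_deriv_iff_real_differentiable real_differentiable_def by blast
    then have "((\<lambda>s. \<Sum>b\<in>B. representation B (F s v) b * l b) has_real_derivative
        (\<Sum>b\<in>B. deriv (\<lambda>s. representation B (F s v) b) t * l b)) (at t)"
      by (intro DERIV_sum DERIV_cmult_right)
    moreover have "l (F s v) = (\<Sum>b\<in>B. representation B (F s v) b * l b)" for s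
      by (subst be(1)) (simp add: linear_sum[OF l] linear_scale[OF l])
    ultimately show ?thesis by (simp add: T_def linear_sum[OF l] linear_scale[OF l])
  qed
  have "linear T"
  proof (rule linearI)
    fix v w and r :: real
    show "T (v + w) = T v + T w"
    proof (rule linear_functionals_separate)
      fix l :: "'v \<Rightarrow> real" assume l: "linear l"
      show "l (T (v + w)) = l (T v + T w)"
        using DERIV_unique[OF T[OF l, of "v + w"]] DERIV_add[OF T[OF l, of v] T[OF l, of w]]
        by (simp add: linear_add[OF F] linear_add[OF l])
    qed
    show "T (r *\<^sub>R v) = r *\<^sub>R T v"
    proof (rule linear_functionals_separate)
      fix l :: "'v \<Rightarrow> real" assume l: "linear l"
      show "l (T (r *\<^sub>R v)) = l (r *\<^sub>R T v)"
        using DERIV_unique[OF T[OF l, of "r *\<^sub>R v"]] DERIV_cmult[OF T[OF l, of v], of r]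
        by (simp add: linear_scale[OF F] linear_scale[OF l])
    qed
  qed
  then show ?thesis unfolding has_End_derivative_def using T by blast
qed

lemma End_derivative_bilinear:
  fixes F :: "real \<Rightarrow> 'v::real_vector \<Rightarrow> 'v"
  assumes C: "fd_complex (C :: 'v cplx)"
    and F: "\<And>s. linear (F s)" "has_End_derivative F S t" and G: "has_End_derivative G T t"
    and l: "linear l"
  shows "((\<lambda>s. l (F s (G s v)) :: real) has_real_derivative l (S (G t v)) + l (F t (T v))) (at t)"
proof -
  obtain B :: "'v set" where B: "finite B" "independent B" "span B = UNIV" by (rule finite_basis_exists[OF C]) (rule that)
  note be = basis_expansion[OF B]
  have exp: "l (K w) = (\<Sum>b\<in>B. representation B w b * l (K b))" if "linear K" for K :: "'v \<Rightarrow> 'v" and w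
    by (subst be(1)[of w]) (simp add: linear_sum[OF that] linear_scale[OF that] linear_sum[OF l] linear_scale[OF l])
  have "((\<lambda>s. \<Sum>b\<in>B. representation B (G s v) b * l (F s b)) has_real_derivative
      (\<Sum>b\<in>B. representation B (T v) b * l (F t b) + l (S b) * representation B (G t v) b)) (at t)"
    using End_derivativeD(1)[OF G be(2)] End_derivativeD(1)[OF F(2) l] by (intro DERIV_sum DERIV_mult)
  moreover have "(\<lambda>s. l (F s (G s v))) = (\<lambda>s. \<Sum>b\<in>B. representation B (G s v) b * l (F s b))"
    by (rule ext) (rule exp[OF F(1)])
  moreover have "l (S (G t v)) + l (F t (T v)) =
      (\<Sum>b\<in>B. representation B (T v) b * l (F t b) + l (S b) * representation B (G t v) b)"
    unfolding exp[OF F(1), of t "T v"] exp[OF End_derivativeD(2)[OF F(2)], of "G t v"] sum.distrib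
    by (simp add: mult.commute)
  ultimately show ?thesis by (simp only:)
qed

text \<open>
  The components of the wrong degrees vanish along the curve, hence so do their derivatives.
\<close>

lemma End_derivative_gr:
  assumes C: "fd_complex C" and F: "\<And>s. F s \<in> End_deg C k" and D: "has_End_derivative F T t"
  shows "T \<in> End_deg C k"
proof -
  have "T v \<in> gr C (i + k)" if v: "v \<in> gr C i" for v i
  proof -
    have "cmp C (T v) j = 0" if "j \<noteq> i + k" for j
    proof (rule linear_functionals_separate)
      fix l :: "'a \<Rightarrow> real" assume l: "linear l"
      have m: "F s v \<in> gr C (i + k)" for s using F[of s] v by (auto simp: End_deg_def)
      have "l (cmp C (F s v) j) = 0" for s using cmp_hom[OF C m[of s], of j] that linear_0[OF l] by simp
      moreover have "((\<lambda>s. l (cmp C (F s v) j)) has_real_derivative l (cmp C (T v) j)) (at t)"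
      proof -
        have "linear (\<lambda>w. l (cmp C w j))" using linear_compose[OF cmp_linear[OF C, of j] l] by (simp add: o_def)
        from End_derivativeD(1)[OF D this, of v] show ?thesis .
      qed
      ultimately have "((\<lambda>s. 0) has_real_derivative l (cmp C (T v) j)) (at t)" by simp
      then show "l (cmp C (T v) j) = l 0" using DERIV_unique DERIV_const linear_0[OF l] by metis
    qed
    then have "{j. cmp C (T v) j \<noteq> 0} \<subseteq> {i + k}" by auto
    from cmp_sum_superset[OF C _ this] have "T v = cmp C (T v) (i + k)" by simp
    then show ?thesis using cmp_gr[OF C] by metis
  qed
  then show ?thesis using End_derivativeD(2)[OF D] by (auto simp: End_deg_def)
qed

section \<open>Chains on generators\<close>

lemma pm_scale_1 [simp]: "pm_scale 1 a = a"
  unfolding pm_scale_def by (rule poly_mapping_eqI) (simp add: Poly_Mapping.map.rep_eq when_def)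

lemma pm_scale_0 [simp]: "pm_scale 0 a = 0"
  unfolding pm_scale_def by (rule poly_mapping_eqI) (simp add: Poly_Mapping.map.rep_eq when_def)

lemma lookup_pm_scale: "Poly_Mapping.lookup (pm_scale c a) x = c * Poly_Mapping.lookup a x"
  unfolding pm_scale_def by (simp add: Poly_Mapping.map.rep_eq when_def)

lemma keys_gen [simp]: "Poly_Mapping.keys (gen s) = {s}"
  by (simp add: gen_def)

lemma lookup_gen [simp]: "Poly_Mapping.lookup (gen s) s = 1"
  by (simp add: gen_def)

lemma lin_extend_gen [simp]: "lin_extend F (gen s) = F s"
  by (simp add: lin_extend_def)

lemma chain_prod_gen: "chain_prod G (gen \<sigma>) (gen \<nu>) = simplex_prod G \<sigma> \<nu>"
  by (simp add: chain_prod_def)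

lemma Delta_0 [simp]: "Delta 0 = {\<lambda>_. 0}"
  by (auto simp: Delta_def)

lemma rvec_Delta1: "0 \<le> a \<Longrightarrow> a \<le> 1 \<Longrightarrow> rvec [a] \<in> Delta 1"
  by (auto simp: Delta_def rvec_def)

lemma shuffles_trivial: "rs_shuffles 0 0 = {id}" "rs_shuffles 0 (Suc 0) = {id}" "rs_shuffles (Suc 0) 0 = {id}"
  by (auto simp: rs_shuffles_def strict_mono_on_def lessThan_Suc permutes_id)

lemma shuffles_11: "rs_shuffles 1 1 = {\<kappa>. \<kappa> permutes {..<2}}"
  by (auto simp: rs_shuffles_def strict_mono_on_def numeral_2_eq_2)

lemma simplex_prod_00: "simplex_prod G (mk_simplex 0 s) (mk_simplex 0 s') =
    gen (mk_simplex 0 (\<lambda>t. s (\<lambda>_. 0) \<otimes>\<^bsub>G\<^esub> s' (\<lambda>_. 0)))"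
  by (simp add: simplex_prod_def mk_simplex_def shuffles_trivial)

lemma Delta1_eta: "t \<in> Delta (Suc 0) \<Longrightarrow> (\<lambda>i. if i = 0 then t i else 0) = t"
  by (auto simp: Delta_def fun_eq_iff)

lemma simplex_prod_01: "simplex_prod G (mk_simplex 0 s) (mk_simplex 1 s') =
    gen (mk_simplex 1 (\<lambda>t. s (\<lambda>_. 0) \<otimes>\<^bsub>G\<^esub> s' t))"
proof -
  have "simplex_prod G (mk_simplex 0 s) (mk_simplex 1 s') = gen (mk_simplex 1
      (\<lambda>t. restrict s (Delta 0) (\<lambda>_. 0) \<otimes>\<^bsub>G\<^esub> restrict s' (Delta (Suc 0)) (\<lambda>i. if i = 0 then t i else 0)))"
    unfolding simplex_prod_def mk_simplex_def One_nat_def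
    by (simp add: shuffles_trivial sign_id del: restrict_apply Delta_0 cong: if_cong)
  also have "\<dots> = gen (mk_simplex 1 (\<lambda>t. s (\<lambda>_. 0) \<otimes>\<^bsub>G\<^esub> s' t))"
    by (intro arg_cong[where f = gen] mk_simplex_cong) (simp add: Delta1_eta)
  finally show ?thesis .
qed

lemma simplex_prod_10: "simplex_prod G (mk_simplex 1 s) (mk_simplex 0 s') =
    gen (mk_simplex 1 (\<lambda>t. s t \<otimes>\<^bsub>G\<^esub> s' (\<lambda>_. 0)))"
proof -
  have "simplex_prod G (mk_simplex 1 s) (mk_simplex 0 s') = gen (mk_simplex 1
      (\<lambda>t. restrict s (Delta (Suc 0)) (\<lambda>i. if i = 0 then t i else 0) \<otimes>\<^bsub>G\<^esub> restrict s' (Delta 0) (\<lambda>_. 0)))"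
    unfolding simplex_prod_def mk_simplex_def One_nat_def
    by (simp add: shuffles_trivial sign_id del: restrict_apply Delta_0 cong: if_cong)
  also have "\<dots> = gen (mk_simplex 1 (\<lambda>t. s t \<otimes>\<^bsub>G\<^esub> s' (\<lambda>_. 0)))"
    by (intro arg_cong[where f = gen] mk_simplex_cong) (simp add: Delta1_eta)
  finally show ?thesis .
qed

text \<open>
  The two shuffles cut the square into two triangles.
\<close>

lemma simplex_prod_11: "simplex_prod G (mk_simplex 1 s) (mk_simplex 1 s') =
    gen (mk_simplex 2 (\<lambda>t. s (rvec [t 0]) \<otimes>\<^bsub>G\<^esub> s' (rvec [t 1]))) +
    pm_scale (- 1) (gen (mk_simplex 2 (\<lambda>t. s (rvec [t 1]) \<otimes>\<^bsub>G\<^esub> s' (rvec [t 0]))))"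
proof -
  have "{..<2::nat} = {0, 1}" by auto
  then have perms: "{\<kappa>. \<kappa> permutes {..<2::nat}} = {id, Transposition.transpose 0 1}"
    by (auto simp: permutes_doubleton_iff)
  have ne: "id \<noteq> Transposition.transpose (0::nat) 1"
    by (metis id_apply transpose_apply_first zero_neq_one)
  have v: "(\<lambda>i. if i < 1 then t (f i) else 0) = rvec [t (f 0)]" for t :: "nat \<Rightarrow> real" and f
    by (auto simp: rvec_def fun_eq_iff)
  have mem: "rvec [t 0] \<in> Delta 1" "rvec [t 1] \<in> Delta 1" if "t \<in> Delta 2" for t
  proof -
    have "\<forall>i<2. 0 \<le> t i \<and> t i \<le> 1" using that unfolding Delta_def by blast
    then show "rvec [t 0] \<in> Delta 1" "rvec [t 1] \<in> Delta 1" by (auto intro!: rvec_Delta1 simp del: One_nat_def)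
  qed
  have "simplex_prod G (mk_simplex 1 s) (mk_simplex 1 s') = (\<Sum>\<kappa>\<in>{id, Transposition.transpose 0 1}.
     pm_scale (of_int (sign \<kappa>)) (gen (mk_simplex 2
       (\<lambda>t. restrict s (Delta 1) (rvec [t (\<kappa> 0)]) \<otimes>\<^bsub>G\<^esub> restrict s' (Delta 1) (rvec [t (\<kappa> 1)])))))"
    unfolding simplex_prod_def mk_simplex_def prod.case shuffles_11 perms
    using v[of _ "\<lambda>i. _ i"] v[of _ "\<lambda>i. _ (1 + i)"] by (simp add: numeral_2_eq_2)
  also have "\<dots> = gen (mk_simplex 2 (\<lambda>t. s (rvec [t 0]) \<otimes>\<^bsub>G\<^esub> s' (rvec [t 1]))) +
    pm_scale (- 1) (gen (mk_simplex 2 (\<lambda>t. s (rvec [t 1]) \<otimes>\<^bsub>G\<^esub> s' (rvec [t 0]))))"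
  proof -
    have e: "mk_simplex 2 (\<lambda>t. restrict s (Delta 1) (rvec [t a]) \<otimes>\<^bsub>G\<^esub> restrict s' (Delta 1) (rvec [t b])) =
        mk_simplex 2 (\<lambda>t. s (rvec [t a]) \<otimes>\<^bsub>G\<^esub> s' (rvec [t b]))" if "a = 0 \<and> b = 1 \<or> a = 1 \<and> b = 0" for a b
      using mem that by (intro mk_simplex_cong) auto
    have two: "(\<Sum>\<kappa>\<in>{id, Transposition.transpose 0 1}. f \<kappa>) = f id + f (Transposition.transpose 0 (1::nat))"
      for f :: "(nat \<Rightarrow> nat) \<Rightarrow> 'a chain" using ne by simp
    show ?thesis unfolding two
      using e[of 0 1] e[of 1 0] by (simp add: sign_swap_id del: restrict_apply One_nat_def)
  qed
  finally show ?thesis .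
qed

lemma boundary_0: "boundary (gen (mk_simplex 0 s)) = 0"
  by (simp add: boundary_def mk_simplex_def)

lemma boundary_1: "boundary (gen (mk_simplex 1 s)) =
    gen (mk_simplex 0 (\<lambda>_. s (rvec [1]))) + pm_scale (- 1) (gen (mk_simplex 0 (\<lambda>_. s (rvec [0]))))"
proof -
  have "{..1::nat} = {0, 1}" by auto
  moreover have "affine_simplex 0 w t = w 0" for w t by (simp add: affine_simplex_def bary_def fun_eq_iff)
  moreover have "vert 1 = rvec [1]" "vert 0 = rvec [0]" by (auto simp: vert_def rvec_def fun_eq_iff)
  moreover have "rvec [1] \<in> Delta 1" "rvec [0] \<in> Delta 1" by (rule rvec_Delta1; simp)+
  ultimately show ?thesis
    unfolding boundary_def lin_extend_gen by (simp add: mk_simplex_def face_def)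
qed

section \<open>Smooth families\<close>

text \<open>
  An open set of parameters as a manifold with a single chart, since the smoothness condition for
  modules is formulated with families over manifolds.
\<close>

definition open_mfd :: "nat \<Rightarrow> (nat \<Rightarrow> real) set \<Rightarrow> (nat \<Rightarrow> real) mfd" where
  "open_mfd n W = \<lparr>mtop = subtopology (Euclidean_space n) W, mdim = n, charts = {(W, \<lambda>x. x)}\<rparr>"

lemma second_countable_Euclidean_space: "second_countable (Euclidean_space n)"
proof -
  obtain B :: "(nat \<Rightarrow> real) set set" where B: "countable B" "topological_basis B" using ex_countable_basis by blast
  have "second_countable (euclidean :: (nat \<Rightarrow> real) topology)"
    unfolding second_countable_def
  proof (intro exI[of _ B] conjI allI impI ballI)
    show "countable B" by (rule B(1))
    show "openin euclidean V" if "V \<in> B" for V using B(2) that topological_basis_open by auto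
    fix U :: "(nat \<Rightarrow> real) set" and x assume "openin euclidean U \<and> x \<in> U"
    then show "\<exists>V\<in>B. x \<in> V \<and> V \<subseteq> U" using topological_basisE[OF B(2), of U x] by auto
  qed
  then show ?thesis unfolding Euclidean_space_def euclidean_product_topology
    by (intro second_countable_subtopology)
qed

lemma id_inv_into: "x \<in> W \<Longrightarrow> inv_into W (\<lambda>x. x) x = x"
  using inv_into_f_f[of "\<lambda>x. x" W x] by simp

lemma smooth_manifold_open_mfd:
  assumes W: "open_Rn n W"
  shows "smooth_manifold (open_mfd n W)"
proof -
  have WR: "W \<subseteq> Rn n" by (rule open_Rn_subset[OF W])
  have "smooth_fun n W (\<lambda>x. inv_into W (\<lambda>x. x) x a)" for a
    by (rule smooth_fun_cong[OF W _ smooth_fun_coord[of n W a]]) (simp add: id_inv_into)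
  moreover have "homeomorphic_map (subtopology (Euclidean_space n) W) (subtopology (Euclidean_space n) W) (\<lambda>x. x)"
    using homeomorphic_map_id[of "subtopology (Euclidean_space n) W"] by (simp add: id_def)
  moreover have "Hausdorff_space (subtopology (Euclidean_space n) W)"
    by (rule Hausdorff_space_subtopology[OF Hausdorff_Euclidean_space])
  moreover have "second_countable (subtopology (Euclidean_space n) W)"
    by (rule second_countable_subtopology[OF second_countable_Euclidean_space])
  moreover have "Rn n \<inter> W = W" using WR by blast
  ultimately show ?thesis
    unfolding smooth_manifold_def open_mfd_def using W
    by (simp add: subtopology_subtopology openin_open_subtopology)
qed

lemma smooth_family_extends:
  assumes N: "\<And>V \<psi>. (V, \<psi>) \<in> charts N \<Longrightarrow> openin (mtop N) V" and W: "open_Rn n W"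
    and F: "smooth_map (eucl (n + k)) N {concat_coords n p t | p t. p \<in> W \<and> t \<in> Rn k} F"
  shows "smooth_on_set (prod_mfd (open_mfd n W) (eucl k)) N (topspace (mtop (open_mfd n W)) \<times> Delta k)
    (\<lambda>(p, t). F (concat_coords n p t))"
proof -
  let ?\<Omega> = "{concat_coords n p t | p t. p \<in> W \<and> t \<in> Rn k}"
  let ?P = "prod_mfd (open_mfd n W) (eucl k)"
  let ?f = "\<lambda>(p, t). F (concat_coords n p t)"
  let ?ch = "\<lambda>(p, q). concat_coords n p q"
  have F': "open_Rn (n + k) ?\<Omega> \<and> continuous_map (subtopology (Euclidean_space (n + k)) ?\<Omega>) (mtop N) F \<and>
     (\<forall>(V, \<psi>)\<in>charts N. \<forall>a<mdim N. smooth_fun (n + k) {z \<in> ?\<Omega>. F z \<in> V} (\<lambda>z. \<psi> (F z) a))"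
    by (rule iffD1[OF smooth_map_eucl_iff F]) (rule N)
  have WR: "W \<subseteq> Rn n" by (rule open_Rn_subset[OF W])
  have tW: "Rn n \<inter> W = W" using WR by blast
  have P: "mtop ?P = prod_topology (subtopology (Euclidean_space n) W) (Euclidean_space k)"
    "mdim ?P = n + k" "charts ?P = {(W \<times> Rn k, ?ch)}"
    by (auto simp: prod_mfd_def open_mfd_def eucl_def)
  have tP: "topspace (mtop ?P) = W \<times> Rn k" using tW by (simp add: P)
  have op: "openin (mtop ?P) (W \<times> Rn k)" unfolding tP[symmetric] by (rule openin_topspace)
  have \<Omega>: "open_Rn (n + k) ?\<Omega>" using F' by blast
  have inj: "inj_on ?ch (W \<times> Rn k)"
  proof (rule inj_onI, clarify)
    fix p q p' q' assume *: "p \<in> W" "q \<in> Rn k" "p' \<in> W" "q' \<in> Rn k" "concat_coords n p q = concat_coords n p' q'"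
    have "p i = p' i" for i
    proof (cases "i < n")
      case True
      then show ?thesis using fun_cong[OF *(5), of i] by (simp add: concat_coords_def)
    next
      case False
      have "p \<in> Rn n" "p' \<in> Rn n" using * WR by auto
      then show ?thesis using False by (simp add: Rn_iff)
    qed
    moreover have "q i = q' i" for i
      using fun_cong[OF *(5), of "i + n"] by (auto simp: concat_coords_def)
    ultimately show "p = p' \<and> q = q'" by auto
  qed
  have "smooth_map ?P N (W \<times> Rn k) ?f"
    unfolding smooth_map_def
  proof (intro conjI)
    show "openin (mtop ?P) (W \<times> Rn k)" by (rule op)
    have cc: "continuous_map (mtop ?P) (Euclidean_space (n + k)) ?ch"
    proof -
      have "continuous_map (mtop ?P) (Euclidean_space (n + k))
          (\<lambda>z i. if i < n + k then (if i < n then fst z i else snd z (i - n)) else 0)"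
        unfolding continuous_map_componentwise_Euclidean_space
      proof (intro allI impI)
        fix i assume "i < n + k"
        have coord: "continuous_map (Euclidean_space m) euclideanreal (\<lambda>x. x i)" for m i
          unfolding continuous_map_Euclidean_space_iff by (rule continuous_on_product_then_coordinatewise[OF continuous_on_id])
        have f1: "continuous_map (mtop ?P) (Euclidean_space n) fst"
          unfolding P using continuous_map_fst continuous_map_into_fulltopology by blast
        have f2: "continuous_map (mtop ?P) (Euclidean_space k) snd"
          unfolding P by (rule continuous_map_snd)
        show "continuous_map (mtop ?P) euclideanreal (\<lambda>z. if i < n then fst z i else snd z (i - n))"
          using continuous_map_compose[OF f1 coord, of i] continuous_map_compose[OF f2 coord, of "i - n"]
          by (cases "i < n") (simp_all add: o_def)
      qed
      then show ?thesis
      proof (rule continuous_map_eq)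
        fix z assume z: "z \<in> topspace (mtop ?P)"
        show "(\<lambda>i. if i < n + k then (if i < n then fst z i else snd z (i - n)) else 0) = ?ch z"
          using z unfolding tP by (auto simp: concat_coords_def Rn_iff split: prod.splits)
      qed
    qed
    have cc': "continuous_map (mtop ?P) (subtopology (Euclidean_space (n + k)) ?\<Omega>) ?ch"
      unfolding continuous_map_in_subtopology using cc tP by auto
    have "continuous_map (mtop ?P) (mtop N) (F \<circ> ?ch)"
      using continuous_map_compose[OF cc'] F' by blast
    then have "continuous_map (mtop ?P) (mtop N) ?f" by (simp add: o_def case_prod_unfold)
    then show "continuous_map (subtopology (mtop ?P) (W \<times> Rn k)) (mtop N) ?f"
      by (rule continuous_map_from_subtopology)
    show "\<forall>(U, \<phi>)\<in>charts ?P. \<forall>(V, \<psi>)\<in>charts N. \<forall>a<mdim N.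
        smooth_fun (mdim ?P) (\<phi> ` {p \<in> U \<inter> (W \<times> Rn k). ?f p \<in> V}) (\<lambda>x. \<psi> (?f (inv_into U \<phi> x)) a)"
    proof -
      have key: "smooth_fun (n + k) (?ch ` {p \<in> W \<times> Rn k \<inter> W \<times> Rn k. ?f p \<in> V})
          (\<lambda>x. \<psi> (?f (inv_into (W \<times> Rn k) ?ch x)) a)" if V: "(V, \<psi>) \<in> charts N" and a: "a < mdim N" for V \<psi> a
      proof -
      have im: "?ch ` {p \<in> W \<times> Rn k. ?f p \<in> V} = {z \<in> ?\<Omega>. F z \<in> V}" by force
      have op2: "open_Rn (n + k) {z \<in> ?\<Omega>. F z \<in> V}"
        using F' by (intro openin_preimage_subtopology[OF \<Omega> _ N[OF V]]) blast
      have "smooth_fun (n + k) {z \<in> ?\<Omega>. F z \<in> V} (\<lambda>z. \<psi> (F z) a)" using F' V a by blast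
      then have "smooth_fun (n + k) {z \<in> ?\<Omega>. F z \<in> V} (\<lambda>x. \<psi> (?f (inv_into (W \<times> Rn k) ?ch x)) a)"
      proof (rule smooth_fun_cong[OF op2, rotated])
        fix z assume "z \<in> {z \<in> ?\<Omega>. F z \<in> V}"
        then obtain p t where "z = ?ch (p, t)" "p \<in> W" "t \<in> Rn k" by auto
        then show "\<psi> (F z) a = \<psi> (?f (inv_into (W \<times> Rn k) ?ch z)) a"
          using inv_into_f_f[OF inj, of "(p, t)"] by simp
      qed
      then show ?thesis using im by simp
      qed
      then show ?thesis unfolding P by (simp only: ball_simps prod.case simp_thms) blast
    qed
  qed
  then show ?thesis
    unfolding smooth_on_set_def using Delta_Rn[of k] tW
    by (intro ballI exI[of _ "W \<times> Rn k"] exI[of _ ?f]) (auto simp: open_mfd_def)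
qed

section \<open>Modules over singular chains\<close>

lemma keys_pm_scale: "Poly_Mapping.keys (pm_scale c a) \<subseteq> Poly_Mapping.keys a"
  by (auto simp: in_keys_iff lookup_pm_scale)

lemma chains_pm_scale: "a \<in> chains M \<Longrightarrow> pm_scale c a \<in> chains M"
  unfolding chains_def using keys_pm_scale[of c a] by blast

lemma chains_zero: "0 \<in> chains M"
  by (simp add: chains_def)

lemma gen_chains_deg: "\<sigma> \<in> smooth_simplices M k \<Longrightarrow> gen \<sigma> \<in> chains_deg M k"
  by (simp add: chains_deg_def)

lemma gen_chains: "\<sigma> \<in> smooth_simplices M k \<Longrightarrow> gen \<sigma> \<in> chains M"
  by (auto simp: chains_def)

lemma vf_scale_zero: "vf_scale 0 x = vf_zero"
  by (simp add: vf_scale_def vf_zero_def)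

locale chain_module = liegrp G for G :: "'g lgroup" (structure) +
  fixes C :: "('v::real_vector) cplx" and \<rho> :: "'g chain \<Rightarrow> 'v \<Rightarrow> 'v"
  assumes Mod: "Mod_obj G (C, \<rho>)"
begin

lemmas Mod_unfolded = Mod[unfolded Mod_obj_def dg_module_def Let_def prod.case]

lemmas rho_add = Mod_unfolded[THEN conjunct1, THEN conjunct1, rule_format]
lemmas rho_scale = Mod_unfolded[THEN conjunct1, THEN conjunct2, THEN conjunct1, rule_format]
lemmas rho_deg = Mod_unfolded[THEN conjunct1, THEN conjunct2, THEN conjunct2, THEN conjunct1, rule_format]
lemmas rho_boundary = Mod_unfolded[THEN conjunct1, THEN conjunct2, THEN conjunct2, THEN conjunct2,
    THEN conjunct1, rule_format]
lemmas rho_prod = Mod_unfolded[THEN conjunct1, THEN conjunct2, THEN conjunct2, THEN conjunct2,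
    THEN conjunct2, THEN conjunct1, rule_format]
lemmas rho_unit = Mod_unfolded[THEN conjunct1, THEN conjunct2, THEN conjunct2, THEN conjunct2,
    THEN conjunct2, THEN conjunct2]
lemmas fdC = Mod_unfolded[THEN conjunct2, THEN conjunct1]
lemmas rho_thin = Mod_unfolded[THEN conjunct2, THEN conjunct2, THEN conjunct1, rule_format]
lemmas rho_smooth = Mod_unfolded[THEN conjunct2, THEN conjunct2, THEN conjunct2, THEN conjunct1,
    rule_format, OF conjI]

lemma rho_zero: "\<rho> 0 = (\<lambda>v. 0)"
  using rho_scale[OF chains_zero, of 0] by simp

lemma rho_linear: "\<sigma> \<in> smooth_simplices NG k \<Longrightarrow> linear (\<rho> (gen \<sigma>))"
  using rho_deg[OF gen_chains_deg] by (auto simp: End_deg_def)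

text \<open>
  The smoothness condition for modules is applied to families over open subsets of Euclidean space,
  regarded as manifolds.
\<close>

lemma matrix_entry_smooth_cochain:
  assumes l: "linear l"
  shows "smooth_cochain (\<lambda>\<sigma>. l (\<rho> (gen \<sigma>) v))"
  unfolding smooth_cochain_def
proof (intro conjI allI impI ballI)
  fix n k W F assume A: "open_Rn n W \<and> smG (n + k) {concat_coords n p t |p t. p \<in> W \<and> t \<in> Rn k} F"
  let ?h = "\<lambda>p. l (\<rho> (gen (mk_simplex k (\<lambda>t. F (concat_coords n p t)))) v)"
  have W: "open_Rn n W" and F: "smG (n + k) {concat_coords n p t |p t. p \<in> W \<and> t \<in> Rn k} F" using A by auto
  have "smooth_on_set (prod_mfd (open_mfd n W) (eucl k)) NG (topspace (mtop (open_mfd n W)) \<times> Delta k)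
    (\<lambda>(p, t). F (concat_coords n p t))"
    by (rule smooth_family_extends[OF _ W F]) (rule chart_open)
  from rho_smooth[OF smooth_manifold_open_mfd[OF W] this, unfolded prod.case smooth_End_def, rule_format, OF l]
  have "smooth_real (open_mfd n W) ?h" .
  then have "smooth_fun n W (\<lambda>x. ?h (inv_into W (\<lambda>x. x) x))"
    by (simp add: smooth_real_def open_mfd_def)
  then show "smooth_fun n W ?h"
    by (rule smooth_fun_cong[OF W, rotated]) (simp add: id_inv_into)
next
  fix k \<sigma> assume "\<sigma> \<in> smooth_simplices NG k" "thin NG \<sigma>"
  then show "l (\<rho> (gen \<sigma>) v) = 0" using rho_thin linear_0[OF l] by simp
qed

definition R :: "'g \<Rightarrow> 'v \<Rightarrow> 'v" where
  "R g = \<rho> (gen (point_simplex g))"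

text \<open>
  A path is given by a curve on the whole line, of which the simplex uses the interval \<open>[0, 1]\<close>. So the
  calculus of smooth curves applies without boundary points.
\<close>

definition S :: "(real \<Rightarrow> 'g) \<Rightarrow> 'v \<Rightarrow> 'v" where
  "S p = \<rho> (gen (mk_simplex 1 (\<lambda>s. p (s 0))))"

lemma point_simplex_smooth: "g \<in> carrier G \<Longrightarrow> point_simplex g \<in> smooth_simplices NG 0"
  unfolding point_simplex_def by (intro mk_simplex_smooth smG_const openin_topspace)

abbreviation smcurve :: "(real \<Rightarrow> 'g) \<Rightarrow> bool" where
  "smcurve p \<equiv> smG 1 (Rn 1) (\<lambda>z. p (z 0))"

lemma path_smooth: "smcurve p \<Longrightarrow> mk_simplex 1 (\<lambda>s. p (s 0)) \<in> smooth_simplices NG 1"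
  by (rule mk_simplex_smooth)

lemma smcurve_carrier: "smcurve p \<Longrightarrow> p t \<in> carrier G"
  using smG_carrier[of 1 "Rn 1" "\<lambda>z. p (z 0)" "rvec [t]"] rvec_Rn[of "[t]" 1] by (simp add: rvec_def)

lemma R_linear: "g \<in> carrier G \<Longrightarrow> linear (R g)"
  unfolding R_def by (rule rho_linear[OF point_simplex_smooth])

lemma S_linear: "smcurve p \<Longrightarrow> linear (S p)"
  unfolding S_def by (rule rho_linear[OF path_smooth])

lemma R_End: "g \<in> carrier G \<Longrightarrow> R g \<in> End_deg C 0"
  using rho_deg[OF gen_chains_deg[OF point_simplex_smooth]] by (simp add: R_def)

lemma S_End: "smcurve p \<Longrightarrow> S p \<in> End_deg C (- 1)"
  using rho_deg[OF gen_chains_deg[OF path_smooth]] by (simp add: S_def)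

lemma R_one: "R \<one> = id"
  using rho_unit by (simp add: R_def chain_unit_def)

lemma R_mult: "g \<in> carrier G \<Longrightarrow> h \<in> carrier G \<Longrightarrow> R (g \<otimes> h) v = R g (R h v)"
  using rho_prod[OF gen_chains[OF point_simplex_smooth] gen_chains[OF point_simplex_smooth], of g h]
  by (simp add: R_def chain_prod_gen point_simplex_def simplex_prod_00)

lemma R_S: "g \<in> carrier G \<Longrightarrow> smcurve p \<Longrightarrow> R g (S p v) = S (\<lambda>t. g \<otimes> p t) v"
  using fun_cong[OF rho_prod[OF gen_chains[OF point_simplex_smooth] gen_chains[OF path_smooth], of g p], of v]
  by (simp add: R_def S_def chain_prod_gen point_simplex_def simplex_prod_01 del: One_nat_def)

lemma S_R: "g \<in> carrier G \<Longrightarrow> smcurve p \<Longrightarrow> S p (R g v) = S (\<lambda>t. p t \<otimes> g) v"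
  using fun_cong[OF rho_prod[OF gen_chains[OF path_smooth] gen_chains[OF point_simplex_smooth], of p g], of v]
  by (simp add: R_def S_def chain_prod_gen point_simplex_def simplex_prod_10 del: One_nat_def)

lemma d_R: "g \<in> carrier G \<Longrightarrow> dif C (R g v) = R g (dif C v)"
  using fun_cong[OF rho_boundary[OF gen_chains_deg[OF point_simplex_smooth], of g], of v]
  by (simp add: R_def point_simplex_def boundary_0 rho_zero gcomm_def ksign_0)

lemma d_S:
  assumes p: "smcurve p"
  shows "dif C (S p v) + S p (dif C v) = R (p 1) v - R (p 0) v"
proof -
  have g: "gen (point_simplex (p t)) \<in> chains NG" for t
    by (rule gen_chains[OF point_simplex_smooth[OF smcurve_carrier[OF p]]])
  have "\<rho> (boundary (gen (mk_simplex 1 (\<lambda>s. p (s 0))))) = gcomm 1 (- int 1) (dif C) (S p)"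
    unfolding S_def by (rule rho_boundary[OF gen_chains_deg[OF path_smooth[OF p]]])
  moreover have "boundary (gen (mk_simplex 1 (\<lambda>s. p (s 0)))) =
      gen (point_simplex (p 1)) + pm_scale (- 1) (gen (point_simplex (p 0)))"
    unfolding boundary_1 by (simp add: point_simplex_def rvec_def)
  ultimately have "(\<lambda>v. R (p 1) v + (- 1) *\<^sub>R R (p 0) v) = gcomm 1 (- 1) (dif C) (S p)"
    using rho_add[OF g chains_pm_scale[OF g], of 1 "-1" 0] rho_scale[OF g, of "-1" 0] by (simp add: R_def)
  from fun_cong[OF this, of v] show ?thesis by (simp add: gcomm_def ksign_def)
qed

text \<open>
  The matrix entry as a smooth function on \<open>G\<close>, set to 0 outside \<open>G\<close> as required by \<open>Cinf\<close>.
\<close>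

definition entry :: "('v \<Rightarrow> real) \<Rightarrow> 'v \<Rightarrow> 'g \<Rightarrow> real" where
  "entry l v g = (if g \<in> carrier G then l (R g v) else 0)"

lemma entry_Cinf:
  assumes l: "linear l"
  shows "entry l v \<in> CG"
proof (rule CinfI)
  fix U \<phi> assume ch: "(U, \<phi>) \<in> charts NG"
  have W: "open_Rn dm (\<phi> ` U)" and F: "smG dm (\<phi> ` U) (inv_into U \<phi>)"
    using smG_chart_inv[OF ch] smG_iff by auto
  have WR: "\<phi> ` U \<subseteq> Rn dm" by (rule open_Rn_subset[OF W])
  have R0: "Rn 0 = {\<lambda>_. 0}" by (auto simp: Rn_iff)
  have cc: "concat_coords dm p (\<lambda>_. 0) = p" if "p \<in> \<phi> ` U" for p
    using WR that by (auto simp: concat_coords_def Rn_iff fun_eq_iff subset_iff)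
  have "{concat_coords dm p t |p t. p \<in> \<phi> ` U \<and> t \<in> Rn 0} = \<phi> ` U"
    unfolding R0 using cc by (auto, force)
  then have "smooth_fun dm (\<phi> ` U) (\<lambda>p. l (\<rho> (gen (mk_simplex 0 (\<lambda>t. inv_into U \<phi> (concat_coords dm p t)))) v))"
    using matrix_entry_smooth_cochain[OF l, of v, unfolded smooth_cochain_def, THEN conjunct1, rule_format,
      of dm "\<phi> ` U" 0 "inv_into U \<phi>"] W F by simp
  then show "smooth_fun dm (\<phi> ` U) (\<lambda>x. entry l v (inv_into U \<phi> x))"
  proof (rule smooth_fun_cong[OF W, rotated])
    fix x assume x: "x \<in> \<phi> ` U"
    have "mk_simplex 0 (\<lambda>t. inv_into U \<phi> (concat_coords dm x t)) = point_simplex (inv_into U \<phi> x)"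
      unfolding point_simplex_def by (rule mk_simplex_cong) (simp add: cc[OF x])
    moreover have "inv_into U \<phi> x \<in> carrier G" using F x smG_carrier by blast
    ultimately show "l (\<rho> (gen (mk_simplex 0 (\<lambda>t. inv_into U \<phi> (concat_coords dm x t)))) v) =
        entry l v (inv_into U \<phi> x)" by (simp add: entry_def R_def)
  qed
next
  show "entry l v p = 0" if "p \<notin> topspace (mtop NG)" for p using that by (simp add: entry_def top_carrier)
qed

section \<open>The operators of degree 0\<close>

definition DL :: "'g vfield \<Rightarrow> 'v \<Rightarrow> 'v" where "DL x = D_L G \<rho> x"

lemma DL_derivative:
  assumes x: "x \<in> lie_alg G"
  shows "has_End_derivative (\<lambda>t. R (expc x t)) (DL x) 0"
proof -
  have "\<exists>T. has_End_derivative (\<lambda>t. R (expc x t)) T 0"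
  proof (rule End_derivative_exists[OF fdC])
    show "linear (R (expc x s))" for s by (rule R_linear[OF expc_carrier[OF x]])
    fix l :: "'v \<Rightarrow> real" and v assume l: "linear l"
    from DERIV_expc[OF x entry_Cinf[OF l, of v], of 0]
    show "\<exists>d. ((\<lambda>s. l (R (expc x s) v)) has_real_derivative d) (at 0)"
      using expc_carrier[OF x] by (auto simp: entry_def)
  qed
  then obtain T where T: "has_End_derivative (\<lambda>t. R (expc x t)) T 0" by blast
  have "DL x = T"
    unfolding DL_def D_L_def lie_exp_scale[OF x] R_def[symmetric]
    by (rule the_equality, rule T, rule End_derivative_unique[OF _ T])
  then show ?thesis using T by simp
qed

lemma DL_linear: "x \<in> lie_alg G \<Longrightarrow> linear (DL x)"
  by (rule End_derivativeD(2)[OF DL_derivative])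

text \<open>
  A left invariant vector field differentiates \<open>\<rho>(g exp(ty)) = \<rho>(g) \<rho>(exp(ty))\<close> at \<open>t = 0\<close>.
\<close>

lemma vf_entry:
  assumes y: "y \<in> lie_alg G" and l: "linear l"
  shows "y (entry l v) = entry l (DL y v)"
proof
  fix g
  show "y (entry l v) g = entry l (DL y v) g"
  proof (cases "g \<in> carrier G")
    case True
    have "((\<lambda>s. entry l v (g \<otimes> expc y s)) has_real_derivative y (entry l v) g) (at 0)"
      using DERIV_expc_translate[OF y True entry_Cinf[OF l, of v], of 0] expc(2)[OF y] True by simp
    moreover have "entry l v (g \<otimes> expc y s) = l (R g (R (expc y s) v))" for s
      using True expc_carrier[OF y] R_mult by (simp add: entry_def)
    moreover have "linear (\<lambda>w. l (R g w))"
      using linear_compose[OF R_linear[OF True] l] by (simp add: o_def)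
    ultimately show ?thesis
      using DERIV_unique End_derivativeD(1)[OF DL_derivative[OF y], of "\<lambda>w. l (R g w)" v] True
      by (simp add: entry_def)
  next
    case False
    then show ?thesis using Cinf_outside[OF vf_Cinf[OF lie_alg_vf[OF y] entry_Cinf[OF l, of v]], of g]
      by (simp add: entry_def top_carrier)
  qed
qed

text \<open>
  The operators are determined by derivations at the unit, so linearity in \<open>x\<close> and the bracket relation
  are inherited from vector fields.
\<close>

lemma DL_entry:
  assumes x: "x \<in> lie_alg G" and l: "linear l"
  shows "l (DL x v) = x (entry l v) \<one>"
  using fun_cong[OF vf_entry[OF x l, of v], of \<one>] by (simp add: entry_def R_one)

lemma DL_add: "x \<in> lie_alg G \<Longrightarrow> y \<in> lie_alg G \<Longrightarrow> DL (vf_add x y) v = DL x v + DL y v"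
  by (rule linear_functionals_separate)
    (simp add: DL_entry lie_alg_add linear_add, simp add: vf_add_def)

lemma DL_scale: "x \<in> lie_alg G \<Longrightarrow> DL (vf_scale c x) v = c *\<^sub>R DL x v"
  by (rule linear_functionals_separate)
    (simp add: DL_entry lie_alg_scale linear_scale, simp add: vf_scale_def)

lemma DL_zero: "DL vf_zero v = 0"
  by (rule linear_functionals_separate) (simp add: DL_entry lie_alg_zero linear_0, simp add: vf_zero_def)

lemma DL_bracket:
  assumes x: "x \<in> lie_alg G" and y: "y \<in> lie_alg G"
  shows "DL (vf_bracket x y) v = DL x (DL y v) - DL y (DL x v)"
proof (rule linear_functionals_separate)
  fix l :: "'v \<Rightarrow> real" assume l: "linear l"
  show "l (DL (vf_bracket x y) v) = l (DL x (DL y v) - DL y (DL x v))"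
    unfolding DL_entry[OF lie_alg_bracket[OF x y] l] linear_diff[OF l] DL_entry[OF x l] DL_entry[OF y l]
    by (simp add: vf_bracket_def vf_entry[OF x l] vf_entry[OF y l])
qed

lemma DL_End: "x \<in> lie_alg G \<Longrightarrow> DL x \<in> End_deg C 0"
  by (rule End_derivative_gr[OF fdC _ DL_derivative]) (rule R_End[OF expc_carrier])

lemma d_linear: "linear l \<Longrightarrow> linear (\<lambda>w. l (dif C w) :: real)"
  using linear_compose[OF dif_linear[OF fdC], of l] by (simp add: o_def)

lemma d_DL:
  assumes x: "x \<in> lie_alg G"
  shows "dif C (DL x v) = DL x (dif C v)"
proof (rule linear_functionals_separate)
  fix l :: "'v \<Rightarrow> real" assume l: "linear l"
  show "l (dif C (DL x v)) = l (DL x (dif C v))"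
    using DERIV_unique[OF End_derivativeD(1)[OF DL_derivative[OF x] d_linear[OF l], of v]]
      End_derivativeD(1)[OF DL_derivative[OF x] l, of "dif C v"] d_R[OF expc_carrier[OF x]] by simp
qed

section \<open>The operators of degree -1\<close>

lemma smcurve_expc: "x \<in> lie_alg G \<Longrightarrow> smcurve (expc x)"
  by (intro smG_expc openin_topspace smooth_fun_coord)

lemma smcurve_scale:
  assumes p: "smcurve p" shows "smcurve (\<lambda>r. p (t * r))"
proof -
  have "smG 1 (Rn 1) (\<lambda>z. p (rvec [t * z 0] 0))"
  proof (rule smG_compose[OF p, where H = "\<lambda>z. rvec [t * z 0]"])
    show "open_Rn 1 (Rn 1)" by (rule openin_topspace)
    show "rvec [t * z 0] \<in> Rn 1" for z by (rule rvec_Rn) simp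
    show "smooth_fun 1 (Rn 1) (\<lambda>z. rvec [t * z 0] j)" if "j < 1" for j
      using that smooth_fun_mult[OF smooth_fun_const smooth_fun_coord, of 1 "Rn 1" t 0] by (simp add: rvec_def)
  qed
  then show ?thesis by (simp add: rvec_def)
qed

lemma path_jet:
  assumes l: "linear l"
  obtains \<alpha> \<psi> where "\<And>j. \<psi> j \<in> CG"
    "\<And>p. smcurve p \<Longrightarrow> p 0 = \<one> \<Longrightarrow> ((\<lambda>t. l (S (\<lambda>r. p (t * r)) v)) has_real_derivative
        (\<Sum>j<dm. \<alpha> j * deriv (\<lambda>t. \<psi> j (p t)) 0)) (at 0)"
proof (rule cochain_derivative_first_order[OF matrix_entry_smooth_cochain[OF l, of v]])
  fix \<alpha> \<psi> assume a: "\<And>j. \<psi> j \<in> CG"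
    and b: "\<And>p. smcurve p \<Longrightarrow> p 0 = \<one> \<Longrightarrow>
      ((\<lambda>t. l (\<rho> (gen (mk_simplex 1 (\<lambda>s. p (t * s 0)))) v)) has_real_derivative
        (\<Sum>j<dm. \<alpha> j * deriv (\<lambda>t. \<psi> j (p t)) 0)) (at 0)"
  show thesis
    by (rule that[of \<psi> \<alpha>, unfolded S_def, OF a b])
qed

definition Di :: "'g vfield \<Rightarrow> 'v \<Rightarrow> 'v" where "Di x = D_i G \<rho> x"

lemma exp_simplex_scale:
  assumes x: "x \<in> lie_alg G"
  shows "exp_simplex G (vf_scale t x) = mk_simplex 1 (\<lambda>s. expc x (t * s 0))"
proof -
  have "vf_scale a (vf_scale t x) = vf_scale (t * a) x" for a by (simp add: vf_scale_def mult_ac)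
  then show ?thesis by (simp add: exp_simplex_def lie_exp_scale[OF x])
qed

lemma Di_derivative:
  assumes x: "x \<in> lie_alg G"
  shows "has_End_derivative (\<lambda>t. S (\<lambda>r. expc x (t * r))) (Di x) 0"
proof -
  have "\<exists>T. has_End_derivative (\<lambda>t. S (\<lambda>r. expc x (t * r))) T 0"
  proof (rule End_derivative_exists[OF fdC])
    show "linear (S (\<lambda>r. expc x (t * r)))" for t by (rule S_linear[OF smcurve_scale[OF smcurve_expc[OF x]]])
    fix l :: "'v \<Rightarrow> real" and v assume l: "linear l"
    show "\<exists>d. ((\<lambda>t. l (S (\<lambda>r. expc x (t * r)) v)) has_real_derivative d) (at 0)"
    proof (rule path_jet[OF l, of v])
      fix \<alpha> \<psi> assume "\<And>p. smcurve p \<Longrightarrow> p 0 = \<one> \<Longrightarrow> ((\<lambda>t. l (S (\<lambda>r. p (t * r)) v)) has_real_derivative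
        (\<Sum>j<dm. \<alpha> j * deriv (\<lambda>t. \<psi> j (p t)) 0)) (at 0)"
      from this[OF smcurve_expc[OF x] expc(2)[OF x]] show ?thesis by (rule exI)
    qed
  qed
  then obtain T where T: "has_End_derivative (\<lambda>t. S (\<lambda>r. expc x (t * r))) T 0" by blast
  have "Di x = T"
    unfolding Di_def D_i_def exp_simplex_scale[OF x]
    by (rule the_equality, rule T[unfolded S_def], rule End_derivative_unique[OF _ T[unfolded S_def]])
  then show ?thesis using T by simp
qed

lemma Di_linear: "x \<in> lie_alg G \<Longrightarrow> linear (Di x)"
  by (rule End_derivativeD(2)[OF Di_derivative])

text \<open>
  The functions \<open>\<psi> j\<close> and numbers \<open>\<alpha> j\<close> do not depend on \<open>x\<close>, which makes \<open>Di\<close> linear in \<open>x\<close>.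
\<close>

lemma Di_jet:
  assumes l: "linear l"
  obtains \<alpha> \<psi> where "\<And>j. \<psi> j \<in> CG"
    "\<And>p. smcurve p \<Longrightarrow> p 0 = \<one> \<Longrightarrow> ((\<lambda>t. l (S (\<lambda>r. p (t * r)) v)) has_real_derivative
        (\<Sum>j<dm. \<alpha> j * deriv (\<lambda>t. \<psi> j (p t)) 0)) (at 0)"
    "\<And>x. x \<in> lie_alg G \<Longrightarrow> l (Di x v) = (\<Sum>j<dm. \<alpha> j * x (\<psi> j) \<one>)"
proof -
  obtain \<alpha> \<psi> where \<psi>: "\<And>j. \<psi> j \<in> CG"
    and D: "\<And>p. smcurve p \<Longrightarrow> p 0 = \<one> \<Longrightarrow> ((\<lambda>t. l (S (\<lambda>r. p (t * r)) v)) has_real_derivative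
        (\<Sum>j<dm. \<alpha> j * deriv (\<lambda>t. \<psi> j (p t)) 0)) (at 0)"
    by (rule path_jet[OF l, of v]) (rule that)
  have "l (Di x v) = (\<Sum>j<dm. \<alpha> j * x (\<psi> j) \<one>)" if x: "x \<in> lie_alg G" for x
  proof -
    have "deriv (\<lambda>t. \<psi> j (expc x t)) 0 = x (\<psi> j) \<one>" for j
      using DERIV_imp_deriv[OF DERIV_expc[OF x \<psi>, of j 0]] expc(2)[OF x] by simp
    then show ?thesis
      using DERIV_unique[OF End_derivativeD(1)[OF Di_derivative[OF x] l, of v] D[OF smcurve_expc[OF x] expc(2)[OF x]]]
      by simp
  qed
  from that[OF \<psi> D this] show thesis .
qed

lemma Di_add:
  assumes x: "x \<in> lie_alg G" and y: "y \<in> lie_alg G"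
  shows "Di (vf_add x y) v = Di x v + Di y v"
proof (rule linear_functionals_separate)
  fix l :: "'v \<Rightarrow> real" assume l: "linear l"
  obtain \<alpha> \<psi> where D: "\<And>x. x \<in> lie_alg G \<Longrightarrow> l (Di x v) = (\<Sum>j<dm. \<alpha> j * x (\<psi> j) \<one>)"
    by (rule Di_jet[OF l, of v]) (rule that)
  show "l (Di (vf_add x y) v) = l (Di x v + Di y v)"
    unfolding linear_add[OF l] D[OF x] D[OF y] D[OF lie_alg_add[OF x y]]
    by (simp add: vf_add_def distrib_left sum.distrib)
qed

lemma Di_scale:
  assumes x: "x \<in> lie_alg G"
  shows "Di (vf_scale c x) v = c *\<^sub>R Di x v"
proof (rule linear_functionals_separate)
  fix l :: "'v \<Rightarrow> real" assume l: "linear l"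
  obtain \<alpha> \<psi> where D: "\<And>x. x \<in> lie_alg G \<Longrightarrow> l (Di x v) = (\<Sum>j<dm. \<alpha> j * x (\<psi> j) \<one>)"
    by (rule Di_jet[OF l, of v]) (rule that)
  show "l (Di (vf_scale c x) v) = l (c *\<^sub>R Di x v)"
    unfolding linear_scale[OF l] D[OF x] D[OF lie_alg_scale[OF x]]
    by (simp add: vf_scale_def sum_distrib_left mult_ac)
qed

lemma Di_zero: "Di vf_zero v = 0"
  using Di_scale[OF lie_alg_zero, of 0 v] by (simp add: vf_scale_zero)

lemma Di_End: "x \<in> lie_alg G \<Longrightarrow> Di x \<in> End_deg C (- 1)"
  by (rule End_derivative_gr[OF fdC _ Di_derivative]) (rule S_End[OF smcurve_scale[OF smcurve_expc]])

text \<open>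
  The boundary of the path \<open>exp(ts x)\<close> is \<open>exp(tx) - 1\<close>.
\<close>

lemma d_Di:
  assumes x: "x \<in> lie_alg G"
  shows "dif C (Di x v) + Di x (dif C v) = DL x v"
proof (rule linear_functionals_separate)
  fix l :: "'v \<Rightarrow> real" assume l: "linear l"
  have eq: "l (dif C (S (\<lambda>r. expc x (t * r)) v)) + l (S (\<lambda>r. expc x (t * r)) (dif C v)) =
      l (R (expc x t) v) - l (v)" for t
    using arg_cong[OF d_S[OF smcurve_scale[OF smcurve_expc[OF x], of t], of v], of l]
    by (simp add: linear_add[OF l] linear_diff[OF l] expc(2)[OF x] R_one)
  have "((\<lambda>t. l (R (expc x t) v) - l v) has_real_derivative l (dif C (Di x v)) + l (Di x (dif C v))) (at 0)"
    unfolding eq[symmetric]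
    by (intro DERIV_add End_derivativeD(1)[OF Di_derivative[OF x] d_linear[OF l]]
        End_derivativeD(1)[OF Di_derivative[OF x] l])
  moreover have "((\<lambda>t. l (R (expc x t) v) - l v) has_real_derivative l (DL x v) - 0) (at 0)"
    by (intro DERIV_diff End_derivativeD(1)[OF DL_derivative[OF x] l] DERIV_const)
  ultimately show "l (dif C (Di x v) + Di x (dif C v)) = l (DL x v)"
    using DERIV_unique linear_add[OF l] by fastforce
qed

end

section \<open>Mixed second derivatives\<close>

lemma smooth1_times_DERIV: "smooth1 h \<Longrightarrow> ((\<lambda>t. t * h t) has_real_derivative h 0) (at 0)"
  using DERIV_mult[OF DERIV_ident smooth1_DERIV, of h 0] by simp

lemma smooth2_slices:
  assumes "smooth2 f" shows "smooth1 (\<lambda>t. f s t)" "smooth1 (\<lambda>t. f t s)" "smooth1 (\<lambda>t. f t t)"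
  unfolding smooth1_def
  by (intro smooth2_compose[OF assms openin_topspace] smooth_fun_const smooth_fun_coord)+

lemma smooth2_hadamard_at_0:
  assumes f: "smooth2 f"
  obtains P Q B where "smooth1 P" "smooth1 Q" "smooth2 B"
    "\<And>s t. f s t = f 0 0 + s * P s + t * Q t + s * t * B s t"
proof -
  have "smooth2 (\<lambda>s t. f s t - f 0 0)"
    using f smooth_fun_diff[OF _ smooth_fun_const] unfolding smooth2_def by simp
  then obtain P Q B where "smooth1 P" "smooth1 Q" "smooth2 B"
    and eq: "\<And>s t. f s t - f 0 0 = s * P s + t * Q t + s * t * B s t"
    by (rule smooth2_hadamard) (simp, rule that)
  moreover have "f s t = f 0 0 + s * P s + t * Q t + s * t * B s t" for s t
    using eq[of s t] by linarith
  ultimately show thesis by (intro that)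
qed

text \<open>
  By Hadamard's lemma both derivatives are the value of the remainder \<open>B\<close> at the origin.
\<close>

lemma mixed_derivatives_commute:
  assumes f: "smooth2 f"
  obtains D where "((\<lambda>s. deriv (\<lambda>t. f s t) 0) has_real_derivative D) (at 0)"
    "((\<lambda>t. deriv (\<lambda>s. f s t) 0) has_real_derivative D) (at 0)"
proof -
  obtain P Q B where P: "smooth1 P" and Q: "smooth1 Q" and B: "smooth2 B"
    and eq: "\<And>s t. f s t = f 0 0 + s * P s + t * Q t + s * t * B s t"
    by (rule smooth2_hadamard_at_0[OF f]) (rule that)
  have eq': "f s = (\<lambda>t. f 0 0 + s * P s + t * Q t + s * (t * B s t))" for s
    by (rule ext) (subst eq, simp)
  have eq'': "(\<lambda>s. f s t) = (\<lambda>s. f 0 0 + s * P s + t * Q t + t * (s * B s t))" for t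
    by (rule ext) (subst eq, simp)
  have "deriv (\<lambda>t. f s t) 0 = Q 0 + s * B s 0" for s
  proof (rule DERIV_imp_deriv)
    have "((\<lambda>t. f 0 0 + s * P s + t * Q t + s * (t * B s t)) has_real_derivative 0 + Q 0 + s * B s 0) (at 0)"
      by (intro DERIV_add DERIV_cmult DERIV_const smooth1_times_DERIV Q smooth2_slices[OF B])
    then show "((\<lambda>t. f s t) has_real_derivative Q 0 + s * B s 0) (at 0)"
      by (simp add: eq'[of s, symmetric])
  qed
  moreover have "deriv (\<lambda>s. f s t) 0 = P 0 + t * B 0 t" for t
  proof (rule DERIV_imp_deriv)
    have "((\<lambda>s. f 0 0 + s * P s + t * Q t + t * (s * B s t)) has_real_derivative 0 + P 0 + 0 + t * B 0 t) (at 0)"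
      by (intro DERIV_add DERIV_cmult DERIV_const smooth1_times_DERIV P smooth2_slices[OF B])
    then show "((\<lambda>s. f s t) has_real_derivative P 0 + t * B 0 t) (at 0)"
      by (simp add: eq''[of t, symmetric])
  qed
  moreover have "((\<lambda>s. Q 0 + s * B s 0) has_real_derivative 0 + B 0 0) (at 0)"
    "((\<lambda>t. P 0 + t * B 0 t) has_real_derivative 0 + B 0 0) (at 0)"
    by (intro DERIV_add DERIV_const smooth1_times_DERIV smooth2_slices[OF B])+
  ultimately show thesis by (intro that[of "B 0 0"]) simp_all
qed

text \<open>
  The remainder is divisible by \<open>s\<^sup>2\<close> on the diagonal.
\<close>

lemma diagonal_derivative:
  assumes f: "smooth2 f" and D1: "((\<lambda>s. f s 0) has_real_derivative D1) (at 0)"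
    and D2: "((\<lambda>t. f 0 t) has_real_derivative D2) (at 0)"
  shows "((\<lambda>s. f s s) has_real_derivative D1 + D2) (at 0)"
proof -
  obtain P Q B where B: "smooth2 B"
    and eq: "\<And>s t. f s t = f 0 0 + s * P s + t * Q t + s * t * B s t"
    by (rule smooth2_hadamard_at_0[OF f]) (rule that)
  have "f s s = f s 0 + f 0 s + - f 0 0 + s * (s * B s s)" for s
    using eq[of s s] eq[of s 0] eq[of 0 s] by simp
  then have e: "(\<lambda>s. f s s) = (\<lambda>s. f s 0 + f 0 s + - f 0 0 + s * (s * B s s))" by (rule ext)
  have d: "((\<lambda>s. f s 0 + f 0 s + - f 0 0 + s * (s * B s s)) has_real_derivative
      D1 + D2 + 0 + (1 * (0 * B 0 0) + B 0 0 * 0)) (at 0)"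
    by (intro DERIV_add D1 D2 DERIV_const DERIV_mult[OF DERIV_ident smooth1_times_DERIV] smooth2_slices[OF B])
  show ?thesis unfolding e by (rule DERIV_cong[OF d]) simp
qed

lemma pd01_eqI:
  assumes "\<And>s. ((\<lambda>t. f s t) has_real_derivative K s) (at 0)" "(K has_real_derivative D) (at 0)"
  shows "pd 0 (pd 1 (\<lambda>z. f (z 0) (z 1))) (rvec [0, 0]) = D"
proof -
  have "pd 1 (\<lambda>z. f (z 0) (z 1)) ((rvec [0, 0])(0 := s)) = K s" for s
    using DERIV_imp_deriv[OF assms(1), of s] by (simp add: pd_def rvec_def)
  then show ?thesis using DERIV_imp_deriv[OF assms(2)] by (simp add: pd_def[of 0] rvec_def)
qed

lemma End_derivative_intertwine:
  assumes F: "has_End_derivative F T t" and F': "has_End_derivative F' T' t" and \<phi>: "linear \<phi>"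
    and eq: "\<And>s v. \<phi> (F s v) = F' s (\<phi> v)"
  shows "\<phi> (T v) = T' (\<phi> v)"
proof (rule linear_functionals_separate)
  fix l :: "'b \<Rightarrow> real" assume l: "linear l"
  have "linear (\<lambda>w. l (\<phi> w))" using linear_compose[OF \<phi> l] by (simp add: o_def)
  from End_derivativeD(1)[OF F this, of v] show "l (\<phi> (T v)) = l (T' (\<phi> v))"
    unfolding eq using DERIV_unique End_derivativeD(1)[OF F' l, of "\<phi> v"] by blast
qed

context liegrp
begin

lemma expc_add:
  assumes x: "x \<in> lie_alg G"
  shows "expc x (a + b) = expc x a \<otimes> expc x b"
proof -
  have c: "expc x t \<in> carrier G" for t by (rule expc_carrier[OF x])
  have "icurve x UNIV (\<lambda>t. expc x (t + a))" by (rule icurve_shift[OF expc(1)[OF x]]) simp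
  from icurve_translate[OF x inv_closed[OF c[of a]] this]
  have "expc x = (\<lambda>t. inv expc x a \<otimes> expc x (t + a))"
    by (rule expc_eqI[OF x]) (simp add: c)
  from fun_cong[OF this, of b] show ?thesis
    using c by (simp add: add.commute m_assoc[symmetric])
qed

lemma expc_minus: "x \<in> lie_alg G \<Longrightarrow> expc x a \<otimes> expc x (- a) = \<one>"
  using expc_add[of x a "- a"] expc(2) by simp

lemma smooth_conjugation:
  assumes x: "x \<in> lie_alg G" and y: "y \<in> lie_alg G"
    and "open_Rn n W" "smooth_fun n W a" "smooth_fun n W b" "smooth_fun n W c"
  shows "smG n W (\<lambda>z. expc x (a z) \<otimes> expc y (b z) \<otimes> expc x (c z))"
  using assms by (intro smG_mult smG_expc)

text \<open>
  Separating the two occurrences of \<open>a\<close>, the derivative along the diagonal is the sum of the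
  derivatives along the two axes. The first one is that of \<open>(y \<psi>)(exp(ax))\<close>. For the second one the order of differentiation is
  interchanged, which gives the derivative of \<open>- (x \<psi>)(exp(ty))\<close>.
\<close>

lemma commutator_derivative:
  assumes x: "x \<in> lie_alg G" and y: "y \<in> lie_alg G" and \<psi>: "\<psi> \<in> CG"
  shows "((\<lambda>a. deriv (\<lambda>t. \<psi> (expc x a \<otimes> expc y t \<otimes> expc x (- a))) 0) has_real_derivative
    vf_bracket x y \<psi> \<one>) (at 0)"
proof -
  define g where "g a b t = \<psi> (expc x a \<otimes> expc y t \<otimes> expc x (- b))" for a b t
  define k where "k a b = deriv (\<lambda>t. g a b t) 0" for a b
  have c: "expc x t \<in> carrier G" "expc y t \<in> carrier G" for t using expc_carrier x y by auto
  note e0 = expc(2)[OF x] expc(2)[OF y]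
  have op: "open_Rn n (Rn n)" for n by (rule openin_topspace)
  have "smooth_fun 3 (Rn 3) (\<lambda>z. g (z 0) (z 1) (z 2))"
    unfolding g_def by (rule smooth_map_compose_Cinf[OF smooth_conjugation[OF x y] \<psi>])
      (intro op smooth_fun_coord smooth_fun_uminus smooth_fun_const)+
  then have "smooth_fun 3 (Rn 3) (pd 2 (\<lambda>z. g (z 0) (z 1) (z 2)))"
    by (rule smooth_fun_pd(1)[OF op]) simp
  then have "smooth_fun 2 (Rn 2) (\<lambda>z. pd 2 (\<lambda>z. g (z 0) (z 1) (z 2)) (rvec (map (\<lambda>g. g z) [\<lambda>z. z 0, \<lambda>z. z 1, \<lambda>z. 0])))"
    by (rule smooth_fun_vec[OF op op, rotated -1]) (auto intro: rvec_Rn smooth_fun_coord smooth_fun_const)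
  moreover have "pd 2 (\<lambda>z. g (z 0) (z 1) (z 2)) (rvec [a, b, 0]) = k a b" for a b
    by (simp add: pd_def rvec_def k_def)
  ultimately have k: "smooth2 k" unfolding smooth2_def by simp
  have k1: "((\<lambda>a. k a 0) has_real_derivative x (y \<psi>) \<one>) (at 0)"
  proof -
    have "k a 0 = y \<psi> (expc x a)" for a
      unfolding k_def g_def using DERIV_imp_deriv[OF DERIV_expc_translate[OF y c(1) \<psi>, of a 0]] c e0 by simp
    then show ?thesis using DERIV_expc[OF x vf_Cinf[OF lie_alg_vf[OF y] \<psi>], of 0] e0 by simp
  qed
  have k2: "((\<lambda>b. k 0 b) has_real_derivative - y (x \<psi>) \<one>) (at 0)"
  proof -
    have "smooth_fun 2 (Rn 2) (\<lambda>z. g 0 (z 0) (z 1))"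
      unfolding g_def by (rule smooth_map_compose_Cinf[OF smooth_conjugation[OF x y] \<psi>])
      (intro op smooth_fun_coord smooth_fun_uminus smooth_fun_const)+
    then have g0: "smooth2 (g 0)" by (simp add: smooth2_def)
    have k0: "k 0 = (\<lambda>b. deriv (g 0 b) 0)" by (simp add: k_def fun_eq_iff)
    obtain D where D: "((\<lambda>b. deriv (\<lambda>t. g 0 b t) 0) has_real_derivative D) (at 0)"
      "((\<lambda>t. deriv (\<lambda>b. g 0 b t) 0) has_real_derivative D) (at 0)"
      by (rule mixed_derivatives_commute[OF g0]) (rule that)
    have "deriv (\<lambda>b. g 0 b t) 0 = - x \<psi> (expc y t)" for t
    proof (rule DERIV_imp_deriv)
      have "((\<lambda>s. \<psi> (expc y t \<otimes> expc x s)) has_real_derivative x \<psi> (expc y t)) (at (- 0))"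
        using DERIV_expc_translate[OF x c(2) \<psi>, of t "- 0"] e0 c by simp
      then show "((\<lambda>b. g 0 b t) has_real_derivative - x \<psi> (expc y t)) (at 0)"
        unfolding DERIV_mirror using e0 c by (simp add: g_def)
    qed
    moreover have "((\<lambda>t. - x \<psi> (expc y t)) has_real_derivative - y (x \<psi>) \<one>) (at 0)"
      using DERIV_minus[OF DERIV_expc[OF y vf_Cinf[OF lie_alg_vf[OF x] \<psi>], of 0]] e0 by simp
    ultimately have "D = - y (x \<psi>) \<one>" using D(2) DERIV_unique by fastforce
    then show ?thesis using D(1) by (simp add: k0)
  qed
  show ?thesis using diagonal_derivative[OF k k1 k2] by (simp add: k_def g_def vf_bracket_def)
qed

end

context chain_module
begin

text \<open>
  Conjugating the path \<open>exp(ty)\<close> by \<open>exp(ax)\<close> and differentiating at \<open>t = 0\<close> gives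
  \<open>\<rho>(exp(ax)) i\<^sub>y \<rho>(exp(-ax))\<close>. Its derivative in \<open>a\<close> is the commutator of \<open>L\<^sub>x\<close> and \<open>i\<^sub>y\<close>. On the other hand it
  is computed from the velocity of the conjugated curve, whose derivative in \<open>a\<close> is the Lie bracket.
\<close>

lemma Di_bracket:
  assumes x: "x \<in> lie_alg G" and y: "y \<in> lie_alg G"
  shows "Di (vf_bracket x y) v = DL x (Di y v) - Di y (DL x v)"
proof (rule linear_functionals_separate)
  fix l :: "'v \<Rightarrow> real" assume l: "linear l"
  have c: "expc x t \<in> carrier G" "expc y t \<in> carrier G" for t using expc_carrier x y by auto
  have op: "open_Rn n (Rn n)" for n by (rule openin_topspace)
  obtain \<alpha> \<psi> where \<psi>: "\<And>j. \<psi> j \<in> CG"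
    and D: "\<And>p. smcurve p \<Longrightarrow> p 0 = \<one> \<Longrightarrow> ((\<lambda>t. l (S (\<lambda>r. p (t * r)) v)) has_real_derivative
        (\<Sum>j<dm. \<alpha> j * deriv (\<lambda>t. \<psi> j (p t)) 0)) (at 0)"
    and E: "\<And>x. x \<in> lie_alg G \<Longrightarrow> l (Di x v) = (\<Sum>j<dm. \<alpha> j * x (\<psi> j) \<one>)"
    by (rule Di_jet[OF l, of v]) (rule that)
  have H: "l (R (expc x a) (Di y (R (expc x (- a)) v))) =
      (\<Sum>j<dm. \<alpha> j * deriv (\<lambda>t. \<psi> j (expc x a \<otimes> expc y t \<otimes> expc x (- a))) 0)" for a
  proof -
    let ?p = "\<lambda>t. expc x a \<otimes> expc y t \<otimes> expc x (- a)"
    have sy: "smcurve (\<lambda>r. expc y (t * r))" for t by (rule smcurve_scale[OF smcurve_expc[OF y]])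
    have sm: "smcurve (\<lambda>r. expc x a \<otimes> expc y (t * r))" for t
      by (rule smG_mult[OF smG_const[OF op c(1)] sy])
    have "S (\<lambda>r. ?p (t * r)) v = R (expc x a) (S (\<lambda>r. expc y (t * r)) (R (expc x (- a)) v))" for t
      by (simp add: R_S[OF c(1) sy] S_R[OF c(1) sm])
    moreover have "linear (\<lambda>w. l (R (expc x a) w))"
      using linear_compose[OF R_linear[OF c(1)] l] by (simp add: o_def)
    ultimately have "((\<lambda>t. l (S (\<lambda>r. ?p (t * r)) v)) has_real_derivative
        l (R (expc x a) (Di y (R (expc x (- a)) v)))) (at 0)"
      using End_derivativeD(1)[OF Di_derivative[OF y]] by simp
    moreover have "smcurve ?p"
      by (rule smooth_conjugation[OF x y op smooth_fun_const smooth_fun_coord smooth_fun_const])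
    moreover have "?p 0 = \<one>" using expc(2)[OF y] expc_minus[OF x] c by simp
    ultimately show ?thesis using D[of ?p] DERIV_unique by blast
  qed
  have "((\<lambda>a. l (R (expc x a) (Di y (R (expc x (- a)) v)))) has_real_derivative
      l (DL x (Di y (R (expc x (- 0)) v))) + l (R (expc x 0) (Di y (- DL x v)))) (at 0)"
  proof (rule End_derivative_bilinear[where F = "\<lambda>s w. R (expc x s) (Di y w)" and G = "\<lambda>s. R (expc x (- s))"
        and S = "\<lambda>w. DL x (Di y w)" and T = "\<lambda>v. - DL x v" and t = 0, OF fdC _ _ _ l])
    show "linear (\<lambda>w. R (expc x s) (Di y w))" for s
      using linear_compose[OF Di_linear[OF y] R_linear[OF c(1)], of s] by (simp add: o_def)
    have "linear (\<lambda>w. DL x (Di y w))"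
      using linear_compose[OF Di_linear[OF y] DL_linear[OF x]] by (simp add: o_def)
    then show "has_End_derivative (\<lambda>s w. R (expc x s) (Di y w)) (\<lambda>w. DL x (Di y w)) 0"
      unfolding has_End_derivative_def using End_derivativeD(1)[OF DL_derivative[OF x]] by blast
    have "((\<lambda>s. l' (R (expc x (- s)) w)) has_real_derivative l' (- DL x w)) (at 0)"
      if l': "linear l'" for l' :: "'v \<Rightarrow> real" and w
      using End_derivativeD(1)[OF DL_derivative[OF x] l', of w] iffD1[OF DERIV_mirror, of "\<lambda>s. l' (R (expc x s) w)" "l' (DL x w)" 0]
      by (simp add: linear_neg[OF l'])
    then show "has_End_derivative (\<lambda>a. R (expc x (- a))) (\<lambda>v. - DL x v) 0"
      unfolding has_End_derivative_def using linear_compose_neg[OF DL_linear[OF x]] by blast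
  qed
  moreover have "((\<lambda>a. l (R (expc x a) (Di y (R (expc x (- a)) v)))) has_real_derivative
      (\<Sum>j<dm. \<alpha> j * vf_bracket x y (\<psi> j) \<one>)) (at 0)"
    unfolding H by (intro DERIV_sum DERIV_cmult commutator_derivative[OF x y \<psi>])
  ultimately have "l (DL x (Di y v)) + l (Di y (- DL x v)) = (\<Sum>j<dm. \<alpha> j * vf_bracket x y (\<psi> j) \<one>)"
    using DERIV_unique expc(2)[OF x] by (fastforce simp: R_one)
  then show "l (Di (vf_bracket x y) v) = l (DL x (Di y v) - Di y (DL x v))"
    unfolding E[OF lie_alg_bracket[OF x y]]
    by (simp add: linear_diff[OF l] linear_neg[OF Di_linear[OF y]] linear_neg[OF l])
qed

lemma S_S:
  assumes p: "smcurve p" and q: "smcurve q" and l: "linear l"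
  shows "l (S p (S q v)) = tau 2 (\<lambda>\<sigma>. l (\<rho> (gen \<sigma>) v)) (\<lambda>u. p (u 0) \<otimes> q (u 1))"
proof -
  have op: "open_Rn n (Rn n)" for n by (rule openin_topspace)
  have sm: "smG 2 (Rn 2) (\<lambda>z. p (z i) \<otimes> q (z j))" for i j
  proof -
    have "smG 2 (Rn 2) (\<lambda>z. r (z i))" if r: "smcurve r" for r i
    proof -
      have "smG 2 (Rn 2) (\<lambda>z. r (rvec [z i] 0))"
      proof (rule smG_compose[OF r, where H = "\<lambda>z. rvec [z i]"])
        show "open_Rn 2 (Rn 2)" by (rule op)
        show "rvec [z i] \<in> Rn 1" for z by (rule rvec_Rn) simp
        show "smooth_fun 2 (Rn 2) (\<lambda>z. rvec [z i] j)" if "j < 1" for j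
          using that smooth_fun_coord[of 2 "Rn 2" i] by (simp add: rvec_def)
      qed
      then show ?thesis by (simp add: rvec_def)
    qed
    then show ?thesis using p q by (intro smG_mult)
  qed
  let ?T = "\<lambda>i j. mk_simplex 2 (\<lambda>u. p (u i) \<otimes> q (u j))"
  have g: "gen (?T i j) \<in> chains NG" for i j by (rule gen_chains[OF mk_simplex_smooth[OF sm]])
  have "\<rho> (chain_prod G (gen (mk_simplex 1 (\<lambda>s. p (s 0)))) (gen (mk_simplex 1 (\<lambda>s. q (s 0))))) v = S p (S q v)"
    using rho_prod[OF gen_chains[OF path_smooth[OF p]] gen_chains[OF path_smooth[OF q]]] by (simp add: S_def)
  moreover have "chain_prod G (gen (mk_simplex 1 (\<lambda>s. p (s 0)))) (gen (mk_simplex 1 (\<lambda>s. q (s 0)))) =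
      gen (?T 0 1) + pm_scale (- 1) (gen (?T 1 0))"
    unfolding chain_prod_gen simplex_prod_11 by (simp add: rvec_def)
  ultimately have "S p (S q v) = \<rho> (gen (?T 0 1)) v + (- 1) *\<^sub>R \<rho> (gen (?T 1 0)) v"
    using rho_add[OF g chains_pm_scale[OF g], of 0 1 "-1" 1 0] rho_scale[OF g, of "-1" 1 0] by simp
  then have "l (S p (S q v)) = l (\<rho> (gen (?T 0 1)) v) - l (\<rho> (gen (?T 1 0)) v)"
    by (simp add: linear_diff[OF l])
  then show ?thesis unfolding tau_2 by (simp add: rvec_def)
qed

text \<open>
  The iterated derivative of the action of the square \<open>exp(s u\<^sub>0 x) exp(t u\<^sub>1 y)\<close> is \<open>i\<^sub>x i\<^sub>y\<close>. The square
  \<open>exp(t u\<^sub>1 y) exp(s u\<^sub>0 x)\<close> has the same first order part and, up to the interchange of \<open>u\<^sub>0\<close> and \<open>u\<^sub>1\<close>, belongs to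
  \<open>i\<^sub>y i\<^sub>x\<close>.
\<close>

lemma Di_Di:
  assumes x: "x \<in> lie_alg G" and y: "y \<in> lie_alg G"
  shows "Di x (Di y v) + Di y (Di x v) = 0"
proof (rule linear_functionals_separate)
  fix l :: "'v \<Rightarrow> real" assume l: "linear l"
  let ?c = "\<lambda>\<sigma>. l (\<rho> (gen \<sigma>) v)"
  let ?X = "\<lambda>s r. expc x (s * r)" and ?Y = "\<lambda>t r. expc y (t * r)"
  let ?A = "\<lambda>a b. expc x a \<otimes> expc y b" and ?A' = "\<lambda>a b. expc y b \<otimes> expc x a"
  have c: "expc x t \<in> carrier G" "expc y t \<in> carrier G" for t using expc_carrier x y by auto
  note e0 = expc(2)[OF x] expc(2)[OF y]
  have op: "open_Rn n (Rn n)" for n by (rule openin_topspace)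
  have sX: "smcurve (?X s)" and sY: "smcurve (?Y s)" for s
    by (rule smcurve_scale[OF smcurve_expc], fact)+
  have lin: "linear (\<lambda>w. l (T w))" if "linear T" for T
    using linear_compose[OF that l] by (simp add: o_def)
  have "pd 0 (pd 1 (\<lambda>z. tau 2 ?c (\<lambda>u. ?A (z 0 * u 0) (z 1 * u 1)))) (rvec [0, 0]) = l (Di x (Di y v))"
  proof (rule pd01_eqI)
    fix s
    show "((\<lambda>t. tau 2 ?c (\<lambda>u. ?A (s * u 0) (t * u 1))) has_real_derivative l (S (?X s) (Di y v))) (at 0)"
      using End_derivativeD(1)[OF Di_derivative[OF y] lin[OF S_linear[OF sX[of s]]], of v]
      by (simp only: S_S[OF sX sY l])
  next
    show "((\<lambda>s. l (S (?X s) (Di y v))) has_real_derivative l (Di x (Di y v))) (at 0)"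
      by (rule End_derivativeD(1)[OF Di_derivative[OF x] l])
  qed
  moreover have "pd 0 (pd 1 (\<lambda>z. tau 2 ?c (\<lambda>u. ?A' (z 0 * u 0) (z 1 * u 1)))) (rvec [0, 0]) = - l (Di y (Di x v))"
  proof (rule pd01_eqI)
    fix s
    have "tau 2 ?c (\<lambda>u. ?A' (s * u 0) (t * u 1)) = - l (S (?Y t) (S (?X s) v))" for t
    proof -
      have "mk_simplex 2 (\<lambda>u. ?A' (s * u 0) (t * u 1)) = mk_simplex 2 (\<lambda>u. ?Y t (u 1) \<otimes> ?X s (u 0))" by simp
      then show ?thesis unfolding S_S[OF sY sX l] tau_2 by (simp add: rvec_def)
    qed
    then show "((\<lambda>t. tau 2 ?c (\<lambda>u. ?A' (s * u 0) (t * u 1))) has_real_derivative - l (Di y (S (?X s) v))) (at 0)"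
      using DERIV_minus[OF End_derivativeD(1)[OF Di_derivative[OF y] l, of "S (?X s) v"]] by simp
  next
    show "((\<lambda>s. - l (Di y (S (?X s) v))) has_real_derivative - l (Di y (Di x v))) (at 0)"
      by (intro DERIV_minus End_derivativeD(1)[OF Di_derivative[OF x] lin[OF Di_linear[OF y]]])
  qed
  moreover have "pd 0 (pd 1 (\<lambda>z. tau 2 ?c (\<lambda>u. ?A (z 0 * u 0) (z 1 * u 1)))) (rvec [0, 0]) =
      pd 0 (pd 1 (\<lambda>z. tau 2 ?c (\<lambda>u. ?A' (z 0 * u 0) (z 1 * u 1)))) (rvec [0, 0])"
  proof (rule tau_mixed_derivative_first_order[OF matrix_entry_smooth_cochain[OF l, of v]])
    show "smG 2 (Rn 2) (\<lambda>z. ?A (z 0) (z 1))" "smG 2 (Rn 2) (\<lambda>z. ?A' (z 0) (z 1))"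
      by (intro smG_mult smG_expc x y op smooth_fun_coord)+
    show "?A 0 0 = \<one>" "?A' 0 0 = \<one>" using e0 by simp_all
    fix f and i :: nat assume "f \<in> CG" "i < 2"
    then consider "i = 0" | "i = 1" by linarith
    then show "pd i (\<lambda>z. f (?A (z 0) (z 1))) (\<lambda>_. 0) = pd i (\<lambda>z. f (?A' (z 0) (z 1))) (\<lambda>_. 0)"
      by cases (simp_all add: pd_def e0 c)
  qed
  ultimately show "l (Di x (Di y v) + Di y (Di x v)) = l 0" by (simp add: linear_add[OF l] linear_0[OF l])
qed

section \<open>The representation\<close>

lemma snd_D_obj: "snd (D_obj G (C, \<rho>)) (x, y) = (\<lambda>v. DL x v + Di y v)"
  by (simp add: D_obj_def DL_def Di_def)

lemma snd_D_obj_T: "snd (D_obj G (C, \<rho>)) (T_L x) = DL x" "snd (D_obj G (C, \<rho>)) (T_i x) = Di x"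
  by (simp_all add: T_L_def T_i_def snd_D_obj DL_zero Di_zero)

lemma has_End_derivative_D_obj:
  assumes x: "x \<in> lie_alg G"
  shows "has_End_derivative (\<lambda>t. \<rho> (gen (point_simplex (lie_exp G (vf_scale t x)))))
      (snd (D_obj G (C, \<rho>)) (T_L x)) 0"
    "has_End_derivative (\<lambda>t. \<rho> (gen (exp_simplex G (vf_scale t x)))) (snd (D_obj G (C, \<rho>)) (T_i x)) 0"
  using DL_derivative[OF x] Di_derivative[OF x]
  by (simp_all add: snd_D_obj_T lie_exp_scale[OF x] exp_simplex_scale[OF x] R_def S_def)

end

lemma Tg_lgr_cases:
  assumes "a \<in> lgr (Tg G) p"
  obtains (L) x where "p = 0" "x \<in> lie_alg G" "a = (x, vf_zero)"
    | (i) y where "p = - 1" "y \<in> lie_alg G" "a = (vf_zero, y)"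
    | (zero) "a = (vf_zero, vf_zero)" "p \<noteq> 0" "p \<noteq> - 1"
  using assms by (auto simp: Tg_def T_L_def T_i_def split: if_splits)

lemma Tg_simps:
  "lcarrier (Tg G) = lie_alg G \<times> lie_alg G"
  "ladd (Tg G) (x, y) (x', y') = (vf_add x x', vf_add y y')"
  "lscale (Tg G) c (x, y) = (vf_scale c x, vf_scale c y)"
  "lbracket (Tg G) (x, y) (x', y') = (vf_bracket x x', vf_add (vf_bracket x y') (vf_bracket y x'))"
  "ldif (Tg G) (x, y) = (y, vf_zero)"
  by (simp_all add: Tg_def)

lemma vf_add_zero: "vf_add x vf_zero = x" "vf_add vf_zero x = x"
  by (simp_all add: vf_add_def vf_zero_def)

lemma (in liegrp) vf_bracket_zero:
  "vf_bracket vf_zero vf_zero = vf_zero"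
  "x \<in> lie_alg G \<Longrightarrow> vf_bracket x vf_zero = vf_zero" "x \<in> lie_alg G \<Longrightarrow> vf_bracket vf_zero x = vf_zero"
  using vf_zero_fun[OF lie_alg_vf] by (auto simp: vf_bracket_def vf_zero_def fun_eq_iff)

text \<open>
  Reduces the bracket of \<open>i\<^sub>x\<close> with \<open>L\<^sub>y\<close> to that of \<open>L\<^sub>y\<close> with \<open>i\<^sub>x\<close>.
\<close>

lemma vf_bracket_swap: "vf_bracket y x = vf_scale (- 1) (vf_bracket x y)"
  by (auto simp: vf_bracket_def vf_scale_def)

context chain_module
begin

lemma Rep_obj_D_obj: "Rep_obj G (D_obj G (C, \<rho>))"
  unfolding Rep_obj_def dgla_rep_def
proof (intro conjI ballI allI)
  have fst: "fst (D_obj G (C, \<rho>)) = C" by (simp add: D_obj_def)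
  let ?\<theta> = "snd (D_obj G (C, \<rho>))"
  note sn = snd_D_obj DL_zero Di_zero
  have z: "linear (\<lambda>v. 0 :: 'v)" by (rule linear_zero)
  show "fd_complex (fst (D_obj G (C, \<rho>)))" unfolding fst by (rule fdC)
  show "?\<theta> (ladd (Tg G) a b) = (\<lambda>v. ?\<theta> a v + ?\<theta> b v)" if "a \<in> lcarrier (Tg G)" "b \<in> lcarrier (Tg G)" for a b
    using that by (cases a; cases b) (auto simp: Tg_simps snd_D_obj DL_add Di_add add_ac)
  show "?\<theta> (lscale (Tg G) c a) = (\<lambda>v. c *\<^sub>R ?\<theta> a v)" if "a \<in> lcarrier (Tg G)" for a c
    using that by (cases a) (auto simp: Tg_simps snd_D_obj DL_scale Di_scale scaleR_add_right)
  show "?\<theta> a \<in> End_deg (fst (D_obj G (C, \<rho>))) p" if "a \<in> lgr (Tg G) p" for a p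
    using that
  proof (cases rule: Tg_lgr_cases)
    case zero
    then show ?thesis unfolding fst using subspace_0[OF gr_subspace[OF fdC]]
      by (auto simp: sn End_deg_def image_subset_iff z)
  qed (use DL_End Di_End in \<open>simp_all add: sn fst\<close>)
  show "?\<theta> (ldif (Tg G) a) = gcomm 1 p (dif (fst (D_obj G (C, \<rho>)))) (?\<theta> a)" if "a \<in> lgr (Tg G) p" for a p
    using that
  proof (cases rule: Tg_lgr_cases)
    case (L x)
    then show ?thesis by (simp add: Tg_simps sn fst gcomm_def d_DL ksign_0)
  next
    case (i y)
    then show ?thesis using d_Di[OF i(2)] by (auto simp: Tg_simps sn fst gcomm_def ksign_def fun_eq_iff)
  next
    case zero
    then show ?thesis by (simp add: Tg_simps sn fst gcomm_def linear_0[OF dif_linear[OF fdC]])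
  qed
  show "?\<theta> (lbracket (Tg G) a b) = gcomm p q (?\<theta> a) (?\<theta> b)"
    if a: "a \<in> lgr (Tg G) p" and b: "b \<in> lgr (Tg G) q" for a b p q
    using a
  proof (cases rule: Tg_lgr_cases)
    case (L x)
    note L0 = linear_0[OF DL_linear[OF L(2)]]
    from b show ?thesis
    proof (cases rule: Tg_lgr_cases)
      case L': (L y)
      then show ?thesis using L by (simp add: Tg_simps sn gcomm_def ksign_0 vf_bracket_zero vf_add_zero DL_bracket)
    next
      case (i y)
      then show ?thesis using L by (simp add: Tg_simps sn gcomm_def ksign_0 vf_bracket_zero vf_add_zero Di_bracket)
    next
      case zero
      then show ?thesis using L L0 by (simp add: Tg_simps sn gcomm_def vf_bracket_zero vf_add_zero)
    qed
  next
    case (i x)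
    note L0 = linear_0[OF Di_linear[OF i(2)]]
    from b show ?thesis
    proof (cases rule: Tg_lgr_cases)
      case (L y)
      then show ?thesis using i vf_bracket_swap[of x y] lie_alg_bracket[of y x]
        by (simp add: Tg_simps sn gcomm_def ksign_0 vf_bracket_zero vf_add_zero Di_bracket Di_scale)
    next
      case i': (i y)
      then show ?thesis using i Di_Di[of x y]
        by (simp add: Tg_simps sn gcomm_def ksign_def vf_bracket_zero vf_add_zero)
    next
      case zero
      then show ?thesis using i L0 by (simp add: Tg_simps sn gcomm_def vf_bracket_zero vf_add_zero)
    qed
  next
    case zero
    from b show ?thesis
      by (cases rule: Tg_lgr_cases)
        (use zero linear_0[OF DL_linear] linear_0[OF Di_linear] in
          \<open>simp_all add: Tg_simps sn gcomm_def vf_bracket_zero vf_add_zero\<close>)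
  qed
qed

end

lemma Rep_hom_D_obj:
  assumes G: "lie_group G" and V: "Mod_obj G V" and W: "Mod_obj G W" and \<phi>: "Mod_hom G V W \<phi>"
  shows "Rep_hom G (D_obj G V) (D_obj G W) \<phi>"
proof -
  obtain C \<rho> where V': "V = (C, \<rho>)" by (cases V)
  obtain C' \<rho>' where W': "W = (C', \<rho>')" by (cases W)
  interpret liegrp G by unfold_locales (rule G)
  interpret A: chain_module G C \<rho> by unfold_locales (use V V' in simp)
  interpret B: chain_module G C' \<rho>' by unfold_locales (use W W' in simp)
  have cm: "cochain_map C C' \<phi>" and eq: "\<And>a v. a \<in> chains (mfd_of G) \<Longrightarrow> \<phi> (\<rho> a v) = \<rho>' a (\<phi> v)"
    using \<phi> by (auto simp: Mod_hom_def V' W')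
  have lin: "linear \<phi>" using cm by (simp add: cochain_map_def)
  have "\<phi> (A.DL x v) = B.DL x (\<phi> v)" if x: "x \<in> lie_alg G" for x v
    by (rule End_derivative_intertwine[OF A.DL_derivative[OF x] B.DL_derivative[OF x] lin])
      (simp add: A.R_def B.R_def eq gen_chains[OF A.point_simplex_smooth[OF expc_carrier[OF x]]])
  moreover have "\<phi> (A.Di x v) = B.Di x (\<phi> v)" if x: "x \<in> lie_alg G" for x v
    by (rule End_derivative_intertwine[OF A.Di_derivative[OF x] B.Di_derivative[OF x] lin])
      (unfold A.S_def B.S_def, rule eq[OF gen_chains[OF A.path_smooth[OF A.smcurve_scale[OF A.smcurve_expc[OF x]]]]])
  ultimately show ?thesis
    using cm lin by (auto simp: Rep_hom_def V' W' D_obj_def A.DL_def[symmetric] B.DL_def[symmetric]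
      A.Di_def[symmetric] B.Di_def[symmetric] Tg_simps linear_add)
qed

section \<open>Tensor products of representations\<close>

lemma Rep_objD:
  assumes "Rep_obj G V"
  shows "fd_complex (fst V)"
    "a \<in> lcarrier (Tg G) \<Longrightarrow> b \<in> lcarrier (Tg G) \<Longrightarrow> snd V (ladd (Tg G) a b) = (\<lambda>v. snd V a v + snd V b v)"
    "a \<in> lcarrier (Tg G) \<Longrightarrow> snd V (lscale (Tg G) c a) = (\<lambda>v. c *\<^sub>R snd V a v)"
    "a \<in> lgr (Tg G) p \<Longrightarrow> snd V a \<in> End_deg (fst V) p"
    "a \<in> lgr (Tg G) p \<Longrightarrow> snd V (ldif (Tg G) a) = gcomm 1 p (dif (fst V)) (snd V a)"
    "a \<in> lgr (Tg G) p \<Longrightarrow> b \<in> lgr (Tg G) q \<Longrightarrow> snd V (lbracket (Tg G) a b) = gcomm p q (snd V a) (snd V b)"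
  using assms unfolding Rep_obj_def dgla_rep_def by simp_all

lemma Rep_objI:
  assumes "fd_complex (fst V)"
    "\<And>a b. a \<in> lcarrier (Tg G) \<Longrightarrow> b \<in> lcarrier (Tg G) \<Longrightarrow> snd V (ladd (Tg G) a b) = (\<lambda>v. snd V a v + snd V b v)"
    "\<And>a c. a \<in> lcarrier (Tg G) \<Longrightarrow> snd V (lscale (Tg G) c a) = (\<lambda>v. c *\<^sub>R snd V a v)"
    "\<And>a p. a \<in> lgr (Tg G) p \<Longrightarrow> snd V a \<in> End_deg (fst V) p"
    "\<And>a p. a \<in> lgr (Tg G) p \<Longrightarrow> snd V (ldif (Tg G) a) = gcomm 1 p (dif (fst V)) (snd V a)"
    "\<And>a b p q. a \<in> lgr (Tg G) p \<Longrightarrow> b \<in> lgr (Tg G) q \<Longrightarrow> snd V (lbracket (Tg G) a b) = gcomm p q (snd V a) (snd V b)"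
  shows "Rep_obj G V"
  unfolding Rep_obj_def dgla_rep_def using assms by simp

lemma End_deg_linear: "T \<in> End_deg C k \<Longrightarrow> linear T"
  by (simp add: End_deg_def)

context liegrp
begin

lemma T_lgr: "x \<in> lie_alg G \<Longrightarrow> T_L x \<in> lgr (Tg G) 0" "x \<in> lie_alg G \<Longrightarrow> T_i x \<in> lgr (Tg G) (- 1)"
  "(vf_zero, vf_zero) \<in> lgr (Tg G) p"
  using lie_alg_zero by (auto simp: Tg_def T_L_def T_i_def image_iff)

lemma lgr_lcarrier: "a \<in> lgr (Tg G) p \<Longrightarrow> a \<in> lcarrier (Tg G)"
  by (erule Tg_lgr_cases) (use lie_alg_zero in \<open>simp_all add: Tg_simps\<close>)

lemma lcarrier_ladd: "a \<in> lcarrier (Tg G) \<Longrightarrow> b \<in> lcarrier (Tg G) \<Longrightarrow> ladd (Tg G) a b \<in> lcarrier (Tg G)"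
  by (cases a; cases b) (simp add: Tg_simps lie_alg_add)

lemma lcarrier_lscale: "a \<in> lcarrier (Tg G) \<Longrightarrow> lscale (Tg G) c a \<in> lcarrier (Tg G)"
  by (cases a) (simp add: Tg_simps lie_alg_scale)

lemma lgr_ldif: "a \<in> lgr (Tg G) p \<Longrightarrow> ldif (Tg G) a \<in> lgr (Tg G) (1 + p)"
  by (erule Tg_lgr_cases) (use T_lgr in \<open>simp_all add: Tg_simps T_L_def T_i_def\<close>)

lemma lgr_lbracket:
  assumes "a \<in> lgr (Tg G) p" "b \<in> lgr (Tg G) q"
  shows "lbracket (Tg G) a b \<in> lgr (Tg G) (p + q)"
  using assms
  by (elim Tg_lgr_cases)
    (use T_lgr lie_alg_bracket lie_alg_add in
      \<open>simp_all add: Tg_simps T_L_def T_i_def vf_bracket_zero vf_add_zero\<close>)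

lemma rep_zero: "Rep_obj G V \<Longrightarrow> snd V (vf_zero, vf_zero) = (\<lambda>v. 0)"
  using Rep_objD(3)[of G V "(vf_zero, vf_zero)" 0] lie_alg_zero by (simp add: Tg_simps vf_scale_zero)

lemma rep_tensor_leib:
  "snd (rep_tensor V W) (x, y) = (\<lambda>z. leib (fst V) 0 (snd V (T_L x)) (snd W (T_L x)) z +
    leib (fst V) (- 1) (snd V (T_i y)) (snd W (T_i y)) z)" if "fd_complex (fst V)"
  by (simp add: rep_tensor_def leib_def[OF that] fun_eq_iff)

text \<open>
  On homogeneous elements the action is a single graded Leibniz operator, so that the axioms of a
  representation follow from those of the two factors by \<open>gcomm_leib\<close>.
\<close>

lemma rep_tensor_homogeneous:
  assumes V: "Rep_obj G V" and W: "Rep_obj G W" and a: "a \<in> lgr (Tg G) p"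
  shows "snd (rep_tensor V W) a = leib (fst V) p (snd V a) (snd W a)"
proof -
  note C = Rep_objD(1)[OF V]
  note z = rep_zero[OF V] rep_zero[OF W]
  from a show ?thesis
    by (cases rule: Tg_lgr_cases) (simp_all add: rep_tensor_leib[OF C] T_L_def T_i_def z leib_zero[OF C])
qed

lemma Rep_obj_rep_tensor:
  assumes V: "Rep_obj G V" and W: "Rep_obj G W"
  shows "Rep_obj G (rep_tensor V W)"
proof (rule Rep_objI)
  have fst: "fst (rep_tensor V W) = cplx_tensor (fst V) (fst W)" by (simp add: rep_tensor_def)
  note C = Rep_objD(1)[OF V] and C' = Rep_objD(1)[OF W]
  note hom = rep_tensor_homogeneous[OF V W]
  have lin: "linear (snd V a)" "linear (snd W a)" if "a \<in> lgr (Tg G) p" for a p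
    using End_deg_linear Rep_objD(4)[OF V that] Rep_objD(4)[OF W that] by auto
  have linT: "linear (snd V (T_L x))" "linear (snd W (T_L x))" "linear (snd V (T_i x))" "linear (snd W (T_i x))"
    if "x \<in> lie_alg G" for x using lin T_lgr that by blast+
  show "fd_complex (fst (rep_tensor V W))" unfolding fst by (rule fd_complex_tensor[OF C C'])
  show "snd (rep_tensor V W) (ladd (Tg G) a b) = (\<lambda>v. snd (rep_tensor V W) a v + snd (rep_tensor V W) b v)"
    if a: "a \<in> lcarrier (Tg G)" and b: "b \<in> lcarrier (Tg G)" for a b
  proof -
    obtain x y where a': "a = (x, y)" "x \<in> lie_alg G" "y \<in> lie_alg G" using a by (auto simp: Tg_simps)
    obtain x' y' where b': "b = (x', y')" "x' \<in> lie_alg G" "y' \<in> lie_alg G" using b by (auto simp: Tg_simps)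
    have T: "T_L (vf_add x x') = ladd (Tg G) (T_L x) (T_L x')" "T_i (vf_add y y') = ladd (Tg G) (T_i y) (T_i y')"
      by (simp_all add: T_L_def T_i_def Tg_simps vf_add_zero)
    note tc = T_lgr(1)[THEN lgr_lcarrier] T_lgr(2)[THEN lgr_lcarrier]
    have s: "snd V (T_L (vf_add x x')) = (\<lambda>v. snd V (T_L x) v + snd V (T_L x') v)"
      "snd W (T_L (vf_add x x')) = (\<lambda>v. snd W (T_L x) v + snd W (T_L x') v)"
      "snd V (T_i (vf_add y y')) = (\<lambda>v. snd V (T_i y) v + snd V (T_i y') v)"
      "snd W (T_i (vf_add y y')) = (\<lambda>v. snd W (T_i y) v + snd W (T_i y') v)"
      unfolding T using Rep_objD(2)[OF V] Rep_objD(2)[OF W] tc a' b' by simp_all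
    show ?thesis
      using linT a' b' by (simp add: Tg_simps rep_tensor_leib[OF C] s leib_add[OF C] fun_eq_iff)
  qed
  show "snd (rep_tensor V W) (lscale (Tg G) c a) = (\<lambda>v. c *\<^sub>R snd (rep_tensor V W) a v)"
    if a: "a \<in> lcarrier (Tg G)" for a c
  proof -
    obtain x y where a': "a = (x, y)" "x \<in> lie_alg G" "y \<in> lie_alg G" using a by (auto simp: Tg_simps)
    have T: "T_L (vf_scale c x) = lscale (Tg G) c (T_L x)" "T_i (vf_scale c y) = lscale (Tg G) c (T_i y)"
      by (simp_all add: T_L_def T_i_def Tg_simps) (simp_all add: vf_scale_def vf_zero_def)
    note tc = T_lgr(1)[THEN lgr_lcarrier] T_lgr(2)[THEN lgr_lcarrier]
    have s: "snd V (T_L (vf_scale c x)) = (\<lambda>v. c *\<^sub>R snd V (T_L x) v)"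
      "snd W (T_L (vf_scale c x)) = (\<lambda>v. c *\<^sub>R snd W (T_L x) v)"
      "snd V (T_i (vf_scale c y)) = (\<lambda>v. c *\<^sub>R snd V (T_i y) v)"
      "snd W (T_i (vf_scale c y)) = (\<lambda>v. c *\<^sub>R snd W (T_i y) v)"
      unfolding T using Rep_objD(3)[OF V] Rep_objD(3)[OF W] tc a' by simp_all
    show ?thesis
      using linT a' by (simp add: Tg_simps rep_tensor_leib[OF C] s leib_scale[OF C] fun_eq_iff scaleR_add_right)
  qed
  show "snd (rep_tensor V W) a \<in> End_deg (fst (rep_tensor V W)) p" if "a \<in> lgr (Tg G) p" for a p
    unfolding hom[OF that] fst by (rule leib_End_deg[OF C C' Rep_objD(4)[OF V that] Rep_objD(4)[OF W that]])
  show "snd (rep_tensor V W) (ldif (Tg G) a) =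
      gcomm 1 p (dif (fst (rep_tensor V W))) (snd (rep_tensor V W) a)" if a: "a \<in> lgr (Tg G) p" for a p
    unfolding hom[OF a] hom[OF lgr_ldif[OF a]] fst dif_cplx_tensor[OF C] Rep_objD(5)[OF V a] Rep_objD(5)[OF W a]
    by (rule gcomm_leib[OF C dif_End_deg[OF C] dif_linear[OF C'] Rep_objD(4)[OF V a] lin(2)[OF a], symmetric])
  show "snd (rep_tensor V W) (lbracket (Tg G) a b) =
      gcomm p q (snd (rep_tensor V W) a) (snd (rep_tensor V W) b)"
    if a: "a \<in> lgr (Tg G) p" and b: "b \<in> lgr (Tg G) q" for a b p q
    unfolding hom[OF a] hom[OF b] hom[OF lgr_lbracket[OF a b]] Rep_objD(6)[OF V a b] Rep_objD(6)[OF W a b]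
    by (rule gcomm_leib[OF C Rep_objD(4)[OF V a] lin(2)[OF a] Rep_objD(4)[OF V b] lin(2)[OF b], symmetric])
qed

text \<open>
  Transfers the structure of a tensor product of representations to the functor applied to a tensor
  product of modules, whose action is known on the carrier.
\<close>

lemma Rep_obj_cong:
  assumes V: "Rep_obj G V" and fst: "fst W = fst V"
    and eq: "\<And>a. a \<in> lcarrier (Tg G) \<Longrightarrow> snd W a = snd V a"
  shows "Rep_obj G W"
  by (rule Rep_objI)
    (simp_all add: fst eq lgr_lcarrier lcarrier_ladd lcarrier_lscale lgr_lcarrier[OF lgr_ldif]
      lgr_lcarrier[OF lgr_lbracket] Rep_objD[OF V])

lemma Rep_iso_id:
  assumes V: "Rep_obj G V" and fst: "fst W = fst V"
    and eq: "\<And>a. a \<in> lcarrier (Tg G) \<Longrightarrow> snd W a = snd V a"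
  shows "Rep_iso G V W id"
proof -
  have "Rep_hom G V W id" "Rep_hom G W V id"
    using eq by (auto simp: Rep_hom_def cochain_map_def fst module_hom_id linear_id[unfolded id_def] id_def)
  then show ?thesis
    unfolding Rep_iso_def using V Rep_obj_cong[OF V fst eq] by (intro conjI exI[of _ id]) simp_all
qed

end

section \<open>The monoidal structure\<close>

lemma nat_tensor_zero_left:
  assumes C: "fd_complex C" and T: "linear T"
  shows "nat_tensor C q (\<lambda>v. 0) T = (\<lambda>z. 0)"
  by (rule tensor_hom_eqI[OF C])
    (simp_all add: nat_tensor_linear[OF C] nat_tensor_apply[OF C] T linear_zero tens_simps)

text \<open>
  The product rule, first for homogeneous pure tensors, where the Koszul sign is a constant factor.
\<close>

lemma tensor_derivative:
  fixes F :: "real \<Rightarrow> 'v::real_vector \<Rightarrow> 'v" and F' :: "real \<Rightarrow> 'w::real_vector \<Rightarrow> 'w"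
  assumes C: "fd_complex (C :: 'v cplx)"
    and F: "\<And>s. linear (F s)" "has_End_derivative F S t"
    and F': "\<And>s. linear (F' s)" "has_End_derivative F' S' t"
  shows "has_End_derivative (\<lambda>s. nat_tensor C q (F s) (F' s))
    (\<lambda>z. nat_tensor C q S (F' t) z + nat_tensor C q (F t) S' z) t"
proof -
  note lS = End_derivativeD(2)[OF F(2)] and lS' = End_derivativeD(2)[OF F'(2)]
  let ?N = "\<lambda>s. nat_tensor C q (F s) (F' s)"
  let ?D = "\<lambda>z. nat_tensor C q S (F' t) z + nat_tensor C q (F t) S' z"
  have lN: "linear (?N s)" for s by (rule nat_tensor_linear[OF C F(1) F'(1)])
  have lD: "linear ?D"
    by (intro linear_compose_add nat_tensor_linear[OF C] lS lS' F(1) F'(1))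
  obtain B :: "'v set" where B: "finite B" "independent B" "span B = UNIV" by (rule finite_basis_exists[OF C]) (rule that)
  note be = basis_expansion[OF B]
  have "((\<lambda>s. l (?N s z)) has_real_derivative l (?D z)) (at t)" if l: "linear l" for l :: "('v, 'w) tensor \<Rightarrow> real" and z
  proof -
    let ?P = "\<lambda>z. ((\<lambda>s. l (?N s z)) has_real_derivative l (?D z)) (at t)"
    have add: "?P (z + z')" if "?P z" "?P z'" for z z'
      using DERIV_add[OF that] by (simp only: linear_add[OF lN] linear_add[OF lD] linear_add[OF l])
    have scale: "?P (c *\<^sub>R z)" if "?P z" for z c
      using DERIV_cmult[OF that, of c] by (simp only: linear_scale[OF lN] linear_scale[OF lD] linear_scale[OF l] real_scaleR_def)
    have zero: "?P 0" using linear_0[OF lN] linear_0[OF lD] linear_0[OF l] by simp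
    have hom: "?P (v \<otimes>\<^sub>t w)" if v: "v \<in> gr C i" for i v w
    proof -
      have exp: "l (a \<otimes>\<^sub>t b) = (\<Sum>e\<in>B. representation B a e * l (e \<otimes>\<^sub>t b))" for a b
        by (subst be(1)[of a])
          (simp add: linear_sum[OF linear_tens_left] linear_sum[OF l] tens_simps linear_scale[OF l])
      have lr: "linear (\<lambda>w. l (e \<otimes>\<^sub>t w))" for e
        using linear_compose[OF linear_tens_right l, of e] by (simp add: o_def)
      have "((\<lambda>s. \<Sum>e\<in>B. representation B (F s v) e * l (e \<otimes>\<^sub>t F' s w)) has_real_derivative
        (\<Sum>e\<in>B. representation B (S v) e * l (e \<otimes>\<^sub>t F' t w) + l (e \<otimes>\<^sub>t S' w) * representation B (F t v) e)) (at t)"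
        by (intro DERIV_sum DERIV_mult End_derivativeD(1)[OF F(2) be(2)] End_derivativeD(1)[OF F'(2) lr])
      then have "((\<lambda>s. l (F s v \<otimes>\<^sub>t F' s w)) has_real_derivative l (S v \<otimes>\<^sub>t F' t w) + l (F t v \<otimes>\<^sub>t S' w)) (at t)"
        unfolding exp[of "F _ v"] exp[of "S v"] by (simp add: sum.distrib mult.commute)
      then have "((\<lambda>s. ksign (i * q) * l (F s v \<otimes>\<^sub>t F' s w)) has_real_derivative
          ksign (i * q) * (l (S v \<otimes>\<^sub>t F' t w) + l (F t v \<otimes>\<^sub>t S' w))) (at t)" by (rule DERIV_cmult)
      then show ?thesis
        by (simp add: nat_tensor_apply[OF C _ _ v] F(1) F'(1) lS lS' linear_add[OF l] linear_scale[OF l] distrib_left)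
    qed
    have tens: "?P (v \<otimes>\<^sub>t w)" for v w
    proof -
      have "?P ((\<Sum>i\<in>A. cmp C v i) \<otimes>\<^sub>t w)" if "finite A" for A
        using that
      proof induction
        case empty
        then show ?case using zero by (simp only: sum.empty tens_simps)
      next
        case (insert i A)
        have "?P (cmp C v i \<otimes>\<^sub>t w + (\<Sum>i\<in>A. cmp C v i) \<otimes>\<^sub>t w)"
          by (rule add[OF hom[OF cmp_gr[OF C]] insert.IH])
        then show ?case by (simp only: sum.insert[OF insert.hyps] tens_simps)
      qed
      from this[OF cmp_finite[OF C, of v]] show ?thesis unfolding cmp_sum[OF C, of v, symmetric] .
    qed
    have "z \<in> span {a \<otimes>\<^sub>t b | a b. True}" unfolding span_tens by (rule UNIV_I)
    then show ?thesis
    proof (induction rule: span_induct_alt)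
      case base
      show ?case by (rule zero)
    next
      case (step c x y)
      then show ?case using add[OF scale[OF tens]] by blast
    qed
  qed
  then show ?thesis unfolding has_End_derivative_def using lD by blast
qed

lemma mod_tensor_gen2:
  assumes "a \<noteq> b"
  shows "(\<Sum>k\<in>Poly_Mapping.keys (gen a + gen b). Poly_Mapping.lookup (gen a + gen b) k *\<^sub>R h k) = h a + (h b :: 'x::real_vector)"
proof -
  have "Poly_Mapping.keys (gen a + gen b) = {a, b}"
    by (auto simp: in_keys_iff gen_def lookup_add lookup_single when_def split: if_splits)
  moreover have "Poly_Mapping.lookup (gen a + gen b) a = 1" "Poly_Mapping.lookup (gen a + gen b) b = 1"
    using assms by (simp_all add: gen_def lookup_add lookup_single)
  ultimately show ?thesis using assms by simp
qed

lemma affine_simplex_0: "affine_simplex 0 w t = w 0"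
  by (simp add: affine_simplex_def bary_def fun_eq_iff)

lemma affine_simplex_1: "t \<in> Delta 1 \<Longrightarrow> affine_simplex 1 vert t = t"
  by (auto simp: affine_simplex_def bary_def fun_eq_iff vert_def Delta_def)

lemma coproduct_point:
  "coproduct (gen (point_simplex g)) = gen (point_simplex g, point_simplex g)"
proof -
  have v: "vert 0 = (\<lambda>_. 0)" by (simp add: vert_def)
  show ?thesis
    by (simp add: coproduct_def point_simplex_def affine_simplex_0 v) (simp add: mk_simplex_def v affine_simplex_0)
qed

lemma coproduct_path:
  "coproduct (gen (mk_simplex 1 (\<lambda>s. p (s 0)))) =
    gen (point_simplex (p 0), mk_simplex 1 (\<lambda>s. p (s 0))) + gen (mk_simplex 1 (\<lambda>s. p (s 0)), point_simplex (p (1::real)))"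
proof -
  have v: "vert 0 = rvec [0]" "vert 1 = rvec [1]" by (auto simp: vert_def rvec_def fun_eq_iff)
  have m: "rvec [0] \<in> Delta 1" "rvec [1] \<in> Delta 1" by (rule rvec_Delta1; simp)+
  let ?s = "restrict (\<lambda>s. p (s 0)) (Delta 1)"
  have a: "mk_simplex 1 (\<lambda>t. ?s (affine_simplex 1 w t)) = mk_simplex 1 (\<lambda>s. p (s 0))" if "w = vert" for w
    unfolding that by (rule mk_simplex_cong) (simp add: affine_simplex_1 del: One_nat_def)
  have b: "mk_simplex 0 (\<lambda>t. ?s (affine_simplex 0 w t)) = point_simplex (p (w 0 0))" if "w 0 = rvec [c]" "rvec [c] \<in> Delta 1" for w c
    unfolding point_simplex_def by (rule mk_simplex_cong) (simp add: affine_simplex_0 that del: One_nat_def)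
  have "{..1::nat} = {0, 1}" by auto
  then have "coproduct (gen (mk_simplex 1 (\<lambda>s. p (s 0)))) =
    gen (mk_simplex 0 (\<lambda>t. ?s (affine_simplex 0 vert t)), mk_simplex 1 (\<lambda>t. ?s (affine_simplex 1 (\<lambda>l. vert (l + 0)) t))) +
    gen (mk_simplex 1 (\<lambda>t. ?s (affine_simplex 1 vert t)), mk_simplex 0 (\<lambda>t. ?s (affine_simplex 0 (\<lambda>l. vert (l + 1)) t)))"
    unfolding coproduct_def lin_extend_gen mk_simplex_def[of 1 "\<lambda>s. p (s 0)"] prod.case
    by (simp del: One_nat_def restrict_apply)
  also have "\<dots> = gen (point_simplex (p (vert 0 0)), mk_simplex 1 (\<lambda>s. p (s 0))) +
      gen (mk_simplex 1 (\<lambda>s. p (s 0)), point_simplex (p (vert (0 + 1) 0)))"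
    using a[of vert] a[of "\<lambda>l. vert (l + 0)"] b[of vert 0] b[of "\<lambda>l. vert (l + 1)" 1] v m
    by (simp del: One_nat_def restrict_apply)
  finally show ?thesis using v by (simp add: vert_def)
qed

lemma D_obj_eqI:
  assumes L: "\<And>x. x \<in> lie_alg G \<Longrightarrow> has_End_derivative (\<lambda>t. \<rho> (gen (point_simplex (lie_exp G (vf_scale t x))))) (TL x) 0"
    and i: "\<And>x. x \<in> lie_alg G \<Longrightarrow> has_End_derivative (\<lambda>t. \<rho> (gen (exp_simplex G (vf_scale t x)))) (Ti x) 0"
    and x: "x \<in> lie_alg G" and y: "y \<in> lie_alg G"
  shows "snd (D_obj G (C, \<rho>)) (x, y) = (\<lambda>v. TL x v + Ti y v)"
proof -
  have "D_L G \<rho> x = TL x" unfolding D_L_def by (rule the_equality, rule L[OF x], rule End_derivative_unique[OF _ L[OF x]])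
  moreover have "D_i G \<rho> y = Ti y" unfolding D_i_def by (rule the_equality, rule i[OF y], rule End_derivative_unique[OF _ i[OF y]])
  ultimately show ?thesis by (simp add: D_obj_def)
qed

lemma (in chain_module) S_const: "p \<in> carrier G \<Longrightarrow> S (\<lambda>r. p) = (\<lambda>v. 0)"
  unfolding S_def
  by (rule rho_thin[of _ 1]) (rule mk_simplex_smooth[OF smG_const[OF openin_topspace]], assumption, rule thin_const)

text \<open>
  The coproduct expresses the action of a path on the tensor product by two terms. In the product rule
  for them, the factor that is not differentiated is evaluated at time 0, where points act as the
  identity and the constant path acts as zero.
\<close>

lemma D_obj_mod_tensor:
  fixes V :: "('g, 'v::real_vector) dgmod" and W :: "('g, 'w::real_vector) dgmod"
  assumes G: "lie_group G" and V: "Mod_obj G V" and W: "Mod_obj G W" and a: "a \<in> lcarrier (Tg G)"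
  shows "snd (D_obj G (mod_tensor V W)) a = snd (rep_tensor (D_obj G V) (D_obj G W)) a"
proof -
  obtain C \<rho> where V': "V = (C, \<rho>)" by (cases V)
  obtain C' \<rho>' where W': "W = (C', \<rho>')" by (cases W)
  interpret liegrp G by unfold_locales (rule G)
  interpret A: chain_module G C \<rho> by unfold_locales (use V V' in simp)
  interpret B: chain_module G C' \<rho>' by unfold_locales (use W W' in simp)
  obtain x y where a': "a = (x, y)" "x \<in> lie_alg G" "y \<in> lie_alg G" using a by (auto simp: Tg_simps)
  let ?\<rho> = "snd (mod_tensor V W)"
  have R: "?\<rho> (gen (point_simplex g)) = nat_tensor C 0 (A.R g) (B.R g)" for g
    by (simp add: mod_tensor_def coproduct_point V' W' A.R_def B.R_def)
      (simp add: point_simplex_def mk_simplex_def)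
  have S: "?\<rho> (gen (mk_simplex 1 (\<lambda>s. p (s 0)))) =
      (\<lambda>z. nat_tensor C (- 1) (A.R (p 0)) (B.S p) z + nat_tensor C 0 (A.S p) (B.R (p 1)) z)" for p
  proof
    fix z
    let ?k = "(point_simplex (p 0), mk_simplex 1 (\<lambda>s. p (s 0)))" and ?k' = "(mk_simplex 1 (\<lambda>s. p (s 0)), point_simplex (p 1))"
    have ne: "?k \<noteq> ?k'" by (simp add: point_simplex_def mk_simplex_def)
    have f: "fst (mk_simplex 1 (\<lambda>s. p (s 0))) = 1" "fst (point_simplex (p 1)) = 0" by (simp_all add: point_simplex_def mk_simplex_def)
    show "?\<rho> (gen (mk_simplex 1 (\<lambda>s. p (s 0)))) z =
      nat_tensor C (- 1) (A.R (p 0)) (B.S p) z + nat_tensor C 0 (A.S p) (B.R (p 1)) z"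
      using mod_tensor_gen2[OF ne, of "\<lambda>(\<sigma>, \<nu>). nat_tensor C (- int (fst \<nu>)) (\<rho> (gen \<sigma>)) (\<rho>' (gen \<nu>)) z"]
      unfolding mod_tensor_def V' W' A.S_def B.S_def A.R_def B.R_def
      by (simp add: case_prod_unfold f coproduct_path del: One_nat_def)
  qed
  have one: "A.R \<one>\<^bsub>G\<^esub> = (\<lambda>v. v)" "B.R \<one>\<^bsub>G\<^esub> = (\<lambda>v. v)" using A.R_one B.R_one by (simp_all add: id_def)
  have L: "has_End_derivative (\<lambda>t. ?\<rho> (gen (point_simplex (lie_exp G (vf_scale t x))))) (leib C 0 (A.DL x) (B.DL x)) 0"
    if x: "x \<in> lie_alg G" for x
  proof -
    have "has_End_derivative (\<lambda>t. nat_tensor C 0 (A.R (expc x t)) (B.R (expc x t)))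
      (\<lambda>z. nat_tensor C 0 (A.DL x) (B.R (expc x 0)) z + nat_tensor C 0 (A.R (expc x 0)) (B.DL x) z) 0"
      by (rule tensor_derivative[OF A.fdC A.R_linear[OF expc_carrier[OF x]] A.DL_derivative[OF x]
            B.R_linear[OF expc_carrier[OF x]] B.DL_derivative[OF x]])
    moreover have "leib C 0 (A.DL x) (B.DL x) =
        (\<lambda>z. nat_tensor C 0 (A.DL x) (B.R (expc x 0)) z + nat_tensor C 0 (A.R (expc x 0)) (B.DL x) z)"
      by (simp add: leib_def[OF A.fdC] expc(2)[OF x] one fun_eq_iff)
    ultimately show ?thesis by (simp add: R lie_exp_scale[OF x])
  qed
  have i: "has_End_derivative (\<lambda>t. ?\<rho> (gen (exp_simplex G (vf_scale t x)))) (leib C (- 1) (A.Di x) (B.Di x)) 0"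
    if x: "x \<in> lie_alg G" for x
  proof -
    let ?p = "\<lambda>t r. expc x (t * r)"
    have sp: "A.smcurve (?p t)" for t by (rule A.smcurve_scale[OF A.smcurve_expc[OF x]])
    have d1: "has_End_derivative (\<lambda>t. nat_tensor C (- 1) (\<lambda>v. v) (B.S (?p t)))
      (\<lambda>z. nat_tensor C (- 1) (\<lambda>v. 0) (B.S (?p 0)) z + nat_tensor C (- 1) (\<lambda>v. v) (B.Di x) z) 0"
      by (rule tensor_derivative[OF A.fdC linear_ident End_derivative_const[OF linear_ident] B.S_linear[OF sp] B.Di_derivative[OF x]])
    have d2: "has_End_derivative (\<lambda>t. nat_tensor C 0 (A.S (?p t)) (B.R (expc x t)))
      (\<lambda>z. nat_tensor C 0 (A.Di x) (B.R (expc x 0)) z + nat_tensor C 0 (A.S (?p 0)) (B.DL x) z) 0"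
      by (rule tensor_derivative[OF A.fdC A.S_linear[OF sp] A.Di_derivative[OF x]
            B.R_linear[OF expc_carrier[OF x]] B.DL_derivative[OF x]])
    have S0: "A.S (?p 0) = (\<lambda>v. 0)" using A.S_const[OF one_closed] by (simp add: expc(2)[OF x])
    have "has_End_derivative (\<lambda>t z. nat_tensor C (- 1) (\<lambda>v. v) (B.S (?p t)) z + nat_tensor C 0 (A.S (?p t)) (B.R (expc x t)) z)
      (\<lambda>z. nat_tensor C (- 1) (\<lambda>v. v) (B.Di x) z + nat_tensor C 0 (A.Di x) (\<lambda>w. w) z) 0"
      unfolding has_End_derivative_def
    proof (intro conjI allI impI)
      show "linear (\<lambda>z. nat_tensor C (- 1) (\<lambda>v. v) (B.Di x) z + nat_tensor C 0 (A.Di x) (\<lambda>w. w) z)"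
        by (intro linear_compose_add nat_tensor_linear[OF A.fdC] linear_ident A.Di_linear[OF x] B.Di_linear[OF x])
      fix l :: "('v, 'w) tensor \<Rightarrow> real" and z assume l: "linear l"
      show "((\<lambda>s. l (nat_tensor C (- 1) (\<lambda>v. v) (B.S (?p s)) z + nat_tensor C 0 (A.S (?p s)) (B.R (expc x s)) z))
        has_real_derivative l (nat_tensor C (- 1) (\<lambda>v. v) (B.Di x) z + nat_tensor C 0 (A.Di x) (\<lambda>w. w) z)) (at 0)"
        using DERIV_add[OF End_derivativeD(1)[OF d1 l, of z] End_derivativeD(1)[OF d2 l, of z]]
        unfolding S0 by (simp add: linear_add[OF l] nat_tensor_zero_left[OF A.fdC] linear_zero
          B.DL_linear[OF x] expc(2)[OF x] one linear_0[OF l] B.S_const)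
    qed
    moreover have "leib C (- 1) (A.Di x) (B.Di x) =
        (\<lambda>z. nat_tensor C (- 1) (\<lambda>v. v) (B.Di x) z + nat_tensor C 0 (A.Di x) (\<lambda>w. w) z)"
      by (simp add: leib_def[OF A.fdC] fun_eq_iff add.commute)
    moreover have "?\<rho> (gen (exp_simplex G (vf_scale t x))) =
        (\<lambda>z. nat_tensor C (- 1) (\<lambda>v. v) (B.S (?p t)) z + nat_tensor C 0 (A.S (?p t)) (B.R (expc x t)) z)" for t
      unfolding A.exp_simplex_scale[OF x] S[of "?p t"] by (simp add: expc(2)[OF x] one)
    ultimately show ?thesis by simp
  qed
  have e: "mod_tensor V W = (cplx_tensor C C', ?\<rho>)" by (simp add: mod_tensor_def V' W')
  have main: "snd (D_obj G (mod_tensor V W)) (x, y) = (\<lambda>z. leib C 0 (A.DL x) (B.DL x) z + leib C (- 1) (A.Di y) (B.Di y) z)"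
    by (subst e) (rule D_obj_eqI[where TL = "\<lambda>x. leib C 0 (A.DL x) (B.DL x)"
        and Ti = "\<lambda>y. leib C (- 1) (A.Di y) (B.Di y)", OF L i a'(2,3)])
  have f: "fst (D_obj G V) = C" by (simp add: D_obj_def V')
  have fdV: "fd_complex (fst (D_obj G V))" unfolding f by (rule A.fdC)
  show ?thesis
    unfolding a'(1) rep_tensor_leib[OF fdV] f A.snd_D_obj_T[folded V'] B.snd_D_obj_T[folded W'] by (rule main)
qed

lemma Rep_obj_D:
  assumes "lie_group G" "Mod_obj G V"
  shows "Rep_obj G (D_obj G V)"
proof -
  interpret chain_module G "fst V" "snd V" by unfold_locales (use assms in simp_all)
  show ?thesis using Rep_obj_D_obj by simp
qed

lemma Rep_iso_D_mult:
  assumes G: "lie_group G" and V: "Mod_obj G V" and W: "Mod_obj G W"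
  shows "Rep_iso G (rep_tensor (D_obj G V) (D_obj G W)) (D_obj G (mod_tensor V W)) D_mult"
proof -
  interpret liegrp G by unfold_locales (rule G)
  show ?thesis
    unfolding D_mult_def
    by (rule Rep_iso_id[OF Rep_obj_rep_tensor[OF Rep_obj_D[OF G V] Rep_obj_D[OF G W]] _ D_obj_mod_tensor[OF G V W]])
      (simp add: rep_tensor_def D_obj_def mod_tensor_def)
qed

section \<open>The monoidal unit\<close>

definition pm_eval :: "('b \<Rightarrow> real) \<Rightarrow> ('b \<Rightarrow>\<^sub>0 real) \<Rightarrow> real" where
  "pm_eval h a = (\<Sum>\<sigma>\<in>Poly_Mapping.keys a. Poly_Mapping.lookup a \<sigma> * h \<sigma>)"

lemma pm_eval_superset:
  "finite K \<Longrightarrow> Poly_Mapping.keys a \<subseteq> K \<Longrightarrow> pm_eval h a = (\<Sum>\<sigma>\<in>K. Poly_Mapping.lookup a \<sigma> * h \<sigma>)"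
  unfolding pm_eval_def by (rule sum.mono_neutral_left) (auto simp: in_keys_iff)

lemma pm_eval_zero [simp]: "pm_eval h 0 = 0"
  by (simp add: pm_eval_def)

lemma pm_eval_gen [simp]: "pm_eval h (gen \<sigma>) = h \<sigma>"
  by (simp add: pm_eval_def)

lemma pm_eval_add: "pm_eval h (a + b) = pm_eval h a + pm_eval h b"
proof -
  let ?K = "Poly_Mapping.keys a \<union> Poly_Mapping.keys b"
  have K: "finite ?K" "Poly_Mapping.keys (a + b) \<subseteq> ?K" using Poly_Mapping.keys_add[of a b] by auto
  show ?thesis
    unfolding pm_eval_superset[OF K] pm_eval_superset[OF K(1) Un_upper1] pm_eval_superset[OF K(1) Un_upper2]
    by (simp add: lookup_add distrib_right sum.distrib)
qed

lemma pm_eval_scale: "pm_eval h (pm_scale c a) = c * pm_eval h a"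
proof -
  have "Poly_Mapping.keys (pm_scale c a) \<subseteq> Poly_Mapping.keys a" by (auto simp: in_keys_iff lookup_pm_scale)
  from pm_eval_superset[OF finite_keys this, of h] show ?thesis
    by (simp add: pm_eval_def lookup_pm_scale sum_distrib_left mult.assoc)
qed

lemma pm_eval_sum: "pm_eval h (\<Sum>i\<in>I. f i) = (\<Sum>i\<in>I. pm_eval h (f i))"
  by (induction I rule: infinite_finite_induct) (simp_all add: pm_eval_add)

lemma pm_eval_lin_extend: "pm_eval h (lin_extend F a) = pm_eval (\<lambda>\<sigma>. pm_eval h (F \<sigma>)) a"
  by (simp add: lin_extend_def pm_eval_sum pm_eval_scale pm_eval_def[of "\<lambda>\<sigma>. pm_eval h (F \<sigma>)"])

lemma pm_eval_mult: "pm_eval (\<lambda>\<sigma>. h \<sigma> * c) a = pm_eval h a * c" "pm_eval (\<lambda>\<sigma>. c * h \<sigma>) a = c * pm_eval h a"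
  by (simp_all add: pm_eval_def sum_distrib_right sum_distrib_left mult_ac)

definition counit :: "'m ssimplex \<Rightarrow> real" where
  "counit \<sigma> = (if fst \<sigma> = 0 then 1 else 0)"

lemma counit_mk [simp]: "counit (mk_simplex k s) = (if k = 0 then 1 else 0)"
  by (simp add: counit_def mk_simplex_def)

lemma snd_mod_unit: "snd mod_unit a = (\<lambda>r. pm_eval counit a * r)"
  by (auto simp: mod_unit_def pm_eval_def counit_def fun_eq_iff intro!: sum.cong)

lemma counit_boundary:
  assumes a: "a \<in> chains_deg M k"
  shows "pm_eval counit (boundary a) = 0"
proof -
  have "pm_eval counit (if k = 0 then 0 else (\<Sum>i\<le>k. pm_scale ((-1) ^ i) (gen (face i (k, s))))) = (0::real)"
    for k and s :: "(nat \<Rightarrow> real) \<Rightarrow> 'a"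
  proof -
    have "(\<Sum>i\<le>k. (- 1) ^ i * (if k = 1 then 1 else 0)) = (0::real)" if "k \<noteq> 0" by (cases "k = 1") simp_all
    then show ?thesis by (auto simp: pm_eval_sum pm_eval_scale face_def)
  qed
  then show ?thesis
    unfolding boundary_def pm_eval_lin_extend case_prod_unfold by (simp add: pm_eval_def[of "\<lambda>_. 0"])
qed

text \<open>
  For simplices of dimension 0 there is exactly one shuffle, with sign 1.
\<close>

lemma counit_simplex_prod: "pm_eval counit (simplex_prod G \<sigma> \<nu>) = counit \<sigma> * counit \<nu>"
proof -
  obtain r f where s: "\<sigma> = (r, f)" by (cases \<sigma>)
  obtain s g where n: "\<nu> = (s, g)" by (cases \<nu>)
  show ?thesis
  proof (cases "r = 0 \<and> s = 0")
    case True
    then show ?thesis by (simp add: s n simplex_prod_def shuffles_trivial counit_def mk_simplex_def)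
  next
    case False
    then show ?thesis by (auto simp: s n simplex_prod_def pm_eval_sum pm_eval_scale counit_def mk_simplex_def)
  qed
qed

lemma counit_chain_prod: "pm_eval counit (chain_prod G a b) = pm_eval counit a * pm_eval counit b"
  by (simp add: chain_prod_def pm_eval_lin_extend counit_simplex_prod pm_eval_mult)

lemma fd_complex_unit: "fd_complex cplx_unit"
proof -
  have "\<exists>!c. (\<forall>i. c i \<in> gr cplx_unit i) \<and> finite {i. c i \<noteq> 0} \<and> v = (\<Sum>i | c i \<noteq> 0. c i)" for v :: real
  proof
    let ?c = "\<lambda>i::int. if i = 0 then v else 0"
    have "{i. ?c i \<noteq> 0} \<subseteq> {0}" by auto
    moreover have "v = (\<Sum>i | ?c i \<noteq> 0. ?c i)" by (cases "v = 0") simp_all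
    ultimately show "(\<forall>i. ?c i \<in> gr cplx_unit i) \<and> finite {i. ?c i \<noteq> 0} \<and> v = (\<Sum>i | ?c i \<noteq> 0. ?c i)"
      by (auto simp: cplx_unit_def intro: finite_subset)
    fix c assume c: "(\<forall>i. c i \<in> gr cplx_unit i) \<and> finite {i. c i \<noteq> 0} \<and> v = (\<Sum>i | c i \<noteq> 0. c i)"
    have z: "c i = 0" if "i \<noteq> 0" for i using c[THEN conjunct1, rule_format, of i] that by (simp add: cplx_unit_def)
    then have "(\<Sum>i | c i \<noteq> 0. c i) = (\<Sum>i\<in>{0}. c i)" by (intro sum.mono_neutral_left) auto
    then have "c 0 = v" using c by simp
    then show "c = ?c" using z by auto
  qed
  moreover have "finite {1::real} \<and> span {1::real} = UNIV"
  proof -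
    have "x \<in> span {1}" for x :: real using span_scale[OF span_base[of 1 "{1::real}"], of x] by simp
    then show ?thesis by auto
  qed
  moreover have "subspace (gr cplx_unit i)" for i by (simp add: cplx_unit_def)
  ultimately show ?thesis unfolding fd_complex_def by (auto simp: cplx_unit_def linear_zero)
qed

text \<open>
  The realization of the complex is in bijection with the one-point cube, so it has a single vertex.
\<close>

lemma cube_triangulation_0:
  assumes "cube_triangulation 0 K p"
  obtains v where "{S \<in> K. card S = Suc 0} = {{v}}"
proof -
  have K: "finite_complex K" using assms by (simp add: cube_triangulation_def)
  obtain g where g: "homeomorphism (realization K) (Cube 0) (affine_realization_map p) g"
    using assms unfolding cube_triangulation_def by (elim conjE exE) (rule that)
  have Cube: "Cube 0 = {\<lambda>_. 0}" by (auto simp: Cube_def)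
  have img: "affine_realization_map p ` realization K = {\<lambda>_. 0}"
    and inv: "\<And>x. x \<in> realization K \<Longrightarrow> g (affine_realization_map p x) = x"
    using g unfolding homeomorphism_def Cube by auto
  have uniq: "x = y" if "x \<in> realization K" "y \<in> realization K" for x y
    using inv[OF that(1)] inv[OF that(2)] img that by (metis image_eqI singletonD)
  obtain w where w: "w \<in> realization K" using img by blast
  have ind: "(\<lambda>u. if u = v then 1 else 0) \<in> realization K" if "{v} \<in> K" for v
  proof -
    have "{u. (if u = v then 1 else 0 :: real) \<noteq> 0} = {v}" by auto
    then show ?thesis using that unfolding realization_def by simp
  qed
  have "{v. w v \<noteq> 0} \<in> K" using w by (simp add: realization_def)
  then obtain v where v: "{v} \<in> K"
    using K unfolding finite_complex_def by (metis empty_subsetI insert_not_empty insert_subset ex_in_conv)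
  have uv: "u = v" if "{u} \<in> K" for u
    using fun_cong[OF uniq[OF ind[OF that] ind[OF v]], of u] by (simp split: if_splits)
  have "{S \<in> K. card S = Suc 0} = {{v}}"
  proof (rule Set.set_eqI)
    fix S
    have "S = {v}" if S: "S \<in> K" "card S = Suc 0"
    proof -
      obtain u where "S = {u}" by (rule card_1_singletonE[of S]) (use S(2) in simp)
      then show ?thesis using uv[of u] S(1) by simp
    qed
    then show "S \<in> {S \<in> K. card S = Suc 0} \<longleftrightarrow> S \<in> {{v}}" using v by fastforce
  qed
  then show thesis by (rule that)
qed

text \<open>
  All matrix entries are the cochain \<open>counit\<close>, constant in families. In dimension 0 no simplex is thin,
  as no rank is negative, and \<open>\<tau>\<close> as well as the sum over a triangulation of the point consists of a
  single term 1.
\<close>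

lemma (in liegrp) Mod_obj_mod_unit: "Mod_obj G mod_unit"
proof -
  let ?\<rho> = "snd (mod_unit :: ('g, real) dgmod)"
  have fst: "fst (mod_unit :: ('g, real) dgmod) = cplx_unit" by (simp add: mod_unit_def)
  have dif: "dif cplx_unit = (\<lambda>_. 0)" by (simp add: cplx_unit_def)
  have dg: "dg_module G mod_unit"
    unfolding dg_module_def case_prod_unfold fst dif
  proof (intro conjI ballI allI)
    show "?\<rho> (a + b) = (\<lambda>v. ?\<rho> a v + ?\<rho> b v)" for a b by (simp add: snd_mod_unit pm_eval_add distrib_right)
    show "?\<rho> (pm_scale c a) = (\<lambda>v. c *\<^sub>R ?\<rho> a v)" for c a by (simp add: snd_mod_unit pm_eval_scale mult.assoc)
    show "?\<rho> a \<in> End_deg cplx_unit (- int k)" if a: "a \<in> chains_deg NG k" for k a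
    proof -
      have "pm_eval counit a = 0" if "k \<noteq> 0"
      proof -
        have "counit \<sigma> = 0" if "\<sigma> \<in> Poly_Mapping.keys a" for \<sigma>
          using that a \<open>k \<noteq> 0\<close> by (auto simp: chains_deg_def smooth_simplices_def counit_def)
        then show ?thesis by (simp add: pm_eval_def)
      qed
      moreover have "linear (\<lambda>r :: real. c * r)" for c by (rule linear_times)
      ultimately show ?thesis by (cases "k = 0") (auto simp: snd_mod_unit End_deg_def cplx_unit_def linear_zero)
    qed
    show "?\<rho> (boundary a) = gcomm 1 (- int k) (\<lambda>_. 0) (?\<rho> a)" if a: "a \<in> chains_deg NG k" for k a
      using counit_boundary[OF a] by (simp add: snd_mod_unit gcomm_def)
    show "?\<rho> (chain_prod G a b) = ?\<rho> a \<circ> ?\<rho> b" for a b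
      by (simp add: snd_mod_unit counit_chain_prod o_def mult.assoc)
    show "?\<rho> (chain_unit G) = id" by (simp add: snd_mod_unit chain_unit_def point_simplex_def id_def)
  qed
  have thin: "?\<rho> (gen \<sigma>) = (\<lambda>_. 0)" if \<sigma>: "\<sigma> \<in> smooth_simplices NG k" and th: "thin NG \<sigma>" for k \<sigma>
  proof (cases "k = 0")
    case True
    then obtain s where "\<sigma> = (0, s)" using \<sigma> by (auto simp: smooth_simplices_def)
    then have False using th unfolding thin_def by (auto simp: Delta_0)
    then show ?thesis ..
  next
    case False
    then have "counit \<sigma> = 0" using \<sigma> by (auto simp: smooth_simplices_def counit_def)
    then show ?thesis by (simp add: snd_mod_unit)
  qed
  have smooth: "smooth_End M (\<lambda>p. ?\<rho> (gen (mk_simplex k (\<lambda>t. s (p, t)))))"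
    for M :: "(nat \<Rightarrow> real) mfd" and k and s :: "(nat \<Rightarrow> real) \<times> (nat \<Rightarrow> real) \<Rightarrow> 'g"
    unfolding smooth_End_def smooth_real_def snd_mod_unit pm_eval_gen counit_mk
    by (simp add: smooth_fun_const case_prod_unfold)
  have basis: "basis_of_type {1::real}"
  proof -
    have "x \<in> span {1}" for x :: real using span_scale[OF span_base[of 1 "{1::real}"], of x] by simp
    then show ?thesis by (auto simp: basis_of_type_def)
  qed
  have rep: "representation {1::real} r 1 = r" for r
  proof -
    have i: "independent {1::real}" "(1::real) \<in> span {1}" using basis by (auto simp: basis_of_type_def)
    show ?thesis using representation_scale[OF i, of r] representation_basis[OF i(1), of 1] by simp
  qed
  have tau0: "tau k counit \<theta> = (if k = 0 then 1 else 0)" for k and \<theta> :: "(nat \<Rightarrow> real) \<Rightarrow> 'g"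
    by (simp add: tau_def sign_id)
  have alt: "alternating NG k counit" for k
    unfolding alternating_def tau0 by (auto simp: sign_id)
  have sub: "subdivision_invariant NG k counit" for k
    unfolding subdivision_invariant_def tau0
  proof (intro allI impI)
    fix K p \<theta> assume "cube_triangulation k K p \<and> smooth_on_set (eucl k) NG (Cube k) \<theta>"
    then have tr: "cube_triangulation k K p" by simp
    show "(if k = 0 then 1 else 0) = (\<Sum>S | S \<in> K \<and> card S = Suc k. simplex_orientation k (ordered_vertex p S) *
          counit (mk_simplex k (\<lambda>t. \<theta> (affine_simplex k (ordered_vertex p S) t))))"
    proof (cases "k = 0")
      case True
      obtain v where "{S \<in> K. card S = Suc 0} = {{v}}" by (rule cube_triangulation_0[of K p]) (use tr True in auto)
      then show ?thesis using True by (simp add: simplex_orientation_def sign_id)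
    qed simp
  qed
  have "\<exists>B. basis_of_type B \<and> (\<forall>b\<in>B. \<forall>b'\<in>B. \<forall>k.
        alternating NG k (\<lambda>\<sigma>. representation B (?\<rho> (gen \<sigma>) b) b') \<and>
        subdivision_invariant NG k (\<lambda>\<sigma>. representation B (?\<rho> (gen \<sigma>) b) b'))"
  proof (intro exI[of _ "{1::real}"] conjI basis ballI allI)
    fix b b' :: real and k assume b: "b \<in> {1}" "b' \<in> {1}"
    have "(\<lambda>\<sigma>. representation {1} (?\<rho> (gen \<sigma>) b) b') = counit"
      using b rep by (simp add: snd_mod_unit fun_eq_iff)
    then show "alternating NG k (\<lambda>\<sigma>. representation {1} (?\<rho> (gen \<sigma>) b) b')"
      "subdivision_invariant NG k (\<lambda>\<sigma>. representation {1} (?\<rho> (gen \<sigma>) b) b')" using alt sub by simp_all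
  qed
  then show ?thesis
    unfolding Mod_obj_def case_prod_unfold Let_def fst
    using dg fd_complex_unit thin smooth by (intro conjI ballI allI impI) simp_all
qed

lemma Rep_obj_rep_unit: "Rep_obj G rep_unit"
proof -
  have "(\<lambda>v. 0) \<in> End_deg cplx_unit p" for p
    by (auto simp: End_deg_def cplx_unit_def linear_zero)
  then show ?thesis
    unfolding Rep_obj_def dgla_rep_def rep_unit_def using fd_complex_unit
    by (auto simp: gcomm_def cplx_unit_def)
qed

lemma D_obj_mod_unit: "snd (D_obj G mod_unit) a = (\<lambda>v. 0)"
proof -
  let ?\<rho> = "snd (mod_unit :: ('a, real) dgmod)"
  have lin: "linear (\<lambda>r :: real. c * r)" for c by (rule linear_times)
  have "D_L G ?\<rho> x = (\<lambda>v. 0)" for x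
  proof -
    have "?\<rho> (gen (point_simplex g)) = (\<lambda>r. 1 * r)" for g by (simp add: snd_mod_unit point_simplex_def)
    then have T: "has_End_derivative (\<lambda>t. ?\<rho> (gen (point_simplex (lie_exp G (vf_scale t x))))) (\<lambda>v. 0) 0"
      using End_derivative_const[OF lin[of 1]] by simp
    show ?thesis unfolding D_L_def by (rule the_equality, rule T, rule End_derivative_unique[OF _ T])
  qed
  moreover have "D_i G ?\<rho> x = (\<lambda>v. 0)" for x
  proof -
    have "?\<rho> (gen (exp_simplex G y)) = (\<lambda>r. 0 * r)" for y by (simp add: snd_mod_unit exp_simplex_def)
    then have T: "has_End_derivative (\<lambda>t. ?\<rho> (gen (exp_simplex G (vf_scale t x)))) (\<lambda>v. 0) 0"
      using End_derivative_const[OF lin[of 0]] by simp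
    show ?thesis unfolding D_i_def by (rule the_equality, rule T, rule End_derivative_unique[OF _ T])
  qed
  ultimately show ?thesis by (cases a) (simp add: D_obj_def)
qed

section \<open>The functor and its monoidal structure\<close>

lemma nat_tensor_id_id:
  fixes C :: "('v::real_vector) cplx"
  shows "fd_complex C \<Longrightarrow> nat_tensor C 0 id (id :: 'w::real_vector \<Rightarrow> 'w) = id"
  using nat_tensor_id[of C] by (simp add: id_def)

lemma fst_rep_unit: "fst rep_unit = cplx_unit"
  by (simp add: rep_unit_def)

lemma D_obj_derivatives:
  assumes G: "lie_group G" and V: "Mod_obj G V" and x: "x \<in> lie_alg G"
  shows "has_End_derivative (\<lambda>t. snd V (gen (point_simplex (lie_exp G (vf_scale t x)))))
      (snd (D_obj G V) (T_L x)) 0 \<and>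
    has_End_derivative (\<lambda>t. snd V (gen (exp_simplex G (vf_scale t x)))) (snd (D_obj G V) (T_i x)) 0"
proof -
  interpret chain_module G "fst V" "snd V" by unfold_locales (use G V in simp_all)
  show ?thesis using has_End_derivative_D_obj[OF x] by simp
qed

theorem theorem3p3:
  fixes G :: "'g lgroup"
    and V :: "('g, 'v::real_vector) dgmod"
    and W :: "('g, 'w::real_vector) dgmod"
    and U :: "('g, 'u::real_vector) dgmod"
    and V' :: "('g, 'a::real_vector) dgmod"
    and W' :: "('g, 'b::real_vector) dgmod"
  assumes "lie_group G"
    and "Mod_obj G V" and "Mod_obj G W" and "Mod_obj G U" and "Mod_obj G V'" and "Mod_obj G W'"
  shows
    \<comment> \<open>the representation \<open>\<D>(\<rho>)\<close>\<close>
    "(\<forall>x\<in>lie_alg G.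
        has_End_derivative (\<lambda>t. snd V (gen (point_simplex (lie_exp G (vf_scale t x)))))
          (snd (D_obj G V) (T_L x)) 0 \<and>
        has_End_derivative (\<lambda>t. snd V (gen (exp_simplex G (vf_scale t x))))
          (snd (D_obj G V) (T_i x)) 0) \<and>
     Rep_obj G (D_obj G V) \<and>
     \<comment> \<open>functoriality\<close>
     (\<forall>\<phi>. Mod_hom G V W \<phi> \<longrightarrow> Rep_hom G (D_obj G V) (D_obj G W) (D_hom \<phi>)) \<and>
     D_hom (id :: 'v \<Rightarrow> 'v) = id \<and>
     (\<forall>\<phi> \<psi>. Mod_hom G V W \<phi> \<and> Mod_hom G W U \<psi> \<longrightarrow> D_hom (\<psi> \<circ> \<phi>) = D_hom \<psi> \<circ> D_hom \<phi>) \<and>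
     \<comment> \<open>monoidality: structure isomorphisms, their naturality, and coherence\<close>
     Rep_iso G (rep_tensor (D_obj G V) (D_obj G W)) (D_obj G (mod_tensor V W)) D_mult \<and>
     Mod_obj G (mod_unit :: ('g, real) dgmod) \<and>
     Rep_iso G rep_unit (D_obj G mod_unit) D_one \<and>
     (\<forall>\<phi> \<psi>. Mod_hom G V V' \<phi> \<and> Mod_hom G W W' \<psi> \<longrightarrow>
        D_hom (nat_tensor (fst V) 0 \<phi> \<psi>) \<circ> D_mult =
        D_mult \<circ> nat_tensor (fst (D_obj G V)) 0 (D_hom \<phi>) (D_hom \<psi>)) \<and>
     D_hom tens_assoc \<circ> D_mult \<circ>
         nat_tensor (fst (rep_tensor (D_obj G V) (D_obj G W))) 0 D_mult (id :: 'u \<Rightarrow> 'u) =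
       D_mult \<circ> nat_tensor (fst (D_obj G V)) 0 id (D_mult :: ('w, 'u) tensor \<Rightarrow> _) \<circ> tens_assoc \<and>
     D_hom tens_lunit \<circ> D_mult \<circ> nat_tensor (fst rep_unit) 0 D_one (id :: 'v \<Rightarrow> 'v) = tens_lunit \<and>
     D_hom tens_runit \<circ> D_mult \<circ> nat_tensor (fst (D_obj G V)) 0 (id :: 'v \<Rightarrow> 'v) D_one = tens_runit"
proof -
  note G = assms(1) and V = assms(2) and W = assms(3) and U = assms(4)
  interpret liegrp G by unfold_locales (rule G)
  have fst_D: "fst (D_obj G X) = fst X" for X :: "('g, 'x::real_vector) dgmod"
    by (simp add: D_obj_def)
  have fd: "fd_complex (fst V)" "fd_complex (fst W)"
    using Rep_objD(1)[OF Rep_obj_D[OF G V]] Rep_objD(1)[OF Rep_obj_D[OF G W]] by (simp_all add: fst_D)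
  have unit: "Rep_iso G rep_unit (D_obj G mod_unit) D_one"
    unfolding D_one_def
    by (rule Rep_iso_id[OF Rep_obj_rep_unit])
      (simp add: rep_unit_def D_obj_def mod_unit_def, simp add: D_obj_mod_unit, simp add: rep_unit_def)
  have fst_tensor: "fst (rep_tensor (D_obj G V) (D_obj G W)) = cplx_tensor (fst V) (fst W)"
    by (simp add: rep_tensor_def fst_D)
  have der: "\<forall>x\<in>lie_alg G.
        has_End_derivative (\<lambda>t. snd V (gen (point_simplex (lie_exp G (vf_scale t x)))))
          (snd (D_obj G V) (T_L x)) 0 \<and>
        has_End_derivative (\<lambda>t. snd V (gen (exp_simplex G (vf_scale t x))))
          (snd (D_obj G V) (T_i x)) 0"
    using D_obj_derivatives[OF G V] by blast
  have hom: "\<forall>\<phi>. Mod_hom G V W \<phi> \<longrightarrow> Rep_hom G (D_obj G V) (D_obj G W) (D_hom \<phi>)"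
    unfolding D_hom_def using Rep_hom_D_obj[OF G V W] by blast
  show ?thesis
    by (intro conjI der hom Rep_obj_D[OF G V] Rep_iso_D_mult[OF G V W] Mod_obj_mod_unit unit)
      (simp_all add: D_hom_def D_mult_def D_one_def fst_D fst_tensor fst_rep_unit nat_tensor_id_id fd fd_complex_tensor fd_complex_unit)
qed

end
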